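(* Let $n\ge 2$ and consider the equation $$w^{(n)}=A(z)\left(w^2\right)^{(n-1)}+\sum_{j+k<n-1}a_{k,j}(z)w^{(k)}w^{(j)}+\sum_{j=0}^{n-1}b_j(z)w^{(j)}+c(z),$$ with coefficients $A,a_{k,j},b_j,c$ analytic in a complex domain $U$ and $A(z)\not\equiv 0$. This equation possesses the strong Painlevé property if and only if it is linearizable by means of the variable change $$u=w'-A(z)w^2-B(z)w,$$ where $B(z)$ is a certain locally analytic function.
   Context: Movable singularity: consider a solution $w=w(z)$ of the equation analytic in a neighborhood of some point $z^*\in U$ and a path $\Gamma$ beginning at $z^*$ along which all the coefficients of the equation can be analytically continued, while the analytic continuation of $w(z)$ along $\Gamma$ comes to a singularity. Such a singularity is called a movable singularity of the solution. The equation possesses the strong Painlevé property if all (if any) movable singularities of its solutions are poles. The expression $(w^2)^{(n-1)}$ denotes $\frac{d^{n-1}}{dz^{n-1}}(w(z)^2)$; the sum runs over non-negative integers $k\geq j$ with $j+k<n-1$. Locally analytic means analytic in some complex domain (a subdomain of $U$). Linearizable by means of the variable change $u=w'-A(z)w^2-B(z)w$ means: the substitution transforms the given equation for $w$ into a linear ordinary differential equation of order $n-1$ for $u$, $u^{(n-1)}=\sum_{j=0}^{n-2}l_j(z)u^{(j)}+l(z)$, with locally analytic coefficients $l_j,l$ and not involving $w$ (so the given equation for $w$ is equivalent to the pair consisting of this linear equation and the Riccati equation $w'=u+A(z)w^2+B(z)w$). *)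

theory Defs
  imports "HOL-Complex_Analysis.Complex_Analysis"
begin

text \<open>
  A germ at a point is represented by any function that is analytic there; its values away from
  the point carry no meaning. \<open>F t\<close> is the germ at \<open>\<gamma> t\<close> obtained by continuing \<open>f\<close> along the part
  of the path parametrised by the interval \<open>T\<close>, where \<open>T\<close> is \<open>{0..1}\<close> or \<open>{0..<1}\<close>.
\<close>

definition analytic_continuation ::
    "(complex \<Rightarrow> complex) \<Rightarrow> (real \<Rightarrow> complex) \<Rightarrow> real set \<Rightarrow> (real \<Rightarrow> complex \<Rightarrow> complex) \<Rightarrow> bool"
  where
  "analytic_continuation f \<gamma> T F \<longleftrightarrow>
     (\<forall>\<^sub>F z in nhds (\<gamma> 0). F 0 z = f z) \<and>
     (\<forall>t\<in>T. F t analytic_on {\<gamma> t}) \<and>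
     (\<forall>t\<in>T. \<exists>\<delta>>0. \<forall>s\<in>T. \<bar>s - t\<bar> < \<delta> \<longrightarrow> (\<forall>\<^sub>F z in nhds (\<gamma> s). F s z = F t z))"

definition continuable_along :: "(complex \<Rightarrow> complex) \<Rightarrow> (real \<Rightarrow> complex) \<Rightarrow> bool" where
  "continuable_along f \<gamma> \<longleftrightarrow> (\<exists>F. analytic_continuation f \<gamma> {0..1} F)"

text \<open>
  A singularity met at an interior parameter of a path is the end point of the truncated path, so
  it suffices to consider singularities at \<open>\<gamma> 1\<close>.
\<close>

definition comes_to_singularity ::
    "(complex \<Rightarrow> complex) \<Rightarrow> (real \<Rightarrow> complex) \<Rightarrow> (real \<Rightarrow> complex \<Rightarrow> complex) \<Rightarrow> bool" where
  "comes_to_singularity w \<gamma> F \<longleftrightarrow>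
     analytic_continuation w \<gamma> {0..<1} F \<and> \<not> continuable_along w \<gamma>"

definition singularity_is_pole ::
    "(real \<Rightarrow> complex) \<Rightarrow> (real \<Rightarrow> complex \<Rightarrow> complex) \<Rightarrow> bool" where
  "singularity_is_pole \<gamma> F \<longleftrightarrow>
     (\<exists>g r \<delta>. r > 0 \<and> g holomorphic_on (ball (\<gamma> 1) r - {\<gamma> 1}) \<and> is_pole g (\<gamma> 1) \<and>
        \<delta> > 0 \<and> (\<forall>t\<in>{0..<1}. 1 - t < \<delta> \<longrightarrow> (\<forall>\<^sub>F z in nhds (\<gamma> t). F t z = g z)))"

definition quadratic_index :: "nat \<Rightarrow> (nat \<times> nat) set" where
  "quadratic_index n = {(k, j). j \<le> k \<and> j + k < n - 1}"

definition quadratic_ode ::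
    "nat \<Rightarrow> (complex \<Rightarrow> complex) \<Rightarrow> (nat \<Rightarrow> nat \<Rightarrow> complex \<Rightarrow> complex) \<Rightarrow>
     (nat \<Rightarrow> complex \<Rightarrow> complex) \<Rightarrow> (complex \<Rightarrow> complex) \<Rightarrow>
     (complex \<Rightarrow> complex) \<Rightarrow> complex \<Rightarrow> bool" where
  "quadratic_ode n A a b c w z \<longleftrightarrow>
     (deriv ^^ n) w z =
       A z * (deriv ^^ (n - 1)) (\<lambda>x. (w x)\<^sup>2) z
       + (\<Sum>(k, j)\<in>quadratic_index n. a k j z * (deriv ^^ k) w z * (deriv ^^ j) w z)
       + (\<Sum>j=0..n - 1. b j z * (deriv ^^ j) w z)
       + c z"

definition linear_ode ::
    "nat \<Rightarrow> (nat \<Rightarrow> complex \<Rightarrow> complex) \<Rightarrow> (complex \<Rightarrow> complex) \<Rightarrow>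
     (complex \<Rightarrow> complex) \<Rightarrow> complex \<Rightarrow> bool" where
  "linear_ode m l l\<^sub>0 u z \<longleftrightarrow>
     (deriv ^^ m) u z = (\<Sum>j<m. l j z * (deriv ^^ j) u z) + l\<^sub>0 z"

text \<open>
  The path starts in \<open>U\<close> but may leave it, as long as the coefficients can be continued along it
  up to and including its end point.
\<close>

definition movable_singularity ::
    "nat \<Rightarrow> (complex \<Rightarrow> complex) \<Rightarrow> (nat \<Rightarrow> nat \<Rightarrow> complex \<Rightarrow> complex) \<Rightarrow>
     (nat \<Rightarrow> complex \<Rightarrow> complex) \<Rightarrow> (complex \<Rightarrow> complex) \<Rightarrow> complex set \<Rightarrow>
     (complex \<Rightarrow> complex) \<Rightarrow> (real \<Rightarrow> complex) \<Rightarrow> (real \<Rightarrow> complex \<Rightarrow> complex) \<Rightarrow> bool" where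
  "movable_singularity n A a b c U w \<gamma> F \<longleftrightarrow>
     path \<gamma> \<and> pathstart \<gamma> \<in> U \<and>
     (\<exists>S. open S \<and> pathstart \<gamma> \<in> S \<and> S \<subseteq> U \<and> w holomorphic_on S \<and>
        (\<forall>z\<in>S. quadratic_ode n A a b c w z)) \<and>
     continuable_along A \<gamma> \<and>
     (\<forall>(k, j)\<in>quadratic_index n. continuable_along (a k j) \<gamma>) \<and>
     (\<forall>j\<in>{0..n - 1}. continuable_along (b j) \<gamma>) \<and>
     continuable_along c \<gamma> \<and>
     comes_to_singularity w \<gamma> F"

definition strong_Painleve ::
    "nat \<Rightarrow> (complex \<Rightarrow> complex) \<Rightarrow> (nat \<Rightarrow> nat \<Rightarrow> complex \<Rightarrow> complex) \<Rightarrow>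
     (nat \<Rightarrow> complex \<Rightarrow> complex) \<Rightarrow> (complex \<Rightarrow> complex) \<Rightarrow> complex set \<Rightarrow> bool" where
  "strong_Painleve n A a b c U \<longleftrightarrow>
     (\<forall>w \<gamma> F. movable_singularity n A a b c U w \<gamma> F \<longrightarrow> singularity_is_pole \<gamma> F)"

definition riccati_change ::
    "(complex \<Rightarrow> complex) \<Rightarrow> (complex \<Rightarrow> complex) \<Rightarrow> (complex \<Rightarrow> complex) \<Rightarrow> complex \<Rightarrow> complex"
  where
  "riccati_change A B w = (\<lambda>z. deriv w z - A z * (w z)\<^sup>2 - B z * w z)"

text \<open>
  The functions \<open>B\<close>, \<open>l j\<close> and \<open>l\<^sub>0\<close> live on a common subdomain \<open>D\<close> of \<open>U\<close>, over which the
  quadratic equation for \<open>w\<close> and the linear equation for the transformed unknown are equivalent.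
\<close>

definition linearizable_by_riccati ::
    "nat \<Rightarrow> (complex \<Rightarrow> complex) \<Rightarrow> (nat \<Rightarrow> nat \<Rightarrow> complex \<Rightarrow> complex) \<Rightarrow>
     (nat \<Rightarrow> complex \<Rightarrow> complex) \<Rightarrow> (complex \<Rightarrow> complex) \<Rightarrow> complex set \<Rightarrow> bool" where
  "linearizable_by_riccati n A a b c U \<longleftrightarrow>
     (\<exists>D B l l\<^sub>0. open D \<and> connected D \<and> D \<noteq> {} \<and> D \<subseteq> U \<and>
        B holomorphic_on D \<and> (\<forall>j<n - 1. l j holomorphic_on D) \<and> l\<^sub>0 holomorphic_on D \<and>
        (\<forall>V w. open V \<and> V \<subseteq> D \<and> w holomorphic_on V \<longrightarrow>
           ((\<forall>z\<in>V. quadratic_ode n A a b c w z) \<longleftrightarrow>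
            (\<forall>z\<in>V. linear_ode (n - 1) l l\<^sub>0 (riccati_change A B w) z))))"

end

theory Submission
  imports Defs
begin

text \<open>
  With \<open>Q = \<Sum> q\<^sub>m d\<^sup>m\<close>, \<open>q\<^bsub>n-1\<^esub> = A\<close> and \<open>q\<^sub>m\<close> half the coefficient of \<open>w w\<^sup>(\<^sup>m\<^sup>)\<close> (all of it for \<open>m = 0\<close>), put \<open>L = Q \<circ> A\<^sup>-\<^sup>1\<close>. There is exactly
  one candidate for \<open>B\<close>, and with it the equation reads \<open>L u = c + S(w)\<close>, where the defect \<open>S\<close> is a
  polynomial of degree two in \<open>w, w', \<dots>, w\<^bsup>(n-2)\<^esup>\<close>. The equation is linearizable if and only if \<open>S\<close> vanishes.

  If \<open>S = 0\<close> on some subdomain, then also wherever the coefficients can be continued, and near the end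
  point of a path \<open>w\<close> is recovered from the Riccati equation as a quotient of solutions of linear
  systems. Where \<open>A\<close> vanishes \<open>B\<close> may have a pole, but the linear part of the equation has a holomorphic
  solution \<open>\<phi>\<close> with \<open>\<phi>' = B \<phi>\<close> of order at most that of \<open>A\<close>, and a holomorphic \<open>v\<close> with \<open>v' = B v + u\<close>;
  then \<open>w = v + \<phi> h\<close> turns the Riccati equation into \<open>h' = (A / \<phi>) (v + \<phi> h)\<^sup>2\<close>.

  Conversely let \<open>S\<close> have a nonzero coefficient at \<open>z\<^sub>0\<close>, of maximal weight \<open>M\<close> under the scaling
  \<open>w \<sim> (z - z\<^sub>0)\<^sup>-\<^sup>1\<close>. For small \<open>e\<close>, a contraction argument on a half strip in the variable
  \<open>s = ln ((z - z\<^sub>0) / e)\<close>, wider than \<open>2\<pi>\<close>, gives a possibly many-valued solution near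
  \<open>(- 1 / (A t) + g t\<^sup>j) / e\<close>, \<open>t = exp s\<close>. By the Painleve property it is single-valued. Hence
  \<open>\<psi> S(w)\<close> has zero residue at \<open>z\<^sub>0\<close> for every \<open>\<psi>\<close> with \<open>L\<^sup>* \<psi> = 0\<close>, by Lagrange's identity. Choosing \<open>\<psi>\<close>
  with a zero of suitable order and letting \<open>e \<rightarrow> 0\<close>, this contradicts the choice of \<open>M\<close>.
\<close>

section \<open>Linear differential equations\<close>

text \<open>The term \<open>g t\<^sup>j\<close> is there because the bare pole yields only one
  relation between all coefficients of weight \<open>M\<close> together. If \<open>j\<close> is the
  least index with a nonzero quadratic coefficient, the power
  \<open>t\<^sup>j\<^sup>+\<^sup>1\<close> carries that coefficient alone. Symmetry of the
  coefficients gives \<open>2 * j \<le> n - 2\<close>, which is the range in which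
  \<open>- 1 / (A0 * t) + g * t ^ j\<close> still solves the limiting equation
  \<open>w\<^sup>(\<^sup>n\<^sup>) = A0 (w\<^sup>2)\<^sup>(\<^sup>n\<^sup>-\<^sup>1\<^sup>)\<close>
  exactly; hence \<open>g\<close> can stay fixed while \<open>e\<close> tends to 0.

  A Laurent series at the pole would meet resonances at t, ..., t^(n-1) and might need logarithms.
  In the variable s = ln t these do no harm: the linearized equation splits into first-order
  equations with constants 1, ..., n-1 and -2, none of them 0, so bounded data have bounded
  solutions.

  In the other direction the obstacle is a zero of \<open>A\<close> at the end point of the path.
  There L and B may be singular, while the equation of order \<open>n\<close> with the coefficients
  \<open>b j\<close> is not. So the auxiliary functions are found as solutions of that equation, and
  only then shown to satisfy first-order equations.\<close>

lemma eq_on_connected: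
  fixes f g :: "complex \<Rightarrow> complex"
  assumes "f holomorphic_on X" "g holomorphic_on X" "open X" "connected X" "x \<in> X"
    and ev: "\<forall>\<^sub>F z in nhds x. f z = g z" and "z \<in> X"
  shows "f z = g z"
proof -
  obtain Y where Y: "open Y" "x \<in> Y" "\<And>z. z \<in> Y \<Longrightarrow> f z = g z"
    using ev by (auto simp: eventually_nhds)
  show ?thesis
    by (rule analytic_continuation_open[of "Y \<inter> X" X f g]) (use assms Y in auto)
qed

lemma holomorphic_on_derivI:
  assumes "\<And>z. z \<in> S \<Longrightarrow> (f has_field_derivative f' z) (at z)"
  shows "f holomorphic_on S"
  unfolding holomorphic_on_def field_differentiable_def
  using assms has_field_derivative_at_within by blast

lemma linear_system_iterates:
  fixes M :: "nat \<Rightarrow> nat \<Rightarrow> complex \<Rightarrow> complex"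
  assumes M: "\<And>i j. i < N \<Longrightarrow> j < N \<Longrightarrow> M i j holomorphic_on ball z0 r"
    and d: "\<And>i. i < N \<Longrightarrow> d i holomorphic_on ball z0 r" and z1: "z1 \<in> ball z0 r"
  shows "\<exists>e. \<forall>i<N. e i z1 = 0 \<and> (\<forall>z\<in>ball z0 r. (e i has_field_derivative (\<Sum>j<N. M i j z * d j z)) (at z))"
proof -
  have "\<exists>e. i < N \<longrightarrow> e z1 = 0 \<and> (\<forall>z\<in>ball z0 r. (e has_field_derivative (\<Sum>j<N. M i j z * d j z)) (at z))" for i
  proof (cases "i < N")
    case True
    have "(\<lambda>z. \<Sum>j<N. M i j z * d j z) holomorphic_on ball z0 r"
      using M d True by (intro holomorphic_intros) auto
    then obtain g where g: "\<And>x. x \<in> ball z0 r \<Longrightarrow> (g has_field_derivative (\<Sum>j<N. M i j x * d j x)) (at x within ball z0 r)"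
      using holomorphic_convex_primitive'[OF convex_ball open_ball] by blast
    have "\<forall>z\<in>ball z0 r. ((\<lambda>z. g z - g z1) has_field_derivative (\<Sum>j<N. M i j z * d j z)) (at z)"
      using g by (auto intro!: derivative_eq_intros simp: at_within_open[OF _ open_ball])
    then show ?thesis by (intro exI[of _ "\<lambda>z. g z - g z1"]) auto
  qed auto
  then have "\<forall>i. \<exists>e. i < N \<longrightarrow> e z1 = 0 \<and> (\<forall>z\<in>ball z0 r. (e has_field_derivative (\<Sum>j<N. M i j z * d j z)) (at z))"
    by blast
  from choice[OF this] show ?thesis by blast
qed

text \<open>Integrating the bound along the segment from \<open>z1\<close> to \<open>z\<close>
  raises the power by one and divides by \<open>Suc k\<close>. This is one Picard step; it gives the
  iterates factorial decay, so that their series converges on a whole disc and not only near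
  \<open>z1\<close>.\<close>

lemma norm_le_power_fact:
  fixes f f' :: "complex \<Rightarrow> complex"
  assumes X: "convex X" "z1 \<in> X" "z \<in> X"
    and f: "\<And>y. y \<in> X \<Longrightarrow> (f has_field_derivative f' y) (at y)"
    and bd: "\<And>y. y \<in> X \<Longrightarrow> norm (f' y) \<le> L * (C * (L * norm (y - z1)) ^ k / fact k)"
    and "f z1 = 0"
  shows "norm (f z) \<le> C * (L * norm (z - z1)) ^ Suc k / fact (Suc k)"
proof -
  define p where "p x = z1 + of_real x * (z - z1)" for x :: real
  have p: "p x \<in> X" if "0 \<le> x" "x \<le> 1" for x
  proof -
    have "p x = (1 - x) *\<^sub>R z1 + x *\<^sub>R z" by (simp add: p_def scaleR_conv_of_real algebra_simps)
    then show ?thesis using convexD[OF X(1,2,3), of "1 - x" x] that by simp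
  qed
  have der: "((f \<circ> p) has_vector_derivative (z - z1) * f' (p x)) (at x)" if "0 \<le> x" "x \<le> 1" for x
  proof (rule field_vector_diff_chain_at)
    show "(p has_vector_derivative z - z1) (at x)" unfolding p_def by (auto intro!: derivative_eq_intros)
    show "(f has_field_derivative f' (p x)) (at (p x))" using f p that by blast
  qed
  define ph where "ph x = C * (L * norm (z - z1) * x) ^ Suc k / fact (Suc k)" for x :: real
  have ph: "(ph has_real_derivative norm (z - z1) * (L * (C * (L * norm (z - z1) * x) ^ k / fact k))) (at x)" for x
    unfolding ph_def
    by (rule derivative_eq_intros refl | simp add: divide_simps del: power_Suc)+
  have "norm ((f \<circ> p) 1 - (f \<circ> p) 0) \<le> ph 1 - ph 0"
  proof (rule differentiable_bound_general)
    show "continuous_on {0..1} (f \<circ> p)"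
    proof (rule continuous_at_imp_continuous_on, rule ballI)
      fix x :: real assume "x \<in> {0..1}"
      then show "isCont (f \<circ> p) x" using has_vector_derivative_continuous[OF der, of x] by simp
    qed
    show "continuous_on {0..1} ph" unfolding ph_def by (intro continuous_intros) auto
    fix x :: real assume x: "0 < x" "x < 1"
    show "((f \<circ> p) has_vector_derivative (z - z1) * f' (p x)) (at x)" using der x by simp
    show "(ph has_vector_derivative norm (z - z1) * (L * (C * (L * norm (z - z1) * x) ^ k / fact k))) (at x)"
      using ph by (simp add: has_real_derivative_iff_has_vector_derivative)
    have "norm (p x - z1) = norm (z - z1) * x" using x by (simp add: p_def norm_mult mult.commute)
    then have "norm (f' (p x)) \<le> L * (C * (L * norm (z - z1) * x) ^ k / fact k)"
      using bd[OF p, of x] x by (simp add: mult.assoc)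
    then show "norm ((z - z1) * f' (p x)) \<le> norm (z - z1) * (L * (C * (L * norm (z - z1) * x) ^ k / fact k))"
      unfolding norm_mult by (rule mult_left_mono) simp
  qed simp
  then show ?thesis using assms by (simp add: p_def ph_def)
qed

text \<open>Picard iteration in the form of a series: the first term is the primitive of
  \<open>f\<close> with value \<open>x0\<close> at \<open>z1\<close>, each further term is the
  primitive of \<open>M\<close> times its predecessor. Factorial decay gives convergence and
  termwise differentiation.\<close>

lemma linear_system_exists_bounded:
  fixes M :: "nat \<Rightarrow> nat \<Rightarrow> complex \<Rightarrow> complex"
  assumes "r > 0" and M: "\<And>i j. i < N \<Longrightarrow> j < N \<Longrightarrow> M i j holomorphic_on ball z0 r"
    and K: "\<And>i j z. i < N \<Longrightarrow> j < N \<Longrightarrow> z \<in> ball z0 r \<Longrightarrow> norm (M i j z) \<le> K"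
    and "K \<ge> 0"
    and f: "\<And>i. i < N \<Longrightarrow> f i holomorphic_on ball z0 r"
    and bf: "\<And>i z. i < N \<Longrightarrow> z \<in> ball z0 r \<Longrightarrow> norm (f i z) \<le> C"
    and z1: "z1 \<in> ball z0 r"
  shows "\<exists>x. \<forall>i<N. x i z1 = x0 i \<and>
          (\<forall>z\<in>ball z0 r. (x i has_field_derivative (\<Sum>j<N. M i j z * x j z) + f i z) (at z))"
proof -
  let ?B = "ball z0 r"
  \<comment> \<open>A single integration operator for all inputs, so that it can be iterated by
    recursion; on inputs that are not holomorphic its value is arbitrary.\<close>
  have "\<exists>e. \<forall>d. (\<forall>i<N. d i holomorphic_on ?B) \<longrightarrow> (\<forall>i<N. e d i z1 = 0 \<and> (\<forall>z\<in>?B. (e d i has_field_derivative (\<Sum>j<N. M i j z * d j z)) (at z)))"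
  proof -
    have "\<exists>e. (\<forall>i<N. d i holomorphic_on ?B) \<longrightarrow> (\<forall>i<N. e i z1 = 0 \<and> (\<forall>z\<in>?B. (e i has_field_derivative (\<Sum>j<N. M i j z * d j z)) (at z)))" for d
    proof (cases "\<forall>i<N. d i holomorphic_on ?B")
      case True
      have "\<exists>e. \<forall>i<N. e i z1 = 0 \<and> (\<forall>z\<in>?B. (e i has_field_derivative (\<Sum>j<N. M i j z * d j z)) (at z))"
        by (rule linear_system_iterates) (use M True z1 in auto)
      then show ?thesis by (elim exE) (rule exI, rule impI, assumption)
    next
      case False
      show ?thesis by (intro exI[of _ d] impI) (use False in simp)
    qed
    from choice[OF allI[OF this]] show ?thesis .
  qed
  then obtain e where e: "\<forall>d. (\<forall>i<N. d i holomorphic_on ?B) \<longrightarrow> (\<forall>i<N. e d i z1 = 0 \<and> (\<forall>z\<in>?B. (e d i has_field_derivative (\<Sum>j<N. M i j z * d j z)) (at z)))"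
    by (elim exE)
  have e0: "e d i z1 = 0" if "\<And>i. i < N \<Longrightarrow> d i holomorphic_on ?B" "i < N" for d i
    using e that by simp
  have e': "(e d i has_field_derivative (\<Sum>j<N. M i j z * d j z)) (at z)"
    if "\<And>i. i < N \<Longrightarrow> d i holomorphic_on ?B" "i < N" "z \<in> ?B" for d i z
    using e that by simp
  have "\<exists>p. \<forall>i<N. p i z1 = x0 i \<and> (\<forall>z\<in>?B. (p i has_field_derivative f i z) (at z))"
  proof -
    have "\<exists>p. i < N \<longrightarrow> p z1 = x0 i \<and> (\<forall>z\<in>?B. (p has_field_derivative f i z) (at z))" for i
    proof (cases "i < N")
      case True
      then obtain g where g: "\<And>x. x \<in> ?B \<Longrightarrow> (g has_field_derivative f i x) (at x within ?B)"
        using holomorphic_convex_primitive'[OF convex_ball open_ball f] by blast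
      have "\<forall>z\<in>?B. ((\<lambda>z. g z - g z1 + x0 i) has_field_derivative f i z) (at z)"
        using g by (auto intro!: derivative_eq_intros simp: at_within_open[OF _ open_ball])
      then show ?thesis by (intro exI[of _ "\<lambda>z. g z - g z1 + x0 i"]) auto
    qed auto
    then have "\<forall>i. \<exists>p. i < N \<longrightarrow> p z1 = x0 i \<and> (\<forall>z\<in>?B. (p has_field_derivative f i z) (at z))"
      by blast
    from choice[OF this] show ?thesis by blast
  qed
  then obtain p where p: "\<forall>i<N. p i z1 = x0 i \<and> (\<forall>z\<in>?B. (p i has_field_derivative f i z) (at z))"
    by (elim exE)
  have p1: "p i z1 = x0 i" if "i < N" for i using p that by simp
  have p': "(p i has_field_derivative f i z) (at z)" if "i < N" "z \<in> ?B" for i z using p that by simp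
  define d where "d = rec_nat p (\<lambda>_. e)"
  have d0: "d 0 = p" and dS: "d (Suc k) = e (d k)" for k by (auto simp: d_def)
  have dhol: "i < N \<Longrightarrow> d k i holomorphic_on ?B" for k i
  proof (induction k arbitrary: i)
    case 0 then show ?case unfolding d0 by (intro holomorphic_on_derivI[OF p']) auto
  next
    case (Suc k) then show ?case unfolding dS by (intro holomorphic_on_derivI[OF e']) auto
  qed
  define d' where "d' k i z = (if k = 0 then f i z else (\<Sum>j<N. M i j z * d (k-1) j z))" for k i z
  have dd: "(d k i has_field_derivative d' k i z) (at z)" if "i < N" "z \<in> ?B" for k i z
    using that e'[OF dhol] p' by (cases k) (auto simp: d'_def d0 dS)
  have dz1: "d k i z1 = (if k = 0 then x0 i else 0)" if "i < N" for k i
    using that p1 e0[OF dhol] by (cases k) (auto simp: d0 dS)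
  \<comment> \<open>Bounds the first term: its initial values plus the bound for \<open>f\<close>
    times the diameter of the disc.\<close>
  define C0 where "C0 = (\<Sum>i<N. norm (x0 i)) + \<bar>C\<bar> * (2*r)"
  have dist: "norm (z - z1) \<le> 2 * r" if "z \<in> ?B" for z
    using that z1 dist_triangle2[of z z1 z0] by (auto simp: dist_norm norm_minus_commute)
  have C0: "C0 \<ge> 0" unfolding C0_def using \<open>r>0\<close> by (simp add: sum_nonneg)
  have bd: "norm (d k i z) \<le> C0 * (real N * K * norm (z - z1)) ^ k / fact k" if "i < N" "z \<in> ?B" for k i z
    using that
  proof (induction k arbitrary: i z)
    case 0
    have "norm (p i z - p i z1) \<le> \<bar>C\<bar> * norm (z - z1)"
    proof (intro field_differentiable_bound[of ?B "p i" "f i"])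
      fix y assume y: "y \<in> ?B"
      show "(p i has_field_derivative f i y) (at y within ?B)"
        using p'[OF \<open>i < N\<close> y] by (rule has_field_derivative_at_within)
      show "norm (f i y) \<le> \<bar>C\<bar>" using bf[OF \<open>i < N\<close> y] by linarith
    qed (use 0 z1 in auto)
    also have "\<dots> \<le> \<bar>C\<bar> * (2*r)" using dist 0 by (intro mult_left_mono) auto
    finally have "norm (p i z) \<le> norm (x0 i) + \<bar>C\<bar> * (2*r)"
      using p1 0 norm_triangle_sub[of "p i z" "p i z1"] by auto
    moreover have "norm (x0 i) \<le> (\<Sum>i<N. norm (x0 i))" using 0
      by (intro member_le_sum) auto
    ultimately show ?case by (simp add: d0 C0_def)
  next
    case (Suc k)
    show ?case
    proof (rule norm_le_power_fact[where X = ?B and f' = "d' (Suc k) i"])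
      fix y assume y: "y \<in> ?B"
      show "(d (Suc k) i has_field_derivative d' (Suc k) i y) (at y)"
        by (rule dd[OF \<open>i < N\<close> y])
      have "norm (d' (Suc k) i y) \<le> (\<Sum>j<N. norm (M i j y * d k j y))"
        by (simp add: d'_def norm_sum)
      also have "\<dots> \<le> (\<Sum>j<N. K * (C0 * (real N * K * norm (y - z1)) ^ k / fact k))"
      proof (rule sum_mono)
        fix j assume "j \<in> {..<N}"
        then have j: "j < N" by simp
        show "norm (M i j y * d k j y) \<le> K * (C0 * (real N * K * norm (y - z1)) ^ k / fact k)"
          unfolding norm_mult by (rule mult_mono[OF K[OF \<open>i < N\<close> j y] Suc.IH[OF j y] \<open>K \<ge> 0\<close> norm_ge_zero])
      qed
      finally show "norm (d' (Suc k) i y) \<le> real N * K * (C0 * (real N * K * norm (y - z1)) ^ k / fact k)" by (simp add: mult_ac)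
    qed (use Suc.prems z1 dz1 in auto)
  qed
  define L where "L = real N * K * (2 * r)"
  have bd': "norm (d k i z) \<le> C0 * (L ^ k / fact k)" if "i < N" "z \<in> ?B" for k i z
  proof -
    have "(real N * K * norm (z - z1)) ^ k \<le> L ^ k"
      unfolding L_def using dist[OF that(2)] \<open>K \<ge> 0\<close> by (intro power_mono mult_left_mono) auto
    then have "C0 * (real N * K * norm (z - z1)) ^ k / fact k \<le> C0 * L ^ k / fact k"
      using C0 by (intro divide_right_mono mult_left_mono) auto
    then show ?thesis using bd[OF that, of k] by simp
  qed
  have L0: "L \<ge> 0" using \<open>r>0\<close> \<open>K \<ge> 0\<close> by (simp add: L_def)
  have ex: "\<exists>g g'. \<forall>z\<in>?B. ((\<lambda>k. d k i z) sums g z) \<and> ((\<lambda>k. d' k i z) sums g' z) \<and> (g has_field_derivative g' z) (at z)"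
    if i: "i < N" for i
  proof (rule series_and_derivative_comparison_complex)
    fix z assume "z \<in> ?B"
    show "\<exists>dd (h::nat \<Rightarrow> complex). 0 < dd \<and> summable h \<and> range h \<subseteq> \<real>\<^sub>\<ge>\<^sub>0 \<and> (\<forall>\<^sub>F k in sequentially. \<forall>y\<in>ball z dd \<inter> ?B. norm (d k i y) \<le> norm (h k))"
    proof (intro exI[of _ 1] exI[of _ "\<lambda>k. complex_of_real (C0 * (L ^ k / fact k))"] conjI)
      have "summable (\<lambda>k. C0 * (L ^ k / fact k))"
        using summable_exp[of L] by (intro summable_mult) (simp add: field_simps)
      then show "summable (\<lambda>k. complex_of_real (C0 * (L ^ k / fact k)))" by (rule summable_of_real)
      have "norm (complex_of_real (C0 * (L ^ k / fact k))) = C0 * (L ^ k / fact k)" for k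
        unfolding norm_of_real using C0 L0 by simp
      then show "\<forall>\<^sub>F k in sequentially. \<forall>y\<in>ball z 1 \<inter> ?B. norm (d k i y) \<le> norm (complex_of_real (C0 * (L ^ k / fact k)))"
        using bd'[OF i] by (intro always_eventually allI ballI) simp
      show "range (\<lambda>k. complex_of_real (C0 * (L ^ k / fact k))) \<subseteq> \<real>\<^sub>\<ge>\<^sub>0"
        using C0 L0 by (auto simp del: of_real_mult of_real_power of_real_divide)
    qed simp
  qed (use dd i in auto)
  define P where "P i g g' \<longleftrightarrow> (\<forall>z\<in>?B. ((\<lambda>k. d k i z) sums g z) \<and> ((\<lambda>k. d' k i z) sums g' z) \<and> (g has_field_derivative g' z) (at z))" for i g g'
  have "\<forall>i. \<exists>g. i < N \<longrightarrow> (\<exists>g'. P i g g')" using ex unfolding P_def by blast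
  from choice[OF this] obtain g where g: "\<forall>i. i < N \<longrightarrow> (\<exists>g'. P i (g i) g')" by (elim exE)
  then have "\<forall>i. \<exists>g'. i < N \<longrightarrow> P i (g i) g'" by blast
  from choice[OF this] obtain g' where g': "\<forall>i. i < N \<longrightarrow> P i (g i) (g' i)" by (elim exE)
  have gs: "(\<lambda>k. d k i z) sums g i z" and gs': "(\<lambda>k. d' k i z) sums g' i z"
    and gd: "(g i has_field_derivative g' i z) (at z)" if "i < N" "z \<in> ?B" for i z
    using g' that unfolding P_def by blast+
  show ?thesis
  proof (intro exI[of _ g] allI impI conjI ballI)
    fix i assume i: "i < N"
    have "(\<lambda>k. d k i z1) = (\<lambda>k. if k = 0 then x0 i else 0)" using dz1[OF i] by auto
    then have "(\<lambda>k. d k i z1) sums x0 i" using sums_single[of 0 "\<lambda>_. x0 i"] by simp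
    then show "g i z1 = x0 i" using gs[OF i z1] sums_unique2 by blast
    fix z assume z: "z \<in> ?B"
    have "(\<lambda>k. \<Sum>j<N. M i j z * d k j z) sums (\<Sum>j<N. M i j z * g j z)"
      using gs z by (intro sums_sum sums_mult) auto
    then have "(\<lambda>k. d' (Suc k) i z) sums (\<Sum>j<N. M i j z * g j z)" by (simp add: d'_def)
    then have "(\<lambda>k. d' k i z) sums ((\<Sum>j<N. M i j z * g j z) + d' 0 i z)" by (rule sums_Suc)
    then have "g' i z = (\<Sum>j<N. M i j z * g j z) + f i z"
      using gs'[OF i z] sums_unique2 by (fastforce simp: d'_def)
    then show "(g i has_field_derivative (\<Sum>j<N. M i j z * g j z) + f i z) (at z)"
      using gd[OF i z] by simp
  qed
qed

text \<open>The radius shrinks from \<open>R\<close> to \<open>r\<close> only to have bounded data,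
  by compactness of the closed disc of radius \<open>r\<close>.\<close>

lemma linear_system_exists:
  fixes M :: "nat \<Rightarrow> nat \<Rightarrow> complex \<Rightarrow> complex"
  assumes r: "0 < r" "r < R" and M: "\<And>i j. i < N \<Longrightarrow> j < N \<Longrightarrow> M i j holomorphic_on ball z0 R"
    and f: "\<And>i. i < N \<Longrightarrow> f i holomorphic_on ball z0 R" and z1: "z1 \<in> ball z0 r"
  shows "\<exists>x. \<forall>i<N. x i z1 = x0 i \<and>
          (\<forall>z\<in>ball z0 r. (x i has_field_derivative (\<Sum>j<N. M i j z * x j z) + f i z) (at z))"
proof -
  have bdd: "\<exists>C\<ge>0. \<forall>z\<in>cball z0 r. norm (h z) \<le> C" if "h holomorphic_on ball z0 R" for h :: "complex \<Rightarrow> complex"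
  proof -
    have "cball z0 r \<subseteq> ball z0 R" using r by auto
    then have "compact (h ` cball z0 r)"
      using that by (intro compact_continuous_image continuous_on_subset[OF holomorphic_on_imp_continuous_on]) auto
    then have "bounded (h ` cball z0 r)" by (rule compact_imp_bounded)
    then obtain C where "\<forall>z\<in>cball z0 r. norm (h z) \<le> C" by (auto simp: bounded_iff)
    then show ?thesis by (intro exI[of _ "\<bar>C\<bar>"]) force
  qed
  have "\<exists>c. i < N \<longrightarrow> j < N \<longrightarrow> c \<ge> 0 \<and> (\<forall>z\<in>cball z0 r. norm (M i j z) \<le> c)" for i j
    using bdd[OF M] by blast
  then obtain C where C: "\<And>i j. i < N \<Longrightarrow> j < N \<Longrightarrow> C i j \<ge> (0::real)"
    "\<And>i j z. i < N \<Longrightarrow> j < N \<Longrightarrow> z\<in>cball z0 r \<Longrightarrow> norm (M i j z) \<le> C i j" by metis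
  define K where "K = (\<Sum>i<N. \<Sum>j<N. C i j)"
  have K0: "K \<ge> 0" unfolding K_def using C by (intro sum_nonneg) auto
  have KC: "C i j \<le> K" if "i < N" "j < N" for i j
  proof -
    have "C i j \<le> (\<Sum>j<N. C i j)" using that C by (intro member_le_sum) auto
    also have "\<dots> \<le> K" unfolding K_def using that C by (intro member_le_sum[of i "{..<N}" "\<lambda>i. \<Sum>j<N. C i j"]) (auto intro: sum_nonneg)
    finally show ?thesis .
  qed
  have sub: "ball z0 r \<subseteq> cball z0 r" "ball z0 r \<subseteq> ball z0 R" using r by auto
  have "\<forall>i. \<exists>c. i < N \<longrightarrow> c \<ge> 0 \<and> (\<forall>z\<in>cball z0 r. norm (f i z) \<le> c)"
    using bdd[OF f] by blast
  from choice[OF this] obtain D where D: "\<forall>i. i < N \<longrightarrow> D i \<ge> (0::real) \<and> (\<forall>z\<in>cball z0 r. norm (f i z) \<le> D i)" by (elim exE)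
  show ?thesis
  proof (rule linear_system_exists_bounded[where K=K and C="\<Sum>i<N. D i"])
    fix i z assume "i < N" "z \<in> ball z0 r"
    then have "norm (f i z) \<le> D i" using sub D by auto
    also have "\<dots> \<le> (\<Sum>i<N. D i)" using D \<open>i<N\<close> by (intro member_le_sum) auto
    finally show "norm (f i z) \<le> (\<Sum>i<N. D i)" .
  next
    fix i j z assume "i < N" "j < N" "z \<in> ball z0 r"
    then show "norm (M i j z) \<le> K" using sub C KC by (meson order_trans subsetD)
  qed (use r K0 z1 sub in \<open>auto intro: holomorphic_on_subset[OF M] holomorphic_on_subset[OF f]\<close>)
qed

text \<open>By the Leibniz rule the equation expresses the derivatives of order k+1 at
  \<open>z1\<close> through those of order at most k, so all of them vanish. The identity theorem
  then covers any connected domain, simply connected or not.\<close>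

lemma linear_system_unique:
  fixes M :: "nat \<Rightarrow> nat \<Rightarrow> complex \<Rightarrow> complex"
  assumes X: "open X" "connected X" "z1 \<in> X"
    and M: "\<And>i j. i < N \<Longrightarrow> j < N \<Longrightarrow> M i j holomorphic_on X"
    and x: "\<And>i z. i < N \<Longrightarrow> z \<in> X \<Longrightarrow> (x i has_field_derivative (\<Sum>j<N. M i j z * x j z)) (at z)"
    and 0: "\<And>i. i < N \<Longrightarrow> x i z1 = 0" and "i < N" "z \<in> X"
  shows "x i z = 0"
proof -
  have hol: "x i holomorphic_on X" if "i < N" for i
    using x[OF that] by (rule holomorphic_on_derivI)
  have "\<forall>i<N. (deriv ^^ k) (x i) z1 = 0" for k
  proof (induction k rule: less_induct)
    case (less k)
    show ?case
    proof (intro allI impI)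
      fix i assume i: "i < N"
      show "(deriv ^^ k) (x i) z1 = 0"
      proof (cases k)
        case 0 then show ?thesis using assms i by simp
      next
        case (Suc m)
        have "(deriv ^^ k) (x i) z1 = (deriv ^^ m) (deriv (x i)) z1"
          by (simp only: Suc funpow_Suc_right o_def)
        also have "\<dots> = (deriv ^^ m) (\<lambda>z. \<Sum>j<N. M i j z * x j z) z1"
          using X x i hol M by (intro higher_deriv_transform_within_open[of _ X])
            (auto intro!: holomorphic_intros DERIV_imp_deriv)
        also have "\<dots> = (\<Sum>j<N. (deriv ^^ m) (\<lambda>z. M i j z * x j z) z1)"
        proof -
          have "(deriv ^^ m) (\<lambda>z. \<Sum>j<n. M i j z * x j z) z1 = (\<Sum>j<n. (deriv ^^ m) (\<lambda>z. M i j z * x j z) z1)"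
            if "n \<le> N" for n using that
          proof (induction n)
            case (Suc n)
            have "(deriv ^^ m) (\<lambda>z. (\<Sum>j<n. M i j z * x j z) + M i n z * x n z) z1 =
              (deriv ^^ m) (\<lambda>z. (\<Sum>j<n. M i j z * x j z)) z1 + (deriv ^^ m) (\<lambda>z. M i n z * x n z) z1"
              using X Suc.prems i by (intro higher_deriv_add[of _ X]) (auto intro!: holomorphic_intros M hol)
            then show ?case using Suc by simp
          qed simp
          then show ?thesis by simp
        qed
        also have "\<dots> = 0"
        proof (intro sum.neutral ballI)
          fix j assume "j \<in> {..<N}"
          then have j: "j < N" by simp
          have "(deriv ^^ m) (\<lambda>z. M i j z * x j z) z1 =
            (\<Sum>l=0..m. of_nat (m choose l) * (deriv ^^ l) (M i j) z1 * (deriv ^^ (m-l)) (x j) z1)"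
            using X i j by (intro higher_deriv_mult[of _ X] M hol)
          also have "\<dots> = 0"
            using less j Suc by (intro sum.neutral) auto
          finally show "(deriv ^^ m) (\<lambda>z. M i j z * x j z) z1 = 0" .
        qed
        finally show ?thesis .
      qed
    qed
  qed
  then show ?thesis
    using hol assms by (intro holomorphic_fun_eq_0_on_connected[of "x i" X z1 z]) auto
qed

section \<open>Scalar linear equations as companion systems\<close>

definition companion :: "nat \<Rightarrow> (nat \<Rightarrow> complex \<Rightarrow> complex) \<Rightarrow> nat \<Rightarrow> nat \<Rightarrow> complex \<Rightarrow> complex" where
  "companion N b i j z = (if Suc i = N then b j z else if j = Suc i then 1 else 0)"

lemma companion_sum:
  assumes "i < N"
  shows "(\<Sum>j<N. companion N b i j z * x j) = (if Suc i = N then \<Sum>j<N. b j z * x j else x (Suc i))"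
proof (cases "Suc i = N")
  case False
  then have "(\<Sum>j<N. companion N b i j z * x j) = (\<Sum>j<N. if j = Suc i then x j else 0)"
    by (intro sum.cong) (auto simp: companion_def)
  also have "\<dots> = x (Suc i)" using False assms by (subst sum.delta) auto
  finally show ?thesis using False by simp
qed (simp add: companion_def)

lemma higher_deriv_chain:
  assumes "open X" and x: "\<And>i z. Suc i < N \<Longrightarrow> z \<in> X \<Longrightarrow> (x i has_field_derivative x (Suc i) z) (at z)"
  shows "i < N \<Longrightarrow> z \<in> X \<Longrightarrow> (deriv ^^ i) (x 0) z = x i z"
proof (induction i arbitrary: z)
  case (Suc i)
  have "\<forall>\<^sub>F y in nhds z. (deriv ^^ i) (x 0) y = x i y"
    using Suc by (intro eventually_nhds_in_open[THEN eventually_mono, OF \<open>open X\<close>]) auto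
  then have "deriv ((deriv ^^ i) (x 0)) z = deriv (x i) z" by (intro deriv_cong_ev) auto
  also have "\<dots> = x (Suc i) z" using Suc x by (intro DERIV_imp_deriv) auto
  finally show ?case by simp
qed simp

lemma linear_ode_exists:
  assumes r: "0 < r" "r < R" and b: "\<And>j. j < N \<Longrightarrow> b j holomorphic_on ball z0 R" and "N > 0"
    and c: "c holomorphic_on ball z0 R" and z1: "z1 \<in> ball z0 r"
  obtains y where "y holomorphic_on ball z0 r" "\<And>k. k < N \<Longrightarrow> (deriv ^^ k) y z1 = x0 k"
    "\<And>z. z \<in> ball z0 r \<Longrightarrow> (deriv ^^ N) y z = (\<Sum>j<N. b j z * (deriv ^^ j) y z) + c z"
proof -
  have comp: "companion N b i j holomorphic_on ball z0 R" if "i < N" "j < N" for i j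
    using that b by (cases "Suc i = N"; cases "j = Suc i") (auto simp: companion_def[abs_def] intro!: holomorphic_intros)
    define f where "f i = (if Suc i = N then c else (\<lambda>z. 0))" for i
    have fh: "f i holomorphic_on ball z0 R" for i using c by (auto simp: f_def)
    have "\<exists>x. \<forall>i<N. x i z1 = x0 i \<and> (\<forall>z\<in>ball z0 r.
        (x i has_field_derivative (\<Sum>j<N. companion N b i j z * x j z) + f i z) (at z))"
      by (rule linear_system_exists[OF r comp fh z1])
    then obtain x where "\<forall>i<N. x i z1 = x0 i \<and> (\<forall>z\<in>ball z0 r.
        (x i has_field_derivative (\<Sum>j<N. companion N b i j z * x j z) + f i z) (at z))"
      by (elim exE)
    then have x: "x i z1 = x0 i" "z \<in> ball z0 r \<Longrightarrow>
        (x i has_field_derivative (\<Sum>j<N. companion N b i j z * x j z) + f i z) (at z)" if "i < N" for i z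
      using that by simp_all
    have step: "(x i has_field_derivative x (Suc i) z) (at z)" if "Suc i < N" "z \<in> ball z0 r" for i z
      using x(2)[of i z] companion_sum[of i N b z "\<lambda>j. x j z"] that by (auto simp: f_def)
    have last: "(x (N-1) has_field_derivative (\<Sum>j<N. b j z * x j z) + c z) (at z)" if "z \<in> ball z0 r" for z
      using x(2)[of "N-1" z] companion_sum[of "N-1" N b z "\<lambda>j. x j z"] that \<open>N>0\<close> by (auto simp: f_def)
    have D: "(deriv ^^ i) (x 0) z = x i z" if "i < N" "z \<in> ball z0 r" for i z
      by (rule higher_deriv_chain[of "ball z0 r" N x]) (use step that in auto)
  show ?thesis
  proof (rule that[of "x 0"])
      show "x 0 holomorphic_on ball z0 r" using x(2)[OF \<open>N>0\<close>] by (rule holomorphic_on_derivI)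
      show "(deriv ^^ k) (x 0) z1 = x0 k" if "k < N" for k using D[OF that z1] x(1)[OF that] by simp
      fix z assume z: "z \<in> ball z0 r"
      have "\<forall>\<^sub>F y in nhds z. (deriv ^^ (N-1)) (x 0) y = x (N-1) y"
        using D[of "N-1"] z \<open>N>0\<close> by (intro eventually_nhds_in_open[THEN eventually_mono, OF open_ball z]) auto
      then have "deriv ((deriv ^^ (N-1)) (x 0)) z = deriv (x (N-1)) z" by (intro deriv_cong_ev) auto
      also have "\<dots> = (\<Sum>j<N. b j z * x j z) + c z" using last z by (intro DERIV_imp_deriv) auto
      also have "deriv ((deriv ^^ (N-1)) (x 0)) z = (deriv ^^ N) (x 0) z"
        using \<open>N>0\<close> by (cases N) auto
      finally show "(deriv ^^ N) (x 0) z = (\<Sum>j<N. b j z * (deriv ^^ j) (x 0) z) + c z"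
        using D z by simp
  qed
qed

lemma linear_ode_unique:
  assumes X: "open X" "connected X" "z1 \<in> X" and b: "\<And>j. j < N \<Longrightarrow> b j holomorphic_on X"
    and y: "y1 holomorphic_on X" "y2 holomorphic_on X"
    and e1: "\<And>z. z \<in> X \<Longrightarrow> (deriv ^^ N) y1 z = (\<Sum>j<N. b j z * (deriv ^^ j) y1 z) + c z"
    and e2: "\<And>z. z \<in> X \<Longrightarrow> (deriv ^^ N) y2 z = (\<Sum>j<N. b j z * (deriv ^^ j) y2 z) + c z"
    and jet: "\<And>k. k < N \<Longrightarrow> (deriv ^^ k) y1 z1 = (deriv ^^ k) y2 z1" and "z \<in> X" "N > 0"
  shows "y1 z = y2 z"
proof -
  define x where "x i z = (deriv ^^ i) y1 z - (deriv ^^ i) y2 z" for i z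
  have D: "(x i has_field_derivative x (Suc i) z) (at z)" if "z \<in> X" for i z
    unfolding x_def[abs_def] using X y that by (intro DERIV_diff has_field_derivative_higher_deriv[of _ X])
  have "x 0 z = 0"
  proof (rule linear_system_unique[of X z1 N "companion N b" x])
    fix i z assume "i < N" "z \<in> X"
    have "x N z = (\<Sum>j<N. b j z * x j z)"
      using e1[OF \<open>z\<in>X\<close>] e2[OF \<open>z\<in>X\<close>] by (simp add: x_def sum_subtractf algebra_simps)
    then have "x (Suc i) z = (\<Sum>j<N. companion N b i j z * x j z)"
      using companion_sum[OF \<open>i<N\<close>, of b z "\<lambda>j. x j z"] by auto
    then show "(x i has_field_derivative (\<Sum>j<N. companion N b i j z * x j z)) (at z)"
      using D[OF \<open>z\<in>X\<close>, of i] by simp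
  next
    fix i j assume "i < N" "j < N"
    then show "companion N b i j holomorphic_on X"
      using b by (cases "Suc i = N"; cases "j = Suc i") (auto simp: companion_def[abs_def] intro!: holomorphic_intros)
  qed (use assms in \<open>auto simp: x_def\<close>)
  then show ?thesis by (simp add: x_def)
qed

section \<open>The defect of a quadratic equation\<close>

text \<open>Half the coefficient of \<open>w\<^sup>(\<^sup>i\<^sup>) w\<^bsup>(m-i)\<^esup>\<close> for \<open>i \<noteq> m - i\<close>, so that a sum over all \<open>i \<le> m\<close> gives the quadratic part.\<close>
definition sym_coeff :: "(nat \<Rightarrow> nat \<Rightarrow> complex \<Rightarrow> complex) \<Rightarrow> nat \<Rightarrow> nat \<Rightarrow> complex \<Rightarrow> complex" where
  "sym_coeff a m i z = (if 2 * i = m then a i i z else a (max i (m - i)) (min i (m - i)) z / 2)"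

definition quad_coeff :: "nat \<Rightarrow> (complex \<Rightarrow> complex) \<Rightarrow> (nat \<Rightarrow> nat \<Rightarrow> complex \<Rightarrow> complex) \<Rightarrow> nat \<Rightarrow> complex \<Rightarrow> complex" where
  "quad_coeff n A a m z = (if m = n - 1 then A z else sym_coeff a m 0 z)"

text \<open>The Leibniz coefficient of the j-th derivative of f in Q(f / A). Where \<open>A\<close>
  vanishes, the convention 1 / 0 = 0 makes the value meaningless; all uses stay away from such
  points.\<close>

definition lin_coeff :: "nat \<Rightarrow> (complex \<Rightarrow> complex) \<Rightarrow> (nat \<Rightarrow> nat \<Rightarrow> complex \<Rightarrow> complex) \<Rightarrow> nat \<Rightarrow> complex \<Rightarrow> complex" where
  "lin_coeff n A a j z = (\<Sum>m=j..n - 1. of_nat (m choose j) * quad_coeff n A a m z * (deriv ^^ (m - j)) (\<lambda>x. 1 / A x) z)"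

text \<open>The value of \<open>B\<close> forced by comparing the coefficients of \<open>w\<^bsup>(n-1)\<^esup>\<close>.\<close>
definition riccati_coeff :: "nat \<Rightarrow> (complex \<Rightarrow> complex) \<Rightarrow> (nat \<Rightarrow> nat \<Rightarrow> complex \<Rightarrow> complex) \<Rightarrow> (nat \<Rightarrow> complex \<Rightarrow> complex) \<Rightarrow> complex \<Rightarrow> complex" where
  "riccati_coeff n A a b z = b (n - 1) z + lin_coeff n A a (n - 2) z"

text \<open>What the linear part of the equation leaves over after subtracting L(w' - B w): the
  coefficient of the m-th derivative of w in the difference, expanded by the Leibniz rule. For
  \<open>m = n - 1\<close> it is 0 by the choice of B.\<close>

definition lin_defect :: "nat \<Rightarrow> (complex \<Rightarrow> complex) \<Rightarrow> (nat \<Rightarrow> nat \<Rightarrow> complex \<Rightarrow> complex) \<Rightarrow> (nat \<Rightarrow> complex \<Rightarrow> complex) \<Rightarrow> nat \<Rightarrow> complex \<Rightarrow> complex" where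
  "lin_defect n A a b m z = b m z + (if m = 0 then 0 else lin_coeff n A a (m - 1) z)
     - (\<Sum>j=m..n - 1. lin_coeff n A a j z * (of_nat (j choose m) * (deriv ^^ (j - m)) (riccati_coeff n A a b) z))"

text \<open>Measures how far the quadratic terms of total order \<open>m\<close> are from a multiple
  of the m-th derivative of the square of w. The multiple is fixed by the index 0, where the defect
  therefore vanishes.\<close>

definition quad_defect :: "(nat \<Rightarrow> nat \<Rightarrow> complex \<Rightarrow> complex) \<Rightarrow> nat \<Rightarrow> nat \<Rightarrow> complex \<Rightarrow> complex" where
  "quad_defect a m i z = sym_coeff a m i z - of_nat (m choose i) * sym_coeff a m 0 z"

definition lin_op :: "nat \<Rightarrow> (complex \<Rightarrow> complex) \<Rightarrow> (nat \<Rightarrow> nat \<Rightarrow> complex \<Rightarrow> complex) \<Rightarrow> (complex \<Rightarrow> complex) \<Rightarrow> complex \<Rightarrow> complex" where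
  "lin_op n A a f z = (\<Sum>j<n. lin_coeff n A a j z * (deriv ^^ j) f z)"

definition quad_op :: "nat \<Rightarrow> (complex \<Rightarrow> complex) \<Rightarrow> (nat \<Rightarrow> nat \<Rightarrow> complex \<Rightarrow> complex) \<Rightarrow> (complex \<Rightarrow> complex) \<Rightarrow> complex \<Rightarrow> complex" where
  "quad_op n A a f z = (\<Sum>m<n. quad_coeff n A a m z * (deriv ^^ m) f z)"

definition defect :: "nat \<Rightarrow> (complex \<Rightarrow> complex) \<Rightarrow> (nat \<Rightarrow> nat \<Rightarrow> complex \<Rightarrow> complex) \<Rightarrow> (nat \<Rightarrow> complex \<Rightarrow> complex) \<Rightarrow> (complex \<Rightarrow> complex) \<Rightarrow> complex \<Rightarrow> complex" where
  "defect n A a b w z = (\<Sum>m<n - 1. \<Sum>i\<le>m. quad_defect a m i z * (deriv ^^ i) w z * (deriv ^^ (m - i)) w z)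
     + (\<Sum>m<n - 1. lin_defect n A a b m z * (deriv ^^ m) w z)"

definition coeffs_holomorphic :: "nat \<Rightarrow> (complex \<Rightarrow> complex) \<Rightarrow> (nat \<Rightarrow> nat \<Rightarrow> complex \<Rightarrow> complex) \<Rightarrow> (nat \<Rightarrow> complex \<Rightarrow> complex) \<Rightarrow> (complex \<Rightarrow> complex) \<Rightarrow> complex set \<Rightarrow> bool" where
  "coeffs_holomorphic n A a b c S \<longleftrightarrow> A holomorphic_on S \<and> (\<forall>(k, j)\<in>quadratic_index n. a k j holomorphic_on S)
     \<and> (\<forall>j\<le>n - 1. b j holomorphic_on S) \<and> c holomorphic_on S"

lemma coeffs_holomorphic_subset: "coeffs_holomorphic n A a b c S \<Longrightarrow> T \<subseteq> S \<Longrightarrow> coeffs_holomorphic n A a b c T"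
  unfolding coeffs_holomorphic_def by (auto elim!: holomorphic_on_subset)

lemma sum_triangle_swap:
  fixes f :: "nat \<Rightarrow> nat \<Rightarrow> complex"
  shows "(\<Sum>m<n. \<Sum>i=0..m. f m i) = (\<Sum>i<n. \<Sum>m=i..n - 1. f m i)"
proof -
  have "(\<Sum>m<n. \<Sum>i=0..m. f m i) = (\<Sum>m<n. \<Sum>i | i \<in> {..<n} \<and> i \<le> m. f m i)"
    by (intro sum.cong) auto
  also have "\<dots> = (\<Sum>i<n. \<Sum>m | m \<in> {..<n} \<and> i \<le> m. f m i)"
    by (rule sum.swap_restrict) auto
  also have "\<dots> = (\<Sum>i<n. \<Sum>m=i..n - 1. f m i)"
    by (intro sum.cong) auto
  finally show ?thesis .
qed

lemma quadratic_sum_sym: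
  "(\<Sum>(k, j)\<in>quadratic_index n. a k j z * X k * X j) = (\<Sum>m<n - 1. \<Sum>i\<le>m. sym_coeff a m i z * X i * X (m - i))"
proof -
  define g where "g i l = (if i = l then a i i z else a (max i l) (min i l) z / 2) * X i * X l" for i l
  let ?T = "{(i, l). i + l < n - 1}"
  have fin: "finite ?T" by (rule finite_subset[of _ "{..<n} \<times> {..<n}"]) auto
  have finI: "finite (quadratic_index n)" by (rule finite_subset[OF _ fin]) (auto simp: quadratic_index_def)
  have "(\<Sum>m<n - 1. \<Sum>i\<le>m. sym_coeff a m i z * X i * X (m - i)) = (\<Sum>m<n - 1. \<Sum>i\<le>m. g i (m - i))"
    by (intro sum.cong) (auto simp: g_def sym_coeff_def)
  also have "\<dots> = (\<Sum>(i, l)\<in>?T. g i l)" by (rule sum.triangle_reindex[symmetric])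
  also have "?T = {(i, l). i + l < n - 1 \<and> l \<le> i} \<union> {(i, l). i + l < n - 1 \<and> i < l}" by auto
  also have "(\<Sum>(i, l)\<in>\<dots>. g i l) = (\<Sum>(i, l)\<in>{(i, l). i + l < n - 1 \<and> l \<le> i}. g i l) + (\<Sum>(i, l)\<in>{(i, l). i + l < n - 1 \<and> i < l}. g i l)"
    by (rule sum.union_disjoint) (auto intro: finite_subset[OF _ fin])
  also have "(\<Sum>(i, l)\<in>{(i, l). i + l < n - 1 \<and> i < l}. g i l) = (\<Sum>(i, l)\<in>{(i, l). i + l < n - 1 \<and> l < i}. g i l)"
    by (rule sum.reindex_bij_witness[of _ prod.swap prod.swap]) (auto simp: g_def max_def min_def)
  also have "\<dots> = (\<Sum>(i, l)\<in>{(i, l). i + l < n - 1 \<and> l \<le> i}. if l < i then g i l else 0)"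
    by (rule sum.mono_neutral_cong_left) (auto intro: finite_subset[OF _ fin] split: if_splits)
  also have "(\<Sum>(i, l)\<in>{(i, l). i + l < n - 1 \<and> l \<le> i}. g i l) + \<dots> = (\<Sum>(i, l)\<in>{(i, l). i + l < n - 1 \<and> l \<le> i}. a i l z * X i * X l)"
    unfolding sum.distrib[symmetric] by (intro sum.cong) (auto simp: g_def max_def min_def)
  also have "{(i, l). i + l < n - 1 \<and> l \<le> i} = quadratic_index n" by (auto simp: quadratic_index_def)
  finally show ?thesis by simp
qed

lemma higher_deriv_square:
  assumes "w holomorphic_on S" "open S" "z \<in> S"
  shows "(deriv ^^ m) (\<lambda>x. (w x)\<^sup>2) z = (\<Sum>i\<le>m. of_nat (m choose i) * (deriv ^^ i) w z * (deriv ^^ (m - i)) w z)"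
  unfolding power2_eq_square using higher_deriv_mult[OF assms(1,1) assms(2,3), of m] by (simp add: atMost_atLeast0)

section \<open>Holomorphy of the derived coefficients\<close>

lemma holomorphic_sym_coeff:
  assumes "coeffs_holomorphic n A a b c S" "m < n - 1" "i \<le> m"
  shows "sym_coeff a m i holomorphic_on S"
proof -
  have *: "\<forall>(k, j)\<in>quadratic_index n. a k j holomorphic_on S" using assms by (simp add: coeffs_holomorphic_def)
  have "(max i (m - i), min i (m - i)) \<in> quadratic_index n" using assms by (auto simp: quadratic_index_def)
  with * have 1: "a (max i (m - i)) (min i (m - i)) holomorphic_on S" by blast
  show ?thesis
  proof (cases "2 * i = m")
    case True
    then have "a i i holomorphic_on S" using * assms by (auto simp: quadratic_index_def)
    then show ?thesis using True by (simp add: sym_coeff_def[abs_def])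
  next
    case False
    then show ?thesis using 1 by (simp add: sym_coeff_def[abs_def] holomorphic_intros)
  qed
qed

lemma holomorphic_quad_defect:
  assumes "coeffs_holomorphic n A a b c S" "m < n - 1" "i \<le> m"
  shows "quad_defect a m i holomorphic_on S"
  unfolding quad_defect_def[abs_def]
  by (intro holomorphic_intros holomorphic_sym_coeff[OF assms(1)]) (use assms in auto)

lemma holomorphic_quad_coeff:
  assumes "coeffs_holomorphic n A a b c S" "m < n"
  shows "quad_coeff n A a m holomorphic_on S"
proof (cases "m = n - 1")
  case True
  then show ?thesis using assms by (simp add: quad_coeff_def[abs_def] coeffs_holomorphic_def)
next
  case False
  then have "sym_coeff a m 0 holomorphic_on S" using assms by (intro holomorphic_sym_coeff[OF assms(1)]) auto
  then show ?thesis using False by (simp add: quad_coeff_def[abs_def])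
qed

lemma holomorphic_lin_coeff:
  assumes "coeffs_holomorphic n A a b c S" "open S" "\<And>z. z \<in> S \<Longrightarrow> A z \<noteq> 0" "n \<ge> 2"
  shows "lin_coeff n A a j holomorphic_on S"
proof -
  have "A holomorphic_on S" using assms by (simp add: coeffs_holomorphic_def)
  then have "(\<lambda>x. 1 / A x) holomorphic_on S" using assms(3) by (intro holomorphic_intros) auto
  with assms(2,4) show ?thesis unfolding lin_coeff_def[abs_def]
    by (intro holomorphic_on_sum holomorphic_on_mult holomorphic_on_const holomorphic_higher_deriv holomorphic_quad_coeff[OF assms(1)]) auto
qed

lemma holomorphic_riccati_coeff:
  assumes "coeffs_holomorphic n A a b c S" "open S" "\<And>z. z \<in> S \<Longrightarrow> A z \<noteq> 0" "n \<ge> 2"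
  shows "riccati_coeff n A a b holomorphic_on S"
  unfolding riccati_coeff_def[abs_def]
  using assms by (intro holomorphic_intros holomorphic_lin_coeff[OF assms]) (auto simp: coeffs_holomorphic_def)

lemma holomorphic_lin_defect:
  assumes "coeffs_holomorphic n A a b c S" "open S" "\<And>z. z \<in> S \<Longrightarrow> A z \<noteq> 0" "n \<ge> 2" "m < n"
  shows "lin_defect n A a b m holomorphic_on S"
proof -
  have b: "b m holomorphic_on S" using assms by (auto simp: coeffs_holomorphic_def)
  have "(\<lambda>z. if m = 0 then 0 else lin_coeff n A a (m - 1) z) holomorphic_on S"
    using holomorphic_lin_coeff[OF assms(1-4)] by (cases "m = 0") (auto intro!: holomorphic_intros)
  then show ?thesis unfolding lin_defect_def[abs_def]
    by (intro holomorphic_intros b assms(2) holomorphic_lin_coeff[OF assms(1-4)] holomorphic_riccati_coeff[OF assms(1-4)])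
qed

lemma lin_coeff_top:
  assumes "n \<ge> 2" "A z \<noteq> 0"
  shows "lin_coeff n A a (n - 1) z = 1"
  using assms by (simp add: lin_coeff_def quad_coeff_def)

section \<open>The equation written with the operator L\<close>

lemma lin_op_eq_quad_op:
  assumes "open S" "z \<in> S" "A holomorphic_on S" "\<And>z. z \<in> S \<Longrightarrow> A z \<noteq> 0" "f holomorphic_on S"
  shows "lin_op n A a f z = quad_op n A a (\<lambda>x. f x / A x) z"
proof -
  have h: "(\<lambda>x. 1 / A x) holomorphic_on S" using assms by (intro holomorphic_intros) auto
  have "(deriv ^^ m) (\<lambda>x. f x / A x) z = (\<Sum>i=0..m. of_nat (m choose i) * (deriv ^^ i) f z * (deriv ^^ (m-i)) (\<lambda>x. 1 / A x) z)" for m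
    using higher_deriv_mult[OF assms(5) h assms(1,2), of m] by simp
  then have "quad_op n A a (\<lambda>x. f x / A x) z = (\<Sum>m<n. \<Sum>i=0..m. quad_coeff n A a m z * (of_nat (m choose i) * (deriv ^^ i) f z * (deriv ^^ (m-i)) (\<lambda>x. 1 / A x) z))"
    by (simp add: quad_op_def sum_distrib_left)
  also have "\<dots> = (\<Sum>i<n. \<Sum>m=i..n-1. quad_coeff n A a m z * (of_nat (m choose i) * (deriv ^^ i) f z * (deriv ^^ (m-i)) (\<lambda>x. 1 / A x) z))"
    by (rule sum_triangle_swap)
  also have "\<dots> = lin_op n A a f z"
    unfolding lin_op_def lin_coeff_def sum_distrib_right by (intro sum.cong refl) (simp add: mult_ac)
  finally show ?thesis ..
qed

text \<open>Because L(A f) = Q(f), the term L(A w^2) is Q(w^2). It reproduces the term of order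
  \<open>n - 1\<close> exactly and, in each lower order, the quadratic terms up to
  \<open>quad_defect\<close>.\<close>

lemma quadratic_part:
  assumes "open S" "z \<in> S" "A holomorphic_on S" "\<And>z. z \<in> S \<Longrightarrow> A z \<noteq> 0" "w holomorphic_on S" "n \<ge> 2"
  shows "A z * (deriv ^^ (n - 1)) (\<lambda>x. (w x)\<^sup>2) z + (\<Sum>(k, j)\<in>quadratic_index n. a k j z * (deriv ^^ k) w z * (deriv ^^ j) w z)
    = lin_op n A a (\<lambda>x. A x * (w x)\<^sup>2) z + (\<Sum>m<n - 1. \<Sum>i\<le>m. quad_defect a m i z * (deriv ^^ i) w z * (deriv ^^ (m - i)) w z)"
proof -
  have "lin_op n A a (\<lambda>x. A x * (w x)\<^sup>2) z = quad_op n A a (\<lambda>x. A x * (w x)\<^sup>2 / A x) z"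
    using assms(1-4) by (rule lin_op_eq_quad_op) (auto intro!: holomorphic_intros assms)
  also have "\<dots> = quad_op n A a (\<lambda>x. (w x)\<^sup>2) z"
  proof -
    have "(deriv ^^ m) (\<lambda>x. A x * (w x)\<^sup>2 / A x) z = (deriv ^^ m) (\<lambda>x. (w x)\<^sup>2) z" for m
    proof (intro higher_deriv_transform_within_open[of _ S])
      show "(\<lambda>x. A x * (w x)\<^sup>2 / A x) holomorphic_on S" using assms by (intro holomorphic_intros) auto
    qed (use assms in \<open>auto intro!: holomorphic_intros\<close>)
    then show ?thesis by (simp add: quad_op_def)
  qed
  also have "\<dots> = (\<Sum>m\<in>insert (n-1) {..<n-1}. quad_coeff n A a m z * (deriv ^^ m) (\<lambda>x. (w x)\<^sup>2) z)"
    unfolding quad_op_def using assms(6) by (intro sum.cong) auto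
  also have "\<dots> = A z * (deriv ^^ (n - 1)) (\<lambda>x. (w x)\<^sup>2) z + (\<Sum>m<n-1. sym_coeff a m 0 z * (deriv ^^ m) (\<lambda>x. (w x)\<^sup>2) z)"
    by (subst sum.insert) (auto simp: quad_coeff_def intro!: sum.cong)
  finally show ?thesis
    unfolding quadratic_sum_sym[of a z "\<lambda>k. (deriv ^^ k) w z" n] higher_deriv_square[OF assms(5,1,2)] quad_defect_def
    by (simp add: sum_distrib_left sum.distrib sum_subtractf algebra_simps)
qed

text \<open>In L(w' - B w) the summand w' shifts the coefficients of L by one place and B w
  contributes Leibniz sums. The n-th derivative has coefficient 1, and the one below it matches
  \<open>b (n - 1)\<close> by the choice of \<open>riccati_coeff\<close>, so the defect ends at
  order \<open>n - 2\<close>.\<close>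

lemma linear_part:
  assumes S: "open S" "z \<in> S" "\<And>z. z \<in> S \<Longrightarrow> A z \<noteq> 0" "w holomorphic_on S" "n \<ge> 2"
    "coeffs_holomorphic n A a b c S"
  shows "(deriv ^^ n) w z - (\<Sum>j=0..n - 1. b j z * (deriv ^^ j) w z)
    = lin_op n A a (\<lambda>x. deriv w x - riccati_coeff n A a b x * w x) z - (\<Sum>m<n - 1. lin_defect n A a b m z * (deriv ^^ m) w z)"
proof -
  let ?B = "riccati_coeff n A a b" and ?l = "\<lambda>j. lin_coeff n A a j z"
  let ?W = "\<lambda>j. (deriv ^^ j) w z"
  have B: "?B holomorphic_on S" using holomorphic_riccati_coeff[OF S(6,1,3,5)] .
  have "(deriv ^^ j) (\<lambda>x. deriv w x - ?B x * w x) z = ?W (Suc j) - (\<Sum>i=0..j. of_nat (j choose i) * (deriv ^^ (j - i)) ?B z * ?W i)" for j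
  proof -
    have "(deriv ^^ j) (\<lambda>x. deriv w x - w x * ?B x) z = (deriv ^^ j) (deriv w) z - (deriv ^^ j) (\<lambda>x. w x * ?B x) z"
      using S B by (intro higher_deriv_diff[of _ S]) (auto intro!: holomorphic_intros)
    also have "(deriv ^^ j) (deriv w) z = ?W (Suc j)" by (simp only: funpow_Suc_right o_def)
    also have "(deriv ^^ j) (\<lambda>x. w x * ?B x) z = (\<Sum>i=0..j. of_nat (j choose i) * ?W i * (deriv ^^ (j - i)) ?B z)"
      by (rule higher_deriv_mult[OF S(4) B S(1,2)])
    finally show ?thesis by (simp only: mult.commute mult.left_commute mult.assoc)
  qed
  then have "lin_op n A a (\<lambda>x. deriv w x - ?B x * w x) z = (\<Sum>j<n. ?l j * ?W (Suc j)) - (\<Sum>j<n. \<Sum>i=0..j. ?l j * (of_nat (j choose i) * (deriv ^^ (j - i)) ?B z) * ?W i)"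
    by (simp add: lin_op_def right_diff_distrib sum_subtractf sum_distrib_left mult.assoc)
  also have "(\<Sum>j<n. \<Sum>i=0..j. ?l j * (of_nat (j choose i) * (deriv ^^ (j - i)) ?B z) * ?W i)
     = (\<Sum>i<n. (\<Sum>j=i..n-1. ?l j * (of_nat (j choose i) * (deriv ^^ (j - i)) ?B z)) * ?W i)"
    unfolding sum_triangle_swap by (simp add: sum_distrib_right)
  finally have 1: "lin_op n A a (\<lambda>x. deriv w x - ?B x * w x) z = (\<Sum>j<n. ?l j * ?W (Suc j)) - (\<Sum>i<n. (\<Sum>j=i..n-1. ?l j * (of_nat (j choose i) * (deriv ^^ (j - i)) ?B z)) * ?W i)" .
  obtain k where n: "n = Suc (Suc k)" using S(5) by (metis One_nat_def Suc_1 Suc_le_D less_eq_Suc_le add_2_eq_Suc le_Suc_ex)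
  have top: "?l (Suc k) = 1" using lin_coeff_top[OF S(5), of A z a] S n by simp
  have "(\<Sum>j<n. ?l j * ?W (Suc j)) = ?W n + (\<Sum>j<Suc k. ?l j * ?W (Suc j))" using top by (simp add: n)
  also have "(\<Sum>j<Suc k. ?l j * ?W (Suc j)) = (\<Sum>m<n. (if m = 0 then 0 else ?l (m - 1)) * ?W m)"
    unfolding n by (subst sum.lessThan_Suc_shift) simp
  finally have 2: "(\<Sum>j<n. ?l j * ?W (Suc j)) = ?W n + (\<Sum>m<n. (if m = 0 then 0 else ?l (m - 1)) * ?W m)" .
  \<comment> \<open>Here \<open>Suc k\<close> is \<open>n - 1\<close>. With top coefficient 1 this
    is the definition of \<open>riccati_coeff\<close>, and it allows the defect sum to be extended
    to all orders below \<open>n\<close>.\<close>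
  have "lin_defect n A a b (Suc k) z = 0"
    using top by (simp add: lin_defect_def n riccati_coeff_def)
  then have "(\<Sum>m<n - 1. lin_defect n A a b m z * ?W m) = (\<Sum>m<n. lin_defect n A a b m z * ?W m)" by (simp add: n)
  also have "\<dots> = (\<Sum>m<n. b m z * ?W m) + (\<Sum>m<n. (if m = 0 then 0 else ?l (m - 1)) * ?W m) -
      (\<Sum>i<n. (\<Sum>j=i..n-1. ?l j * (of_nat (j choose i) * (deriv ^^ (j - i)) ?B z)) * ?W i)"
    unfolding lin_defect_def by (simp only: left_diff_distrib distrib_right sum_subtractf sum.distrib)
  also have "(\<Sum>m<n. b m z * ?W m) = (\<Sum>j=0..n - 1. b j z * ?W j)" by (intro sum.cong) (auto simp: n)
  finally have 3: "(\<Sum>m<n - 1. lin_defect n A a b m z * ?W m) = (\<Sum>j=0..n - 1. b j z * ?W j) + (\<Sum>m<n. (if m = 0 then 0 else ?l (m - 1)) * ?W m) -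
      (\<Sum>i<n. (\<Sum>j=i..n-1. ?l j * (of_nat (j choose i) * (deriv ^^ (j - i)) ?B z)) * ?W i)" .
  show ?thesis unfolding 1 2 3 by simp
qed

lemma lin_op_diff:
  assumes "open S" "z \<in> S" "f holomorphic_on S" "g holomorphic_on S"
  shows "lin_op n A a (\<lambda>x. f x - g x) z = lin_op n A a f z - lin_op n A a g z"
  unfolding lin_op_def using higher_deriv_diff[OF assms(3,4,1,2)] by (simp add: right_diff_distrib sum_subtractf)

lemma lin_op_cong:
  assumes "open S" "z \<in> S" "f holomorphic_on S" "\<And>x. x \<in> S \<Longrightarrow> f x = g x"
  shows "lin_op n A a f z = lin_op n A a g z"
proof -
  have "g holomorphic_on S" using assms(3,4) by (simp cong: holomorphic_cong)
  then have "(deriv ^^ j) f z = (deriv ^^ j) g z" for j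
    using assms by (intro higher_deriv_transform_within_open[of f S]) auto
  then show ?thesis by (simp add: lin_op_def)
qed

lemma quadratic_ode_residual:
  assumes S: "open S" "z \<in> S" "\<And>z. z \<in> S \<Longrightarrow> A z \<noteq> 0" "w holomorphic_on S" "n \<ge> 2"
    "coeffs_holomorphic n A a b c S"
  shows "(deriv ^^ n) w z - (A z * (deriv ^^ (n - 1)) (\<lambda>x. (w x)\<^sup>2) z
       + (\<Sum>(k, j)\<in>quadratic_index n. a k j z * (deriv ^^ k) w z * (deriv ^^ j) w z)
       + (\<Sum>j=0..n - 1. b j z * (deriv ^^ j) w z) + c z)
    = lin_op n A a (riccati_change A (riccati_coeff n A a b) w) z - c z - defect n A a b w z"
proof -
  let ?B = "riccati_coeff n A a b"
  have A: "A holomorphic_on S" using S by (simp add: coeffs_holomorphic_def)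
  have B: "?B holomorphic_on S" using holomorphic_riccati_coeff[OF S(6,1,3,5)] .
  have h: "(\<lambda>x. deriv w x - ?B x * w x) holomorphic_on S" "(\<lambda>x. A x * (w x)\<^sup>2) holomorphic_on S"
    using S A B by (auto intro!: holomorphic_intros)
  have "riccati_change A ?B w = (\<lambda>x. (deriv w x - ?B x * w x) - A x * (w x)\<^sup>2)"
    by (auto simp: riccati_change_def)
  then have "lin_op n A a (riccati_change A ?B w) z = lin_op n A a (\<lambda>x. deriv w x - ?B x * w x) z - lin_op n A a (\<lambda>x. A x * (w x)\<^sup>2) z"
    using lin_op_diff[OF S(1,2) h] by simp
  then show ?thesis
    using quadratic_part[where a=a and S=S and z=z and A=A and w=w and n=n] linear_part[OF S] S A unfolding defect_def by (simp add: algebra_simps)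
qed

lemma quadratic_ode_iff:
  assumes S: "open S" "z \<in> S" "\<And>z. z \<in> S \<Longrightarrow> A z \<noteq> 0" "w holomorphic_on S" "n \<ge> 2"
    "coeffs_holomorphic n A a b c S"
  shows "quadratic_ode n A a b c w z \<longleftrightarrow>
    lin_op n A a (riccati_change A (riccati_coeff n A a b) w) z = c z + defect n A a b w z"
  unfolding quadratic_ode_def using quadratic_ode_residual[OF S] by (auto simp: algebra_simps)

lemma lin_op_linear_ode:
  assumes "n \<ge> 2" "A z \<noteq> 0"
  shows "lin_op n A a u z = f z \<longleftrightarrow> linear_ode (n - 1) (\<lambda>j z. - lin_coeff n A a j z) f u z"
proof -
  obtain k where n: "n = Suc (Suc k)" using assms(1) by (metis add_2_eq_Suc le_Suc_ex)
  show ?thesis using lin_coeff_top[of n A z a] assms by (auto simp: lin_op_def linear_ode_def n sum_negf algebra_simps)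
qed

section \<open>Recovering coefficients from jets\<close>

lemma power_jet:
  "(deriv ^^ k) (\<lambda>x. (x - z) ^ m) z = (if k = m then fact m else (0::complex))"
proof -
  have "pochhammer (of_nat (Suc m - k)) k = (0::complex)" if "k > m"
    using that by (simp add: pochhammer_0_left)
  then show ?thesis
    unfolding higher_deriv_power by (cases k m rule: linorder_cases) (auto simp: pochhammer_fact[symmetric])
qed

lemma higher_deriv_sum_holomorphic:
  assumes "finite I" "open S" "z \<in> S" "\<And>i. i \<in> I \<Longrightarrow> f i holomorphic_on S"
  shows "(deriv ^^ k) (\<lambda>x. \<Sum>i\<in>I. f i x) z = (\<Sum>i\<in>I. (deriv ^^ k) (f i) z)"
  using assms(1,4)
proof (induction I)
  case (insert i I)
  then have "(deriv ^^ k) (\<lambda>x. f i x + (\<Sum>i\<in>I. f i x)) z = (deriv ^^ k) (f i) z + (deriv ^^ k) (\<lambda>x. \<Sum>i\<in>I. f i x) z"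
    using assms by (intro higher_deriv_add[of _ S]) (auto intro!: holomorphic_intros)
  then show ?case using insert by simp
qed simp

text \<open>Jets at a point are arbitrary. An identity between differential polynomials valid for
  all functions thus becomes an identity between ordinary polynomials in the free variables
  \<open>X i\<close>.\<close>

lemma exists_polynomial_jet:
  fixes X :: "nat \<Rightarrow> complex"
  obtains p where "p holomorphic_on UNIV" "\<And>i. i < n \<Longrightarrow> (deriv ^^ i) p z = X i"
proof -
  define p where "p = (\<lambda>x. \<Sum>k<n. X k / fact k * (x - z) ^ k)"
  show ?thesis
  proof (rule that[of p])
    show "p holomorphic_on UNIV" unfolding p_def by (intro holomorphic_intros)
    fix i assume i: "i < n"
    have "(deriv ^^ i) p z = (\<Sum>k<n. (deriv ^^ i) (\<lambda>x. X k / fact k * (x - z) ^ k) z)"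
      unfolding p_def by (rule higher_deriv_sum_holomorphic[of _ UNIV]) (auto intro!: holomorphic_intros)
    also have "\<dots> = (\<Sum>k<n. if k = i then X i else 0)"
    proof (intro sum.cong refl)
      fix k
      have "(deriv ^^ i) (\<lambda>x. X k / fact k * (x - z) ^ k) z = X k / fact k * (deriv ^^ i) (\<lambda>x. (x - z) ^ k) z"
        by (rule higher_deriv_cmult[of _ UNIV]) (auto intro!: holomorphic_intros)
      then show "(deriv ^^ i) (\<lambda>x. X k / fact k * (x - z) ^ k) z = (if k = i then X i else 0)"
        by (simp add: power_jet)
    qed
    finally show "(deriv ^^ i) p z = X i" using i by simp
  qed
qed

text \<open>The origin gives the constant term, and replacing X by -X separates the even from the
  odd part. Polarization of the quadratic form at two unit vectors yields only the sum of
  \<open>f m i\<close> and \<open>f m (m - i)\<close>, which is why symmetry is assumed.\<close>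

lemma quadratic_polynomial_zero:
  fixes f :: "nat \<Rightarrow> nat \<Rightarrow> complex"
  assumes zero: "\<And>X. (\<Sum>m<N. \<Sum>i\<le>m. f m i * X i * X (m - i)) + (\<Sum>m<n. g m * X m) + h = 0"
    and sym: "\<And>m i. i \<le> m \<Longrightarrow> f m (m - i) = f m i"
  shows "\<And>m i. m < N \<Longrightarrow> i \<le> m \<Longrightarrow> f m i = 0" "\<And>m. m < n \<Longrightarrow> g m = 0" "h = 0"
proof -
  define F where "F X = (\<Sum>m<N. \<Sum>i\<le>m. f m i * X i * X (m - i))" for X
  define G where "G X = (\<Sum>m<n. g m * X m)" for X
  show h: "h = 0" using zero[of "\<lambda>_. 0"] by simp
  have "F X + G X = 0" for X using zero[of X] h by (simp add: F_def G_def)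
  moreover have "F (\<lambda>k. - X k) = F X" "G (\<lambda>k. - X k) = - G X" for X
    by (simp_all add: F_def G_def sum_negf)
  ultimately have FG: "F X = 0" "G X = 0" for X
  proof -
    assume 1: "\<And>X. F X + G X = 0" and 2: "\<And>X. F (\<lambda>k. - X k) = F X" "\<And>X. G (\<lambda>k. - X k) = - G X"
    have "F X - G X = 0" using 1[of "\<lambda>k. - X k"] 2[of X] by simp
    with 1[of X] have "2 * F X = 0" "2 * G X = 0" by (auto simp: algebra_simps)
    then show "F X = 0" "G X = 0" by auto
  qed
  show "g m = 0" if "m < n" for m
  proof -
    have "G (\<lambda>k. if k = m then 1 else 0) = g m"
      using that unfolding G_def by (simp add: if_distrib cong: if_cong)
    then show ?thesis using FG by simp
  qed
  define P where "P X Y = (\<Sum>m<N. \<Sum>i\<le>m. f m i * X i * Y (m - i))" for X Y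
  show "f m0 i0 = 0" if mi: "m0 < N" "i0 \<le> m0" for m0 i0
  proof -
    define e where "e j k = (if k = j then 1 else 0 :: complex)" for j k :: nat
    have P: "P (e i) (e l) = f (i + l) i" if "i + l < N" for i l
    proof -
      have "P (e i) (e l) = (\<Sum>m<N. \<Sum>k\<le>m. if k = i then (if m = i + l then f (i + l) i else 0) else 0)"
        unfolding P_def e_def by (intro sum.cong refl) auto
      also have "\<dots> = (\<Sum>m<N. if m = i + l then f (i + l) i else 0)"
        by (intro sum.cong refl) (auto simp: sum.delta)
      also have "\<dots> = f (i + l) i" using that by simp
      finally show ?thesis .
    qed
    have "F (\<lambda>k. X k + Y k) = F X + F Y + P X Y + P Y X" for X Y
      unfolding F_def P_def sum.distrib[symmetric] by (intro sum.cong refl) (simp add: algebra_simps)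
    then have "P (e i0) (e (m0 - i0)) + P (e (m0 - i0)) (e i0) = 0" using FG by simp
    then have "f m0 i0 + f m0 (m0 - i0) = 0" using P mi by simp
    then show ?thesis using sym[OF mi(2)] by simp
  qed
qed

lemma deriv_op_mult:
  assumes "open S" "z \<in> S" "h holomorphic_on S" "f holomorphic_on S"
  shows "(\<Sum>j<n. l j * (deriv ^^ j) (\<lambda>x. h x * f x) z) =
    (\<Sum>m<n. (\<Sum>j=m..n - 1. l j * (of_nat (j choose m) * (deriv ^^ (j - m)) h z)) * (deriv ^^ m) f z)"
proof -
  have "(deriv ^^ j) (\<lambda>x. h x * f x) z = (\<Sum>i=0..j. of_nat (j choose i) * (deriv ^^ i) f z * (deriv ^^ (j - i)) h z)" for j
    using higher_deriv_mult[OF assms(4,3,1,2), of j] by (simp only: mult.commute[of "h _"])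
  then have "(\<Sum>j<n. l j * (deriv ^^ j) (\<lambda>x. h x * f x) z) = (\<Sum>j<n. \<Sum>i=0..j. l j * (of_nat (j choose i) * (deriv ^^ (j - i)) h z) * (deriv ^^ i) f z)"
    by (simp add: sum_distrib_left mult_ac)
  also have "\<dots> = (\<Sum>m<n. (\<Sum>j=m..n - 1. l j * (of_nat (j choose m) * (deriv ^^ (j - m)) h z)) * (deriv ^^ m) f z)"
    unfolding sum_triangle_swap by (simp add: sum_distrib_right)
  finally show ?thesis .
qed

lemma riccati_change_holomorphic:
  assumes "open S" "A holomorphic_on S" "B holomorphic_on S" "w holomorphic_on S"
  shows "riccati_change A B w holomorphic_on S"
  unfolding riccati_change_def using assms by (auto intro!: holomorphic_intros)

lemma higher_deriv_mult_cong:
  assumes "open S" "z \<in> S" "f holomorphic_on S" "g holomorphic_on S" "h holomorphic_on S" "k holomorphic_on S"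
    and "\<And>i. i \<le> m \<Longrightarrow> (deriv ^^ i) f z = (deriv ^^ i) h z" "\<And>i. i \<le> m \<Longrightarrow> (deriv ^^ i) g z = (deriv ^^ i) k z"
  shows "(deriv ^^ m) (\<lambda>x. f x * g x) z = (deriv ^^ m) (\<lambda>x. h x * k x) z"
  unfolding higher_deriv_mult[OF assms(3,4,1,2)] higher_deriv_mult[OF assms(5,6,1,2)] using assms(7,8)
  by (intro sum.cong) auto

text \<open>The highest derivative of w enters the m-th derivative of u only through w', linearly
  and with coefficient 1. Hence the jet of w of order m+1 is equivalent to the value of w together
  with the jet of u of order m.\<close>

lemma riccati_change_jet:
  assumes S: "open S" "z \<in> S" "A holomorphic_on S" "B holomorphic_on S" "w holomorphic_on S" "p holomorphic_on S"
    and jet: "\<And>i. i \<le> m \<Longrightarrow> (deriv ^^ i) w z = (deriv ^^ i) p z"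
  shows "(deriv ^^ m) (riccati_change A B w) z - (deriv ^^ m) (riccati_change A B p) z = (deriv ^^ Suc m) w z - (deriv ^^ Suc m) p z"
proof -
  have eq: "(deriv ^^ m) (riccati_change A B f) z = (deriv ^^ Suc m) f z - (deriv ^^ m) (\<lambda>x. A x * (f x * f x)) z - (deriv ^^ m) (\<lambda>x. B x * f x) z"
    if f: "f holomorphic_on S" for f
  proof -
    have "(deriv ^^ m) (\<lambda>x. (deriv f x - A x * (f x * f x)) - B x * f x) z = (deriv ^^ m) (\<lambda>x. deriv f x - A x * (f x * f x)) z - (deriv ^^ m) (\<lambda>x. B x * f x) z"
      using S f by (intro higher_deriv_diff[of _ S]) (auto intro!: holomorphic_intros)
    also have "(deriv ^^ m) (\<lambda>x. deriv f x - A x * (f x * f x)) z = (deriv ^^ m) (deriv f) z - (deriv ^^ m) (\<lambda>x. A x * (f x * f x)) z"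
      using S f by (intro higher_deriv_diff[of _ S]) (auto intro!: holomorphic_intros)
    also have "(deriv ^^ m) (deriv f) z = (deriv ^^ Suc m) f z" by (simp only: funpow_Suc_right o_def)
    finally show ?thesis by (simp add: riccati_change_def power2_eq_square)
  qed
  have h: "(\<lambda>x. w x * w x) holomorphic_on S" "(\<lambda>x. p x * p x) holomorphic_on S" using S by (auto intro!: holomorphic_intros)
  have sq: "(deriv ^^ i) (\<lambda>x. w x * w x) z = (deriv ^^ i) (\<lambda>x. p x * p x) z" if "i \<le> m" for i
    by (rule higher_deriv_mult_cong[of S]) (use that jet S in auto)
  have "(deriv ^^ m) (\<lambda>x. A x * (w x * w x)) z = (deriv ^^ m) (\<lambda>x. A x * (p x * p x)) z"
    by (rule higher_deriv_mult_cong[of S]) (use S h sq in auto)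
  moreover have "(deriv ^^ m) (\<lambda>x. B x * w x) z = (deriv ^^ m) (\<lambda>x. B x * p x) z"
    using S jet by (intro higher_deriv_mult_cong[of S]) auto
  ultimately show ?thesis by (simp add: eq[OF S(5)] eq[OF S(6)])
qed

lemma nonzero_ball:
  fixes h :: "complex \<Rightarrow> complex"
  assumes "h holomorphic_on S" "open S" "z \<in> S" "h z \<noteq> 0"
  obtains r where "r > 0" "ball z r \<subseteq> S" "\<And>x. x \<in> ball z r \<Longrightarrow> h x \<noteq> 0"
proof -
  have "isCont h z" using assms continuous_on_eq_continuous_at holomorphic_on_imp_continuous_on by blast
  then have "\<forall>\<^sub>F x in nhds z. h x \<noteq> 0"
    using assms(4) tendsto_imp_eventually_ne[of h "h z" "nhds z" 0] by (simp add: isCont_def tendsto_at_iff_tendsto_nhds)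
  moreover have "\<forall>\<^sub>F x in nhds z. x \<in> S" using assms by (simp add: eventually_nhds_in_open)
  ultimately have "\<forall>\<^sub>F x in nhds z. h x \<noteq> 0 \<and> x \<in> S" by (rule eventually_conj)
  then obtain r where "r > 0" "\<And>x. dist x z < r \<Longrightarrow> h x \<noteq> 0 \<and> x \<in> S" by (auto simp: eventually_nhds_metric)
  then show ?thesis by (intro that[of r]) (auto simp: dist_commute)
qed

text \<open>The solution is a quotient \<open>h\<^sub>0 / h\<^sub>1\<close> with \<open>h\<^sub>0' = B h\<^sub>0 + u h\<^sub>1\<close> and \<open>h\<^sub>1' = - A h\<^sub>0\<close>.\<close>
lemma riccati_exists:
  assumes "R > 0" and hol: "A holomorphic_on ball z1 R" "B holomorphic_on ball z1 R" "u holomorphic_on ball z1 R"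
  obtains r w where "0 < r" "r \<le> R" "w holomorphic_on ball z1 r" "w z1 = w0"
    "\<And>z. z \<in> ball z1 r \<Longrightarrow> riccati_change A B w z = u z"
proof -
  define M where "M i j = (if i = 0 then (if j = 0 then B else u) else if j = 0 then (\<lambda>z. - A z) else (\<lambda>z. 0))" for i j :: nat
  have M: "M i j holomorphic_on ball z1 R" for i j
    using hol by (auto simp: M_def intro!: holomorphic_intros)
  have "\<exists>x. \<forall>i<2. x i z1 = (if i = 0 then w0 else 1) \<and>
          (\<forall>z\<in>ball z1 (R/2). (x i has_field_derivative (\<Sum>j<2. M i j z * x j z) + (\<lambda>i z. 0) i z) (at z))"
    by (rule linear_system_exists[of "R/2" R]) (use \<open>R>0\<close> M in auto)
  then obtain x where x: "\<forall>i<(2::nat). x i z1 = (if i = 0 then w0 else 1) \<and>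
          (\<forall>z\<in>ball z1 (R/2). (x i has_field_derivative (\<Sum>j<2. M i j z * x j z) + (\<lambda>i z. 0) i z) (at z))"
    by (elim exE)
  have x0: "(x 0 has_field_derivative B z * x 0 z + u z * x 1 z) (at z)" "(x 1 has_field_derivative - A z * x 0 z) (at z)"
    if "z \<in> ball z1 (R/2)" for z
    using x[rule_format, of 0] x[rule_format, of 1] that by (auto simp: M_def numeral_2_eq_2)
  have x1: "x 0 z1 = w0" "x 1 z1 = 1" using x[rule_format, of 0] x[rule_format, of 1] by auto
  have "x 1 holomorphic_on ball z1 (R/2)" using x0(2) by (rule holomorphic_on_derivI)
  then obtain r where r: "r > 0" "ball z1 r \<subseteq> ball z1 (R/2)" "\<And>z. z \<in> ball z1 r \<Longrightarrow> x 1 z \<noteq> 0"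
    using x1 \<open>R>0\<close> by (elim nonzero_ball) auto
  define s where "s = min r (R/2)"
  have s: "0 < s" "s \<le> R" "ball z1 s \<subseteq> ball z1 r" "ball z1 s \<subseteq> ball z1 (R/2)" using r \<open>R>0\<close> by (auto simp: s_def)
  define w where "w z = x 0 z / x 1 z" for z
  have w: "(w has_field_derivative u z + A z * (w z)\<^sup>2 + B z * w z) (at z)" if "z \<in> ball z1 s" for z
  proof -
    have nz: "x 1 z \<noteq> 0" and z: "z \<in> ball z1 (R/2)" using that s r by auto
    have "(w has_field_derivative ((B z * x 0 z + u z * x 1 z) * x 1 z - x 0 z * (- A z * x 0 z)) / (x 1 z * x 1 z)) (at z)"
      unfolding w_def[abs_def] by (rule DERIV_divide[OF x0(1)[OF z] x0(2)[OF z] nz])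
    moreover have "((B z * x 0 z + u z * x 1 z) * x 1 z - x 0 z * (- A z * x 0 z)) / (x 1 z * x 1 z) = u z + A z * (w z)\<^sup>2 + B z * w z"
      using nz by (simp add: w_def divide_simps power2_eq_square) (simp add: algebra_simps)
    ultimately show ?thesis by simp
  qed
  show ?thesis
  proof (rule that[of s w])
    show "w holomorphic_on ball z1 s" using w by (rule holomorphic_on_derivI)
    show "w z1 = w0" using x1 by (simp add: w_def)
    show "riccati_change A B w z = u z" if "z \<in> ball z1 s" for z
      using DERIV_imp_deriv[OF w[OF that]] by (simp add: riccati_change_def)
  qed (use s in auto)
qed

lemma sym_coeff_sym: "i \<le> m \<Longrightarrow> sym_coeff a m (m - i) z = sym_coeff a m i z"
  by (auto simp: sym_coeff_def max.commute min.commute)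

lemma quad_defect_sym: "i \<le> m \<Longrightarrow> quad_defect a m (m - i) z = quad_defect a m i z"
  by (simp add: quad_defect_def sym_coeff_sym binomial_symmetric[symmetric])

section \<open>Every linearization is the canonical one\<close>

definition ode_residual :: "nat \<Rightarrow> (complex \<Rightarrow> complex) \<Rightarrow> (nat \<Rightarrow> nat \<Rightarrow> complex \<Rightarrow> complex) \<Rightarrow>
     (nat \<Rightarrow> complex \<Rightarrow> complex) \<Rightarrow> (complex \<Rightarrow> complex) \<Rightarrow> (complex \<Rightarrow> complex) \<Rightarrow> complex \<Rightarrow> complex" where
  "ode_residual n A a b c w z = (deriv ^^ n) w z - (A z * (deriv ^^ (n - 1)) (\<lambda>x. (w x)\<^sup>2) z
       + (\<Sum>(k, j)\<in>quadratic_index n. a k j z * (deriv ^^ k) w z * (deriv ^^ j) w z)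
       + (\<Sum>j=0..n - 1. b j z * (deriv ^^ j) w z) + c z)"

lemma quadratic_ode_residual_0: "quadratic_ode n A a b c w z \<longleftrightarrow> ode_residual n A a b c w z = 0"
  by (simp add: quadratic_ode_def ode_residual_def)

lemma quadratic_index_less: "(k, j) \<in> quadratic_index n \<Longrightarrow> k < n \<and> j < n"
  by (auto simp: quadratic_index_def)

lemma ode_residual_jet:
  assumes "open S" "z \<in> S" "w holomorphic_on S" "p holomorphic_on S" "n \<ge> 2"
    and jet: "\<And>i. i < n \<Longrightarrow> (deriv ^^ i) w z = (deriv ^^ i) p z"
  shows "ode_residual n A a b c w z - ode_residual n A a b c p z = (deriv ^^ n) w z - (deriv ^^ n) p z"
proof -
  have "(deriv ^^ (n - 1)) (\<lambda>x. (w x)\<^sup>2) z = (deriv ^^ (n - 1)) (\<lambda>x. (p x)\<^sup>2) z"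
    unfolding power2_eq_square using assms by (intro higher_deriv_mult_cong[of S]) auto
  moreover have "(\<Sum>(k, j)\<in>quadratic_index n. a k j z * (deriv ^^ k) w z * (deriv ^^ j) w z) =
      (\<Sum>(k, j)\<in>quadratic_index n. a k j z * (deriv ^^ k) p z * (deriv ^^ j) p z)"
    using jet by (intro sum.cong) (auto dest!: quadratic_index_less)
  moreover have "(\<Sum>j=0..n - 1. b j z * (deriv ^^ j) w z) = (\<Sum>j=0..n - 1. b j z * (deriv ^^ j) p z)"
    using jet assms by (intro sum.cong) auto
  ultimately show ?thesis by (simp add: ode_residual_def)
qed

text \<open>The hypothesis compares only solution sets, but a test function p can be matched with a
  solution: choose u solving the linear equation with the jet of the transform of p at
  \<open>z1\<close>, then w from the Riccati equation with \<open>w z1 = p z1\<close>. Then w and p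
  have the same jet of order \<open>n - 1\<close>, both residuals of w vanish, and those of p differ
  from them by the same difference of n-th derivatives.\<close>

lemma linearized_residual:
  assumes "n \<ge> 2" "open D" "A holomorphic_on D" "B holomorphic_on D"
    and l: "\<And>j. j < n - 1 \<Longrightarrow> l j holomorphic_on D" "l0 holomorphic_on D"
    and equiv: "\<And>V w. open V \<Longrightarrow> V \<subseteq> D \<Longrightarrow> w holomorphic_on V \<Longrightarrow>
           ((\<forall>z\<in>V. quadratic_ode n A a b c w z) \<longleftrightarrow> (\<forall>z\<in>V. linear_ode (n - 1) l l0 (riccati_change A B w) z))"
    and z1: "z1 \<in> D" and p: "p holomorphic_on D"
  shows "ode_residual n A a b c p z1 = (deriv ^^ (n - 1)) (riccati_change A B p) z1
      - (\<Sum>j<n - 1. l j z1 * (deriv ^^ j) (riccati_change A B p) z1) - l0 z1"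
proof -
  obtain R where R: "R > 0" "ball z1 R \<subseteq> D" using \<open>open D\<close> z1 openE by blast
  have sub: "f holomorphic_on ball z1 R" if "f holomorphic_on D" for f using that R holomorphic_on_subset by blast
  obtain u where u: "u holomorphic_on ball z1 (R/2)"
    "\<And>k. k < n - 1 \<Longrightarrow> (deriv ^^ k) u z1 = (deriv ^^ k) (riccati_change A B p) z1"
    "\<And>z. z \<in> ball z1 (R/2) \<Longrightarrow> (deriv ^^ (n - 1)) u z = (\<Sum>j<n - 1. l j z * (deriv ^^ j) u z) + l0 z"
    by (rule linear_ode_exists[of "R/2" R "n - 1" l z1 l0 z1 "\<lambda>k. (deriv ^^ k) (riccati_change A B p) z1"])
      (use R assms sub in auto)
  have sub2: "f holomorphic_on ball z1 (R/2)" if "f holomorphic_on D" for f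
    by (rule holomorphic_on_subset[OF sub[OF that]]) (use R in auto)
  obtain r w where w: "0 < r" "r \<le> R/2" "w holomorphic_on ball z1 r" "w z1 = p z1"
    "\<And>z. z \<in> ball z1 r \<Longrightarrow> riccati_change A B w z = u z"
    by (rule riccati_exists[of "R/2" A z1 B u "p z1"]) (use R u sub2 assms in auto)
  have "ball z1 r \<subseteq> ball z1 R" using w R by (intro subset_ball) linarith
  then have rD: "ball z1 r \<subseteq> D" using R by blast
  have S: "open (ball z1 r)" "z1 \<in> ball z1 r" "A holomorphic_on ball z1 r" "B holomorphic_on ball z1 r"
    "w holomorphic_on ball z1 r" "p holomorphic_on ball z1 r"
    using w assms rD holomorphic_on_subset by auto
  have ru: "(deriv ^^ k) (riccati_change A B w) z = (deriv ^^ k) u z" if "z \<in> ball z1 r" for k z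
  proof (rule higher_deriv_transform_within_open[of _ "ball z1 r"])
    show "u holomorphic_on ball z1 r" using u(1) w(2) by (rule holomorphic_on_subset[OF _ subset_ball])
  qed (use S that w riccati_change_holomorphic in auto)
  have "linear_ode (n - 1) l l0 (riccati_change A B w) z" if "z \<in> ball z1 r" for z
    unfolding linear_ode_def using ru[OF that] u(3)[of z] that w(2) by auto
  then have "\<forall>z\<in>ball z1 r. quadratic_ode n A a b c w z" using equiv[OF S(1) rD S(5)] by blast
  then have res: "ode_residual n A a b c w z1 = 0" using w by (simp add: quadratic_ode_residual_0)
  have jet: "(deriv ^^ i) w z1 = (deriv ^^ i) p z1" if "i < n" for i using that
  proof (induction i rule: less_induct)
    case (less i)
    show ?case
    proof (cases i)
      case (Suc m)
      have "(deriv ^^ m) (riccati_change A B w) z1 - (deriv ^^ m) (riccati_change A B p) z1 = (deriv ^^ Suc m) w z1 - (deriv ^^ Suc m) p z1"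
        by (rule riccati_change_jet[OF S]) (use less Suc in auto)
      moreover have "(deriv ^^ m) (riccati_change A B w) z1 = (deriv ^^ m) (riccati_change A B p) z1"
        using ru[of z1 m] u(2)[of m] less.prems Suc w by simp
      ultimately show ?thesis using Suc by simp
    qed (use w in simp)
  qed
  have "(deriv ^^ (n - 1)) (riccati_change A B w) z1 - (deriv ^^ (n - 1)) (riccati_change A B p) z1 = (deriv ^^ Suc (n - 1)) w z1 - (deriv ^^ Suc (n - 1)) p z1"
    by (rule riccati_change_jet[OF S]) (use jet assms in auto)
  moreover have "ode_residual n A a b c w z1 - ode_residual n A a b c p z1 = (deriv ^^ n) w z1 - (deriv ^^ n) p z1"
    by (rule ode_residual_jet[OF S(1,2,5,6) assms(1)]) (use jet in auto)
  moreover have "(deriv ^^ (n - 1)) (riccati_change A B w) z1 = (\<Sum>j<n - 1. l j z1 * (deriv ^^ j) (riccati_change A B p) z1) + l0 z1"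
    using ru[of z1] u(3)[of z1] u(2) w R by simp
  moreover have "Suc (n - 1) = n" using assms by simp
  ultimately show ?thesis using res by (simp add: algebra_simps)
qed

text \<open>Equal residuals for all jets are a polynomial identity. Its quadratic part says that L
  composed with multiplication by \<open>A\<close> has the coefficients of Q and reproduces all
  mixed terms; its linear part is the relation that determines \<open>B\<close> and expresses that
  nothing is left over.\<close>

lemma linearization_canonical:
  assumes "n \<ge> 2" "open D" "coeffs_holomorphic n A a b c D" "B holomorphic_on D"
    and l: "\<And>j. j < n - 1 \<Longrightarrow> l j holomorphic_on D" "l0 holomorphic_on D"
    and equiv: "\<And>V w. open V \<Longrightarrow> V \<subseteq> D \<Longrightarrow> w holomorphic_on V \<Longrightarrow>
           ((\<forall>z\<in>V. quadratic_ode n A a b c w z) \<longleftrightarrow> (\<forall>z\<in>V. linear_ode (n - 1) l l0 (riccati_change A B w) z))"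
    and z: "z \<in> D" "A z \<noteq> 0"
  shows "\<And>m i. m < n - 1 \<Longrightarrow> i \<le> m \<Longrightarrow> quad_defect a m i z = 0"
    and "\<And>m. m < n \<Longrightarrow> b m z + (if m = 0 then 0 else lin_coeff n A a (m - 1) z)
     - (\<Sum>j=m..n - 1. lin_coeff n A a j z * (of_nat (j choose m) * (deriv ^^ (j - m)) B z)) = 0"
proof -
  have A: "A holomorphic_on D" using assms(3) by (simp add: coeffs_holomorphic_def)
  obtain N where n: "n = Suc (Suc N)" using assms(1) by (metis add_2_eq_Suc le_Suc_ex)
  \<comment> \<open>The linear equation read as an operator with leading coefficient 1;
    \<open>q\<close> and \<open>be\<close> are its compositions with multiplication by
    \<open>A\<close> and by \<open>B\<close>.\<close>
  define L where "L j = (if j = n - 1 then 1 else - l j z)" for j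
  define q where "q m = (\<Sum>j=m..n - 1. L j * (of_nat (j choose m) * (deriv ^^ (j - m)) A z))" for m
  define be where "be m = (\<Sum>j=m..n - 1. L j * (of_nat (j choose m) * (deriv ^^ (j - m)) B z))" for m
  have qtop: "q (n - 1) = A z" by (simp add: q_def L_def)
  have poly: "(\<Sum>m<n - 1. \<Sum>i\<le>m. (of_nat (m choose i) * q m - sym_coeff a m i z) * X i * X (m - i))
      + (\<Sum>m<n. (be m - b m z - (if m = 0 then 0 else L (m - 1))) * X m) + (l0 z - c z) = 0" for X
  proof -
    obtain p where p: "p holomorphic_on UNIV" "\<And>i. i < n \<Longrightarrow> (deriv ^^ i) p z = X i"
      by (rule exists_polynomial_jet[of n z X]) blast
    have pD: "p holomorphic_on D" "(\<lambda>x. (p x)\<^sup>2) holomorphic_on D"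
      using p holomorphic_on_subset by (auto intro!: holomorphic_intros)
    have dp: "deriv p holomorphic_on D" "(\<lambda>x. B x * p x) holomorphic_on D" "(\<lambda>x. A x * (p x)\<^sup>2) holomorphic_on D"
      using pD assms A by (auto intro!: holomorphic_intros)
    let ?u = "riccati_change A B p"
    have "(deriv ^^ (n - 1)) ?u z - (\<Sum>j<n - 1. l j z * (deriv ^^ j) ?u z) = (\<Sum>j<n. L j * (deriv ^^ j) ?u z)"
      by (simp add: n L_def sum_negf)
    also have "\<dots> = (\<Sum>j<n. L j * ((deriv ^^ Suc j) p z - (deriv ^^ j) (\<lambda>x. A x * (p x)\<^sup>2) z - (deriv ^^ j) (\<lambda>x. B x * p x) z))"
    proof (intro sum.cong refl arg_cong2[where f = "(*)"])
      fix j
      have "(deriv ^^ j) (\<lambda>x. (deriv p x - A x * (p x)\<^sup>2) - B x * p x) z = (deriv ^^ j) (\<lambda>x. deriv p x - A x * (p x)\<^sup>2) z - (deriv ^^ j) (\<lambda>x. B x * p x) z"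
        using dp assms(2) z by (intro higher_deriv_diff[of _ D]) (auto intro!: holomorphic_on_diff)
      also have "(deriv ^^ j) (\<lambda>x. deriv p x - A x * (p x)\<^sup>2) z = (deriv ^^ j) (deriv p) z - (deriv ^^ j) (\<lambda>x. A x * (p x)\<^sup>2) z"
        using dp assms(2) z by (intro higher_deriv_diff[of _ D]) auto
      also have "(deriv ^^ j) (deriv p) z = (deriv ^^ Suc j) p z" by (simp only: funpow_Suc_right o_def)
      finally show "(deriv ^^ j) ?u z = (deriv ^^ Suc j) p z - (deriv ^^ j) (\<lambda>x. A x * (p x)\<^sup>2) z - (deriv ^^ j) (\<lambda>x. B x * p x) z"
        by (simp add: riccati_change_def)
    qed
    also have "\<dots> = (\<Sum>j<n. L j * (deriv ^^ Suc j) p z) - (\<Sum>j<n. L j * (deriv ^^ j) (\<lambda>x. A x * (p x)\<^sup>2) z) - (\<Sum>j<n. L j * (deriv ^^ j) (\<lambda>x. B x * p x) z)"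
      by (simp only: right_diff_distrib sum_subtractf)
    also have "(\<Sum>j<n. L j * (deriv ^^ j) (\<lambda>x. A x * (p x)\<^sup>2) z) = (\<Sum>m<n. q m * (deriv ^^ m) (\<lambda>x. (p x)\<^sup>2) z)"
      unfolding q_def by (rule deriv_op_mult[OF assms(2) z(1) A pD(2)])
    also have "(\<Sum>j<n. L j * (deriv ^^ j) (\<lambda>x. B x * p x) z) = (\<Sum>m<n. be m * (deriv ^^ m) p z)"
      unfolding be_def by (rule deriv_op_mult[OF assms(2) z(1) assms(4) pD(1)])
    also have "(\<Sum>j<n. L j * (deriv ^^ Suc j) p z) = (deriv ^^ n) p z + (\<Sum>m<n. (if m = 0 then 0 else L (m - 1)) * (deriv ^^ m) p z)"
    proof -
      have "(\<Sum>j<n. L j * (deriv ^^ Suc j) p z) = (deriv ^^ n) p z + (\<Sum>j<Suc N. L j * (deriv ^^ Suc j) p z)" by (simp add: n L_def)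
      also have "(\<Sum>j<Suc N. L j * (deriv ^^ Suc j) p z) = (\<Sum>m<n. (if m = 0 then 0 else L (m - 1)) * (deriv ^^ m) p z)"
        unfolding n by (subst sum.lessThan_Suc_shift) simp
      finally show ?thesis .
    qed
    also have "(\<Sum>m<n. q m * (deriv ^^ m) (\<lambda>x. (p x)\<^sup>2) z) = A z * (deriv ^^ (n - 1)) (\<lambda>x. (p x)\<^sup>2) z + (\<Sum>m<n - 1. q m * (deriv ^^ m) (\<lambda>x. (p x)\<^sup>2) z)"
      using qtop by (simp add: n)
    finally have 1: "(deriv ^^ (n - 1)) ?u z - (\<Sum>j<n - 1. l j z * (deriv ^^ j) ?u z) =
      (deriv ^^ n) p z + (\<Sum>m<n. (if m = 0 then 0 else L (m - 1)) * (deriv ^^ m) p z)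
      - (A z * (deriv ^^ (n - 1)) (\<lambda>x. (p x)\<^sup>2) z + (\<Sum>m<n - 1. q m * (deriv ^^ m) (\<lambda>x. (p x)\<^sup>2) z))
      - (\<Sum>m<n. be m * (deriv ^^ m) p z)" .
    have 2: "ode_residual n A a b c p z = (deriv ^^ (n - 1)) ?u z - (\<Sum>j<n - 1. l j z * (deriv ^^ j) ?u z) - l0 z"
      by (rule linearized_residual[OF assms(1,2) A assms(4)]) (use l equiv z pD in auto)
    have 3: "(\<Sum>(k, j)\<in>quadratic_index n. a k j z * (deriv ^^ k) p z * (deriv ^^ j) p z) =
      (\<Sum>m<n - 1. \<Sum>i\<le>m. sym_coeff a m i z * X i * X (m - i))"
    proof -
      have "(\<Sum>(k, j)\<in>quadratic_index n. a k j z * (deriv ^^ k) p z * (deriv ^^ j) p z) = (\<Sum>(k, j)\<in>quadratic_index n. a k j z * X k * X j)"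
        using p(2) by (intro sum.cong) (auto dest!: quadratic_index_less)
      then show ?thesis by (simp only: quadratic_sum_sym)
    qed
    have 4: "(\<Sum>j=0..n - 1. b j z * (deriv ^^ j) p z) = (\<Sum>m<n. b m z * X m)"
      using p(2) by (intro sum.cong) (auto simp: n)
    have 5: "(\<Sum>m<n - 1. q m * (deriv ^^ m) (\<lambda>x. (p x)\<^sup>2) z) = (\<Sum>m<n - 1. \<Sum>i\<le>m. of_nat (m choose i) * q m * X i * X (m - i))"
      unfolding higher_deriv_square[OF pD(1) assms(2) z(1)] sum_distrib_left using p(2) by (intro sum.cong refl) (auto simp: mult_ac)
    have 6: "(\<Sum>m<n. be m * (deriv ^^ m) p z) = (\<Sum>m<n. be m * X m)" "(\<Sum>m<n. (if m = 0 then 0 else L (m - 1)) * (deriv ^^ m) p z) = (\<Sum>m<n. (if m = 0 then 0 else L (m - 1)) * X m)"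
      using p(2) by (auto intro!: sum.cong)
    have "(\<Sum>m<n - 1. \<Sum>i\<le>m. sym_coeff a m i z * X i * X (m - i)) + (\<Sum>m<n. b m z * X m) + c z
      = (\<Sum>m<n - 1. \<Sum>i\<le>m. of_nat (m choose i) * q m * X i * X (m - i)) + (\<Sum>m<n. be m * X m) - (\<Sum>m<n. (if m = 0 then 0 else L (m - 1)) * X m) + l0 z"
      using 2 unfolding 1 ode_residual_def 3 4 5 6 by (simp add: algebra_simps)
    then show ?thesis unfolding left_diff_distrib sum_subtractf by (simp only: diff_eq_eq add_diff_eq diff_add_eq add.commute add.left_commute add.assoc) (simp add: algebra_simps)
  qed
  have qs: "of_nat (m choose i) * q m - sym_coeff a m i z = 0" if "m < n - 1" "i \<le> m" for m i
    using quadratic_polynomial_zero(1)[OF poly] that by (simp add: sym_coeff_sym binomial_symmetric[symmetric])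
  have lin: "be m - b m z - (if m = 0 then 0 else L (m - 1)) = 0" if "m < n" for m
    by (rule quadratic_polynomial_zero(2)[OF poly _ that]) (simp add: sym_coeff_sym binomial_symmetric[symmetric])
  have qsym: "q m = sym_coeff a m 0 z" if "m < n - 1" for m using qs[OF that, of 0] by simp
  show "quad_defect a m i z = 0" if "m < n - 1" "i \<le> m" for m i
    using qs[OF that] qsym[OF that(1)] by (simp add: quad_defect_def)
  have qq: "q m = quad_coeff n A a m z" if "m < n" for m
    using qtop qsym[of m] that by (auto simp: quad_coeff_def)
  obtain r where r: "r > 0" "ball z r \<subseteq> D" "\<And>x. x \<in> ball z r \<Longrightarrow> A x \<noteq> 0"
    using nonzero_ball[OF A assms(2) z] by blast
  have AS: "A holomorphic_on ball z r" using A r(2) holomorphic_on_subset by blast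
  have zr: "z \<in> ball z r" using r by simp
  \<comment> \<open>From L(A f) = Q(f) on a disc without zeros of \<open>A\<close> follows L(f) =
    Q(f / A). The test function \<open>(x - z) ^ i\<close> isolates the i-th coefficient at
    \<open>z\<close>.\<close>
  have LL: "L i = lin_coeff n A a i z" if "i < n" for i
  proof -
    define f where "f = (\<lambda>x. (x - z) ^ i)"
    have f: "f holomorphic_on ball z r" unfolding f_def by (intro holomorphic_intros)
    have fA: "(\<lambda>x. f x / A x) holomorphic_on ball z r" using f AS r(3) by (intro holomorphic_intros) auto
    have "(\<Sum>j<n. L j * (deriv ^^ j) f z) = (\<Sum>j<n. L j * (deriv ^^ j) (\<lambda>x. A x * (f x / A x)) z)"
    proof (intro sum.cong refl arg_cong2[where f="(*)"])
      fix j show "(deriv ^^ j) f z = (deriv ^^ j) (\<lambda>x. A x * (f x / A x)) z"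
      proof (rule higher_deriv_transform_within_open[OF f _ open_ball zr])
        show "(\<lambda>x. A x * (f x / A x)) holomorphic_on ball z r" by (rule holomorphic_on_mult[OF AS fA])
        show "f x = A x * (f x / A x)" if "x \<in> ball z r" for x using r(3)[OF that] by simp
      qed
    qed
    also have "\<dots> = (\<Sum>m<n. q m * (deriv ^^ m) (\<lambda>x. f x / A x) z)"
      unfolding q_def by (rule deriv_op_mult[OF open_ball zr AS fA])
    also have "\<dots> = quad_op n A a (\<lambda>x. f x / A x) z" unfolding quad_op_def using qq by (intro sum.cong) auto
    also have "\<dots> = lin_op n A a f z" using lin_op_eq_quad_op[OF open_ball zr AS r(3) f] by simp
    finally have "(\<Sum>j<n. L j * (deriv ^^ j) f z) = (\<Sum>j<n. lin_coeff n A a j z * (deriv ^^ j) f z)" by (simp add: lin_op_def)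
    moreover have "(\<Sum>j<n. h j * (deriv ^^ j) f z) = h i * fact i" for h :: "nat \<Rightarrow> complex"
      using that unfolding f_def power_jet by (simp add: if_distrib cong: if_cong)
    ultimately show ?thesis by simp
  qed
  show "b m z + (if m = 0 then 0 else lin_coeff n A a (m - 1) z)
     - (\<Sum>j=m..n - 1. lin_coeff n A a j z * (of_nat (j choose m) * (deriv ^^ (j - m)) B z)) = 0" if "m < n" for m
  proof -
    have "be m = (\<Sum>j=m..n - 1. lin_coeff n A a j z * (of_nat (j choose m) * (deriv ^^ (j - m)) B z))"
      unfolding be_def by (intro sum.cong refl arg_cong2[where f="(*)"] LL) (use n in auto)
    moreover have "(if m = 0 then 0 else L (m - 1)) = (if m = 0 then 0 else lin_coeff n A a (m - 1) z)" using LL[of "m - 1"] that by auto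
    ultimately show ?thesis using lin[OF that] by (auto simp: algebra_simps)
  qed
qed

text \<open>The relation of order \<open>n - 1\<close> identifies B with
  \<open>riccati_coeff\<close> on a whole neighbourhood, hence with all derivatives; the lower
  relations then say that the linear defects vanish.\<close>

lemma linearization_defects_zero:
  assumes "n \<ge> 2" "open D" "coeffs_holomorphic n A a b c D" "B holomorphic_on D"
    and l: "\<And>j. j < n - 1 \<Longrightarrow> l j holomorphic_on D" "l0 holomorphic_on D"
    and equiv: "\<And>V w. open V \<Longrightarrow> V \<subseteq> D \<Longrightarrow> w holomorphic_on V \<Longrightarrow>
           ((\<forall>z\<in>V. quadratic_ode n A a b c w z) \<longleftrightarrow> (\<forall>z\<in>V. linear_ode (n - 1) l l0 (riccati_change A B w) z))"
    and z: "z \<in> D" "A z \<noteq> 0" and m: "m < n - 1"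
  shows "lin_defect n A a b m z = 0"
proof -
  have A: "A holomorphic_on D" using assms(3) by (simp add: coeffs_holomorphic_def)
  obtain r where r: "r > 0" "ball z r \<subseteq> D" "\<And>x. x \<in> ball z r \<Longrightarrow> A x \<noteq> 0"
    using nonzero_ball[OF A assms(2) z] by blast
  have zr: "z \<in> ball z r" using r by simp
  have B: "B x = riccati_coeff n A a b x" if "x \<in> ball z r" for x
  proof -
    have "b (n - 1) x + (if n - 1 = 0 then 0 else lin_coeff n A a (n - 1 - 1) x)
     - (\<Sum>j=n - 1..n - 1. lin_coeff n A a j x * (of_nat (j choose (n - 1)) * (deriv ^^ (j - (n - 1))) B x)) = 0"
      by (rule linearization_canonical(2)[OF assms(1-4), of l l0]) (use l equiv r that assms(1) in auto)
    moreover have "lin_coeff n A a (n - 1) x = 1" using assms(1) r(3)[OF that] by (rule lin_coeff_top)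
    moreover have "n - 1 - 1 = n - 2" by simp
    ultimately show ?thesis using assms(1) by (simp add: riccati_coeff_def)
  qed
  have S: "coeffs_holomorphic n A a b c (ball z r)" using coeffs_holomorphic_subset[OF assms(3) r(2)] .
  have "(deriv ^^ k) B z = (deriv ^^ k) (riccati_coeff n A a b) z" for k
    by (rule higher_deriv_transform_within_open[of _ "ball z r"])
      (use assms(1,4) r zr B S in \<open>auto intro: holomorphic_on_subset holomorphic_riccati_coeff\<close>)
  then show ?thesis
    using linearization_canonical(2)[OF assms(1-4), of l l0 z m] l equiv z m by (simp add: lin_defect_def)
qed

section \<open>Spreading the absence of defects\<close>

text \<open>The condition on \<open>A\<close> is included because \<open>lin_defect\<close> has no
  meaning at a zero of \<open>A\<close>.\<close>

definition defect_free :: "nat \<Rightarrow> (complex \<Rightarrow> complex) \<Rightarrow> (nat \<Rightarrow> nat \<Rightarrow> complex \<Rightarrow> complex) \<Rightarrow> (nat \<Rightarrow> complex \<Rightarrow> complex) \<Rightarrow> complex \<Rightarrow> bool" where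
  "defect_free n A a b z \<longleftrightarrow> A z \<noteq> 0 \<and> (\<forall>m<n - 1. (\<forall>i\<le>m. quad_defect a m i z = 0) \<and> lin_defect n A a b m z = 0)"

text \<open>Restricted to the indices occurring in the equation: only these coefficients have
  continuations along a path, so only these can be compared.\<close>

definition coeffs_eq where
  "coeffs_eq n A a b c A' a' b' c' z \<longleftrightarrow> A z = A' z \<and> (\<forall>(k, j)\<in>quadratic_index n. a k j z = a' k j z)
     \<and> (\<forall>j\<le>n - 1. b j z = b' j z) \<and> c z = c' z"
  for A A' c c' :: "complex \<Rightarrow> complex" and b b' :: "nat \<Rightarrow> complex \<Rightarrow> complex" and a a' :: "nat \<Rightarrow> nat \<Rightarrow> complex \<Rightarrow> complex"

lemma open_nonzero:
  fixes A :: "complex \<Rightarrow> complex"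
  assumes "open X" "A holomorphic_on X"
  shows "open {z \<in> X. A z \<noteq> 0}"
proof -
  have "open (X \<inter> A -` (- {0}))"
    using assms by (intro continuous_open_preimage) (auto intro: holomorphic_on_imp_continuous_on)
  moreover have "X \<inter> A -` (- {0}) = {z \<in> X. A z \<noteq> 0}" by auto
  ultimately show ?thesis by simp
qed

text \<open>A holomorphic function that is not identically zero on a domain has countably many
  zeros, and removing a countable set from a plane domain leaves it connected.\<close>

lemma connected_nonzero:
  fixes A :: "complex \<Rightarrow> complex"
  assumes X: "open X" "connected X" "A holomorphic_on X" "x \<in> X" "A x \<noteq> 0"
  shows "connected {z \<in> X. A z \<noteq> 0}"
proof -
  have "countable {z \<in> X. A z = 0}"
  proof (cases "A constant_on X")
    case True
    then obtain k where "\<And>z. z \<in> X \<Longrightarrow> A z = k" by (auto simp: constant_on_def)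
    then have "{z \<in> X. A z = 0} = {}" using X by auto
    then show ?thesis by (simp only: countable_empty)
  next
    case False
    obtain C :: "nat \<Rightarrow> complex set" where C: "\<And>k. compact (C k)" "\<Union>(range C) = X"
      using open_Union_compact_subsets[OF X(1)] by metis
    then have "fsigma X" unfolding fsigma_Union_compact by (intro exI[of _ C]) auto
    then show ?thesis by (rule holomorphic_countable_zeros[OF X(3,1,2) _ False])
  qed
  then have "connected (X - {z \<in> X. A z = 0})" using X by (intro connected_open_diff_countable) auto
  moreover have "X - {z \<in> X. A z = 0} = {z \<in> X. A z \<noteq> 0}" by auto
  ultimately show ?thesis by simp
qed

text \<open>The identity theorem, applied on the set where \<open>A\<close> does not vanish: the
  defects are holomorphic there, and it is still connected.\<close>

lemma defect_free_propagate:
  assumes n: "n \<ge> 2" and X: "open X" "connected X" "coeffs_holomorphic n A a b c X"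
    and Y: "open Y" "Y \<noteq> {}" "Y \<subseteq> X" "\<And>z. z \<in> Y \<Longrightarrow> defect_free n A a b z" and z: "z \<in> X" "A z \<noteq> 0"
  shows "defect_free n A a b z"
proof -
  define X' where "X' = {z \<in> X. A z \<noteq> 0}"
  have A: "A holomorphic_on X" using X by (simp add: coeffs_holomorphic_def)
  have X': "open X'" "connected X'" "Y \<subseteq> X'" "z \<in> X'"
    using open_nonzero[OF X(1) A] connected_nonzero[OF X(1,2) A z] Y z by (auto simp: X'_def defect_free_def)
  have hol: "coeffs_holomorphic n A a b c X'" using X(3) by (rule coeffs_holomorphic_subset) (auto simp: X'_def)
  have nz: "\<And>z. z \<in> X' \<Longrightarrow> A z \<noteq> 0" by (simp add: X'_def)
  have "f z = 0" if "f holomorphic_on X'" "\<And>z. z \<in> Y \<Longrightarrow> f z = 0" for f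
    by (rule analytic_continuation_open[of Y X' f "\<lambda>_. 0"]) (use that X' Y in auto)
  then have "quad_defect a m i z = 0" "lin_defect n A a b m z = 0" if "m < n - 1" "i \<le> m" for m i
    using that Y(4) n holomorphic_quad_defect[OF hol] holomorphic_lin_defect[OF hol X'(1) nz n] by (auto simp: defect_free_def)
  then show ?thesis using z by (auto simp: defect_free_def)
qed

lemma eventually_nonzero:
  fixes A :: "complex \<Rightarrow> complex"
  assumes "open X" "connected X" "A holomorphic_on X" "x \<in> X" "A x \<noteq> 0" "y \<in> X"
  shows "\<forall>\<^sub>F z in at y. A z \<noteq> 0 \<and> z \<in> X"
  by (rule non_zero_neighbour_alt[OF assms(3,1,2,6,4,5)])

text \<open>The statement uses punctured neighbourhoods because a path may run through zeros of
  \<open>A\<close>, where freedom from defects fails by definition.\<close>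

lemma defect_free_eventually:
  assumes n: "n \<ge> 2" and X: "open X" "connected X" "coeffs_holomorphic n A a b c X" and xy: "x \<in> X" "y \<in> X"
    and ev: "\<forall>\<^sub>F z in at x. defect_free n A a b z"
  shows "\<forall>\<^sub>F z in at y. defect_free n A a b z"
proof -
  obtain T where T: "open T" "x \<in> T" "\<And>z. z \<in> T \<Longrightarrow> z \<noteq> x \<Longrightarrow> defect_free n A a b z"
    using ev by (auto simp: eventually_at_topological)
  define Y where "Y = T \<inter> X - {x}"
  have "x islimpt (T \<inter> X)" using T X xy by (intro interior_limit_point) (simp add: interior_open open_Int)
  then have "Y \<noteq> {}" using T X xy by (force simp: islimpt_def Y_def)
  then obtain p where p: "p \<in> Y" by auto
  have Y: "open Y" "Y \<subseteq> X" using T X by (auto simp: Y_def open_delete open_Int)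
  have "A p \<noteq> 0" "p \<in> X" using p T by (auto simp: Y_def defect_free_def)
  moreover have "A holomorphic_on X" using X by (simp add: coeffs_holomorphic_def)
  ultimately have "\<forall>\<^sub>F z in at y. A z \<noteq> 0 \<and> z \<in> X" using eventually_nonzero[OF X(1,2)] xy by blast
  then show ?thesis
  proof (rule eventually_mono)
    fix z assume "A z \<noteq> 0 \<and> z \<in> X"
    then show "defect_free n A a b z"
      by (elim conjE) (rule defect_free_propagate[OF n X Y(1) \<open>Y \<noteq> {}\<close> Y(2)], use T in \<open>auto simp: Y_def\<close>)
  qed
qed

lemma higher_deriv_cong_open:
  assumes "open S" "z \<in> S" "\<And>x. x \<in> S \<Longrightarrow> f x = g x"
  shows "(deriv ^^ k) f z = (deriv ^^ k) g z"
  by (rule higher_deriv_cong_ev) (use assms in \<open>auto intro: eventually_nhds_in_open[THEN eventually_mono]\<close>)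

lemma sym_coeff_cong:
  assumes "coeffs_eq n A a b c A' a' b' c' z" "m < n - 1" "i \<le> m"
  shows "sym_coeff a m i z = sym_coeff a' m i z"
proof -
  have *: "\<forall>(k, j)\<in>quadratic_index n. a k j z = a' k j z" using assms by (simp add: coeffs_eq_def)
  have "(max i (m - i), min i (m - i)) \<in> quadratic_index n" using assms by (auto simp: quadratic_index_def)
  moreover have "(i, i) \<in> quadratic_index n" if "2 * i = m" using assms that by (auto simp: quadratic_index_def)
  ultimately show ?thesis using * unfolding sym_coeff_def by auto
qed

text \<open>Agreement on an open set is required, since the defects involve derivatives of 1 / A and
  of \<open>riccati_coeff\<close>.\<close>

lemma defect_free_cong:
  assumes n: "n \<ge> 2" and S: "open S" "z \<in> S" and eq: "\<And>x. x \<in> S \<Longrightarrow> coeffs_eq n A a b c A' a' b' c' x"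
  shows "defect_free n A a b z \<longleftrightarrow> defect_free n A' a' b' z"
proof -
  have quad: "quad_coeff n A a m x = quad_coeff n A' a' m x" if "m < n" "x \<in> S" for m x
    using sym_coeff_cong[OF eq[OF that(2)], of m 0] eq[OF that(2)] that by (auto simp: quad_coeff_def coeffs_eq_def)
  have "(deriv ^^ k) (\<lambda>y. 1 / A y) x = (deriv ^^ k) (\<lambda>y. 1 / A' y) x" if "x \<in> S" for k x
    by (rule higher_deriv_cong_open[OF S(1) that]) (use eq in \<open>auto simp: coeffs_eq_def\<close>)
  then have lin: "lin_coeff n A a j x = lin_coeff n A' a' j x" if "x \<in> S" for j x
    unfolding lin_coeff_def using quad that n by (intro sum.cong) auto
  have ric: "riccati_coeff n A a b x = riccati_coeff n A' a' b' x" if "x \<in> S" for x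
    using lin eq that by (simp add: riccati_coeff_def coeffs_eq_def)
  have "(deriv ^^ k) (riccati_coeff n A a b) z = (deriv ^^ k) (riccati_coeff n A' a' b') z" for k
    by (rule higher_deriv_cong_open[OF S ric])
  then have "lin_defect n A a b m z = lin_defect n A' a' b' m z" if "m < n - 1" for m
    using lin[OF S(2)] eq[OF S(2)] that by (simp add: lin_defect_def coeffs_eq_def)
  moreover have "quad_defect a m i z = quad_defect a' m i z" if "m < n - 1" "i \<le> m" for m i
    using sym_coeff_cong[OF eq[OF S(2)]] that by (simp add: quad_defect_def)
  ultimately show ?thesis using eq[OF S(2)] by (simp add: defect_free_def coeffs_eq_def)
qed

lemma defect_eq_0: "defect_free n A a b z \<Longrightarrow> defect n A a b w z = 0"
  by (simp add: defect_free_def defect_def)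

section \<open>Solutions as quotients of holomorphic functions\<close>

definition lin_lhs where
  "lin_lhs n b f z = (deriv ^^ n) f z - (\<Sum>j<n. b j z * (deriv ^^ j) f z)"
  for b :: "nat \<Rightarrow> complex \<Rightarrow> complex"

text \<open>The right-hand side may be singular at zeros of \<open>A\<close>, the left-hand side is
  not. This is what carries solutions of first-order equations with coefficient B across such
  zeros.\<close>

lemma lin_lhs_factors:
  assumes S: "open S" "z \<in> S" "f holomorphic_on S" "n \<ge> 2" "coeffs_holomorphic n A a b c S"
    "\<And>z. z \<in> S \<Longrightarrow> defect_free n A a b z"
  shows "lin_lhs n b f z = lin_op n A a (\<lambda>x. deriv f x - riccati_coeff n A a b x * f x) z"
proof -
  have "{0..n - 1} = {..<n}" using S by auto
  then show ?thesis
    using linear_part[OF S(1,2) _ S(3,4,5)] S(2,6) by (simp add: lin_lhs_def defect_free_def)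
qed

lemma lin_op_zero: "lin_op n A a (\<lambda>x. 0) z = 0"
  by (simp add: lin_op_def)

text \<open>The center \<open>z0\<close> may be a zero of \<open>A\<close>, so the Riccati equation
  itself cannot be linearized there. Substituting w = v + \<phi> h with \<phi>, v holomorphic at
  \<open>z0\<close> replaces it by a Riccati equation for h with holomorphic coefficients, and h is
  a quotient of solutions of a linear system on the full disc.\<close>

lemma solution_is_quotient:
  assumes n: "n \<ge> 2" and coh: "coeffs_holomorphic n A a b c (ball z0 R)"
    and df: "\<And>z. z \<in> ball z0 R - {z0} \<Longrightarrow> defect_free n A a b z" and r: "0 < r" "r < R"
    and V: "open V" "connected V" "V \<noteq> {}" "V \<subseteq> ball z0 r" and w: "w holomorphic_on V"
    and ode: "\<And>z. z \<in> V \<Longrightarrow> quadratic_ode n A a b c w z"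
  obtains N H where "N holomorphic_on ball z0 r" "H holomorphic_on ball z0 r" "\<exists>x\<in>ball z0 r. H x \<noteq> 0"
    "\<And>z. z \<in> V \<Longrightarrow> w z * H z = N z"
proof -
  define r1 where "r1 = (r + R) / 2"
  have r1: "0 < r1" "r1 < R" "r < r1" using r by (auto simp: r1_def)
  let ?B = "riccati_coeff n A a b" and ?Q = "\<lambda>f. quad_op n A a f"
  let ?X = "ball z0 R - {z0}" and ?X1 = "ball z0 r1 - {z0}"
  have X: "open ?X" "open ?X1" "connected ?X1" "?X1 \<subseteq> ?X" using r1 by (auto simp: open_delete connected_punctured_ball)
  have cohX: "coeffs_holomorphic n A a b c ?X" by (rule coeffs_holomorphic_subset[OF coh]) auto
  have nz: "\<And>z. z \<in> ?X \<Longrightarrow> A z \<noteq> 0" using df by (auto simp: defect_free_def)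
  have AR: "A holomorphic_on ball z0 R" and cR: "c holomorphic_on ball z0 R" and bR: "\<And>j. j < n \<Longrightarrow> b j holomorphic_on ball z0 R"
    using coh n by (auto simp: coeffs_holomorphic_def)
  have BX: "?B holomorphic_on ?X" by (rule holomorphic_riccati_coeff[OF cohX X(1) nz n])
  \<comment> \<open>The local constructions start at a point \<open>z1\<close> other than the
    possible singularity of B.\<close>
  have "V - {z0} \<noteq> {}" using V(1,3) by (metis insert_Diff_single insert_not_empty not_open_singleton subset_singletonD Diff_eq_empty_iff)
  then obtain z1 where z1: "z1 \<in> V" "z1 \<noteq> z0" by auto
  have "open (V - {z0})" using V by (simp add: open_delete)
  then obtain \<rho> where \<rho>: "\<rho> > 0" "ball z1 \<rho> \<subseteq> V - {z0}" using z1 openE by (metis DiffI singletonD)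
  define V2 where "V2 = ball z1 (\<rho>/2)"
  have V2: "open V2" "connected V2" "z1 \<in> V2" "V2 \<subseteq> ball z1 \<rho>" "V2 \<subseteq> V" "V2 \<subseteq> ?X" "V2 \<subseteq> ?X1" "V2 \<subseteq> ball z0 r" "V2 \<subseteq> ball z0 r1" "V2 \<noteq> {}"
  proof -
    show "V2 \<subseteq> ball z1 \<rho>" using \<rho> by (auto simp: V2_def)
    then have *: "V2 \<subseteq> V - {z0}" using \<rho> by blast
    have "V \<subseteq> ball z0 r" "ball z0 r \<subseteq> ball z0 r1" "ball z0 r1 \<subseteq> ball z0 R" using V r1 by auto
    with * show "V2 \<subseteq> V" "V2 \<subseteq> ?X" "V2 \<subseteq> ?X1" "V2 \<subseteq> ball z0 r" "V2 \<subseteq> ball z0 r1" by blast+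
  qed (use \<rho> in \<open>auto simp: V2_def\<close>)
  have V1X: "ball z1 \<rho> \<subseteq> ?X" using \<rho> V r by fastforce
  have cohV2: "coeffs_holomorphic n A a b c V2" by (rule coeffs_holomorphic_subset[OF cohX V2(6)])
  have dfV2: "\<And>z. z \<in> V2 \<Longrightarrow> defect_free n A a b z" using df V2(6) by blast
  have nzV2: "\<And>z. z \<in> V2 \<Longrightarrow> A z \<noteq> 0" using nz V2(6) by blast
  have BV2: "?B holomorphic_on V2" and AV2: "A holomorphic_on V2" and wV2: "w holomorphic_on V2"
    using holomorphic_on_subset BX AR w V2 X by (blast, meson Diff_subset order_trans, blast)
  \<comment> \<open>Near \<open>z1\<close> a solution \<open>v0\<close> of v' - B v = u exists. As L
    u = h, it also satisfies the linear equation of order \<open>n\<close> with coefficients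
    \<open>b j\<close> and right-hand side \<open>h\<close>, all holomorphic at \<open>z0\<close>.
    The solution of that equation with the same jet at \<open>z1\<close> is the required
    extension.\<close>
  have solve: "\<exists>v. v holomorphic_on ball z0 r1 \<and> v z1 = s \<and> (\<forall>z\<in>V2. deriv v z - ?B z * v z = u z)"
    if u: "u holomorphic_on ball z1 \<rho>" and h: "h holomorphic_on ball z0 R" and uh: "\<And>z. z \<in> V2 \<Longrightarrow> lin_op n A a u z = h z" for u h s
  proof -
    obtain v0 where v0: "v0 holomorphic_on V2" "\<And>k. k < 1 \<Longrightarrow> (deriv ^^ k) v0 z1 = s"
      "\<And>z. z \<in> V2 \<Longrightarrow> (deriv ^^ 1) v0 z = (\<Sum>j<1. ?B z * (deriv ^^ j) v0 z) + u z"
      unfolding V2_def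
      by (rule linear_ode_exists[of "\<rho>/2" \<rho> 1 "\<lambda>j. ?B" z1 u z1 "\<lambda>k. s"])
        (use \<rho> u V1X BX in \<open>auto intro: holomorphic_on_subset\<close>)
    obtain v where v: "v holomorphic_on ball z0 r1" "\<And>k. k < n \<Longrightarrow> (deriv ^^ k) v z1 = (deriv ^^ k) v0 z1"
      "\<And>z. z \<in> ball z0 r1 \<Longrightarrow> (deriv ^^ n) v z = (\<Sum>j<n. b j z * (deriv ^^ j) v z) + h z"
      by (rule linear_ode_exists[of r1 R n b z0 h z1 "\<lambda>k. (deriv ^^ k) v0 z1"]) (use r1 bR n h V2 in auto)
    have u0: "deriv v0 z - ?B z * v0 z = u z" if "z \<in> V2" for z using v0(3)[OF that] by simp
    have eq: "v z = v0 z" if "z \<in> V2" for z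
    proof (rule linear_ode_unique[of V2 z1 n b v v0 h])
      show "(deriv ^^ n) v0 z = (\<Sum>j<n. b j z * (deriv ^^ j) v0 z) + h z" if "z \<in> V2" for z
      proof -
        have "(\<lambda>x. deriv v0 x - ?B x * v0 x) holomorphic_on V2" using v0(1) BV2 V2(1) by (intro holomorphic_intros)
        then have "lin_op n A a (\<lambda>x. deriv v0 x - ?B x * v0 x) z = lin_op n A a u z"
          using u0 by (intro lin_op_cong[OF V2(1) that]) auto
        then have "lin_lhs n b v0 z = h z"
          using lin_lhs_factors[OF V2(1) that v0(1) n cohV2 dfV2] uh[OF that] by simp
        then show ?thesis by (simp add: lin_lhs_def algebra_simps)
      qed
      show "b j holomorphic_on V2" if "j < n" for j using bR[OF that] V2(9) r1 by (meson holomorphic_on_subset less_imp_le order_trans subset_ball)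
    qed (use v v0(1) V2 that n in \<open>auto intro: holomorphic_on_subset\<close>)
    have "deriv v z - ?B z * v z = u z" if "z \<in> V2" for z
    proof -
      have "deriv v z = deriv v0 z" using higher_deriv_cong_open[OF V2(1) that, of v v0 1] eq by simp
      then show ?thesis using u0[OF that] eq[OF that] by simp
    qed
    moreover have "v z1 = s" using v(2)[of 0] v0(2)[of 0] n by simp
    ultimately show ?thesis using v(1) by blast
  qed
  obtain \<phi> where \<phi>: "\<phi> holomorphic_on ball z0 r1" "\<phi> z1 = 1" "\<And>z. z \<in> V2 \<Longrightarrow> deriv \<phi> z - ?B z * \<phi> z = 0"
    using solve[of "\<lambda>_. 0" "\<lambda>_. 0" 1] lin_op_zero[of n A a] by (auto simp: )
  have BX1: "?B holomorphic_on ?X1" using BX X(4) by (rule holomorphic_on_subset)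
  have AX1: "A holomorphic_on ?X1" using AR by (rule holomorphic_on_subset) (use r1 in auto)
  have onX1: "f holomorphic_on ?X1" if "f holomorphic_on ball z0 r1" for f :: "complex \<Rightarrow> complex" using that by (rule holomorphic_on_subset) auto
  have extend: "deriv v z - ?B z * v z = u z" if "v holomorphic_on ball z0 r1" "u holomorphic_on ?X1"
     "\<And>z. z \<in> V2 \<Longrightarrow> deriv v z - ?B z * v z = u z" "z \<in> ?X1" for v u z
    by (rule analytic_continuation_open[of V2 ?X1 "\<lambda>z. deriv v z - ?B z * v z" u])
      (use that V2 X onX1[OF that(1)] BX1 in \<open>auto intro!: holomorphic_intros\<close>)
  have d\<phi>: "deriv \<phi> z = ?B z * \<phi> z" if "z \<in> ?X1" for z
    using extend[OF \<phi>(1) _ \<phi>(3) that] by simp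
  have \<phi>nz: "\<phi> z \<noteq> 0" if "z \<in> ?X1" for z
  proof
    assume 0: "\<phi> z = 0"
    have "\<phi> z1 = (\<lambda>_. 0) z1"
    proof (rule linear_ode_unique[OF X(2,3) that, of 1 "\<lambda>_. ?B" \<phi> "\<lambda>_. 0" "\<lambda>_. 0" z1])
      show "(deriv ^^ 1) \<phi> x = (\<Sum>j<1. ?B x * (deriv ^^ j) \<phi> x) + 0" if "x \<in> ?X1" for x using d\<phi>[OF that] by simp
      show "(deriv ^^ k) \<phi> z = (deriv ^^ k) (\<lambda>_. 0) z" if "k < 1" for k using that 0 by simp
      show "z1 \<in> ?X1" using V2(3,7) by blast
    qed (use onX1[OF \<phi>(1)] BX1 in simp_all)
    then show False using \<phi>(2) by simp
  qed
  define q where "q z = A z / \<phi> z" for z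
  have qhol: "q holomorphic_on ?X1" unfolding q_def using AX1 onX1[OF \<phi>(1)] \<phi>nz by (intro holomorphic_intros) auto
  have z0: "z0 \<in> ball z0 r1" using r1 by simp
  have AR1: "A holomorphic_on ball z0 r1" using AR by (rule holomorphic_on_subset) (use r1 in auto)
  \<comment> \<open>This is the claim that the order of \<phi> at \<open>z0\<close> does not exceed
    that of \<open>A\<close>.\<close>
  have no_pole: "\<not> is_pole q z0"
  proof
    assume pole: "is_pole q z0"
    from zorder_exist_pole[OF qhol open_ball z0 pole] obtain m g e where
      g: "m > 0" "g z0 \<noteq> 0" "e > 0" "cball z0 e \<subseteq> ball z0 r1" "g holomorphic_on cball z0 e"
        "\<And>w. w \<in> cball z0 e - {z0} \<Longrightarrow> q w = g w / (w - z0) ^ m"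
      by (metis zero_less_nat_eq neg_0_less_iff_less)
    \<comment> \<open>Chosen to reduce the supposed pole of A / \<phi> of order m to a simple one.
      Since L(A f) = Q(f) is holomorphic at \<open>z0\<close>, there is a holomorphic v with v' - B
      v = A f. Then v / \<phi> is a single-valued primitive of f A / \<phi>, whose residue
      \<open>g z0\<close> is not 0.\<close>
    define f where "f z = (z - z0) ^ (m - 1)" for z
    have fhol: "f holomorphic_on S" for S unfolding f_def by (intro holomorphic_intros)
    have Qf: "?Q f holomorphic_on ball z0 R"
      unfolding quad_op_def by (intro holomorphic_intros holomorphic_quad_coeff[OF coh] fhol) auto
    have LQ: "lin_op n A a (\<lambda>x. A x * f x) z = ?Q f z" if "z \<in> V2" for z
    proof -
      have "lin_op n A a (\<lambda>x. A x * f x) z = ?Q (\<lambda>x. A x * f x / A x) z"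
        using nzV2 by (intro lin_op_eq_quad_op[OF V2(1) that AV2]) (auto intro!: holomorphic_on_mult AV2 fhol)
      also have "\<dots> = ?Q f z"
        unfolding quad_op_def
        using nzV2 by (intro sum.cong refl arg_cong2[where f="(*)"] higher_deriv_cong_open[OF V2(1) that]) auto
      finally show ?thesis .
    qed
    have "A holomorphic_on ball z1 \<rho>" using AR by (rule holomorphic_on_subset) (use V1X in blast)
    then have Af: "(\<lambda>x. A x * f x) holomorphic_on ball z1 \<rho>" by (intro holomorphic_on_mult fhol)
    obtain v where v: "v holomorphic_on ball z0 r1" "\<And>z. z \<in> V2 \<Longrightarrow> deriv v z - ?B z * v z = A z * f z"
      using solve[OF Af Qf LQ, of 0] by blast
    have dv: "deriv v z - ?B z * v z = A z * f z" if "z \<in> ?X1" for z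
      by (rule extend[OF v(1) _ v(2) that]) (auto intro!: holomorphic_on_mult AX1 fhol)
    have D: "((\<lambda>z. v z / \<phi> z) has_field_derivative g z / (z - z0)) (at z)" if "z \<in> cball z0 e - {z0}" for z
    proof -
      have z: "z \<in> ?X1" using that g by auto
      have "((\<lambda>z. v z / \<phi> z) has_field_derivative (deriv v z * \<phi> z - v z * deriv \<phi> z) / (\<phi> z * \<phi> z)) (at z)"
        using z \<phi>nz[OF z] v(1) \<phi>(1) by (intro DERIV_divide holomorphic_derivI[OF _ open_ball]) auto
      moreover have "(deriv v z * \<phi> z - v z * deriv \<phi> z) / (\<phi> z * \<phi> z) = f z * q z"
      proof -
        have "deriv v z = A z * f z + ?B z * v z" using dv[OF z] by (simp add: algebra_simps)
        then show ?thesis using d\<phi>[OF z] \<phi>nz[OF z] by (simp add: q_def field_simps)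
      qed
      moreover have "f z * q z = g z / (z - z0)"
      proof -
        have "(z - z0) ^ m = (z - z0) ^ (m - 1) * (z - z0)" using g(1) by (cases m) auto
        then show ?thesis using g(6)[OF that] that by (simp add: f_def)
      qed
      ultimately show ?thesis by simp
    qed
    have "((\<lambda>z. g z / (z - z0)) has_contour_integral 0) (circlepath z0 e)"
    proof (rule Cauchy_theorem_primitive[where S = "cball z0 e - {z0}" and f = "\<lambda>z. v z / \<phi> z"])
      show "((\<lambda>z. v z / \<phi> z) has_field_derivative g x / (x - z0)) (at x within cball z0 e - {z0})" if "x \<in> cball z0 e - {z0}" for x
        using D[OF that] by (rule has_field_derivative_at_within)
    qed (use g in auto)
    moreover have "((\<lambda>z. g z / (z - z0)) has_contour_integral (2 * of_real pi * \<i> * g z0)) (circlepath z0 e)"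
      by (rule Cauchy_integral_circlepath_simple) (use g in auto)
    ultimately have "2 * of_real pi * \<i> * g z0 = 0" using has_contour_integral_unique by blast
    then show False using g by simp
  qed
  have "not_essential q z0" unfolding q_def
    by (intro not_essential_divide not_essential_holomorphic[OF AR1 z0] not_essential_holomorphic[OF \<phi>(1) z0]
      isolated_singularity_at_holomorphic[OF onX1[OF AR1]] isolated_singularity_at_holomorphic[OF onX1[OF \<phi>(1)]]) (use r1 in auto)
  then obtain l where l: "q \<midarrow>z0\<rightarrow> l" using no_pole by (auto simp: not_essential_def)
  \<comment> \<open>A / \<phi> with its removable singularity filled in.\<close>
  define \<kappa> where "\<kappa> z = (if z = z0 then l else q z)" for z
  have \<kappa>hol: "\<kappa> holomorphic_on ball z0 r1"
    unfolding \<kappa>_def[abs_def] by (rule removable_singularity[OF qhol open_ball l])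
  have \<kappa>: "A z = \<kappa> z * \<phi> z" if "z \<in> ?X1" for z using that \<phi>nz[OF that] by (simp add: \<kappa>_def q_def)
  define u where "u = riccati_change A ?B w"
  have wV1: "w holomorphic_on ball z1 \<rho>" and AV1: "A holomorphic_on ball z1 \<rho>" and BV1: "?B holomorphic_on ball z1 \<rho>"
    using w \<rho> holomorphic_on_subset AR V1X BX by (blast, blast, blast)
  have uhol: "u holomorphic_on ball z1 \<rho>" unfolding u_def by (rule riccati_change_holomorphic[OF open_ball AV1 BV1 wV1])
  have Lu: "lin_op n A a u z = c z" if "z \<in> V2" for z
    using quadratic_ode_iff[OF V2(1) that _ wV2 n cohV2] ode[of z] that V2(5) dfV2 defect_eq_0[OF dfV2[OF that]]
    by (auto simp: u_def defect_free_def)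
  obtain v where v: "v holomorphic_on ball z0 r1" "\<And>z. z \<in> V2 \<Longrightarrow> deriv v z - ?B z * v z = u z"
    using solve[OF uhol cR Lu, of 0] by blast
  \<comment> \<open>Variation of constants: both first-order terms with coefficient B cancel,
    leaving hh' = \<kappa> w^2 with w = v + \<phi> hh.\<close>
  define hh where "hh z = (w z - v z) / \<phi> z" for z
  have dhh: "(hh has_field_derivative \<kappa> z * (w z)\<^sup>2) (at z)" if "z \<in> V2" for z
  proof -
    have z: "z \<in> ?X1" using that V2 by blast
    then have "(hh has_field_derivative ((deriv w z - deriv v z) * \<phi> z - (w z - v z) * deriv \<phi> z) / (\<phi> z * \<phi> z)) (at z)"
      unfolding hh_def[abs_def] using \<phi>nz[OF z] v(1) \<phi>(1) wV2 V2(1) that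
      by (intro DERIV_divide DERIV_diff holomorphic_derivI[of _ "ball z0 r1"] holomorphic_derivI[of _ V2]) auto
    moreover have "deriv w z = u z + \<kappa> z * \<phi> z * (w z)\<^sup>2 + ?B z * w z" using \<kappa>[OF z] by (simp add: u_def riccati_change_def)
    moreover have "deriv v z = u z + ?B z * v z" using v(2)[OF that] by (simp add: algebra_simps)
    ultimately show ?thesis using d\<phi>[OF z] \<phi>nz[OF z] by (auto simp: field_simps)
  qed
  have hhhol: "hh holomorphic_on V2" using dhh by (rule holomorphic_on_derivI)
  have \<kappa>V2: "\<kappa> holomorphic_on V2" and \<phi>V2: "\<phi> holomorphic_on V2" and vV2: "v holomorphic_on V2"
    using \<kappa>hol \<phi>(1) v(1) V2(9) holomorphic_on_subset by blast+
  define V3 where "V3 = ball z1 (\<rho>/4)"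
  have V3: "open V3" "connected V3" "z1 \<in> V3" "V3 \<subseteq> V2" using \<rho> by (auto simp: V3_def V2_def)
  \<comment> \<open>The denominator of hh. Its equation H' = - \<kappa> \<phi> w H is chosen so that
    the pair (hh H, H) solves a linear system in which w no longer occurs.\<close>
  obtain H0 where H0: "H0 holomorphic_on V3" "\<And>k. k < 1 \<Longrightarrow> (deriv ^^ k) H0 z1 = 1"
      "\<And>z. z \<in> V3 \<Longrightarrow> (deriv ^^ 1) H0 z = (\<Sum>j<1. (- \<kappa> z * \<phi> z * w z) * (deriv ^^ j) H0 z) + 0"
    unfolding V3_def
    by (rule linear_ode_exists[of "\<rho>/4" "\<rho>/2" 1 "\<lambda>j z. - \<kappa> z * \<phi> z * w z" z1 "\<lambda>_. 0" z1 "\<lambda>k. 1"])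
      (use \<rho> \<kappa>V2 \<phi>V2 wV2 in \<open>auto simp: V2_def intro!: holomorphic_intros\<close>)
  \<comment> \<open>Linearization of h' = \<kappa> (v + \<phi> h)^2 for h = x0 / x1. The entries are
    holomorphic at \<open>z0\<close>, so the system is solved on the whole disc; uniqueness near
    \<open>z1\<close> identifies its solution with (hh H0, H0).\<close>
  define M where "M i j = (if i = 0 then (if j = 0 then (\<lambda>z. \<kappa> z * v z * \<phi> z) else (\<lambda>z. \<kappa> z * (v z)\<^sup>2))
     else if j = 0 then (\<lambda>z. - (\<kappa> z * (\<phi> z)\<^sup>2)) else (\<lambda>z. - (\<kappa> z * v z * \<phi> z)))" for i j :: nat
  have M: "M i j holomorphic_on ball z0 r1" for i j
    using \<kappa>hol v(1) \<phi>(1) by (auto simp: M_def intro!: holomorphic_intros)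
  have "\<exists>x. \<forall>i<2. x i z1 = (if i = 0 then hh z1 else 1) \<and>
          (\<forall>z\<in>ball z0 r. (x i has_field_derivative (\<Sum>j<2. M i j z * x j z) + (\<lambda>i z. 0) i z) (at z))"
    by (rule linear_system_exists[of r r1]) (use r r1 M V2 in auto)
  then obtain x where x: "\<forall>i<(2::nat). x i z1 = (if i = 0 then hh z1 else 1) \<and>
          (\<forall>z\<in>ball z0 r. (x i has_field_derivative (\<Sum>j<2. M i j z * x j z) + (\<lambda>i z. 0) i z) (at z))"
    by (elim exE)
  have xd: "(x i has_field_derivative (\<Sum>j<2. M i j z * x j z)) (at z)" if "i < 2" "z \<in> ball z0 r" for i z
    using x that by simp
  have xhol: "x i holomorphic_on ball z0 r" if "i < 2" for i using xd[OF that] by (rule holomorphic_on_derivI)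
  define y where "y i z = x i z - (if i = 0 then hh z * H0 z else H0 z)" for i :: nat and z
  have y0: "y i z = 0" if "i < 2" "z \<in> V3" for i z
  proof (rule linear_system_unique[of V3 z1 2 M y])
    show "M i j holomorphic_on V3" for i j using M V3(4) V2(9) by (meson holomorphic_on_subset order_trans)
    fix i z assume iz: "i < (2::nat)" "z \<in> V3"
    then have z: "z \<in> V2" "z \<in> ?X1" "z \<in> ball z0 r" using V3 V2 by auto
    have dH: "(H0 has_field_derivative - \<kappa> z * \<phi> z * w z * H0 z) (at z)"
      using holomorphic_derivI[OF H0(1) V3(1) iz(2)] H0(3)[OF iz(2)] by simp
    have whh: "w z = v z + \<phi> z * hh z" using \<phi>nz[OF z(2)] by (simp add: hh_def)
    have "((\<lambda>z. hh z * H0 z) has_field_derivative hh z * (- \<kappa> z * \<phi> z * w z * H0 z) + \<kappa> z * (w z)\<^sup>2 * H0 z) (at z)"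
      using DERIV_mult[OF dhh[OF z(1)] dH] by (simp add: algebra_simps)
    moreover have "hh z * (- \<kappa> z * \<phi> z * w z * H0 z) + \<kappa> z * (w z)\<^sup>2 * H0 z = \<kappa> z * v z * \<phi> z * (hh z * H0 z) + \<kappa> z * (v z)\<^sup>2 * H0 z"
      unfolding whh by (simp add: algebra_simps power2_eq_square)
    ultimately have d0: "((\<lambda>z. hh z * H0 z) has_field_derivative \<kappa> z * v z * \<phi> z * (hh z * H0 z) + \<kappa> z * (v z)\<^sup>2 * H0 z) (at z)" by simp
    have "- \<kappa> z * \<phi> z * w z * H0 z = - (\<kappa> z * (\<phi> z)\<^sup>2) * (hh z * H0 z) + - (\<kappa> z * v z * \<phi> z) * H0 z"
      unfolding whh by (simp add: algebra_simps power2_eq_square)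
    with dH have d1: "(H0 has_field_derivative - (\<kappa> z * (\<phi> z)\<^sup>2) * (hh z * H0 z) + - (\<kappa> z * v z * \<phi> z) * H0 z) (at z)" by simp
    consider "i = 0" | "i = 1" using iz by linarith
    then show "(y i has_field_derivative (\<Sum>j<2. M i j z * y j z)) (at z)"
    proof cases
      case 1
      then show ?thesis using DERIV_diff[OF xd[OF iz(1) z(3)] d0]
        by (simp add: y_def[abs_def] M_def numeral_2_eq_2 algebra_simps)
    next
      case 2
      then show ?thesis using DERIV_diff[OF xd[OF iz(1) z(3)] d1]
        by (simp add: y_def[abs_def] M_def numeral_2_eq_2 algebra_simps)
    qed
  next
    show "y i z1 = 0" if "i < 2" for i using x that H0(2)[of 0] by (auto simp: y_def)
  qed (use V3 that in auto)
  have wV3: "w z * x 1 z = v z * x 1 z + \<phi> z * x 0 z" if "z \<in> V3" for z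
  proof -
    have "\<phi> z \<noteq> 0" using \<phi>nz that V3 V2 by blast
    moreover have "x 0 z = hh z * x 1 z" using y0[of 0 z] y0[of 1 z] that by (simp add: y_def)
    ultimately show ?thesis by (simp add: hh_def field_simps)
  qed
  show ?thesis
  proof (rule that[of "\<lambda>z. v z * x 1 z + \<phi> z * x 0 z" "x 1"])
    have sub: "ball z0 r \<subseteq> ball z0 r1" using r1 by auto
    have vr: "v holomorphic_on ball z0 r" "\<phi> holomorphic_on ball z0 r" using v(1) \<phi>(1) sub holomorphic_on_subset by blast+
    show N: "(\<lambda>z. v z * x 1 z + \<phi> z * x 0 z) holomorphic_on ball z0 r" using vr xhol by (intro holomorphic_intros) auto
    show "x 1 holomorphic_on ball z0 r" using xhol by simp
    show "\<exists>x'\<in>ball z0 r. x 1 x' \<noteq> 0" using x V2 by (intro bexI[of _ z1]) auto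
    \<comment> \<open>Without denominators the relation can be continued over all of
      \<open>V\<close>, including \<open>z0\<close> if it belongs to \<open>V\<close>.\<close>
    show "w z * x 1 z = v z * x 1 z + \<phi> z * x 0 z" if "z \<in> V" for z
      by (rule analytic_continuation_open[of V3 V "\<lambda>z. w z * x 1 z" "\<lambda>z. v z * x 1 z + \<phi> z * x 0 z"])
        (use V3 V2 V w that wV3 xhol[of 1] N in \<open>auto intro!: holomorphic_on_mult intro: holomorphic_on_subset\<close>)
  qed
qed

section \<open>Continuation along paths\<close>

text \<open>The form of continuation used throughout: a property of germs along a path holds
  everywhere once it holds at the start and is locally constant in the parameter.\<close>

lemma connected_locally_constant:
  fixes T :: "real set"
  assumes "connected T" "a \<in> T" "P a" "t \<in> T"
    and loc: "\<And>t. t \<in> T \<Longrightarrow> \<forall>\<^sub>F s in at t within T. P s \<longleftrightarrow> P t"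
  shows "P t"
proof (rule connected_induction_simple[where P = P and S = T and a = a and b = t])
  fix u assume u: "u \<in> T"
  then obtain X where X: "open X" "u \<in> X" "\<And>s. s \<in> X \<Longrightarrow> s \<noteq> u \<Longrightarrow> s \<in> T \<Longrightarrow> P s \<longleftrightarrow> P u"
    using loc[OF u] by (auto simp: eventually_at_topological)
  show "\<exists>S. openin (top_of_set T) S \<and> u \<in> S \<and> (\<forall>x\<in>S. \<forall>y\<in>S. P x \<longrightarrow> P y)"
  proof (intro exI[of _ "T \<inter> X"] conjI ballI impI)
    show "openin (top_of_set T) (T \<inter> X)" using X(1) by (rule openin_open_Int)
    show "P y" if "x \<in> T \<inter> X" "y \<in> T \<inter> X" "P x" for x y using that X(3) by (cases "x = u"; cases "y = u") auto
  qed (use u X in auto)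
qed (use assms in auto)

lemma holomorphic_ode_residual:
  assumes "coeffs_holomorphic n A a b c S" "open S" "w holomorphic_on S"
  shows "ode_residual n A a b c w holomorphic_on S"
proof -
  have "(\<lambda>z. \<Sum>(k, j)\<in>quadratic_index n. a k j z * (deriv ^^ k) w z * (deriv ^^ j) w z) holomorphic_on S"
    unfolding split_def using assms by (intro holomorphic_intros) (auto simp: coeffs_holomorphic_def)
  moreover have "(\<lambda>z. \<Sum>j=0..n - 1. b j z * (deriv ^^ j) w z) holomorphic_on S"
    using assms by (intro holomorphic_intros) (auto simp: coeffs_holomorphic_def)
  moreover have "A holomorphic_on S" "c holomorphic_on S" using assms by (auto simp: coeffs_holomorphic_def)
  moreover have "(deriv ^^ (n - 1)) (\<lambda>x. (w x)\<^sup>2) holomorphic_on S" "(deriv ^^ n) w holomorphic_on S"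
    using assms by (auto intro!: holomorphic_intros)
  ultimately show ?thesis unfolding ode_residual_def[abs_def] by (intro holomorphic_on_diff holomorphic_on_add holomorphic_on_mult) auto
qed

lemma quadratic_ode_cong:
  assumes "open S" "z \<in> S" "\<And>x. x \<in> S \<Longrightarrow> w x = w' x" and eq: "coeffs_eq n A a b c A' a' b' c' z"
  shows "quadratic_ode n A a b c w z \<longleftrightarrow> quadratic_ode n A' a' b' c' w' z"
proof -
  have d: "(deriv ^^ k) w z = (deriv ^^ k) w' z" for k by (rule higher_deriv_cong_open[OF assms(1,2)]) (use assms in auto)
  have d2: "(deriv ^^ k) (\<lambda>x. (w x)\<^sup>2) z = (deriv ^^ k) (\<lambda>x. (w' x)\<^sup>2) z" for k
    by (rule higher_deriv_cong_open[OF assms(1,2)]) (use assms in auto)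
  have s1: "(\<Sum>(k, j)\<in>quadratic_index n. a k j z * (deriv ^^ k) w' z * (deriv ^^ j) w' z) = (\<Sum>(k, j)\<in>quadratic_index n. a' k j z * (deriv ^^ k) w' z * (deriv ^^ j) w' z)"
    using eq by (intro sum.cong) (auto simp: coeffs_eq_def)
  have s2: "(\<Sum>j=0..n - 1. b j z * (deriv ^^ j) w' z) = (\<Sum>j=0..n - 1. b' j z * (deriv ^^ j) w' z)"
    using eq by (intro sum.cong) (auto simp: coeffs_eq_def)
  show ?thesis unfolding quadratic_ode_def d d2 s1 s2 using eq by (simp only: coeffs_eq_def)
qed

lemma coeffs_eq_refl: "coeffs_eq n A a b c A a b c z"
  by (auto simp: coeffs_eq_def)

lemma finite_quadratic_index: "finite (quadratic_index n)"
  by (rule finite_subset[of _ "{..<n} \<times> {..<n}"]) (auto simp: quadratic_index_def)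

text \<open>The equivalence of both directions is what makes equations between germs locally
  constant along a path.\<close>

lemma eventually_holomorphic_eq_iff:
  fixes f g :: "complex \<Rightarrow> complex"
  assumes X: "open X" "connected X" "f holomorphic_on X" "g holomorphic_on X" "x \<in> X" "y \<in> X"
  shows "(\<forall>\<^sub>F z in nhds x. f z = g z) \<longleftrightarrow> (\<forall>\<^sub>F z in nhds y. f z = g z)"
proof -
  have "\<forall>\<^sub>F z in nhds v. f z = g z" if "u \<in> X" "v \<in> X" "\<forall>\<^sub>F z in nhds u. f z = g z" for u v
    by (rule eventually_nhds_in_open[THEN eventually_mono, OF X(1) that(2)])
      (rule eq_on_connected[OF X(3,4,1,2) that(1,3)])
  then show ?thesis using X by blast
qed

lemma germ_near:
  assumes "analytic_continuation w \<gamma> T F" "t \<in> T"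
  shows "\<forall>\<^sub>F s in at t within T. \<forall>\<^sub>F z in nhds (\<gamma> s). F s z = F t z"
proof -
  obtain \<delta> where "\<delta> > 0" "\<forall>s\<in>T. \<bar>s - t\<bar> < \<delta> \<longrightarrow> (\<forall>\<^sub>F z in nhds (\<gamma> s). F s z = F t z)"
    using assms unfolding analytic_continuation_def by blast
  then show ?thesis unfolding eventually_at by (intro exI[of _ \<delta>]) (auto simp: dist_real_def)
qed

text \<open>For parameters near \<open>t\<close> the germ \<open>F s\<close> comes from the one
  function \<open>F t\<close>, so the relation with \<open>N\<close> and \<open>H\<close> can be
  moved between the two base points inside a small disc.\<close>

lemma eventually_quotient_iff:
  assumes "analytic_continuation w \<gamma> {0..<1} F" and \<gamma>: "path \<gamma>" and t: "t \<in> {t0..<1}" "0 \<le> t0"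
    and X: "open X" "N holomorphic_on X" "H holomorphic_on X" "\<gamma> t \<in> X"
  shows "\<forall>\<^sub>F s in at t within {t0..<1}. (\<forall>\<^sub>F z in nhds (\<gamma> s). F s z * H z = N z) \<longleftrightarrow> (\<forall>\<^sub>F z in nhds (\<gamma> t). F t z * H z = N z)"
proof -
  have an: "F t analytic_on {\<gamma> t}" using assms by (auto simp: analytic_continuation_def)
  then obtain e where e: "e > 0" "F t holomorphic_on ball (\<gamma> t) e" by (auto simp: analytic_on_def)
  obtain e' where e': "e' > 0" "ball (\<gamma> t) e' \<subseteq> X" using X openE by blast
  define Y where "Y = ball (\<gamma> t) (min e e')"
  have Y: "open Y" "connected Y" "\<gamma> t \<in> Y" "Y \<subseteq> X" "Y \<subseteq> ball (\<gamma> t) e" using e e' by (auto simp: Y_def)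
  have hol: "(\<lambda>z. F t z * H z) holomorphic_on Y" "N holomorphic_on Y"
    using e X Y by (auto intro!: holomorphic_on_mult intro: holomorphic_on_subset)
  have "continuous_on {t0..<1} \<gamma>" 
    by (rule continuous_on_subset[of "{0..1}"]) (use \<gamma> t in \<open>auto simp: path_def\<close>)
  then have "(\<gamma> \<longlongrightarrow> \<gamma> t) (at t within {t0..<1})" using t by (auto simp: continuous_on_def)
  then have 1: "\<forall>\<^sub>F s in at t within {t0..<1}. \<gamma> s \<in> Y" by (rule topological_tendstoD[OF _ Y(1,3)])
  have "\<forall>\<^sub>F s in at t within {0..<1}. \<forall>\<^sub>F z in nhds (\<gamma> s). F s z = F t z"
    by (rule germ_near[OF assms(1)]) (use t in auto)
  then have 2: "\<forall>\<^sub>F s in at t within {t0..<1}. \<forall>\<^sub>F z in nhds (\<gamma> s). F s z = F t z"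
    by (rule filter_leD[OF at_le, rotated]) (use t in auto)
  show ?thesis using 1 2
  proof eventually_elim
    case (elim s)
    have "(\<forall>\<^sub>F z in nhds (\<gamma> s). F s z * H z = N z) \<longleftrightarrow> (\<forall>\<^sub>F z in nhds (\<gamma> s). F t z * H z = N z)"
      by (rule eventually_cong[OF elim(2)]) auto
    also have "\<dots> \<longleftrightarrow> (\<forall>\<^sub>F z in nhds (\<gamma> t). F t z * H z = N z)"
      by (rule eventually_holomorphic_eq_iff[OF Y(1,2) hol elim(1) Y(3)])
    finally show ?case .
  qed
qed

text \<open>Once the coefficients near the end point \<open>z\<^sub>0\<close> are those of a linearizable equation, the continued
  solution is a quotient of functions holomorphic at \<open>z\<^sub>0\<close>.\<close>
lemma quotient_singularity_is_pole:
  assumes F: "analytic_continuation w \<gamma> {0..<1} F" "\<not> continuable_along w \<gamma>" and \<gamma>: "path \<gamma>"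
    and t0: "0 \<le> t0" "t0 < 1" and r: "r > 0" "\<And>t. t \<in> {t0..1} \<Longrightarrow> \<gamma> t \<in> ball (\<gamma> 1) r"
    and N: "N holomorphic_on ball (\<gamma> 1) r" and H: "H holomorphic_on ball (\<gamma> 1) r" "\<exists>x\<in>ball (\<gamma> 1) r. H x \<noteq> 0"
    and q: "\<forall>\<^sub>F z in nhds (\<gamma> t0). F t0 z * H z = N z"
  shows "singularity_is_pole \<gamma> F"
proof -
  let ?z = "\<gamma> 1" and ?B = "ball (\<gamma> 1) r"
  have qt: "\<forall>\<^sub>F z in nhds (\<gamma> t). F t z * H z = N z" if "t \<in> {t0..<1}" for t
    by (rule connected_locally_constant[of "{t0..<1}" t0 "\<lambda>t. \<forall>\<^sub>F z in nhds (\<gamma> t). F t z * H z = N z"])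
      (use that t0 q eventually_quotient_iff[OF F(1) \<gamma> _ t0(1) open_ball N H(1)] r in auto)
  have z0: "?z \<in> ?B" using r by simp
  have "\<forall>\<^sub>F z in at ?z. H z \<noteq> 0 \<and> z \<in> ?B" using eventually_nonzero[OF open_ball connected_ball H(1) _ _ z0] H(2) by blast
  then obtain d where d: "d > 0" "\<And>z. z \<noteq> ?z \<Longrightarrow> dist z ?z < d \<Longrightarrow> H z \<noteq> 0 \<and> z \<in> ?B"
    by (auto simp: eventually_at)
  define r' where "r' = min d r"
  have r': "r' > 0" "ball ?z r' \<subseteq> ?B" "\<And>z. z \<in> ball ?z r' - {?z} \<Longrightarrow> H z \<noteq> 0"
    using d r by (auto simp: r'_def dist_commute)
  define g where "g z = N z / H z" for z
  have sub: "ball ?z r' - {?z} \<subseteq> ?B" using r' by blast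
  have ghol: "g holomorphic_on ball ?z r' - {?z}"
    unfolding g_def using holomorphic_on_subset[OF N sub] holomorphic_on_subset[OF H(1) sub] r' by (intro holomorphic_intros) auto
  have "continuous_on {0..1} \<gamma>" using \<gamma> by (simp add: path_def)
  then have "(\<gamma> \<longlongrightarrow> \<gamma> 1) (at 1 within {0..1})" by (auto simp: continuous_on_def)
  then have "\<forall>\<^sub>F s in at 1 within {0..1}. \<gamma> s \<in> ball ?z r'"
    by (rule topological_tendstoD[OF _ open_ball]) (use r' in simp)
  then obtain d' where d': "d' > 0" "\<And>s. s \<in> {0..1} \<Longrightarrow> s \<noteq> 1 \<Longrightarrow> dist s 1 < d' \<Longrightarrow> \<gamma> s \<in> ball ?z r'"
    by (auto simp: eventually_at)
  define \<delta> where "\<delta> = min d' (1 - t0)"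
  have \<delta>: "\<delta> > 0" "\<And>s. s \<in> {0..<1} \<Longrightarrow> 1 - s < \<delta> \<Longrightarrow> \<gamma> s \<in> ball ?z r' \<and> s \<in> {t0..<1}"
    using d' t0 by (auto simp: \<delta>_def dist_real_def)
  \<comment> \<open>The path may pass through its own end point at an earlier time, so equality with
    \<open>g\<close> is claimed only away from that point.\<close>
  have Fg: "\<forall>\<^sub>F z in nhds (\<gamma> s). z \<noteq> ?z \<longrightarrow> F s z = g z" if s: "s \<in> {0..<1}" "1 - s < \<delta>" for s
  proof -
    have "\<forall>\<^sub>F z in nhds (\<gamma> s). z \<in> ball ?z r'" using \<delta>(2)[OF s] by (intro eventually_nhds_in_open) auto
    with qt[of s] \<delta>(2)[OF s] show ?thesis
    proof (elim conjE)
      assume s': "s \<in> {t0..<1}"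
      have "\<forall>\<^sub>F z in nhds (\<gamma> s). F s z * H z = N z" using qt[OF s'] .
      then show ?thesis using \<open>\<forall>\<^sub>F z in nhds (\<gamma> s). z \<in> ball ?z r'\<close>
        by eventually_elim (use r'(3) in \<open>auto simp: g_def field_simps\<close>)
    qed
  qed
  have Fan: "F s analytic_on {\<gamma> s}" if "s \<in> {0..<1}" for s using F(1) that by (simp add: analytic_continuation_def)
  \<comment> \<open>With a finite limit \<open>g\<close> would extend holomorphically and serve as
    the germ at parameter 1, against the assumption that \<open>w\<close> cannot be continued to the
    end.\<close>
  have no_limit: "\<not> (g \<midarrow>?z\<rightarrow> l)" for l
  proof
    assume l: "g \<midarrow>?z\<rightarrow> l"
    define G where "G z = (if z = ?z then l else g z)" for z
    have G: "G holomorphic_on ball ?z r'"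
      unfolding G_def[abs_def] by (rule removable_singularity[OF ghol open_ball l])
    have FG: "\<forall>\<^sub>F z in nhds (\<gamma> s). F s z = G z" if s: "s \<in> {0..<1}" "1 - s < \<delta>" for s
    proof (cases "\<gamma> s = ?z")
      case False
      have "\<forall>\<^sub>F z in nhds (\<gamma> s). z \<noteq> ?z" using False by (rule t1_space_nhds)
      with Fg[OF s] show ?thesis by eventually_elim (auto simp: G_def)
    next
      case True
      have ev: "\<forall>\<^sub>F z in at ?z. F s z = g z" using Fg[OF s] True by (auto simp: eventually_at_filter)
      have "F s \<midarrow>?z\<rightarrow> F s ?z" using analytic_at_imp_isCont[OF Fan[OF s(1)]] True by (simp add: isCont_def)
      then have "g \<midarrow>?z\<rightarrow> F s ?z" using ev by (rule Lim_transform_eventually)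
      then have Fl: "F s ?z = l" using l tendsto_unique[OF at_neq_bot] by blast
      show ?thesis using Fg[OF s] by (rule eventually_mono) (use Fl in \<open>auto simp: G_def\<close>)
    qed
    define F' where "F' t = (if t = 1 then G else F t)" for t :: real
    have "analytic_continuation w \<gamma> {0..1} F'"
      unfolding analytic_continuation_def
    proof (intro conjI ballI)
      show "\<forall>\<^sub>F z in nhds (\<gamma> 0). F' 0 z = w z" using F(1) by (simp add: F'_def analytic_continuation_def)
      fix t :: real assume t: "t \<in> {0..1}"
      have "G analytic_on {?z}" using G r' by (auto simp: analytic_on_def)
      then show "F' t analytic_on {\<gamma> t}" using Fan[of t] t by (auto simp: F'_def)
      show "\<exists>\<delta>>0. \<forall>s\<in>{0..1}. \<bar>s - t\<bar> < \<delta> \<longrightarrow> (\<forall>\<^sub>F z in nhds (\<gamma> s). F' s z = F' t z)"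
      proof (cases "t = 1")
        case True
        show ?thesis using FG \<delta>(1) by (intro exI[of _ \<delta>]) (auto simp: F'_def True)
      next
        case False
        then obtain e where e: "e > 0" "\<forall>s\<in>{0..<1}. \<bar>s - t\<bar> < e \<longrightarrow> (\<forall>\<^sub>F z in nhds (\<gamma> s). F s z = F t z)"
          using F(1) t by (force simp: analytic_continuation_def)
        show ?thesis using e False t by (intro exI[of _ "min e (1 - t)"]) (auto simp: F'_def)
      qed
    qed
    then show False using F(2) by (auto simp: continuable_along_def)
  qed
  have zB: "?z \<in> ?B" using r by simp
  have sub': "N holomorphic_on ?B - {?z}" "H holomorphic_on ?B - {?z}" using N H(1) by (auto intro: holomorphic_on_subset)
  have "not_essential g ?z" unfolding g_def
    by (intro not_essential_divide not_essential_holomorphic[OF N zB] not_essential_holomorphic[OF H(1) zB]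
      isolated_singularity_at_holomorphic[OF sub'(1)] isolated_singularity_at_holomorphic[OF sub'(2)]) (use zB in auto)
  then have pole: "is_pole g ?z" using no_limit by (auto simp: not_essential_def)
  \<comment> \<open>A passage through the end point at these late parameters is now impossible:
    \<open>F s\<close> is analytic there and would give \<open>g\<close> a finite limit.\<close>
  have "\<forall>\<^sub>F z in nhds (\<gamma> s). F s z = g z" if s: "s \<in> {0..<1}" "1 - s < \<delta>" for s
  proof (cases "\<gamma> s = ?z")
    case False
    have "\<forall>\<^sub>F z in nhds (\<gamma> s). z \<noteq> ?z" using False by (rule t1_space_nhds)
    with Fg[OF s] show ?thesis by eventually_elim auto
  next
    case True
    have ev: "\<forall>\<^sub>F z in at ?z. F s z = g z" using Fg[OF s] True by (auto simp: eventually_at_filter)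
    have "F s \<midarrow>?z\<rightarrow> F s ?z" using analytic_at_imp_isCont[OF Fan[OF s(1)]] True by (simp add: isCont_def)
    then have "g \<midarrow>?z\<rightarrow> F s ?z" using ev by (rule Lim_transform_eventually)
    then show ?thesis using no_limit by blast
  qed
  then show ?thesis unfolding singularity_is_pole_def using r'(1) ghol pole \<delta>(1) by blast
qed

section \<open>Linearizability implies the Painleve property\<close>

text \<open>Linearizability is given only on some subdomain. The defects vanish there off the zeros
  of \<open>A\<close>, hence on all of \<open>U\<close> off these zeros.\<close>

lemma linearizable_imp_defect_free:
  assumes n: "n \<ge> 2" and U: "open U" "connected U" and coh: "coeffs_holomorphic n A a b c U" and nz: "\<exists>z\<in>U. A z \<noteq> 0"
    and lin: "linearizable_by_riccati n A a b c U" and z: "z \<in> U" "A z \<noteq> 0"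
  shows "defect_free n A a b z"
proof -
  obtain D B l l0 where D': "open D" "connected D" "D \<noteq> {}" "D \<subseteq> U" "B holomorphic_on D" "\<forall>j<n - 1. l j holomorphic_on D" "l0 holomorphic_on D"
    and equiv': "\<forall>V w. open V \<and> V \<subseteq> D \<and> w holomorphic_on V \<longrightarrow>
           ((\<forall>z\<in>V. quadratic_ode n A a b c w z) \<longleftrightarrow> (\<forall>z\<in>V. linear_ode (n - 1) l l0 (riccati_change A B w) z))"
    using lin unfolding linearizable_by_riccati_def by (elim exE conjE) (rule that; assumption)
  note D = D'(1,3-7)
  have equiv: "(\<forall>z\<in>V. quadratic_ode n A a b c w z) \<longleftrightarrow> (\<forall>z\<in>V. linear_ode (n - 1) l l0 (riccati_change A B w) z)"
    if "open V" "V \<subseteq> D" "w holomorphic_on V" for V w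
    using equiv' that by simp
  have cohD: "coeffs_holomorphic n A a b c D" using coh D(3) by (rule coeffs_holomorphic_subset)
  have A: "A holomorphic_on U" using coh by (simp add: coeffs_holomorphic_def)
  define Y where "Y = {z \<in> D. A z \<noteq> 0}"
  have "Y \<noteq> {}"
  proof
    assume "Y = {}"
    then have A0: "A x = 0" if "x \<in> D" for x using that by (auto simp: Y_def)
    have "A z = 0"
      by (rule analytic_continuation_open[OF D(1) U(1) D(2) U(2) D(3) A holomorphic_on_const]) (use z A0 in simp_all)
    then show False using z by simp
  qed
  moreover have "open Y" unfolding Y_def using D A by (intro open_nonzero) (auto intro: holomorphic_on_subset)
  moreover have "defect_free n A a b y" if "y \<in> Y" for y
    unfolding defect_free_def
  proof (intro conjI allI impI)
    have y: "y \<in> D" "A y \<noteq> 0" using that by (auto simp: Y_def)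
    then show "A y \<noteq> 0" by simp
    show "quad_defect a m i y = 0" if "m < n - 1" "i \<le> m" for m i
      by (rule linearization_canonical(1)[OF n D(1) cohD D(4), of l l0]) (use D y that equiv in simp_all)
    show "lin_defect n A a b m y = 0" if "m < n - 1" for m
      by (rule linearization_defects_zero[OF n D(1) cohD D(4), of l l0]) (use D y that equiv in simp_all)
  qed
  ultimately show ?thesis
    by - (rule defect_free_propagate[OF n U coh, of Y], use D z in \<open>auto simp: Y_def\<close>)
qed


lemma analytic_at_imp_eventually_ball:
  assumes "f analytic_on {x}"
  shows "\<forall>\<^sub>F \<rho> in at_right 0. f holomorphic_on ball x \<rho>"
proof -
  obtain e where "e > 0" "f holomorphic_on ball x e" using assms by (auto simp: analytic_on_def)
  then show ?thesis unfolding eventually_at_right_field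
    by (intro exI[of _ e]) (auto intro: holomorphic_on_subset)
qed

lemma linearizable_imp_strong_Painleve:
  assumes n: "n \<ge> 2" and U: "open U" "connected U" and coh: "coeffs_holomorphic n A a b c U" and nz: "\<exists>z\<in>U. A z \<noteq> 0"
    and lin: "linearizable_by_riccati n A a b c U"
  shows "strong_Painleve n A a b c U"
  unfolding strong_Painleve_def
proof (intro allI impI)
  fix w \<gamma> F assume mov: "movable_singularity n A a b c U w \<gamma> F"
  then have \<gamma>: "path \<gamma>" and \<gamma>0: "\<gamma> 0 \<in> U" by (auto simp: movable_singularity_def pathstart_def)
  have F: "analytic_continuation w \<gamma> {0..<1} F" "\<not> continuable_along w \<gamma>"
    using mov by (auto simp: movable_singularity_def comes_to_singularity_def)
  obtain S where S: "open S" "\<gamma> 0 \<in> S" "S \<subseteq> U" "w holomorphic_on S" "\<And>z. z \<in> S \<Longrightarrow> quadratic_ode n A a b c w z"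
    using mov unfolding movable_singularity_def pathstart_def by blast
  obtain CA where CA: "analytic_continuation A \<gamma> {0..1} CA"
    using mov by (auto simp: movable_singularity_def continuable_along_def)
  obtain Cc where Cc: "analytic_continuation c \<gamma> {0..1} Cc"
    using mov by (auto simp: movable_singularity_def continuable_along_def)
  have "\<forall>j. \<exists>G. j \<le> n - 1 \<longrightarrow> analytic_continuation (b j) \<gamma> {0..1} G"
    using mov by (auto simp: movable_singularity_def continuable_along_def)
  from choice[OF this] obtain Gb where Gb: "\<forall>j. j \<le> n - 1 \<longrightarrow> analytic_continuation (b j) \<gamma> {0..1} (Gb j)" by (elim exE)
  have "\<forall>kj. \<exists>G. kj \<in> quadratic_index n \<longrightarrow> analytic_continuation (a (fst kj) (snd kj)) \<gamma> {0..1} G"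
    using mov by (fastforce simp: movable_singularity_def continuable_along_def)
  from choice[OF this] obtain Ga where Ga: "\<forall>kj. kj \<in> quadratic_index n \<longrightarrow> analytic_continuation (a (fst kj) (snd kj)) \<gamma> {0..1} (Ga kj)" by (elim exE)
  define Ca where "Ca t k j = Ga (k, j) t" for t k j
  define Cb where "Cb t j = Gb j t" for t j
  have near: "\<forall>\<^sub>F s in at t within {0..1}. \<forall>\<^sub>F z in nhds (\<gamma> s). coeffs_eq n (CA s) (Ca s) (Cb s) (Cc s) (CA t) (Ca t) (Cb t) (Cc t) z"
    if t: "t \<in> {0..1}" for t
  proof -
    have 1: "\<forall>\<^sub>F s in at t within {0..1}. \<forall>kj\<in>quadratic_index n. \<forall>\<^sub>F z in nhds (\<gamma> s). Ga kj s z = Ga kj t z"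
      using Ga germ_near[OF _ t] by (intro eventually_ball_finite finite_quadratic_index) blast
    have 2: "\<forall>\<^sub>F s in at t within {0..1}. \<forall>j\<in>{..n - 1}. \<forall>\<^sub>F z in nhds (\<gamma> s). Gb j s z = Gb j t z"
      using Gb germ_near[OF _ t] by (intro eventually_ball_finite) auto
    show ?thesis using 1 2 germ_near[OF CA t] germ_near[OF Cc t]
    proof eventually_elim
      case (elim s)
      have "\<forall>\<^sub>F z in nhds (\<gamma> s). \<forall>kj\<in>quadratic_index n. Ga kj s z = Ga kj t z"
        using elim(1) by (intro eventually_ball_finite finite_quadratic_index)
      moreover have "\<forall>\<^sub>F z in nhds (\<gamma> s). \<forall>j\<in>{..n - 1}. Gb j s z = Gb j t z"
        using elim(2) by (intro eventually_ball_finite) auto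
      ultimately show ?case using elim(3,4)
        by eventually_elim (auto simp: coeffs_eq_def Ca_def Cb_def)
    qed
  qed
  have start: "\<forall>\<^sub>F z in nhds (\<gamma> 0). coeffs_eq n (CA 0) (Ca 0) (Cb 0) (Cc 0) A a b c z"
  proof -
    have "\<forall>\<^sub>F z in nhds (\<gamma> 0). \<forall>kj\<in>quadratic_index n. Ga kj 0 z = a (fst kj) (snd kj) z"
      using Ga by (intro eventually_ball_finite finite_quadratic_index) (auto simp: analytic_continuation_def)
    moreover have "\<forall>\<^sub>F z in nhds (\<gamma> 0). \<forall>j\<in>{..n - 1}. Gb j 0 z = b j z"
      using Gb by (intro eventually_ball_finite) (auto simp: analytic_continuation_def)
    moreover have "\<forall>\<^sub>F z in nhds (\<gamma> 0). CA 0 z = A z" "\<forall>\<^sub>F z in nhds (\<gamma> 0). Cc 0 z = c z"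
      using CA Cc by (auto simp: analytic_continuation_def)
    ultimately show ?thesis by eventually_elim (auto simp: coeffs_eq_def Ca_def Cb_def)
  qed
  have hol: "\<forall>\<^sub>F \<rho> in at_right 0. coeffs_holomorphic n (CA t) (Ca t) (Cb t) (Cc t) (ball (\<gamma> t) \<rho>)" if t: "t \<in> {0..1}" for t
  proof -
    have "\<forall>\<^sub>F \<rho> in at_right 0. \<forall>kj\<in>quadratic_index n. Ga kj t holomorphic_on ball (\<gamma> t) \<rho>"
      using Ga t by (intro eventually_ball_finite finite_quadratic_index ballI analytic_at_imp_eventually_ball) (auto simp: analytic_continuation_def)
    moreover have "\<forall>\<^sub>F \<rho> in at_right 0. \<forall>j\<in>{..n - 1}. Gb j t holomorphic_on ball (\<gamma> t) \<rho>"
      using Gb t by (intro eventually_ball_finite ballI analytic_at_imp_eventually_ball) (auto simp: analytic_continuation_def)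
    moreover have "\<forall>\<^sub>F \<rho> in at_right 0. CA t holomorphic_on ball (\<gamma> t) \<rho>" "\<forall>\<^sub>F \<rho> in at_right 0. Cc t holomorphic_on ball (\<gamma> t) \<rho>"
      using CA Cc t by (auto simp: analytic_continuation_def intro!: analytic_at_imp_eventually_ball)
    ultimately show ?thesis by eventually_elim (auto simp: coeffs_holomorphic_def Ca_def[abs_def] Cb_def[abs_def])
  qed
  have pos: "\<forall>\<^sub>F \<rho> in at_right (0::real). 0 < \<rho>" by (simp add: eventually_at_right_less)
  have cont: "(\<gamma> \<longlongrightarrow> \<gamma> t) (at t within {0..1})" if "t \<in> {0..1}" for t
    using \<gamma> that by (auto simp: path_def continuous_on_def)
  have le: "at t within {0..<1} \<le> at t within {0..1}" for t :: real by (rule at_le) auto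
  \<comment> \<open>Carried along the whole closed path: the continued coefficients are free of
    defects near \<open>\<gamma> t\<close>, off that point itself. Thus the criterion reaches the
    end point even if the path leaves \<open>U\<close>.\<close>
  define P1 where "P1 t \<longleftrightarrow> (\<forall>\<^sub>F z in at (\<gamma> t). defect_free n (CA t) (Ca t) (Cb t) z)" for t
  have df_cong: "(\<forall>\<^sub>F z in at x. defect_free n A1 a1 b1 z) \<longleftrightarrow> (\<forall>\<^sub>F z in at x. defect_free n A2 a2 b2 z)"
    if "\<forall>\<^sub>F z in nhds x. coeffs_eq n A1 a1 b1 c1 A2 a2 b2 c2 z" for x A1 a1 b1 c1 A2 a2 b2 c2
  proof -
    have "\<forall>\<^sub>F z in nhds x. defect_free n A1 a1 b1 z \<longleftrightarrow> defect_free n A2 a2 b2 z"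
    proof -
      obtain Y where Y: "open Y" "x \<in> Y" "\<And>z. z \<in> Y \<Longrightarrow> coeffs_eq n A1 a1 b1 c1 A2 a2 b2 c2 z"
        using \<open>\<forall>\<^sub>F z in nhds x. coeffs_eq n A1 a1 b1 c1 A2 a2 b2 c2 z\<close> by (auto simp: eventually_nhds)
      show ?thesis
        by (rule eventually_nhds_in_open[THEN eventually_mono, OF Y(1,2)]) (rule defect_free_cong[OF n Y(1) _ Y(3)])
    qed
    then have "\<forall>\<^sub>F z in at x. defect_free n A1 a1 b1 z \<longleftrightarrow> defect_free n A2 a2 b2 z" by (auto simp: eventually_at_filter elim: eventually_mono)
    then show ?thesis by (rule eventually_cong) auto
  qed
  have "P1 0"
  proof -
    obtain x where "x \<in> U" "A x \<noteq> 0" using nz by blast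
    moreover have "A holomorphic_on U" using coh by (simp add: coeffs_holomorphic_def)
    ultimately have "\<forall>\<^sub>F z in at (\<gamma> 0). A z \<noteq> 0 \<and> z \<in> U" using eventually_nonzero[OF U] \<gamma>0 by blast
    then have "\<forall>\<^sub>F z in at (\<gamma> 0). defect_free n A a b z"
      by (rule eventually_mono) (use linearizable_imp_defect_free[OF n U coh nz lin] in blast)
    then show ?thesis unfolding P1_def using df_cong[OF start] by blast
  qed
  moreover have "\<forall>\<^sub>F s in at t within {0..1}. P1 s \<longleftrightarrow> P1 t" if t: "t \<in> {0..1}" for t
  proof -
    obtain \<rho> where \<rho>: "\<rho> > 0" "coeffs_holomorphic n (CA t) (Ca t) (Cb t) (Cc t) (ball (\<gamma> t) \<rho>)"
      using eventually_happens[OF eventually_conj[OF pos hol[OF t]]] by (auto simp: trivial_limit_at_right_real)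
    have "\<forall>\<^sub>F s in at t within {0..1}. \<gamma> s \<in> ball (\<gamma> t) \<rho>"
      by (rule topological_tendstoD[OF cont[OF t] open_ball]) (use \<rho> in simp)
    then show ?thesis using near[OF t]
    proof eventually_elim
      case (elim s)
      have ct: "\<gamma> t \<in> ball (\<gamma> t) \<rho>" using \<rho> by simp
      have "P1 s \<longleftrightarrow> (\<forall>\<^sub>F z in at (\<gamma> s). defect_free n (CA t) (Ca t) (Cb t) z)"
        unfolding P1_def by (rule df_cong[OF elim(2)])
      also have "\<dots> \<longleftrightarrow> P1 t" unfolding P1_def
        using defect_free_eventually[OF n open_ball connected_ball \<rho>(2) elim(1) ct]
          defect_free_eventually[OF n open_ball connected_ball \<rho>(2) ct elim(1)] by blast
      finally show ?case .
    qed
  qed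
  ultimately have "P1 1" by (intro connected_locally_constant[of "{0..1}" 0 P1 1]) auto
  \<comment> \<open>Carried along the half-open path only, since the solution has no germ at its
    end: the continued solution satisfies the continued equation.\<close>
  define P2 where "P2 t \<longleftrightarrow> (\<forall>\<^sub>F z in nhds (\<gamma> t). quadratic_ode n (CA t) (Ca t) (Cb t) (Cc t) (F t) z)" for t
  have ode_cong: "(\<forall>\<^sub>F z in nhds x. quadratic_ode n A1 a1 b1 c1 w1 z) \<longleftrightarrow> (\<forall>\<^sub>F z in nhds x. quadratic_ode n A2 a2 b2 c2 w2 z)"
    if "\<forall>\<^sub>F z in nhds x. coeffs_eq n A1 a1 b1 c1 A2 a2 b2 c2 z" "\<forall>\<^sub>F z in nhds x. w1 z = w2 z" for x A1 a1 b1 c1 A2 a2 b2 c2 w1 w2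
  proof -
    note ev = eventually_conj[OF that]
    obtain Y where Y: "open Y" "x \<in> Y" "\<And>z. z \<in> Y \<Longrightarrow> coeffs_eq n A1 a1 b1 c1 A2 a2 b2 c2 z \<and> w1 z = w2 z"
      using ev by (auto simp: eventually_nhds)
    have "\<forall>\<^sub>F z in nhds x. quadratic_ode n A1 a1 b1 c1 w1 z \<longleftrightarrow> quadratic_ode n A2 a2 b2 c2 w2 z"
      by (rule eventually_nhds_in_open[THEN eventually_mono, OF Y(1,2)]) (rule quadratic_ode_cong[OF Y(1)], use Y in auto)
    then show ?thesis by (rule eventually_cong) auto
  qed
  have "P2 0"
  proof -
    have "\<forall>\<^sub>F z in nhds (\<gamma> 0). quadratic_ode n A a b c w z"
      by (rule eventually_nhds_in_open[THEN eventually_mono, OF S(1,2)]) (rule S(5))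
    moreover have "\<forall>\<^sub>F z in nhds (\<gamma> 0). F 0 z = w z" using F(1) by (simp add: analytic_continuation_def)
    ultimately show ?thesis unfolding P2_def using ode_cong[OF start] by blast
  qed
  moreover have "\<forall>\<^sub>F s in at t within {0..<1}. P2 s \<longleftrightarrow> P2 t" if t: "t \<in> {0..<1}" for t
  proof -
    have t': "t \<in> {0..1}" using t by auto
    have "F t analytic_on {\<gamma> t}" using F(1) t by (simp add: analytic_continuation_def)
    from eventually_happens[OF eventually_conj[OF pos eventually_conj[OF hol[OF t'] analytic_at_imp_eventually_ball[OF this]]]]
    obtain \<rho> where \<rho>: "\<rho> > 0" "coeffs_holomorphic n (CA t) (Ca t) (Cb t) (Cc t) (ball (\<gamma> t) \<rho>)" "F t holomorphic_on ball (\<gamma> t) \<rho>"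
      by (auto simp: trivial_limit_at_right_real)
    have 1: "\<forall>\<^sub>F s in at t within {0..1}. \<gamma> s \<in> ball (\<gamma> t) \<rho>"
      by (rule topological_tendstoD[OF cont[OF t'] open_ball]) (use \<rho> in simp)
    show ?thesis using filter_leD[OF le 1] filter_leD[OF le near[OF t']] germ_near[OF F(1) t]
    proof eventually_elim
      case (elim s)
      have ct: "\<gamma> t \<in> ball (\<gamma> t) \<rho>" using \<rho> by simp
      have "P2 s \<longleftrightarrow> (\<forall>\<^sub>F z in nhds (\<gamma> s). quadratic_ode n (CA t) (Ca t) (Cb t) (Cc t) (F t) z)"
        unfolding P2_def by (rule ode_cong[OF elim(2,3)])
      also have "\<dots> \<longleftrightarrow> P2 t" unfolding P2_def quadratic_ode_residual_0
        by (rule eventually_holomorphic_eq_iff[OF open_ball connected_ball holomorphic_ode_residual[OF \<rho>(2) open_ball \<rho>(3)] _ elim(1) ct]) simp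
      finally show ?case .
    qed
  qed
  ultimately have P2: "P2 t" if "t \<in> {0..<1}" for t using that by (intro connected_locally_constant[of "{0..<1}" 0 P2 t]) auto
  have one: "(1::real) \<in> {0..1}" by simp
  obtain d where d: "d > 0" "\<And>z. z \<noteq> \<gamma> 1 \<Longrightarrow> dist z (\<gamma> 1) < d \<Longrightarrow> defect_free n (CA 1) (Ca 1) (Cb 1) z"
    using \<open>P1 1\<close> unfolding P1_def eventually_at by auto
  obtain \<rho> where \<rho>: "\<rho> > 0" "coeffs_holomorphic n (CA 1) (Ca 1) (Cb 1) (Cc 1) (ball (\<gamma> 1) \<rho>)"
    using eventually_happens[OF eventually_conj[OF pos hol[OF one]]] by (auto simp: trivial_limit_at_right_real)
  define R where "R = min d \<rho>"
  have R: "R > 0" using d \<rho> by (simp add: R_def)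
  have cohR: "coeffs_holomorphic n (CA 1) (Ca 1) (Cb 1) (Cc 1) (ball (\<gamma> 1) R)"
    by (rule coeffs_holomorphic_subset[OF \<rho>(2)]) (auto simp: R_def)
  have dfR: "defect_free n (CA 1) (Ca 1) (Cb 1) z" if "z \<in> ball (\<gamma> 1) R - {\<gamma> 1}" for z
    using that d(2)[of z] by (auto simp: R_def dist_commute)
  have "\<forall>\<^sub>F s in at 1 within {0..1}. \<gamma> s \<in> ball (\<gamma> 1) (R/2)"
    by (rule topological_tendstoD[OF cont[OF one] open_ball]) (use R in simp)
  with near[OF one] have "\<forall>\<^sub>F s in at 1 within {0..1}. \<gamma> s \<in> ball (\<gamma> 1) (R/2) \<and>
      (\<forall>\<^sub>F z in nhds (\<gamma> s). coeffs_eq n (CA s) (Ca s) (Cb s) (Cc s) (CA 1) (Ca 1) (Cb 1) (Cc 1) z)"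
    by eventually_elim auto
  then obtain e where e: "e > 0" "\<And>s. s \<in> {0..1} \<Longrightarrow> s \<noteq> 1 \<Longrightarrow> dist s 1 < e \<Longrightarrow> \<gamma> s \<in> ball (\<gamma> 1) (R/2) \<and>
      (\<forall>\<^sub>F z in nhds (\<gamma> s). coeffs_eq n (CA s) (Ca s) (Cb s) (Cc s) (CA 1) (Ca 1) (Cb 1) (Cc 1) z)"
    unfolding eventually_at by metis
  \<comment> \<open>From this parameter on the coefficient germs are those of the end point and the
    path stays in the disc of radius \<open>R/2\<close>, where the quotient representation is
    available.\<close>
  define t0 where "t0 = max 0 (1 - e/2)"
  have t0: "0 \<le> t0" "t0 < 1" "\<And>t. t \<in> {t0..<1} \<Longrightarrow> dist t 1 < e" using e(1) by (auto simp: t0_def dist_real_def)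
  have near1: "\<gamma> t \<in> ball (\<gamma> 1) (R/2)" if "t \<in> {t0..1}" for t
    using e(2)[of t] t0 that R by (cases "t = 1") auto
  have c1: "\<forall>\<^sub>F z in nhds (\<gamma> t0). coeffs_eq n (CA t0) (Ca t0) (Cb t0) (Cc t0) (CA 1) (Ca 1) (Cb 1) (Cc 1) z"
    using e(2)[of t0] t0 by auto
  have "\<forall>\<^sub>F z in nhds (\<gamma> t0). F t0 z = F t0 z" by simp
  from ode_cong[OF c1 this] have "\<forall>\<^sub>F z in nhds (\<gamma> t0). quadratic_ode n (CA 1) (Ca 1) (Cb 1) (Cc 1) (F t0) z"
    using P2[of t0] t0 unfolding P2_def by simp
  moreover have "\<forall>\<^sub>F z in nhds (\<gamma> t0). z \<in> ball (\<gamma> 1) (R/2)"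
    by (rule eventually_nhds_in_open) (use near1[of t0] t0 in auto)
  ultimately have "\<forall>\<^sub>F z in nhds (\<gamma> t0). quadratic_ode n (CA 1) (Ca 1) (Cb 1) (Cc 1) (F t0) z \<and> z \<in> ball (\<gamma> 1) (R/2)"
    by (rule eventually_conj)
  then obtain Y where Y: "open Y" "\<gamma> t0 \<in> Y" "\<And>z. z \<in> Y \<Longrightarrow> quadratic_ode n (CA 1) (Ca 1) (Cb 1) (Cc 1) (F t0) z \<and> z \<in> ball (\<gamma> 1) (R/2)"
    unfolding eventually_nhds by blast
  have "F t0 analytic_on {\<gamma> t0}" using F(1) t0 by (simp add: analytic_continuation_def)
  then obtain e1 where e1: "e1 > 0" "F t0 holomorphic_on ball (\<gamma> t0) e1" by (auto simp: analytic_on_def)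
  obtain e2 where e2: "e2 > 0" "ball (\<gamma> t0) e2 \<subseteq> Y" using Y openE by blast
  define V where "V = ball (\<gamma> t0) (min e1 e2)"
  have V: "open V" "connected V" "V \<noteq> {}" "\<gamma> t0 \<in> V" "V \<subseteq> Y" "V \<subseteq> ball (\<gamma> t0) e1" using e1 e2 by (auto simp: V_def)
  obtain N H where NH: "N holomorphic_on ball (\<gamma> 1) (R/2)" "H holomorphic_on ball (\<gamma> 1) (R/2)" "\<exists>x\<in>ball (\<gamma> 1) (R/2). H x \<noteq> 0"
    "\<And>z. z \<in> V \<Longrightarrow> F t0 z * H z = N z"
    by (rule solution_is_quotient[OF n cohR dfR, of "R/2" V "F t0"])
      (use R V Y e1(2) in \<open>auto intro: holomorphic_on_subset\<close>)
  show "singularity_is_pole \<gamma> F"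
  proof (rule quotient_singularity_is_pole[OF F \<gamma> t0(1,2) _ near1 NH(1,2,3)])
    show "\<forall>\<^sub>F z in nhds (\<gamma> t0). F t0 z * H z = N z"
      by (rule eventually_nhds_in_open[THEN eventually_mono, OF V(1,4)]) (rule NH(4))
  qed (use R in auto)
qed

section \<open>Solutions near a simple pole\<close>

text \<open>The image of the half strip under the exponential is the punctured unit disc. Its height
  8 lies between 2 pi and 4 pi, so points over the same value differ by at most one period, and an
  overlap remains on which periodicity can be tested.\<close>

definition strip :: "complex set" where
  "strip = {s. Re s < 0 \<and> \<bar>Im s\<bar> < 4}"

lemma strip_eq: "strip = {s. Re s < 0} \<inter> ({s. Im s < 4} \<inter> {s. Im s > - 4})"
  by (auto simp: strip_def abs_less_iff)

lemma open_strip: "open strip"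
  unfolding strip_eq by (intro open_Int open_halfspace_Re_lt open_halfspace_Im_lt open_halfspace_Im_gt)

lemma convex_strip: "convex strip"
  unfolding strip_eq by (intro convex_Int convex_halfspace_Re_lt convex_halfspace_Im_lt convex_halfspace_Im_gt)

section \<open>First-order equations on the half strip\<close>

text \<open>The integral of exp (b x), with either sign of \<open>b\<close>; integrating from the
  left end is used for b > 0, integrating away from -1 for b < 0.\<close>

lemma strip_horizontal_bound:
  assumes G: "\<And>s. s \<in> strip \<Longrightarrow> (G has_field_derivative G' s) (at s)"
    and bd: "\<And>s. s \<in> strip \<Longrightarrow> norm (G' s) \<le> C * exp (b * Re s)" and "b \<noteq> 0"
    and x: "x1 \<le> x2" "x2 < 0" "\<bar>y\<bar> < 4"
  shows "norm (G (Complex x2 y) - G (Complex x1 y)) \<le> C * (exp (b * x2) - exp (b * x1)) / b"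
proof (cases "x1 = x2")
  case False
  have in_strip: "Complex x y \<in> strip" if "x \<le> x2" for x using that x by (simp add: strip_def)
  have p: "((\<lambda>x. Complex x y) has_vector_derivative 1) (at x)" for x
  proof -
    have "((\<lambda>x. of_real x + \<i> * of_real y) has_vector_derivative 1) (at x)"
      by (auto intro!: derivative_eq_intros)
    then show ?thesis by (simp add: Complex_eq)
  qed
  have der: "((G \<circ> (\<lambda>x. Complex x y)) has_vector_derivative 1 * G' (Complex x y)) (at x)" if "x \<le> x2" for x
    by (rule field_vector_diff_chain_at[OF p G[OF in_strip[OF that]]])
  have "norm ((G \<circ> (\<lambda>x. Complex x y)) x2 - (G \<circ> (\<lambda>x. Complex x y)) x1) \<le> C * exp (b * x2) / b - C * exp (b * x1) / b"
  proof (rule differentiable_bound_general)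
    show "x1 < x2" using False x by simp
    show "continuous_on {x1..x2} (G \<circ> (\<lambda>x. Complex x y))"
    proof (rule continuous_at_imp_continuous_on, rule ballI)
      fix x assume "x \<in> {x1..x2}"
      then show "isCont (G \<circ> (\<lambda>x. Complex x y)) x" using has_vector_derivative_continuous[OF der, of x] by simp
    qed
    show "continuous_on {x1..x2} (\<lambda>x. C * exp (b * x) / b)" using \<open>b \<noteq> 0\<close> by (intro continuous_intros) auto
    fix x assume x: "x1 < x" "x < x2"
    show "((G \<circ> (\<lambda>x. Complex x y)) has_vector_derivative 1 * G' (Complex x y)) (at x)" using der x by simp
    have "((\<lambda>x. C * exp (b * x) / b) has_real_derivative C * exp (b * x)) (at x)"
      using \<open>b \<noteq> 0\<close> by (auto intro!: derivative_eq_intros)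
    then show "((\<lambda>x. C * exp (b * x) / b) has_vector_derivative C * exp (b * x)) (at x)"
      by (simp add: has_real_derivative_iff_has_vector_derivative)
    show "norm (1 * G' (Complex x y)) \<le> C * exp (b * x)" using bd[OF in_strip, of x] x by simp
  qed
  then show ?thesis by (simp add: diff_divide_distrib right_diff_distrib)
qed simp

lemma strip_vertical_bound:
  assumes G: "\<And>s. s \<in> strip \<Longrightarrow> (G has_field_derivative G' s) (at s)"
    and bd: "\<And>s. s \<in> strip \<Longrightarrow> norm (G' s) \<le> C * exp (b * Re s)" and x: "x < 0" "\<bar>y\<bar> < 4"
  shows "norm (G (Complex x y) - G (Complex x 0)) \<le> 4 * (C * exp (b * x))"
proof -
  have C: "0 \<le> C * exp (b * x)" using bd[of "Complex x 0"] x by (simp add: strip_def) (meson norm_ge_zero order_trans)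
  have "norm (G (Complex x y) - G (Complex x 0)) \<le> (C * exp (b * x)) * norm (Complex x y - Complex x 0)"
  proof (rule field_differentiable_bound[where S = "strip \<inter> ({s. Re s \<le> x} \<inter> {s. Re s \<ge> x})" and f' = G'])
    show "convex (strip \<inter> ({s. Re s \<le> x} \<inter> {s. Re s \<ge> x}))"
      by (intro convex_Int convex_strip convex_halfspace_Re_le convex_halfspace_Re_ge)
    have *: "Re s = x" if "s \<in> strip \<inter> ({s. Re s \<le> x} \<inter> {s. Re s \<ge> x})" for s using that by auto
    show "norm (G' s) \<le> C * exp (b * x)" if "s \<in> strip \<inter> ({s. Re s \<le> x} \<inter> {s. Re s \<ge> x})" for s
      using bd[of s] *[OF that] that by auto
  qed (use x G bd in \<open>auto intro: has_field_derivative_at_within simp: strip_def\<close>)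
  also have "norm (Complex x y - Complex x 0) = \<bar>y\<bar>" by (simp add: cmod_def)
  also have "(C * exp (b * x)) * \<bar>y\<bar> \<le> (C * exp (b * x)) * 4" using C x by (intro mult_left_mono) auto
  finally show ?thesis by simp
qed

lemma integrating_factor:
  fixes a :: real
  assumes "(H has_field_derivative exp (- of_real a * s) * h s) (at s)"
  shows "((\<lambda>s. exp (of_real a * s) * (H s - c)) has_field_derivative of_real a * (exp (of_real a * s) * (H s - c)) + h s) (at s)"
proof -
  have D: "((\<lambda>s. exp (of_real a * s) * (H s - c)) has_field_derivative
     exp (of_real a * s) * of_real a * (H s - c) + exp (of_real a * s) * (exp (- of_real a * s) * h s)) (at s)"
    using assms by (auto intro!: derivative_eq_intros)
  have e: "exp (of_real a * s) * (exp (- of_real a * s) * h s) = h s"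
    by (simp add: mult.assoc[symmetric] exp_add[symmetric])
  have f: "exp (of_real a * s) * of_real a * (H s - c) + exp (of_real a * s) * (exp (- of_real a * s) * h s) = of_real a * (exp (of_real a * s) * (H s - c)) + h s"
    unfolding e by (simp add: mult_ac)
  show ?thesis using D unfolding f .
qed

text \<open>For \<open>a > 0\<close> the solution is the one vanishing at \<open>-1\<close>; for \<open>a < 0\<close> the integral starts at
  \<open>-\<infinity>\<close>, which selects the only bounded solution.\<close>
lemma strip_solve_bounded:
  assumes "a \<noteq> (0::real)"
  shows "\<exists>\<kappa>\<ge>0. \<forall>h C. h holomorphic_on strip \<longrightarrow> (\<forall>s\<in>strip. norm (h s) \<le> C) \<longrightarrow>
    (\<exists>y. (\<forall>s\<in>strip. (y has_field_derivative of_real a * y s + h s) (at s) \<and> norm (y s) \<le> \<kappa> * C))"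
proof -
  have prim: "\<exists>H. H (-1) = 0 \<and> (\<forall>s\<in>strip. (H has_field_derivative exp (- of_real a * s) * h s) (at s))"
    if h: "h holomorphic_on strip" for h
  proof -
    have "(\<lambda>s. exp (- of_real a * s) * h s) holomorphic_on strip" using h by (intro holomorphic_intros)
    from holomorphic_convex_primitive'[OF convex_strip open_strip this] obtain g where
      g: "\<And>s. s \<in> strip \<Longrightarrow> (g has_field_derivative exp (- of_real a * s) * h s) (at s within strip)" by blast
    have "(g has_field_derivative exp (- of_real a * s) * h s) (at s)" if "s \<in> strip" for s
      using g[OF that] at_within_open[OF that open_strip] by simp
    then show ?thesis by (intro exI[of _ "\<lambda>s. g s - g (-1)"]) (auto intro!: derivative_eq_intros)
  qed
  have bH: "norm (exp (- of_real a * s) * h s) \<le> C * exp (- a * Re s)" if "norm (h s) \<le> C" for h :: "complex \<Rightarrow> complex" and C s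
    using that by (simp add: norm_mult mult.commute)
  show ?thesis
  proof (cases "a > 0")
    case True
    \<comment> \<open>The 4 comes from the vertical segment above or below -1, the
      \<open>1 / a\<close> from the horizontal one, and \<open>exp a\<close> is the size of the
      integrating factor at -1.\<close>
    define \<kappa> where "\<kappa> = (4 + 1 / a) * exp a"
    show ?thesis
    proof (intro exI[of _ \<kappa>] conjI allI impI)
      show "\<kappa> \<ge> 0" using True by (simp add: \<kappa>_def)
      fix h :: "complex \<Rightarrow> complex" and C assume h: "h holomorphic_on strip" "\<forall>s\<in>strip. norm (h s) \<le> C"
      obtain H where H: "H (-1) = 0" "\<And>s. s \<in> strip \<Longrightarrow> (H has_field_derivative exp (- of_real a * s) * h s) (at s)"
        using prim[OF h(1)] by blast
      have C: "C \<ge> 0" using h(2)[rule_format, of "-1"] by (simp add: strip_def) (meson norm_ge_zero order_trans)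
      have bd: "norm (exp (- of_real a * s) * h s) \<le> C * exp (- a * Re s)" if "s \<in> strip" for s
        using bH h(2) that by blast
      have Hb: "norm (H (Complex x y)) \<le> 4 * C * exp a + C * exp a / a * max 1 (exp (- a * (x + 1)))" if xy: "x < 0" "\<bar>y\<bar> < 4" for x y
      proof -
        have m1: "Complex (- 1) 0 = - 1" by (simp add: complex_eq_iff)
        have "norm (H (Complex (-1) y) - H (Complex (-1) 0)) \<le> 4 * (C * exp (- a * - 1))"
          by (rule strip_vertical_bound[OF H(2) bd]) (use xy in auto)
        then have v: "norm (H (Complex (-1) y)) \<le> 4 * C * exp a" using H(1) m1 by simp
        have hz: "norm (H (Complex x y) - H (Complex (-1) y)) \<le> C * exp a / a * max 1 (exp (- a * (x + 1)))"
        proof (cases "x \<le> -1")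
          case le: True
          have "norm (H (Complex (-1) y) - H (Complex x y)) \<le> C * (exp (- a * - 1) - exp (- a * x)) / (- a)"
            by (rule strip_horizontal_bound[OF H(2) bd]) (use xy le True in auto)
          also have "\<dots> = C * (exp (- a * x) - exp a) / a" using True by (simp add: field_simps)
          also have "\<dots> \<le> C * exp (- a * x) / a" using C True by (intro divide_right_mono mult_left_mono) auto
          also have "exp (- a * x) = exp a * exp (- a * (x + 1))" by (simp add: exp_add[symmetric] algebra_simps)
          also have "C * (exp a * exp (- a * (x + 1))) / a = C * exp a / a * exp (- a * (x + 1))" by simp
          also have "\<dots> \<le> C * exp a / a * max 1 (exp (- a * (x + 1)))" using C True by (intro mult_left_mono) auto
          finally show ?thesis by (simp add: norm_minus_commute)
        next
          case False
          have "norm (H (Complex x y) - H (Complex (-1) y)) \<le> C * (exp (- a * x) - exp (- a * - 1)) / (- a)"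
            by (rule strip_horizontal_bound[OF H(2) bd]) (use xy False True in auto)
          also have "\<dots> = C * (exp a - exp (- a * x)) / a" using True by (simp add: field_simps)
          also have "\<dots> \<le> C * exp a / a" using C True by (intro divide_right_mono mult_left_mono) auto
          also have "\<dots> = C * exp a / a * 1" by simp
          also have "\<dots> \<le> C * exp a / a * max 1 (exp (- a * (x + 1)))" using C True by (intro mult_left_mono) auto
          finally show ?thesis .
        qed
        show ?thesis using norm_triangle_sub[of "H (Complex x y)" "H (Complex (-1) y)"] v hz by linarith
      qed
      show "\<exists>y. \<forall>s\<in>strip. (y has_field_derivative of_real a * y s + h s) (at s) \<and> norm (y s) \<le> \<kappa> * C"
      proof (intro exI[of _ "\<lambda>s. exp (of_real a * s) * (H s - 0)"] ballI conjI)
        fix s assume s: "s \<in> strip"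
        show "((\<lambda>s. exp (of_real a * s) * (H s - 0)) has_field_derivative of_real a * (exp (of_real a * s) * (H s - 0)) + h s) (at s)"
          by (rule integrating_factor[where H = H and h = h and s = s, OF H(2)[OF s]])
        have re: "Re s < 0" "\<bar>Im s\<bar> < 4" using s by (auto simp: strip_def)
        have "norm (H s) \<le> 4 * C * exp a + C * exp a / a * max 1 (exp (- a * (Re s + 1)))" using Hb[OF re] by simp
        then have "exp (a * Re s) * norm (H s) \<le> exp (a * Re s) * (4 * C * exp a + C * exp a / a * max 1 (exp (- a * (Re s + 1))))"
          by (rule mult_left_mono) simp
        also have "\<dots> = exp (a * Re s) * (4 * C * exp a) + C * exp a / a * (exp (a * Re s) * max 1 (exp (- a * (Re s + 1))))"
          by (simp only: distrib_left mult.left_commute)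
        also have "\<dots> \<le> 1 * (4 * C * exp a) + C * exp a / a * 1"
        proof (intro add_mono mult_mono mult_left_mono)
          show e1: "exp (a * Re s) \<le> 1" using True re by (simp add: mult_nonneg_nonpos)
          have "exp (a * Re s) * exp (- a * (Re s + 1)) = exp (- a)" by (simp add: exp_add[symmetric] algebra_simps)
          then show "exp (a * Re s) * max 1 (exp (- a * (Re s + 1))) \<le> 1" using e1 True by (simp add: max_def)
        qed (use C True in auto)
        also have "\<dots> = \<kappa> * C" by (simp add: \<kappa>_def algebra_simps)
        finally show "norm (exp (of_real a * s) * (H s - 0)) \<le> \<kappa> * C" by (simp add: norm_mult)
      qed
    qed
  next
    case False
    define \<alpha> where "\<alpha> = - a"
    have \<alpha>: "\<alpha> > 0" "- a = \<alpha>" using False assms by (auto simp: \<alpha>_def)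
    show ?thesis
    proof (intro exI[of _ "1 / \<alpha>"] conjI allI impI)
      show "1 / \<alpha> \<ge> 0" using \<alpha> by simp
      fix h :: "complex \<Rightarrow> complex" and C assume h: "h holomorphic_on strip" "\<forall>s\<in>strip. norm (h s) \<le> C"
      obtain H where H: "\<And>s. s \<in> strip \<Longrightarrow> (H has_field_derivative exp (- of_real a * s) * h s) (at s)"
        using prim[OF h(1)] by blast
      have C: "C \<ge> 0" using h(2)[rule_format, of "-1"] by (simp add: strip_def) (meson norm_ge_zero order_trans)
      have bd: "norm (exp (- of_real a * s) * h s) \<le> C * exp (\<alpha> * Re s)" if "s \<in> strip" for s
        using bH[of h s C] h(2) that \<alpha>(2) by simp
      have hor: "norm (H (Complex x2 y) - H (Complex x1 y)) \<le> C * exp (\<alpha> * x2) / \<alpha>" if "x1 \<le> x2" "x2 < 0" "\<bar>y\<bar> < 4" for x1 x2 y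
      proof -
        have "norm (H (Complex x2 y) - H (Complex x1 y)) \<le> C * (exp (\<alpha> * x2) - exp (\<alpha> * x1)) / \<alpha>"
          by (rule strip_horizontal_bound[OF H bd]) (use that \<alpha> in auto)
        also have "\<dots> \<le> C * exp (\<alpha> * x2) / \<alpha>" using C \<alpha> by (intro divide_right_mono mult_left_mono) auto
        finally show ?thesis .
      qed
      \<comment> \<open>The integral from minus infinity is obtained as the limit of the primitive
        along the negative real axis.\<close>
      define u where "u k = H (Complex (- real k - 1) 0)" for k
      have lim0: "(\<lambda>k. c * exp (\<alpha> * (- real k - 1))) \<longlonglongrightarrow> 0" for c
      proof -
        have "(\<lambda>k. exp (- \<alpha>) ^ k) \<longlonglongrightarrow> 0" using \<alpha> by (intro LIMSEQ_power_zero) simp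
        then have "(\<lambda>k. c * exp (- \<alpha>) * exp (- \<alpha>) ^ k) \<longlonglongrightarrow> c * exp (- \<alpha>) * 0" by (intro tendsto_mult tendsto_const)
        moreover have "c * exp (- \<alpha>) * exp (- \<alpha>) ^ k = c * exp (\<alpha> * (- real k - 1))" for k
          by (simp add: exp_of_nat_mult[symmetric] exp_add[symmetric] algebra_simps)
        ultimately show ?thesis by simp
      qed
      have "Cauchy u"
      proof (rule metric_CauchyI)
        fix e :: real assume "e > 0"
        obtain N where N: "\<And>k. k \<ge> N \<Longrightarrow> C / \<alpha> * exp (\<alpha> * (- real k - 1)) < e"
          using order_tendstoD(2)[OF lim0 \<open>e > 0\<close>, of "C / \<alpha>"] unfolding eventually_sequentially by blast
        have uu: "dist (u k) (u l) < e" if "N \<le> k" "k \<le> l" for k l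
        proof -
          have "norm (u k - u l) \<le> C * exp (\<alpha> * (- real k - 1)) / \<alpha>" unfolding u_def by (rule hor) (use that in auto)
          then show ?thesis using N[OF that(1)] by (simp add: dist_norm)
        qed
        show "\<exists>M. \<forall>m\<ge>M. \<forall>k\<ge>M. dist (u m) (u k) < e"
          using uu by (intro exI[of _ N]) (metis dist_commute nle_le)
      qed
      then obtain c where c: "u \<longlonglongrightarrow> c" using Cauchy_convergent_iff convergent_def by blast
      \<comment> \<open>The limit taken on the real axis serves every height, because the
        oscillation of the primitive along a vertical segment tends to 0 to the left.\<close>
      have Hc: "norm (H (Complex x y) - c) \<le> C * exp (\<alpha> * x) / \<alpha>" if xy: "x < 0" "\<bar>y\<bar> < 4" for x y
      proof (rule LIMSEQ_le_const[of "\<lambda>k. C * exp (\<alpha> * x) / \<alpha> + 4 * C * exp (\<alpha> * (- real k - 1)) - (norm (H (Complex x y) - u k) - norm (H (Complex x y) - c))"])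
        have "(\<lambda>k. C * exp (\<alpha> * x) / \<alpha> + 4 * C * exp (\<alpha> * (- real k - 1)) - (norm (H (Complex x y) - u k) - norm (H (Complex x y) - c)))
          \<longlonglongrightarrow> C * exp (\<alpha> * x) / \<alpha> + 0 - (norm (H (Complex x y) - c) - norm (H (Complex x y) - c))"
          by (intro tendsto_intros c lim0)
        then show "(\<lambda>k. C * exp (\<alpha> * x) / \<alpha> + 4 * C * exp (\<alpha> * (- real k - 1)) - (norm (H (Complex x y) - u k) - norm (H (Complex x y) - c)))
          \<longlonglongrightarrow> C * exp (\<alpha> * x) / \<alpha>" by simp
        obtain N where N: "real N \<ge> - x" using real_arch_simple by blast
        show "\<exists>N. \<forall>k\<ge>N. norm (H (Complex x y) - c) \<le> C * exp (\<alpha> * x) / \<alpha> + 4 * C * exp (\<alpha> * (- real k - 1)) - (norm (H (Complex x y) - u k) - norm (H (Complex x y) - c))"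
        proof (intro exI[of _ N] allI impI)
          fix k assume k: "k \<ge> N"
          have "norm (H (Complex x y) - H (Complex (- real k - 1) y)) \<le> C * exp (\<alpha> * x) / \<alpha>"
            by (rule hor) (use xy N k in auto)
          moreover have "norm (H (Complex (- real k - 1) y) - u k) \<le> 4 * (C * exp (\<alpha> * (- real k - 1)))"
            unfolding u_def by (rule strip_vertical_bound[OF H bd]) (use xy in auto)
          ultimately have "norm (H (Complex x y) - u k) \<le> C * exp (\<alpha> * x) / \<alpha> + 4 * (C * exp (\<alpha> * (- real k - 1)))"
            using norm_triangle_ineq[of "H (Complex x y) - H (Complex (- real k - 1) y)" "H (Complex (- real k - 1) y) - u k"] by simp
          then show "norm (H (Complex x y) - c) \<le> C * exp (\<alpha> * x) / \<alpha> + 4 * C * exp (\<alpha> * (- real k - 1)) - (norm (H (Complex x y) - u k) - norm (H (Complex x y) - c))"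
            by simp
        qed
      qed
      show "\<exists>y. \<forall>s\<in>strip. (y has_field_derivative of_real a * y s + h s) (at s) \<and> norm (y s) \<le> 1 / \<alpha> * C"
      proof (intro exI[of _ "\<lambda>s. exp (of_real a * s) * (H s - c)"] ballI conjI)
        fix s assume s: "s \<in> strip"
        show "((\<lambda>s. exp (of_real a * s) * (H s - c)) has_field_derivative of_real a * (exp (of_real a * s) * (H s - c)) + h s) (at s)"
          by (rule integrating_factor[where H = H and h = h and s = s, OF H[OF s]])
        have re: "Re s < 0" "\<bar>Im s\<bar> < 4" using s by (auto simp: strip_def)
        have "exp (a * Re s) * norm (H s - c) \<le> exp (a * Re s) * (C * exp (\<alpha> * Re s) / \<alpha>)"
          using Hc[OF re] by (intro mult_left_mono) auto
        also have "\<dots> = (exp (a * Re s) * exp (\<alpha> * Re s)) * (C / \<alpha>)" by simp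
        also have "exp (a * Re s) * exp (\<alpha> * Re s) = 1" by (simp add: \<alpha>_def exp_add[symmetric])
        finally show "norm (exp (of_real a * s) * (H s - c)) \<le> 1 / \<alpha> * C" by (simp add: norm_mult)
      qed
    qed
  qed
qed

section \<open>The linearized equation at the pole\<close>

text \<open>The coefficient of t^i times the i-th derivative of \<omega> in t^(k+1) times the k-th
  derivative of 2 \<omega> / t.\<close>

definition pole_coeff :: "nat \<Rightarrow> nat \<Rightarrow> complex" where
  "pole_coeff k i = 2 * (- 1) ^ (k - i) * fact k / fact i"

definition strip_solves where
  "strip_solves n \<eta> F \<longleftrightarrow> (\<forall>k<n. \<forall>s\<in>strip. (\<eta> k has_field_derivative of_nat k * \<eta> k s + \<eta> (Suc k) s) (at s)) \<and>
       \<eta> n holomorphic_on strip \<and> (\<forall>s\<in>strip. \<eta> n s + (\<Sum>i<n. pole_coeff (n - 1) i * \<eta> i s) = F s)"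
  for \<eta> :: "nat \<Rightarrow> complex \<Rightarrow> complex" and F :: "complex \<Rightarrow> complex"

text \<open>In the variables \<open>\<eta>\<^sub>k = t\<^sup>k \<omega>\<^sup>(\<^sup>k\<^sup>)\<close>, \<open>t = exp s\<close>, this solves \<open>(\<omega>' + 2 \<omega> / t)\<^sup>(\<^sup>n\<^sup>-\<^sup>1\<^sup>) = t\<^sup>-\<^sup>n F\<close>, the
  linearization of \<open>w' = A w\<^sup>2 + u\<close>, \<open>u\<^sup>(\<^sup>n\<^sup>-\<^sup>1\<^sup>) = f\<close> at the simple pole.\<close>
lemma strip_linear_solver:
  assumes n: "n \<ge> 1"
  shows "\<exists>\<kappa>>0. \<forall>F C. F holomorphic_on strip \<longrightarrow> (\<forall>s\<in>strip. norm (F s) \<le> C) \<longrightarrow>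
    (\<exists>\<eta>. strip_solves n \<eta> F \<and> (\<forall>k\<le>n. \<forall>s\<in>strip. norm (\<eta> k s) \<le> \<kappa> * C))"
proof -
  have "\<exists>\<kappa>. a \<noteq> 0 \<longrightarrow> \<kappa> \<ge> 0 \<and> (\<forall>h C. h holomorphic_on strip \<longrightarrow> (\<forall>s\<in>strip. norm (h s) \<le> C) \<longrightarrow>
    (\<exists>y. (\<forall>s\<in>strip. (y has_field_derivative of_real a * y s + h s) (at s) \<and> norm (y s) \<le> \<kappa> * C)))" for a :: real
    using strip_solve_bounded[of a] by blast
  then have "\<forall>a::real. \<exists>\<kappa>. a \<noteq> 0 \<longrightarrow> \<kappa> \<ge> 0 \<and> (\<forall>h C. h holomorphic_on strip \<longrightarrow> (\<forall>s\<in>strip. norm (h s) \<le> C) \<longrightarrow>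
    (\<exists>y. (\<forall>s\<in>strip. (y has_field_derivative of_real a * y s + h s) (at s) \<and> norm (y s) \<le> \<kappa> * C)))" by blast
  from choice[OF this] obtain kap where kap: "\<forall>a::real. a \<noteq> 0 \<longrightarrow> kap a \<ge> 0 \<and> (\<forall>h C. h holomorphic_on strip \<longrightarrow> (\<forall>s\<in>strip. norm (h s) \<le> C) \<longrightarrow>
    (\<exists>y. (\<forall>s\<in>strip. (y has_field_derivative of_real a * y s + h s) (at s) \<and> norm (y s) \<le> kap a * C)))" by (elim exE)
  define K where "K = (1 + kap (- 2)) * (\<Prod>i<n. 1 + kap (real i))"
  have kap0: "a \<noteq> 0 \<Longrightarrow> kap a \<ge> 0" for a using kap by blast
  \<comment> \<open>With v = \<omega>' + 2 \<omega> / t, the function \<open>V i\<close> is t^(i+1)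
    times the i-th derivative of v. Starting from F at the top, each one solves a first-order
    equation with positive constant \<open>Suc i\<close>.\<close>
  have chain: "\<exists>V. V m = F \<and> (\<forall>i<m. \<forall>s\<in>strip. (V i has_field_derivative of_nat (Suc i) * V i s + V (Suc i) s) (at s)) \<and>
      (\<forall>i\<le>m. \<forall>s\<in>strip. norm (V i s) \<le> (\<Prod>i<m. 1 + kap (real (Suc i))) * C)"
    if "F holomorphic_on strip" "\<forall>s\<in>strip. norm (F s) \<le> C" for m F C
    using that
  proof (induction m arbitrary: F C)
    case 0
    then show ?case by (intro exI[of _ "\<lambda>_. F"]) auto
  next
    case (Suc m)
    have C: "C \<ge> 0" using Suc.prems(2)[rule_format, of "-1"] by (simp add: strip_def) (meson norm_ge_zero order_trans)
    obtain y where y: "\<forall>s\<in>strip. (y has_field_derivative of_real (real (Suc m)) * y s + F s) (at s) \<and> norm (y s) \<le> kap (real (Suc m)) * C"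
      using kap[rule_format, of "real (Suc m)"] Suc.prems by (metis of_nat_eq_0_iff nat.distinct(2))
    have yh: "y holomorphic_on strip" by (rule holomorphic_on_derivI) (use y in blast)
    have k0: "kap (real (Suc m)) \<ge> 0" using kap0 by simp
    have yb: "\<forall>s\<in>strip. norm (y s) \<le> (1 + kap (real (Suc m))) * C"
    proof
      fix s assume "s \<in> strip"
      then have "norm (y s) \<le> kap (real (Suc m)) * C" using y by blast
      also have "\<dots> \<le> (1 + kap (real (Suc m))) * C" using C by (intro mult_right_mono) auto
      finally show "norm (y s) \<le> (1 + kap (real (Suc m))) * C" .
    qed
    obtain V where V: "V m = y" "\<forall>i<m. \<forall>s\<in>strip. (V i has_field_derivative of_nat (Suc i) * V i s + V (Suc i) s) (at s)"
      "\<forall>i\<le>m. \<forall>s\<in>strip. norm (V i s) \<le> (\<Prod>i<m. 1 + kap (real (Suc i))) * ((1 + kap (real (Suc m))) * C)"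
      using Suc.IH[OF yh yb] by blast
    define V' where "V' = V(Suc m := F)"
    have P1: "(\<Prod>i<Suc m. 1 + kap (real (Suc i))) \<ge> 1" using kap0 by (intro prod_ge_1) simp
    show ?case
    proof (intro exI[of _ V'] conjI allI impI ballI)
      show "V' (Suc m) = F" by (simp add: V'_def)
      show "(V' i has_field_derivative of_nat (Suc i) * V' i s + V' (Suc i) s) (at s)" if "i < Suc m" "s \<in> strip" for i s
      proof (cases "i = m")
        case True
        then show ?thesis using y that V(1) by (simp add: V'_def del: of_nat_Suc)
      next
        case False
        then have "i < m" using that by simp
        then show ?thesis using V(2) that by (simp add: V'_def del: of_nat_Suc)
      qed
      show "norm (V' i s) \<le> (\<Prod>i<Suc m. 1 + kap (real (Suc i))) * C" if "i \<le> Suc m" "s \<in> strip" for i s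
      proof (cases "i = Suc m")
        case True
        then have "norm (V' i s) \<le> 1 * C" using Suc.prems(2) that by (simp add: V'_def)
        also have "\<dots> \<le> (\<Prod>i<Suc m. 1 + kap (real (Suc i))) * C" using P1 C by (intro mult_right_mono) auto
        finally show ?thesis .
      next
        case False
        then have "i \<le> m" using that by simp
        then show ?thesis using V(3)[rule_format, of i s] that by (simp add: V'_def mult.assoc del: of_nat_Suc)
      qed
    qed
  qed
  define P where "P = (\<Prod>i<n - 1. 1 + kap (real (Suc i)))"
  have P1: "P \<ge> 1" unfolding P_def using kap0 by (intro prod_ge_1) simp
  define Q where "Q = (1 + kap (- 2)) * P"
  have Q: "Q \<ge> P" "Q \<ge> kap (-2) * P" "Q \<ge> 1" using P1 kap0[of "-2"]
    by (auto simp: Q_def algebra_simps intro: order_trans[OF P1])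
  \<comment> \<open>Growth of the recursion for \<eta> below: one step multiplies the bound by at
    most 1 + k + (k + 2).\<close>
  define B where "B k = (\<Prod>i<k. 2 * real i + 4)" for k :: nat
  have B1: "B k \<ge> 1" for k unfolding B_def by (intro prod_ge_1) auto
  show ?thesis
  proof (intro exI[of _ "B n * Q"] conjI allI impI)
    show "0 < B n * Q" using B1[of n] Q(3) by (simp add: zero_less_mult_iff)
    fix F C assume F: "F holomorphic_on strip" "\<forall>s\<in>strip. norm (F s) \<le> C"
    have C: "C \<ge> 0" using F(2)[rule_format, of "-1"] by (simp add: strip_def) (meson norm_ge_zero order_trans)
    obtain V where V: "V (n - 1) = F" "\<And>i s. i < n - 1 \<Longrightarrow> s \<in> strip \<Longrightarrow> (V i has_field_derivative of_nat (Suc i) * V i s + V (Suc i) s) (at s)"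
      "\<And>i s. i \<le> n - 1 \<Longrightarrow> s \<in> strip \<Longrightarrow> norm (V i s) \<le> P * C"
      using chain[OF F, of "n - 1"] unfolding P_def by blast
    have Vh: "V i holomorphic_on strip" if "i \<le> n - 1" for i
    proof (cases "i = n - 1")
      case False
      then have "i < n - 1" using that by simp
      show ?thesis by (rule holomorphic_on_derivI[OF V(2)[OF \<open>i < n - 1\<close>]])
    qed (use V(1) F in simp)
    have "(- 2 :: real) \<noteq> 0" by simp
    moreover have "\<forall>s\<in>strip. norm (V 0 s) \<le> P * C" using V(3)[of 0] by simp
    \<comment> \<open>From t v = t \<omega>' + 2 \<omega>: the only equation with a negative
      constant, corresponding to the homogeneous solution t^(-2), which is unbounded at the
      pole.\<close>
    ultimately obtain e where e: "\<forall>s\<in>strip. (e has_field_derivative of_real (-2) * e s + V 0 s) (at s) \<and> norm (e s) \<le> kap (-2) * (P * C)"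
      using kap[rule_format, of "-2"] Vh[of 0] by blast
    define Vm where "Vm k s = (if k = 0 then 0 else V (k - 1) s)" for k s
    \<comment> \<open>The k-th derivative of t v = t \<omega>' + 2 \<omega>, multiplied by t^k and
      solved for the highest derivative of \<omega>. Defining the \<eta>'s by it makes the last
      equation automatic; the differential relations are then proved by induction.\<close>
    define \<eta> where "\<eta> = rec_nat e (\<lambda>k h s. V k s + of_nat k * Vm k s - of_nat (k + 2) * h s)"
    have \<eta>0: "\<eta> 0 = e" and \<eta>S: "\<eta> (Suc k) s = V k s + of_nat k * Vm k s - of_nat (k + 2) * \<eta> k s" for k s
      by (simp_all add: \<eta>_def)
    have Vmd: "of_nat k * of_nat k * Vm k s + of_nat k * V k s = of_nat k * (of_nat k * Vm k s + V k s)" for k s by (simp add: algebra_simps)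
    have d: "(\<eta> k has_field_derivative of_nat k * \<eta> k s + \<eta> (Suc k) s) (at s)" if "k < n" "s \<in> strip" for k s
      using that
    proof (induction k)
      case 0
      then show ?case using e by (simp add: \<eta>0 \<eta>S Vm_def)
    next
      case (Suc k)
      have IH: "(\<eta> k has_field_derivative of_nat k * \<eta> k s + \<eta> (Suc k) s) (at s)" using Suc by simp
      have dV: "(V k has_field_derivative of_nat (Suc k) * V k s + V (Suc k) s) (at s)" using Suc.prems by (intro V(2)) auto
      have dVm: "((\<lambda>s. of_nat k * Vm k s) has_field_derivative of_nat k * (of_nat k * Vm k s + V k s)) (at s)"
      proof (cases k)
        case (Suc l)
        then have "(Vm k has_field_derivative of_nat k * Vm k s + V k s) (at s)"
          using V(2)[of l s] Suc.prems \<open>Suc k < n\<close> by (simp add: Vm_def[abs_def])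
        then show ?thesis by (rule DERIV_cmult)
      qed simp
      have D: "((\<lambda>s. V k s + of_nat k * Vm k s - of_nat (k + 2) * \<eta> k s) has_field_derivative
          (of_nat (Suc k) * V k s + V (Suc k) s) + of_nat k * (of_nat k * Vm k s + V k s) - of_nat (k + 2) * (of_nat k * \<eta> k s + \<eta> (Suc k) s)) (at s)"
        by (intro DERIV_diff DERIV_add dV dVm DERIV_cmult IH)
      have Vmk: "Vm (Suc k) s = V k s" by (simp add: Vm_def)
      have "(of_nat (Suc k) * V k s + V (Suc k) s) + of_nat k * (of_nat k * Vm k s + V k s) - of_nat (k + 2) * (of_nat k * \<eta> k s + \<eta> (Suc k) s)
        = of_nat (Suc k) * \<eta> (Suc k) s + \<eta> (Suc (Suc k)) s"
        unfolding \<eta>S[of "Suc k"] Vmk unfolding \<eta>S[of k] by (simp add: algebra_simps)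
      moreover have "\<eta> (Suc k) = (\<lambda>s. V k s + of_nat k * Vm k s - of_nat (k + 2) * \<eta> k s)" using \<eta>S by blast
      ultimately show ?case using D by simp
    qed
    have \<eta>h: "\<eta> k holomorphic_on strip" if "k \<le> n" for k
    proof (cases k)
      case 0
      then show ?thesis using d[of 0] n by (auto intro: holomorphic_on_derivI)
    next
      case (Suc l)
      have "Vm l holomorphic_on strip" using Vh[of "l - 1"] Suc that by (cases l) (auto simp: Vm_def[abs_def])
      moreover have "\<eta> l holomorphic_on strip" by (rule holomorphic_on_derivI[OF d]) (use Suc that in auto)
      moreover have "V l holomorphic_on strip" using Vh Suc that by simp
      ultimately have "(\<lambda>s. V l s + of_nat l * Vm l s - of_nat (l + 2) * \<eta> l s) holomorphic_on strip" by (intro holomorphic_intros)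
      then show ?thesis using Suc \<eta>S by (simp add: fun_eq_iff[symmetric] \<eta>S[abs_def] cong: holomorphic_cong)
    qed
    have \<eta>b: "norm (\<eta> k s) \<le> B k * (Q * C)" if "k \<le> n" "s \<in> strip" for k s
      using that
    proof (induction k)
      case 0
      have "norm (e s) \<le> kap (-2) * P * C" using e that by (simp add: mult.assoc)
      also have "\<dots> \<le> Q * C" using Q C by (intro mult_right_mono) auto
      finally show ?case by (simp add: \<eta>0 B_def)
    next
      case (Suc k)
      have PQ: "P * C \<le> B k * (Q * C)"
      proof -
        have "P * C \<le> Q * C" using Q C by (intro mult_right_mono) auto
        also have "\<dots> = 1 * (Q * C)" by simp
        also have "\<dots> \<le> B k * (Q * C)" using B1 Q C by (intro mult_right_mono) auto
        finally show ?thesis .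
      qed
      have "norm (Vm k s) \<le> P * C" using V(3)[of "k - 1" s] Suc.prems C P1 by (auto simp: Vm_def)
      then have m: "norm (of_nat k * Vm k s) \<le> real k * (B k * (Q * C))"
        using PQ by (simp add: norm_mult mult_left_mono)
      have "norm (V k s) \<le> P * C" using Suc.prems by (intro V(3)) auto
      then have "norm (V k s) \<le> B k * (Q * C)" using PQ by linarith
      moreover have "norm (of_nat (k + 2) * \<eta> k s) \<le> real (k + 2) * (B k * (Q * C))"
        unfolding norm_mult norm_of_nat using Suc by (intro mult_left_mono) auto
      ultimately have "norm (\<eta> (Suc k) s) \<le> B k * (Q * C) + real k * (B k * (Q * C)) + real (k + 2) * (B k * (Q * C))"
        unfolding \<eta>S using m norm_triangle_ineq4[of "V k s + of_nat k * Vm k s" "of_nat (k + 2) * \<eta> k s"]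
          norm_triangle_ineq[of "V k s" "of_nat k * Vm k s"] by linarith
      also have "\<dots> = (2 * real k + 3) * (B k * (Q * C))" by (simp add: algebra_simps)
      also have "\<dots> \<le> (2 * real k + 4) * (B k * (Q * C))" using B1[of k] Q C by (intro mult_right_mono) auto
      also have "\<dots> = B (Suc k) * (Q * C)" by (simp add: B_def mult_ac)
      finally show ?case .
    qed
    have Bmono: "B k \<le> B n" if "k \<le> n" for k using that
    proof (induction n)
      case (Suc m)
      show ?case
      proof (cases "k = Suc m")
        case False
        have "B k \<le> 1 * B m" using Suc False by simp
        also have "\<dots> \<le> (2 * real m + 4) * B m" using B1[of m] by (intro mult_right_mono) auto
        finally show ?thesis by (simp add: B_def mult.commute)
      qed simp
    qed (simp add: B_def)
    \<comment> \<open>This says that \<open>V k\<close> is t^(k+1) times the k-th derivative of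
      \<omega>' + 2 \<omega> / t; the induction uses that passing from k to k+1 multiplies the
      coefficients of \<open>pole_coeff\<close> by -(k+1) and adds a new one equal to 2.\<close>
    have lin: "V k s = \<eta> (Suc k) s + (\<Sum>i\<le>k. pole_coeff k i * \<eta> i s)" for k s
    proof (induction k)
      case 0
      then show ?case by (simp add: \<eta>S Vm_def pole_coeff_def)
    next
      case (Suc k)
      have pc: "pole_coeff (Suc k) (Suc k) = 2" by (simp add: pole_coeff_def del: fact_Suc)
      have "pole_coeff (Suc k) i = - (of_nat (Suc k) * pole_coeff k i)" if "i \<le> k" for i
        using that by (simp add: pole_coeff_def Suc_diff_le)
      then have "(\<Sum>i\<le>k. pole_coeff (Suc k) i * \<eta> i s) = - (of_nat (Suc k) * (\<Sum>i\<le>k. pole_coeff k i * \<eta> i s))"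
        unfolding sum_distrib_left sum_negf[symmetric] by (intro sum.cong) auto
      also have "(\<Sum>i\<le>k. pole_coeff k i * \<eta> i s) = V k s - \<eta> (Suc k) s" using Suc by simp
      finally have "(\<Sum>i\<le>Suc k. pole_coeff (Suc k) i * \<eta> i s) = - (of_nat (Suc k) * (V k s - \<eta> (Suc k) s)) + 2 * \<eta> (Suc k) s"
        by (simp add: pc del: of_nat_Suc)
      then show ?case unfolding \<eta>S[of "Suc k"] by (simp add: Vm_def algebra_simps)
    qed
    have n': "{..n - 1} = {..<n}" "Suc (n - 1) = n" using n by auto
    show "\<exists>\<eta>. strip_solves n \<eta> F \<and> (\<forall>k\<le>n. \<forall>s\<in>strip. norm (\<eta> k s) \<le> B n * Q * C)"
      unfolding strip_solves_def
    proof (intro exI[of _ \<eta>] conjI allI impI ballI)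
      show "norm (\<eta> k s) \<le> B n * Q * C" if "k \<le> n" "s \<in> strip" for k s
      proof -
        have "norm (\<eta> k s) \<le> B k * (Q * C)" by (rule \<eta>b[OF that])
        also have "\<dots> \<le> B n * (Q * C)" using Bmono[OF that(1)] Q C by (intro mult_right_mono) auto
        finally show ?thesis by (simp add: mult.assoc)
      qed
      show "\<eta> n s + (\<Sum>i<n. pole_coeff (n - 1) i * \<eta> i s) = F s" if "s \<in> strip" for s
        using lin[of "n - 1" s] V(1) n' by simp
    qed (use d \<eta>h in auto)
  qed
qed


section \<open>The nonlinear equation as a fixed point\<close>

definition quad_fun where
  "quad_fun n Q P R s x = (\<Sum>i<n. \<Sum>l<n. Q i l s * (x i * x l)) + (\<Sum>i<n. P i s * x i) + R s"
  for Q :: "nat \<Rightarrow> nat \<Rightarrow> complex \<Rightarrow> complex" and P :: "nat \<Rightarrow> complex \<Rightarrow> complex" and R :: "complex \<Rightarrow> complex" and x :: "nat \<Rightarrow> complex"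

lemma quad_fun_Lipschitz:
  assumes Q: "\<And>i l. i < n \<Longrightarrow> l < n \<Longrightarrow> norm (Q i l s) \<le> q" and P: "\<And>i. i < n \<Longrightarrow> norm (P i s) \<le> p" and "0 \<le> q"
    and x: "\<And>i. i < n \<Longrightarrow> norm (x i) \<le> \<rho>" and y: "\<And>i. i < n \<Longrightarrow> norm (y i) \<le> \<rho>"
    and d: "\<And>i. i < n \<Longrightarrow> norm (x i - y i) \<le> d" and "0 \<le> \<rho>" "0 \<le> d"
  shows "norm (quad_fun n Q P R s x - quad_fun n Q P R s y) \<le> (2 * real n * real n * q * \<rho> + real n * p) * d"
proof -
  have "quad_fun n Q P R s x - quad_fun n Q P R s y = (\<Sum>i<n. \<Sum>l<n. Q i l s * (x i * x l - y i * y l)) + (\<Sum>i<n. P i s * (x i - y i))"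
    by (simp add: quad_fun_def right_diff_distrib sum_subtractf)
  then have 0: "norm (quad_fun n Q P R s x - quad_fun n Q P R s y) \<le> norm (\<Sum>i<n. \<Sum>l<n. Q i l s * (x i * x l - y i * y l)) + norm (\<Sum>i<n. P i s * (x i - y i))"
    by (simp add: norm_triangle_ineq)
  have 1: "norm (\<Sum>i<n. \<Sum>l<n. Q i l s * (x i * x l - y i * y l)) \<le> (\<Sum>i<n. \<Sum>l<n. q * (2 * \<rho> * d))"
  proof (rule sum_norm_le, rule sum_norm_le)
    fix i l assume "i \<in> {..<n}" "l \<in> {..<n}"
    then have il: "i < n" "l < n" by auto
    have "x i * x l - y i * y l = (x i - y i) * x l + y i * (x l - y l)" by (simp add: algebra_simps)
    also have "norm \<dots> \<le> norm ((x i - y i) * x l) + norm (y i * (x l - y l))" by (rule norm_triangle_ineq)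
    also have "\<dots> \<le> d * \<rho> + \<rho> * d"
      unfolding norm_mult
      by (intro add_mono mult_mono d[OF il(1)] d[OF il(2)] x[OF il(2)] y[OF il(1)] norm_ge_zero \<open>0 \<le> \<rho>\<close> \<open>0 \<le> d\<close>)
    finally have "norm (x i * x l - y i * y l) \<le> 2 * \<rho> * d" by simp
    then show "norm (Q i l s * (x i * x l - y i * y l)) \<le> q * (2 * \<rho> * d)"
      unfolding norm_mult by (intro mult_mono Q[OF il] \<open>0 \<le> q\<close> norm_ge_zero)
  qed
  have 2: "norm (\<Sum>i<n. P i s * (x i - y i)) \<le> (\<Sum>i<n. p * d)"
  proof (rule sum_norm_le)
    fix i assume "i \<in> {..<n}"
    then have i: "i < n" by simp
    have "0 \<le> p" using P[OF i] norm_ge_zero order_trans by blast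
    then show "norm (P i s * (x i - y i)) \<le> p * d" unfolding norm_mult by (intro mult_mono P[OF i] d[OF i] norm_ge_zero)
  qed
  have "(\<Sum>i<n. \<Sum>l<n. q * (2 * \<rho> * d)) + (\<Sum>i<n. p * d) = (2 * real n * real n * q * \<rho> + real n * p) * d"
    by (simp add: algebra_simps)
  then show ?thesis using 0 1 2 by linarith
qed

text \<open>The solution operator has norm at most \<kappa>, and the first smallness condition makes
  its composition with the quadratic right-hand side halve differences on the ball of radius \<rho>.
  The second keeps the iterates, bounded by the geometric sum
  \<open>2 * \<kappa> * \<theta>\<close>, inside that ball.\<close>

lemma strip_fixed_point:
  assumes n: "n \<ge> 1" and \<kappa>: "\<kappa> > 0"
    and K: "\<forall>F C. F holomorphic_on strip \<longrightarrow> (\<forall>s\<in>strip. norm (F s) \<le> C) \<longrightarrow>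
      (\<exists>\<eta>. strip_solves n \<eta> F \<and> (\<forall>k\<le>n. \<forall>s\<in>strip. norm (\<eta> k s) \<le> \<kappa> * C))"
    and hol: "\<And>i l. i < n \<Longrightarrow> l < n \<Longrightarrow> Q i l holomorphic_on strip" "\<And>i. i < n \<Longrightarrow> P i holomorphic_on strip" "R holomorphic_on strip"
    and bd: "\<And>i l s. i < n \<Longrightarrow> l < n \<Longrightarrow> s \<in> strip \<Longrightarrow> norm (Q i l s) \<le> q" "\<And>i s. i < n \<Longrightarrow> s \<in> strip \<Longrightarrow> norm (P i s) \<le> p"
      "\<And>s. s \<in> strip \<Longrightarrow> norm (R s) \<le> \<theta>"
    and small: "\<kappa> * (2 * real n * real n * q * \<rho> + real n * p) \<le> 1 / 2" "2 * \<kappa> * \<theta> \<le> \<rho>"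
  shows "\<exists>\<eta>. (\<forall>k<n. \<forall>s\<in>strip. (\<eta> k has_field_derivative of_nat k * \<eta> k s + \<eta> (Suc k) s) (at s)) \<and>
     (\<forall>k\<le>n. \<forall>s\<in>strip. norm (\<eta> k s) \<le> 2 * \<kappa> * \<theta>) \<and>
     (\<forall>s\<in>strip. \<eta> n s + (\<Sum>i<n. pole_coeff (n - 1) i * \<eta> i s) = quad_fun n Q P R s (\<lambda>k. \<eta> k s))"
proof -
  let ?\<Phi> = "quad_fun n Q P R"
  have m1: "(-1::complex) \<in> strip" by (simp add: strip_def)
  have \<theta>0: "\<theta> \<ge> 0" using bd(3)[OF m1] norm_ge_zero order_trans by blast
  have "norm (Q 0 0 (-1)) \<le> q" using n by (intro bd(1) m1) auto
  then have q0: "q \<ge> 0" using norm_ge_zero order_trans by blast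
  have "0 \<le> 2 * \<kappa> * \<theta>" using \<kappa> \<theta>0 by simp
  then have \<rho>0: "\<rho> \<ge> 0" using small(2) by linarith
  have \<Phi>hol: "(\<lambda>s. ?\<Phi> s (\<lambda>k. \<eta> k s)) holomorphic_on strip" if "\<And>k. k < n \<Longrightarrow> \<eta> k holomorphic_on strip" for \<eta>
    unfolding quad_fun_def using that hol by (intro holomorphic_intros) auto
  \<comment> \<open>The hypothesis provides a solution for each bound C separately. The supremum of
    |F| gives one solution that obeys every admissible bound, hence an operator depending on F
    alone.\<close>
  have "\<forall>F. \<exists>\<eta>. \<forall>C. F holomorphic_on strip \<longrightarrow> (\<forall>s\<in>strip. norm (F s) \<le> C) \<longrightarrow>
      strip_solves n \<eta> F \<and> (\<forall>k\<le>n. \<forall>s\<in>strip. norm (\<eta> k s) \<le> \<kappa> * C)"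
  proof
    fix F :: "complex \<Rightarrow> complex"
    show "\<exists>\<eta>. \<forall>C. F holomorphic_on strip \<longrightarrow> (\<forall>s\<in>strip. norm (F s) \<le> C) \<longrightarrow>
      strip_solves n \<eta> F \<and> (\<forall>k\<le>n. \<forall>s\<in>strip. norm (\<eta> k s) \<le> \<kappa> * C)"
    proof (cases "F holomorphic_on strip \<and> bdd_above ((\<lambda>s. norm (F s)) ` strip)")
      case True
      define C0 where "C0 = (SUP s\<in>strip. norm (F s))"
      have "\<forall>s\<in>strip. norm (F s) \<le> C0" unfolding C0_def using True by (auto intro: cSUP_upper)
      then obtain \<eta> where \<eta>: "strip_solves n \<eta> F" "\<forall>k\<le>n. \<forall>s\<in>strip. norm (\<eta> k s) \<le> \<kappa> * C0" using K True by blast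
      have "C0 \<le> C" if "\<forall>s\<in>strip. norm (F s) \<le> C" for C unfolding C0_def using m1 that by (intro cSUP_least) auto
      then have "norm (\<eta> k s) \<le> \<kappa> * C" if "\<forall>s\<in>strip. norm (F s) \<le> C" "k \<le> n" "s \<in> strip" for C k s
        using \<eta>(2) that \<kappa> by (meson less_imp_le mult_left_mono order_trans)
      then show ?thesis using \<eta>(1) by blast
    next
      case False
      then have "\<not> (F holomorphic_on strip \<and> (\<forall>s\<in>strip. norm (F s) \<le> C))" for C
        by (auto simp: bdd_above_def)
      then show ?thesis by blast
    qed
  qed
  from choice[OF this] obtain Kop where Kop: "\<forall>F C. F holomorphic_on strip \<longrightarrow> (\<forall>s\<in>strip. norm (F s) \<le> C) \<longrightarrow>
      strip_solves n (Kop F) F \<and> (\<forall>k\<le>n. \<forall>s\<in>strip. norm (Kop F k s) \<le> \<kappa> * C)" by (elim exE)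
  \<comment> \<open>The chosen solution operator need not be linear, so it is applied to increments
    of the right-hand side only. The state keeps, next to the approximation, the right-hand side for
    which it is an exact solution.\<close>
  define step where "step = (\<lambda>(S, F). (\<lambda>k s. S k s + Kop (\<lambda>s. ?\<Phi> s (\<lambda>k. S k s) - F s) k s, \<lambda>s. ?\<Phi> s (\<lambda>k. S k s)))"
  define st where "st m = (step ^^ m) (\<lambda>k s. 0, \<lambda>s. 0)" for m
  define S where "S m = fst (st m)" for m
  define F where "F m = snd (st m)" for m
  define G where "G m s = F (Suc m) s - F m s" for m s
  define d where "d m = Kop (G m)" for m
  have st_Suc: "st (Suc m) = step (S m, F m)" for m by (simp add: st_def S_def F_def)
  have F_Suc: "F (Suc m) = (\<lambda>s. ?\<Phi> s (\<lambda>k. S m k s))" for m using st_Suc[of m] by (simp add: F_def step_def)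
  have S_Suc: "S (Suc m) k s = S m k s + d m k s" for m k s
  proof -
    have "S (Suc m) = (\<lambda>k s. S m k s + Kop (\<lambda>s. ?\<Phi> s (\<lambda>k. S m k s) - F m s) k s)" using st_Suc[of m] by (simp add: S_def step_def)
    moreover have "(\<lambda>s. ?\<Phi> s (\<lambda>k. S m k s) - F m s) = G m" by (auto simp: G_def F_Suc)
    ultimately show ?thesis by (simp add: d_def)
  qed
  have S0: "S 0 k s = 0" "F 0 s = 0" for k s by (simp_all add: S_def F_def st_def)
  \<comment> \<open>The right-hand side increments halve at each step; the bound for
    \<open>S m\<close> is the partial sum of the corresponding geometric series.\<close>
  have inv: "(\<forall>k\<le>n. S m k holomorphic_on strip) \<and> F m holomorphic_on strip \<and> strip_solves n (S m) (F m) \<and>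
      (\<forall>k\<le>n. \<forall>s\<in>strip. norm (S m k s) \<le> 2 * \<kappa> * \<theta> * (1 - (1/2) ^ m)) \<and> G m holomorphic_on strip \<and> (\<forall>s\<in>strip. norm (G m s) \<le> \<theta> * (1/2) ^ m)" for m
  proof (induction m)
    case 0
    have S00: "S 0 = (\<lambda>k s. 0)" "F 0 = (\<lambda>s. 0)" using S0 by (auto simp: fun_eq_iff)
    have "G 0 s = R s" for s by (simp add: G_def F_Suc S00 quad_fun_def)
    then have "G 0 = R" by auto
    then show ?case using hol(3) bd(3) by (auto simp: S00 strip_solves_def)
  next
    case (Suc m)
    have sol: "strip_solves n (d m) (G m)" and db: "\<forall>k\<le>n. \<forall>s\<in>strip. norm (d m k s) \<le> \<kappa> * (\<theta> * (1/2) ^ m)"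
      using Kop[rule_format, of "G m" "\<theta> * (1/2) ^ m"] Suc by (auto simp: d_def)
    have dh: "d m k holomorphic_on strip" if "k \<le> n" for k
    proof (cases "k = n")
      case False
      then have "\<forall>s\<in>strip. (d m k has_field_derivative of_nat k * d m k s + d m (Suc k) s) (at s)" using sol that by (auto simp: strip_solves_def)
      then show ?thesis by (intro holomorphic_on_derivI) blast
    qed (use sol in \<open>simp add: strip_solves_def\<close>)
    have SS: "S (Suc m) k = (\<lambda>s. S m k s + d m k s)" for k using S_Suc by auto
    have Sh: "S (Suc m) k holomorphic_on strip" if "k \<le> n" for k unfolding SS using Suc dh that by (intro holomorphic_intros) auto
    have Fh: "F (Suc j) holomorphic_on strip" if "\<forall>k\<le>n. S j k holomorphic_on strip" for j
      unfolding F_Suc using that by (intro \<Phi>hol) auto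
    have Fm: "F (Suc m) holomorphic_on strip" using Suc by (intro Fh) auto
    have Fm2: "F (Suc (Suc m)) holomorphic_on strip" using Sh by (intro Fh) auto
    have sol2: "strip_solves n (S (Suc m)) (F (Suc m))"
      unfolding strip_solves_def
    proof (intro conjI allI impI ballI)
      fix s assume s: "s \<in> strip"
      show "(S (Suc m) k has_field_derivative of_nat k * S (Suc m) k s + S (Suc m) (Suc k) s) (at s)" if "k < n" for k
      proof -
        have "(S m k has_field_derivative of_nat k * S m k s + S m (Suc k) s) (at s)" "(d m k has_field_derivative of_nat k * d m k s + d m (Suc k) s) (at s)"
          using Suc sol s that by (auto simp: strip_solves_def)
        from DERIV_add[OF this] show ?thesis unfolding SS by (simp add: algebra_simps)
      qed
      have "S m n s + (\<Sum>i<n. pole_coeff (n - 1) i * S m i s) = F m s" "d m n s + (\<Sum>i<n. pole_coeff (n - 1) i * d m i s) = G m s"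
        using Suc sol s by (auto simp: strip_solves_def)
      moreover have "S (Suc m) n s + (\<Sum>i<n. pole_coeff (n - 1) i * S (Suc m) i s) =
        (S m n s + (\<Sum>i<n. pole_coeff (n - 1) i * S m i s)) + (d m n s + (\<Sum>i<n. pole_coeff (n - 1) i * d m i s))"
        unfolding SS by (simp add: distrib_left sum.distrib)
      ultimately show "S (Suc m) n s + (\<Sum>i<n. pole_coeff (n - 1) i * S (Suc m) i s) = F (Suc m) s"
        by (simp add: G_def)
    qed (use Sh in simp)
    have Sb: "norm (S (Suc m) k s) \<le> 2 * \<kappa> * \<theta> * (1 - (1/2) ^ Suc m)" if "k \<le> n" "s \<in> strip" for k s
    proof -
      have "norm (S (Suc m) k s) \<le> norm (S m k s) + norm (d m k s)" unfolding SS by (rule norm_triangle_ineq)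
      also have "\<dots> \<le> 2 * \<kappa> * \<theta> * (1 - (1/2) ^ m) + \<kappa> * (\<theta> * (1/2) ^ m)" using Suc db that by (intro add_mono) auto
      also have "\<dots> = 2 * \<kappa> * \<theta> * (1 - (1/2) ^ Suc m)" by (simp add: algebra_simps)
      finally show ?thesis .
    qed
    have le\<rho>: "2 * \<kappa> * \<theta> * (1 - (1/2) ^ j) \<le> \<rho>" for j :: nat
    proof -
      have "2 * \<kappa> * \<theta> * (1 - (1/2) ^ j) \<le> 2 * \<kappa> * \<theta> * 1" using \<kappa> \<theta>0 by (intro mult_left_mono) auto
      then show ?thesis using small(2) by simp
    qed
    have Gb: "norm (G (Suc m) s) \<le> \<theta> * (1/2) ^ Suc m" if s: "s \<in> strip" for s
    proof -
      have "G (Suc m) s = ?\<Phi> s (\<lambda>k. S (Suc m) k s) - ?\<Phi> s (\<lambda>k. S m k s)" by (simp add: G_def F_Suc)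
      also have "norm \<dots> \<le> (2 * real n * real n * q * \<rho> + real n * p) * (\<kappa> * (\<theta> * (1/2) ^ m))"
      proof (rule quad_fun_Lipschitz)
        show "norm (S (Suc m) i s) \<le> \<rho>" if "i < n" for i using Sb[of i s] le\<rho>[of "Suc m"] that s by simp
        show "norm (S m i s) \<le> \<rho>" if "i < n" for i
          using Suc le\<rho>[of m] that s by (meson less_imp_le order_trans)
        show "norm (S (Suc m) i s - S m i s) \<le> \<kappa> * (\<theta> * (1/2) ^ m)" if "i < n" for i unfolding SS using db that s by simp
      qed (use bd s q0 \<rho>0 \<kappa> \<theta>0 in auto)
      also have "\<dots> = (\<kappa> * (2 * real n * real n * q * \<rho> + real n * p)) * (\<theta> * (1/2) ^ m)" by (simp add: mult_ac)
      also have "\<dots> \<le> 1 / 2 * (\<theta> * (1/2) ^ m)" using small(1) \<theta>0 by (intro mult_right_mono) auto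
      finally show ?thesis by simp
    qed
    have "G (Suc m) holomorphic_on strip" unfolding G_def[abs_def] using Fm Fm2 by (intro holomorphic_intros)
    then show ?case using Sh Fm sol2 Sb Gb by blast
  qed
  have dsol: "strip_solves n (d m) (G m)" and db: "k \<le> n \<Longrightarrow> s \<in> strip \<Longrightarrow> norm (d m k s) \<le> \<kappa> * \<theta> * (1/2) ^ m" for m k s
    using Kop[rule_format, of "G m" "\<theta> * (1/2) ^ m"] inv[of m] by (auto simp: d_def mult.assoc)
  define g where "g k s = (\<Sum>m. d m k s)" for k s
  have geo: "summable (\<lambda>m. \<kappa> * \<theta> * (1/2) ^ m)" by (intro summable_mult) simp
  have dsums: "(\<lambda>m. d m k s) sums g k s" if "k \<le> n" "s \<in> strip" for k s
    unfolding g_def using db[OF that] by (intro summable_sums summable_comparison_test'[OF geo]) auto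
  have Ssum: "S m k s = (\<Sum>i<m. d i k s)" for m k s
    by (induction m) (simp_all add: S0 S_Suc)
  have Slim: "(\<lambda>m. S m k s) \<longlonglongrightarrow> g k s" if "k \<le> n" "s \<in> strip" for k s
    using dsums[OF that] unfolding Ssum sums_def .
  have gder: "(g k has_field_derivative of_nat k * g k s + g (Suc k) s) (at s)" if k: "k < n" and s: "s \<in> strip" for k s
  proof -
    have "\<exists>g0 g0'. \<forall>z\<in>strip. ((\<lambda>m. d m k z) sums g0 z) \<and> ((\<lambda>m. of_nat k * d m k z + d m (Suc k) z) sums g0' z) \<and> (g0 has_field_derivative g0' z) (at z)"
    proof (rule series_and_derivative_comparison_complex[OF open_strip])
      show "(d m k has_field_derivative of_nat k * d m k z + d m (Suc k) z) (at z)" if "z \<in> strip" for m z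
        using dsol[of m] k that by (simp add: strip_solves_def)
      fix z assume "z \<in> strip"
      show "\<exists>dd (h::nat \<Rightarrow> complex). 0 < dd \<and> summable h \<and> range h \<subseteq> \<real>\<^sub>\<ge>\<^sub>0 \<and> (\<forall>\<^sub>F m in sequentially. \<forall>y\<in>ball z dd \<inter> strip. norm (d m k y) \<le> norm (h m))"
      proof (intro exI[of _ 1] exI[of _ "\<lambda>m. complex_of_real (\<kappa> * \<theta> * (1/2) ^ m)"] conjI)
        show "summable (\<lambda>m. complex_of_real (\<kappa> * \<theta> * (1/2) ^ m))" using geo by (rule summable_of_real)
        show "range (\<lambda>m. complex_of_real (\<kappa> * \<theta> * (1/2) ^ m)) \<subseteq> \<real>\<^sub>\<ge>\<^sub>0" using \<kappa> \<theta>0 by (auto simp del: of_real_mult of_real_power)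
        have "norm (complex_of_real (\<kappa> * \<theta> * (1/2) ^ m)) = \<kappa> * \<theta> * (1/2) ^ m" for m unfolding norm_of_real using \<kappa> \<theta>0 by simp
        then show "\<forall>\<^sub>F m in sequentially. \<forall>y\<in>ball z 1 \<inter> strip. norm (d m k y) \<le> norm (complex_of_real (\<kappa> * \<theta> * (1/2) ^ m))"
          using db[of k] k by (intro always_eventually allI ballI) simp
      qed simp
    qed
    then obtain g0 g0' where g0: "\<forall>z\<in>strip. ((\<lambda>m. d m k z) sums g0 z) \<and> ((\<lambda>m. of_nat k * d m k z + d m (Suc k) z) sums g0' z) \<and> (g0 has_field_derivative g0' z) (at z)"
      by (elim exE)
    have eq: "g0 z = g k z" if "z \<in> strip" for z using g0 that dsums[of k z] k sums_unique2 by (metis less_imp_le)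
    have "(\<lambda>m. of_nat k * d m k s + d m (Suc k) s) sums (of_nat k * g k s + g (Suc k) s)"
      using k s by (intro sums_add sums_mult dsums) auto
    then have "g0' s = of_nat k * g k s + g (Suc k) s" using g0 s sums_unique2 by blast
    then have "(g0 has_field_derivative of_nat k * g k s + g (Suc k) s) (at s)" using g0 s by auto
    then show ?thesis by (rule has_field_derivative_transform_within_open[OF _ open_strip s eq])
  qed
  have gb: "norm (g k s) \<le> 2 * \<kappa> * \<theta>" if "k \<le> n" "s \<in> strip" for k s
  proof (rule LIMSEQ_le_const2[OF tendsto_norm[OF Slim[OF that]]], intro exI allI impI)
    fix m
    have "norm (S m k s) \<le> 2 * \<kappa> * \<theta> * (1 - (1/2) ^ m)" using inv[of m] that by blast
    also have "\<dots> \<le> 2 * \<kappa> * \<theta> * 1" using \<kappa> \<theta>0 by (intro mult_left_mono) auto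
    finally show "norm (S m k s) \<le> 2 * \<kappa> * \<theta>" by simp
  qed
  have eqn: "g n s + (\<Sum>i<n. pole_coeff (n - 1) i * g i s) = ?\<Phi> s (\<lambda>k. g k s)" if s: "s \<in> strip" for s
  proof -
    have "(\<lambda>m. S (Suc m) n s + (\<Sum>i<n. pole_coeff (n - 1) i * S (Suc m) i s)) \<longlonglongrightarrow> g n s + (\<Sum>i<n. pole_coeff (n - 1) i * g i s)"
      using s by (intro tendsto_intros LIMSEQ_Suc Slim) auto
    moreover have "S (Suc m) n s + (\<Sum>i<n. pole_coeff (n - 1) i * S (Suc m) i s) = ?\<Phi> s (\<lambda>k. S m k s)" for m
      using inv[of "Suc m"] s by (simp add: strip_solves_def F_Suc)
    moreover have "(\<lambda>m. ?\<Phi> s (\<lambda>k. S m k s)) \<longlonglongrightarrow> ?\<Phi> s (\<lambda>k. g k s)"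
      unfolding quad_fun_def using s by (intro tendsto_intros Slim) auto
    ultimately show ?thesis using LIMSEQ_unique by fastforce
  qed
  show ?thesis using gder gb eqn by blast
qed

section \<open>Exact solutions of the limiting equation\<close>

definition ffact :: "complex \<Rightarrow> nat \<Rightarrow> complex" where
  "ffact x m = (\<Prod>i<m. x - of_nat i)"

lemma ffact_Suc: "ffact x (Suc m) = ffact x m * (x - of_nat m)"
  by (simp add: ffact_def)

lemma ffact_Suc': "ffact x (Suc m) = x * ffact (x - 1) m"
  unfolding ffact_def by (subst prod.lessThan_Suc_shift) (simp add: algebra_simps)

lemma ffact_eq_0: "j < m \<Longrightarrow> ffact (of_nat j) m = 0"
  unfolding ffact_def by (rule prod_zero) auto

text \<open>t^(k+1) times the k-th derivative of - 1 / (A0 t) + g t^j at t = exp s.\<close>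

definition lead :: "complex \<Rightarrow> complex \<Rightarrow> nat \<Rightarrow> nat \<Rightarrow> complex \<Rightarrow> complex" where
  "lead A0 g j k s = - ((- 1) ^ k * fact k / A0) + g * ffact (of_nat j) k * exp s ^ (j + 1)"

lemma lead_deriv:
  "(lead A0 g j k has_field_derivative of_nat (Suc k) * lead A0 g j k s + lead A0 g j (Suc k) s) (at s)"
proof -
  have "((\<lambda>s::complex. exp s ^ Suc j) has_field_derivative (1 + of_nat j) * (exp s * exp s ^ j)) (at s)"
    by (rule DERIV_power_Suc[OF DERIV_exp])
  then have "((\<lambda>s::complex. - ((- 1) ^ k * fact k / A0) + g * ffact (of_nat j) k * exp s ^ Suc j) has_field_derivative
      0 + g * ffact (of_nat j) k * ((1 + of_nat j) * (exp s * exp s ^ j))) (at s)"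
    by (intro DERIV_add DERIV_const DERIV_cmult)
  then have "(lead A0 g j k has_field_derivative 0 + g * ffact (of_nat j) k * ((1 + of_nat j) * (exp s * exp s ^ j))) (at s)"
    unfolding lead_def[abs_def] by simp
  moreover have "0 + g * ffact (of_nat j) k * ((1 + of_nat j) * (exp s * exp s ^ j)) = of_nat (Suc k) * lead A0 g j k s + lead A0 g j (Suc k) s"
  proof -
    define p where "p = (- 1) ^ k * fact k / A0"
    have "(- 1) ^ Suc k * fact (Suc k) / A0 = - (of_nat (Suc k) * p)" by (simp add: p_def)
    then show ?thesis unfolding lead_def p_def[symmetric] ffact_Suc by (simp add: algebra_simps)
  qed
  ultimately show ?thesis by simp
qed

text \<open>The Leibniz rule for t^(-1) t^x = t^(x-1), with powers of t removed.\<close>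

lemma ffact_convolution:
  "(\<Sum>i\<le>m. of_nat (m choose i) * ((- 1) ^ i * fact i) * ffact x (m - i)) = ffact (x - 1) m"
proof (induction m)
  case 0
  then show ?case by (simp add: ffact_def)
next
  case (Suc m)
  have c: "of_nat (Suc m choose Suc i) * fact (Suc i) = of_nat (Suc m) * (of_nat (m choose i) * (fact i :: complex))" for i
  proof -
    have "Suc i * (Suc m choose Suc i) = Suc m * (m choose i)" by (simp only: Suc_times_binomial_eq mult.commute)
    then have "of_nat (Suc i * (Suc m choose Suc i)) = (of_nat (Suc m * (m choose i)) :: complex)" by (rule arg_cong)
    then have e: "of_nat (Suc i) * of_nat (Suc m choose Suc i) = (of_nat (Suc m) * of_nat (m choose i) :: complex)" by (simp only: of_nat_mult)
    have "of_nat (Suc m choose Suc i) * fact (Suc i) = (of_nat (Suc i) * of_nat (Suc m choose Suc i)) * (fact i :: complex)"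
      by (simp only: fact_Suc of_nat_mult mult_ac)
    then show ?thesis unfolding e by (simp only: mult.assoc)
  qed
  have "(\<Sum>i\<le>Suc m. of_nat (Suc m choose i) * ((- 1) ^ i * fact i) * ffact x (Suc m - i))
    = ffact x (Suc m) + (\<Sum>i\<le>m. of_nat (Suc m choose Suc i) * ((- 1) ^ Suc i * fact (Suc i)) * ffact x (m - i))"
    by (subst sum.atMost_Suc_shift) simp
  also have "(\<Sum>i\<le>m. of_nat (Suc m choose Suc i) * ((- 1) ^ Suc i * fact (Suc i)) * ffact x (m - i))
    = (\<Sum>i\<le>m. - of_nat (Suc m) * (of_nat (m choose i) * ((- 1) ^ i * fact i) * ffact x (m - i)))"
  proof (intro sum.cong refl)
    fix i
    have "of_nat (Suc m choose Suc i) * ((- 1) ^ Suc i * fact (Suc i)) * ffact x (m - i) = - ((of_nat (Suc m choose Suc i) * fact (Suc i)) * ((- 1) ^ i * ffact x (m - i)))"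
      by (simp only: power_Suc mult_ac) simp
    also have "\<dots> = - of_nat (Suc m) * (of_nat (m choose i) * ((- 1) ^ i * fact i) * ffact x (m - i))"
      unfolding c by (simp only: mult_minus_left mult_minus_right mult_ac)
    finally show "of_nat (Suc m choose Suc i) * ((- 1) ^ Suc i * fact (Suc i)) * ffact x (m - i) = - of_nat (Suc m) * (of_nat (m choose i) * ((- 1) ^ i * fact i) * ffact x (m - i))" .
  qed
  also have "\<dots> = - of_nat (Suc m) * ffact (x - 1) m" unfolding sum_distrib_left[symmetric] Suc ..
  finally show ?case unfolding ffact_Suc'[of x] ffact_Suc[of "x - 1"] by (simp add: algebra_simps)
qed

text \<open>For w = - 1 / (A0 t) + g t^j the square consists of 1 / (A0 t)^2, a multiple of t^(j-1)
  and one of t^(2j). The derivative of order \<open>n - 1\<close> annihilates the last two if 1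
  \<le> j and 2 j \<le> n - 2, and the pole part satisfies w' = A0 w^2.\<close>

lemma lead_square:
  assumes n: "n \<ge> 2" and A0: "A0 \<noteq> 0" and j: "j \<ge> 1" and g: "g = 0 \<or> 2 * j \<le> n - 2"
  shows "A0 * (\<Sum>i\<le>n - 1. of_nat ((n - 1) choose i) * (lead A0 g j i s * lead A0 g j (n - 1 - i) s)) = lead A0 g j n s"
proof -
  define m where "m = n - 1"
  have nm: "n = Suc m" using n by (simp add: m_def)
  define p where "p k = - ((- 1) ^ k * fact k / A0)" for k :: nat
  define f where "f k = ffact (of_nat j) k" for k
  define T where "T = exp s ^ (j + 1)"
  have L: "lead A0 g j k s = p k + g * f k * T" for k by (simp add: lead_def p_def f_def T_def)
  have pp: "(\<Sum>i\<le>m. of_nat (m choose i) * (p i * p (m - i))) = p (Suc m) / A0"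
  proof -
    have "of_nat (m choose i) * (p i * p (m - i)) = (- 1) ^ m * fact m / (A0 * A0)" if "i \<le> m" for i
    proof -
      have "(- 1) ^ i * (- 1) ^ (m - i) = ((- 1) ^ m :: complex)" using that by (simp add: power_add[symmetric])
      moreover have "of_nat (m choose i) * (fact i * fact (m - i)) = (fact m :: complex)"
        using binomial_fact_lemma[OF that] by (metis mult.commute of_nat_fact of_nat_mult)
      moreover have "of_nat (m choose i) * (p i * p (m - i)) = ((- 1) ^ i * (- 1) ^ (m - i)) * (of_nat (m choose i) * (fact i * fact (m - i))) / (A0 * A0)"
        by (simp add: p_def mult_ac)
      ultimately show ?thesis by simp
    qed
    then have "(\<Sum>i\<le>m. of_nat (m choose i) * (p i * p (m - i))) = of_nat (Suc m) * ((- 1) ^ m * fact m / (A0 * A0))" by simp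
    then show ?thesis by (simp add: p_def)
  qed
  have pf: "g * (\<Sum>i\<le>m. of_nat (m choose i) * (p i * f (m - i))) = 0"
  proof (cases "g = 0")
    case False
    have "(\<Sum>i\<le>m. of_nat (m choose i) * (p i * f (m - i))) = - (1 / A0) * (\<Sum>i\<le>m. of_nat (m choose i) * ((- 1) ^ i * fact i) * ffact (of_nat j) (m - i))"
      unfolding sum_distrib_left by (intro sum.cong refl) (simp add: p_def f_def)
    also have "\<dots> = - (1 / A0) * ffact (of_nat (j - 1)) m" unfolding ffact_convolution using j by (simp add: of_nat_diff)
    also have "ffact (of_nat (j - 1)) m = 0" by (rule ffact_eq_0) (use g False j nm in auto)
    finally show ?thesis by simp
  qed simp
  have fp: "(\<Sum>i\<le>m. of_nat (m choose i) * (f i * p (m - i))) = (\<Sum>i\<le>m. of_nat (m choose i) * (p i * f (m - i)))"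
    by (rule sum.reindex_bij_witness[of _ "\<lambda>i. m - i" "\<lambda>i. m - i"]) (auto simp: binomial_symmetric[symmetric] mult.commute)
  have ff: "g * (f i * f (m - i)) = 0" if "i \<le> m" for i
  proof (cases "g = 0")
    case False
    then have "j < i \<or> j < m - i" using g that nm j by auto
    then show ?thesis using ffact_eq_0 by (auto simp: f_def)
  qed simp
  have gf: "g * f (Suc m) = 0"
  proof (cases "g = 0")
    case False
    then have "j < Suc m" using g nm j by linarith
    then show ?thesis using ffact_eq_0 by (simp add: f_def)
  qed simp
  have "(\<Sum>i\<le>m. of_nat (m choose i) * (lead A0 g j i s * lead A0 g j (m - i) s))
    = (\<Sum>i\<le>m. of_nat (m choose i) * (p i * p (m - i)) + T * (g * (of_nat (m choose i) * (p i * f (m - i)))) + T * (g * (of_nat (m choose i) * (f i * p (m - i)))))"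
  proof (intro sum.cong refl)
    fix i assume "i \<in> {..m}"
    then have "g * (f i * f (m - i)) = 0" using ff by simp
    then have "of_nat (m choose i) * (T * T * g) * (g * (f i * f (m - i))) = 0" by simp
    then show "of_nat (m choose i) * (lead A0 g j i s * lead A0 g j (m - i) s) = of_nat (m choose i) * (p i * p (m - i)) + T * (g * (of_nat (m choose i) * (p i * f (m - i)))) + T * (g * (of_nat (m choose i) * (f i * p (m - i))))"
      unfolding L by (simp only: distrib_left distrib_right mult_ac) simp
  qed
  also have "\<dots> = p (Suc m) / A0 + T * (g * (\<Sum>i\<le>m. of_nat (m choose i) * (p i * f (m - i)))) + T * (g * (\<Sum>i\<le>m. of_nat (m choose i) * (f i * p (m - i))))"
    unfolding sum.distrib sum_distrib_left[symmetric] pp ..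
  also have "\<dots> = p (Suc m) / A0" unfolding fp pf by simp
  finally show ?thesis using A0 gf by (simp add: m_def[symmetric] nm L)
qed

section \<open>Perturbation of the exact solutions\<close>

lemma quotient_bound: "0 \<le> x \<Longrightarrow> 0 < k \<Longrightarrow> x * (1 / (k * x + 1)) \<le> 1 / (k::real)"
proof -
  assume x: "0 \<le> x" "0 < k"
  then have "k * x + 1 > 0" by (simp add: add_nonneg_pos)
  then show ?thesis using x by (simp add: field_simps)
qed

text \<open>Under z = z0 + e t the limiting equation is invariant, while every other term gains a
  factor e t. The solution is sought as \<open>lead\<close> plus t \<eta>; the linearization at the
  pole part goes to the left-hand side. Note that \<open>g0\<close> is obtained before
  \<open>e\<close>, so one nonzero g serves for all small e.\<close>

lemma pole_solution_exists:
  fixes M :: "nat \<Rightarrow> nat \<Rightarrow> complex \<Rightarrow> complex"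
  assumes n: "n \<ge> 2" and A0: "A0 \<noteq> 0" and R: "R > 0" and j: "j \<ge> 1"
    and hol: "\<And>i l. M i l holomorphic_on ball z0 R" "\<And>i. i < n \<Longrightarrow> N i holomorphic_on ball z0 R" "c holomorphic_on ball z0 R"
  obtains g0 where "g0 > 0"
    "\<And>g. norm g \<le> g0 \<Longrightarrow> g = 0 \<or> 2 * j \<le> n - 2 \<Longrightarrow>
      \<exists>e0 K. 0 < e0 \<and> e0 < R \<and> (\<forall>e. 0 < e \<and> e < e0 \<longrightarrow> (\<exists>X.
        (\<forall>k<n. \<forall>s\<in>strip. (X k has_field_derivative of_nat (Suc k) * X k s + X (Suc k) s) (at s)) \<and>
        (\<forall>k<n. \<forall>s\<in>strip. norm (X k s - lead A0 g j k s) \<le> K * e * exp (Re s)) \<and>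
        (\<forall>s\<in>strip. X n s = A0 * (\<Sum>i\<le>n - 1. of_nat ((n - 1) choose i) * (X i s * X (n - 1 - i) s))
           + of_real e * exp s * ((\<Sum>i<n. \<Sum>l<n. M i l (z0 + of_real e * exp s) * (X i s * X l s))
             + (\<Sum>i<n. N i (z0 + of_real e * exp s) * X i s) + c (z0 + of_real e * exp s)))))"
proof -
  have "n \<ge> 1" using n by simp
  from strip_linear_solver[OF this] obtain \<kappa> where \<kappa>: "\<kappa> > 0" and Kall: "\<forall>F C. F holomorphic_on strip \<longrightarrow> (\<forall>s\<in>strip. norm (F s) \<le> C) \<longrightarrow>
      (\<exists>\<eta>. strip_solves n \<eta> F \<and> (\<forall>k\<le>n. \<forall>s\<in>strip. norm (\<eta> k s) \<le> \<kappa> * C))"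
    by (elim exE conjE) (rule that; assumption)
  define FF where "FF = (\<Sum>k<n. norm (ffact (of_nat j) k))"
  have FF: "norm (ffact (of_nat j) k) \<le> FF" if "k < n" for k
    unfolding FF_def using that by (intro member_le_sum) auto
  have FF0: "FF \<ge> 0" unfolding FF_def by (intro sum_nonneg) auto
  define L where "L = (\<Sum>k<n. fact k / norm A0) + FF"
  have L0: "L \<ge> 0" unfolding L_def using FF0 by (intro add_nonneg_nonneg sum_nonneg) auto
  have bdd: "\<exists>C\<ge>0. \<forall>z\<in>ball z0 (R/2). norm (h z) \<le> C" if "h holomorphic_on ball z0 R" for h :: "complex \<Rightarrow> complex"
  proof -
    have "cball z0 (R/2) \<subseteq> ball z0 R" using R by auto
    then have "compact (h ` cball z0 (R/2))"
      using that by (intro compact_continuous_image continuous_on_subset[OF holomorphic_on_imp_continuous_on]) auto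
    then have "bounded (h ` cball z0 (R/2))" by (rule compact_imp_bounded)
    then obtain C where "\<forall>z\<in>cball z0 (R/2). norm (h z) \<le> C" by (auto simp: bounded_iff)
    then have "\<forall>z\<in>ball z0 (R/2). norm (h z) \<le> \<bar>C\<bar>"
      using ball_subset_cball by (meson abs_ge_self order_trans subsetD)
    then show ?thesis by (intro exI[of _ "\<bar>C\<bar>"]) simp
  qed
  have "\<exists>C. C \<ge> 0 \<and> (\<forall>z\<in>ball z0 (R/2). norm (M i l z) \<le> C)" for i l using bdd[OF hol(1)] by blast
  then obtain CM where CM: "\<And>i l. CM i l \<ge> (0::real)" "\<And>i l z. z\<in>ball z0 (R/2) \<Longrightarrow> norm (M i l z) \<le> CM i l" by metis
  have "\<exists>C. i < n \<longrightarrow> C \<ge> 0 \<and> (\<forall>z\<in>ball z0 (R/2). norm (N i z) \<le> C)" for i using bdd[OF hol(2)] by blast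
  then obtain CN where CN: "\<And>i. i < n \<Longrightarrow> CN i \<ge> (0::real)" "\<And>i z. i < n \<Longrightarrow> z\<in>ball z0 (R/2) \<Longrightarrow> norm (N i z) \<le> CN i" by metis
  obtain Cc where Cc: "Cc \<ge> 0" "\<And>z. z\<in>ball z0 (R/2) \<Longrightarrow> norm (c z) \<le> Cc" using bdd[OF hol(3)] by blast
  define BM where "BM = (\<Sum>i<n. \<Sum>l<n. CM i l) + (\<Sum>i<n. CN i) + Cc"
  have nn: "0 \<le> (\<Sum>i<n. \<Sum>l<n. CM i l)" "0 \<le> (\<Sum>i<n. CN i)" using CM(1) CN(1) by (auto intro!: sum_nonneg)
  have BM0: "BM \<ge> 0" unfolding BM_def using nn Cc(1) by simp
  have BM: "norm (M i l z) \<le> BM" "norm (N i z) \<le> BM" "norm (c z) \<le> BM" if "i < n" "l < n" "z \<in> ball z0 (R/2)" for i l z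
  proof -
    have "CM i l \<le> (\<Sum>l<n. CM i l)" using that CM by (intro member_le_sum) auto
    also have "\<dots> \<le> (\<Sum>i<n. \<Sum>l<n. CM i l)" using that CM by (intro member_le_sum[of i "{..<n}" "\<lambda>i. \<Sum>l<n. CM i l"]) (auto intro: sum_nonneg)
    finally show "norm (M i l z) \<le> BM" using CM(2)[OF that(3), of i l] nn Cc(1) unfolding BM_def by linarith
    have "CN i \<le> (\<Sum>i<n. CN i)" using that CN by (intro member_le_sum) auto
    then show "norm (N i z) \<le> BM" using CN(2)[OF that(1,3)] nn Cc(1) unfolding BM_def by linarith
    show "norm (c z) \<le> BM" using Cc(2)[OF that(3)] nn unfolding BM_def by linarith
  qed
  define a2 where "a2 = norm A0 * 2 ^ n"
  have a20: "a2 > 0" using A0 by (simp add: a2_def)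
  define q where "q = a2 + BM"
  have q0: "q > 0" using a20 BM0 by (simp add: q_def)
  \<comment> \<open>The terms containing both g and the correction do not shrink with e, so g itself
    must be small. Their share in the contraction constant is at most 1/8; \<rho> accounts for 1/4
    and e for another 1/8, in total 1/2.\<close>
  define g0 where "g0 = min 1 (1 / (8 * (2 * \<kappa> * real n * a2 * FF) + 1))"
  define \<rho> where "\<rho> = 1 / (4 * (\<kappa> * (2 * real n * real n * q)) + 1)"
  have \<rho>0: "\<rho> > 0" unfolding \<rho>_def using \<kappa> q0 by (intro divide_pos_pos add_nonneg_pos mult_nonneg_nonneg) auto
  have \<rho>1: "\<kappa> * (2 * real n * real n * q) * \<rho> \<le> 1 / 4"
    unfolding \<rho>_def using \<kappa> q0 by (intro quotient_bound) auto
  define E1 where "E1 = 2 * real n * BM * L + BM"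
  define E2 where "E2 = real n * real n * (BM * (L * L)) + real n * (BM * L) + BM"
  have E0: "E1 \<ge> 0" "E2 \<ge> 0" unfolding E1_def E2_def using BM0 L0 by auto
  \<comment> \<open>In turn: the points stay in the half disc where the coefficients are bounded; e
    \<le> 1 for the bound on Q; the share 1/8 of the linear terms; the correction of size
    \<open>2 * \<kappa> * e * E2\<close> fits into the radius \<rho>.\<close>
  define e0 where "e0 = min (min (R/2) 1) (min (1 / (8 * (\<kappa> * real n * E1) + 1)) (\<rho> * (1 / (1 * (2 * \<kappa> * E2) + 1))))"
  have e00: "e0 > 0" unfolding e0_def using R \<rho>0 \<kappa> E0 by (auto intro!: divide_pos_pos add_nonneg_pos mult_nonneg_nonneg mult_pos_pos)
  show ?thesis
  proof (rule that[of g0])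
    show "g0 > 0" unfolding g0_def using \<kappa> a20 FF0 by (auto intro!: divide_pos_pos add_nonneg_pos mult_nonneg_nonneg)
    fix g :: complex assume g: "norm g \<le> g0" "g = 0 \<or> 2 * j \<le> n - 2"
    have g1: "norm g \<le> 1" using g by (simp add: g0_def)
    have "2 * \<kappa> * real n * a2 * FF * norm g \<le> 2 * \<kappa> * real n * a2 * FF * (1 / (8 * (2 * \<kappa> * real n * a2 * FF) + 1))"
      using g(1) \<kappa> a20 FF0 by (intro mult_left_mono) (auto simp: g0_def)
    also have "\<dots> \<le> 1 / 8" using \<kappa> a20 FF0 by (intro quotient_bound) auto
    finally have gs: "2 * \<kappa> * real n * a2 * FF * norm g \<le> 1 / 8" .
    let ?X0 = "lead A0 g j"
    have X0b: "norm (?X0 k s) \<le> L" if "k < n" "s \<in> strip" for k s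
    proof -
      have t: "norm (exp s) \<le> 1" using that by (simp add: strip_def)
      have "norm (?X0 k s) \<le> norm (- ((- 1) ^ k * fact k / A0)) + norm (g * ffact (of_nat j) k * exp s ^ (j + 1))"
        unfolding lead_def by (rule norm_triangle_ineq)
      moreover have "norm (- ((- 1) ^ k * fact k / A0)) = fact k / norm A0" by (simp add: norm_mult norm_divide norm_power)
      moreover have "fact k / norm A0 \<le> (\<Sum>k<n. fact k / norm A0)" using that by (intro member_le_sum) auto
      moreover have "norm (g * ffact (of_nat j) k * exp s ^ (j + 1)) \<le> 1 * FF * 1"
        unfolding norm_mult norm_power[of "exp s"] using t FF[OF that(1)] FF0 g1 by (intro mult_mono power_le_one) auto
      ultimately show ?thesis unfolding L_def by linarith
    qed
    have X0h: "?X0 k holomorphic_on strip" for k using lead_deriv by (rule holomorphic_on_derivI)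
    show "\<exists>e0 K. 0 < e0 \<and> e0 < R \<and> (\<forall>e. 0 < e \<and> e < e0 \<longrightarrow> (\<exists>X.
        (\<forall>k<n. \<forall>s\<in>strip. (X k has_field_derivative of_nat (Suc k) * X k s + X (Suc k) s) (at s)) \<and>
        (\<forall>k<n. \<forall>s\<in>strip. norm (X k s - ?X0 k s) \<le> K * e * exp (Re s)) \<and>
        (\<forall>s\<in>strip. X n s = A0 * (\<Sum>i\<le>n - 1. of_nat ((n - 1) choose i) * (X i s * X (n - 1 - i) s))
           + of_real e * exp s * ((\<Sum>i<n. \<Sum>l<n. M i l (z0 + of_real e * exp s) * (X i s * X l s))
             + (\<Sum>i<n. N i (z0 + of_real e * exp s) * X i s) + c (z0 + of_real e * exp s)))))"
    proof (rule exI[of _ e0], rule exI[of _ "2 * \<kappa> * E2"], intro conjI allI impI)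
      show "0 < e0" by (rule e00)
      show "e0 < R" using R by (simp add: e0_def min_less_iff_disj)
      fix e :: real assume "0 < e \<and> e < e0"
      then have e: "0 < e" "e < R/2" "e \<le> 1" "e \<le> 1 / (8 * (\<kappa> * real n * E1) + 1)" "e \<le> \<rho> * (1 / (1 * (2 * \<kappa> * E2) + 1))"
        by (auto simp: e0_def)
      define z where "z s = z0 + of_real e * exp s" for s
      have zin: "z s \<in> ball z0 (R/2)" if "s \<in> strip" for s
      proof -
        have "norm (exp s) \<le> 1" using that by (simp add: strip_def)
        then have "e * norm (exp s) \<le> e * 1" using e by (intro mult_left_mono) auto
        moreover have "dist z0 (z s) = e * norm (exp s)" using e by (simp add: z_def dist_norm norm_mult)
        ultimately show ?thesis using e unfolding mem_ball by linarith
      qed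
      have zh: "(\<lambda>s. h (z s)) holomorphic_on strip" if "h holomorphic_on ball z0 R" for h
      proof -
        have "h holomorphic_on ball z0 (R/2)" using that by (rule holomorphic_on_subset) (use R in auto)
        moreover have "z holomorphic_on strip" unfolding z_def by (intro holomorphic_intros)
        moreover have "z ` strip \<subseteq> ball z0 (R/2)" using zin by blast
        ultimately show ?thesis using holomorphic_on_compose_gen[of z strip h "ball z0 (R/2)"] by (simp add: o_def)
      qed
      define cc where "cc i l = (if i + l = n - 1 then of_nat ((n - 1) choose i) else (0::complex))" for i l
      have ccb: "norm (cc i l) \<le> 2 ^ n" for i l
      proof -
        have "(n - 1) choose i \<le> 2 ^ (n - 1)" by (rule binomial_le_pow2)
        also have "\<dots> \<le> 2 ^ n" by (rule power_increasing) auto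
        finally have "real ((n - 1) choose i) \<le> 2 ^ n" by (metis of_nat_le_iff of_nat_numeral of_nat_power)
        then show ?thesis by (simp add: cc_def)
      qed
      \<comment> \<open>Inserting lead + t \<eta>, subtracting the equation of \<open>lead\<close>
        and dividing by t leaves \<open>Q\<close>, \<open>P\<close> and \<open>Rr\<close> as the
        quadratic, the remaining linear, and the constant part in \<eta>.\<close>
      define Q where "Q i l s = A0 * exp s * cc i l + of_real e * (exp s * exp s) * M i l (z s)" for i l s
      define P where "P i s = 2 * A0 * g * of_nat ((n - 1) choose i) * ffact (of_nat j) (n - 1 - i) * exp s ^ (j + 1)
        + of_real e * exp s * ((\<Sum>l<n. M i l (z s) * ?X0 l s + M l i (z s) * ?X0 l s) + N i (z s))" for i s
      define Rr where "Rr s = of_real e * ((\<Sum>i<n. \<Sum>l<n. M i l (z s) * (?X0 i s * ?X0 l s)) + (\<Sum>i<n. N i (z s) * ?X0 i s) + c (z s))" for s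
      define p where "p = 2 * a2 * FF * norm g + e * E1"
      have t1: "norm (exp s) \<le> 1" if "s \<in> strip" for s using that by (simp add: strip_def)
      have Qb: "norm (Q i l s) \<le> q" if "i < n" "l < n" "s \<in> strip" for i l s
      proof -
        have "norm (A0 * exp s * cc i l) \<le> norm A0 * 1 * 2 ^ n"
          unfolding norm_mult using t1[OF that(3)] ccb by (intro mult_mono) auto
        moreover have "norm (of_real e * (exp s * exp s) * M i l (z s)) \<le> 1 * (1 * 1) * BM"
          unfolding norm_mult using t1[OF that(3)] e BM(1)[OF that(1,2) zin[OF that(3)]] BM0 by (intro mult_mono) auto
        ultimately show ?thesis unfolding Q_def q_def a2_def
          using norm_triangle_ineq[of "A0 * exp s * cc i l" "of_real e * (exp s * exp s) * M i l (z s)"] by simp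
      qed
      have Pb: "norm (P i s) \<le> p" if "i < n" "s \<in> strip" for i s
      proof -
        have ch: "real ((n - 1) choose i) \<le> 2 ^ n" using ccb[of i "n - 1 - i"] that by (simp add: cc_def)
        have "norm (2 * A0 * g * of_nat ((n - 1) choose i) * ffact (of_nat j) (n - 1 - i) * exp s ^ (j + 1)) \<le> 2 * norm A0 * norm g * 2 ^ n * FF * 1"
          unfolding norm_mult norm_power[of "exp s"] using t1[OF that(2)] ch FF[of "n - 1 - i"] FF0 that n
          by (intro mult_mono power_le_one mult_nonneg_nonneg) auto
        moreover have "norm ((\<Sum>l<n. M i l (z s) * ?X0 l s + M l i (z s) * ?X0 l s) + N i (z s)) \<le> (\<Sum>l<n. BM * L + BM * L) + BM"
        proof (rule order_trans[OF norm_triangle_ineq], rule add_mono)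
          show "norm (\<Sum>l<n. M i l (z s) * ?X0 l s + M l i (z s) * ?X0 l s) \<le> (\<Sum>l<n. BM * L + BM * L)"
          proof (rule sum_norm_le, rule order_trans[OF norm_triangle_ineq], rule add_mono)
            fix l assume "l \<in> {..<n}"
            then have l: "l < n" by simp
            show "norm (M i l (z s) * ?X0 l s) \<le> BM * L" unfolding norm_mult
              by (intro mult_mono BM(1)[OF that(1) l zin[OF that(2)]] X0b[OF l that(2)] BM0 norm_ge_zero)
            show "norm (M l i (z s) * ?X0 l s) \<le> BM * L" unfolding norm_mult
              by (intro mult_mono BM(1)[OF l that(1) zin[OF that(2)]] X0b[OF l that(2)] BM0 norm_ge_zero)
          qed
          show "norm (N i (z s)) \<le> BM" by (rule BM(2)[OF that(1,1) zin[OF that(2)]])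
        qed
        then have "norm ((\<Sum>l<n. M i l (z s) * ?X0 l s + M l i (z s) * ?X0 l s) + N i (z s)) \<le> E1" by (simp add: E1_def)
        then have "norm (of_real e * exp s * ((\<Sum>l<n. M i l (z s) * ?X0 l s + M l i (z s) * ?X0 l s) + N i (z s))) \<le> e * 1 * E1"
          unfolding norm_mult[of _ "(\<Sum>l<n. M i l (z s) * ?X0 l s + M l i (z s) * ?X0 l s) + N i (z s)"] norm_mult[of "of_real e"]
          using t1[OF that(2)] e by (intro mult_mono) auto
        ultimately show ?thesis unfolding P_def p_def a2_def
          using norm_triangle_ineq[of "2 * A0 * g * of_nat ((n - 1) choose i) * ffact (of_nat j) (n - 1 - i) * exp s ^ (j + 1)"
            "of_real e * exp s * ((\<Sum>l<n. M i l (z s) * ?X0 l s + M l i (z s) * ?X0 l s) + N i (z s))"] by (simp add: mult_ac)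
      qed
      have Rb: "norm (Rr s) \<le> e * E2" if s: "s \<in> strip" for s
      proof -
        have "norm (\<Sum>i<n. \<Sum>l<n. M i l (z s) * (?X0 i s * ?X0 l s)) \<le> (\<Sum>i<n. \<Sum>l<n. BM * (L * L))"
        proof (rule sum_norm_le, rule sum_norm_le)
          fix i l assume "i \<in> {..<n}" "l \<in> {..<n}"
          then have il: "i < n" "l < n" by auto
          show "norm (M i l (z s) * (?X0 i s * ?X0 l s)) \<le> BM * (L * L)" unfolding norm_mult
            by (intro mult_mono BM(1)[OF il zin[OF s]] X0b[OF il(1) s] X0b[OF il(2) s] BM0 L0 mult_nonneg_nonneg norm_ge_zero)
        qed
        moreover have "norm (\<Sum>i<n. N i (z s) * ?X0 i s) \<le> (\<Sum>i<n. BM * L)"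
        proof (rule sum_norm_le)
          fix i assume "i \<in> {..<n}"
          then have i: "i < n" by auto
          show "norm (N i (z s) * ?X0 i s) \<le> BM * L" unfolding norm_mult
            by (intro mult_mono BM(2)[OF i i zin[OF s]] X0b[OF i s] BM0 norm_ge_zero)
        qed
        moreover have "norm (c (z s)) \<le> BM" using BM(3)[of 0 0] n zin[OF s] by simp
        ultimately have "norm ((\<Sum>i<n. \<Sum>l<n. M i l (z s) * (?X0 i s * ?X0 l s)) + (\<Sum>i<n. N i (z s) * ?X0 i s) + c (z s)) \<le> E2"
          unfolding E2_def
          using norm_triangle_ineq[of "(\<Sum>i<n. \<Sum>l<n. M i l (z s) * (?X0 i s * ?X0 l s)) + (\<Sum>i<n. N i (z s) * ?X0 i s)" "c (z s)"]
            norm_triangle_ineq[of "\<Sum>i<n. \<Sum>l<n. M i l (z s) * (?X0 i s * ?X0 l s)" "\<Sum>i<n. N i (z s) * ?X0 i s"] by simp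
        then show ?thesis unfolding Rr_def norm_mult[of "of_real e"] using e by (simp add: mult_left_mono)
      qed
      have small1: "\<kappa> * (2 * real n * real n * q * \<rho> + real n * p) \<le> 1 / 2"
      proof -
        have "\<kappa> * real n * E1 * e \<le> \<kappa> * real n * E1 * (1 / (8 * (\<kappa> * real n * E1) + 1))"
          using e \<kappa> E0 by (intro mult_left_mono) auto
        also have "\<dots> \<le> 1 / 8" using \<kappa> E0 by (intro quotient_bound) auto
        finally have "\<kappa> * real n * E1 * e \<le> 1 / 8" .
        moreover have "\<kappa> * (2 * real n * real n * q * \<rho> + real n * p) = \<kappa> * (2 * real n * real n * q) * \<rho> + 2 * \<kappa> * real n * a2 * FF * norm g + \<kappa> * real n * E1 * e"
          by (simp add: p_def algebra_simps)
        ultimately show ?thesis using \<rho>1 gs by linarith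
      qed
      have small2: "2 * \<kappa> * (e * E2) \<le> \<rho>"
      proof -
        have "2 * \<kappa> * (e * E2) = 2 * \<kappa> * E2 * e" by simp
        also have "\<dots> \<le> 2 * \<kappa> * E2 * (\<rho> * (1 / (1 * (2 * \<kappa> * E2) + 1)))" using e \<kappa> E0 by (intro mult_left_mono) auto
        also have "\<dots> = \<rho> * (2 * \<kappa> * E2 * (1 / (1 * (2 * \<kappa> * E2) + 1)))" by simp
        also have "\<dots> \<le> \<rho> * (1 / 1)" using \<rho>0 \<kappa> E0 by (intro mult_left_mono quotient_bound) auto
        finally show ?thesis by simp
      qed
      have "\<exists>\<eta>. (\<forall>k<n. \<forall>s\<in>strip. (\<eta> k has_field_derivative of_nat k * \<eta> k s + \<eta> (Suc k) s) (at s)) \<and>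
        (\<forall>k\<le>n. \<forall>s\<in>strip. norm (\<eta> k s) \<le> 2 * \<kappa> * (e * E2)) \<and>
        (\<forall>s\<in>strip. \<eta> n s + (\<Sum>i<n. pole_coeff (n - 1) i * \<eta> i s) = quad_fun n Q P Rr s (\<lambda>k. \<eta> k s))"
      proof (rule strip_fixed_point[OF \<open>n \<ge> 1\<close> \<kappa> Kall])
        show "norm (Q i l s) \<le> q" if "i < n" "l < n" "s \<in> strip" for i l s by (rule Qb[OF that])
        show "norm (P i s) \<le> p" if "i < n" "s \<in> strip" for i s by (rule Pb[OF that])
        show "norm (Rr s) \<le> e * E2" if "s \<in> strip" for s by (rule Rb[OF that])
        show "\<kappa> * (2 * real n * real n * q * \<rho> + real n * p) \<le> 1 / 2" by (rule small1)
        show "2 * \<kappa> * (e * E2) \<le> \<rho>" by (rule small2)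
        show "Q i l holomorphic_on strip" for i l unfolding Q_def[abs_def] by (intro holomorphic_intros zh hol)
        show "P i holomorphic_on strip" if "i < n" for i unfolding P_def[abs_def] by (intro holomorphic_intros zh hol X0h that)
        show "Rr holomorphic_on strip" unfolding Rr_def[abs_def] by (intro holomorphic_intros zh hol X0h) auto
      qed
      then obtain \<eta> where \<eta>: "\<forall>k<n. \<forall>s\<in>strip. (\<eta> k has_field_derivative of_nat k * \<eta> k s + \<eta> (Suc k) s) (at s)"
        "\<forall>k\<le>n. \<forall>s\<in>strip. norm (\<eta> k s) \<le> 2 * \<kappa> * (e * E2)"
        "\<forall>s\<in>strip. \<eta> n s + (\<Sum>i<n. pole_coeff (n - 1) i * \<eta> i s) = quad_fun n Q P Rr s (\<lambda>k. \<eta> k s)"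
        by (elim exE conjE) (rule that; assumption)
      define X where "X k s = ?X0 k s + exp s * \<eta> k s" for k s
      show "\<exists>X. (\<forall>k<n. \<forall>s\<in>strip. (X k has_field_derivative of_nat (Suc k) * X k s + X (Suc k) s) (at s)) \<and>
        (\<forall>k<n. \<forall>s\<in>strip. norm (X k s - ?X0 k s) \<le> 2 * \<kappa> * E2 * e * exp (Re s)) \<and>
        (\<forall>s\<in>strip. X n s = A0 * (\<Sum>i\<le>n - 1. of_nat ((n - 1) choose i) * (X i s * X (n - 1 - i) s))
           + of_real e * exp s * ((\<Sum>i<n. \<Sum>l<n. M i l (z0 + of_real e * exp s) * (X i s * X l s))
             + (\<Sum>i<n. N i (z0 + of_real e * exp s) * X i s) + c (z0 + of_real e * exp s)))"
      proof (intro exI[of _ X] conjI allI impI ballI)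
        fix k s assume k: "k < n" and s: "s \<in> strip"
        have "(X k has_field_derivative (of_nat (Suc k) * ?X0 k s + ?X0 (Suc k) s) + (exp s * \<eta> k s + (of_nat k * \<eta> k s + \<eta> (Suc k) s) * exp s)) (at s)"
          unfolding X_def[abs_def] by (intro DERIV_add lead_deriv DERIV_mult DERIV_exp \<eta>(1)[rule_format, OF k s])
        then show "(X k has_field_derivative of_nat (Suc k) * X k s + X (Suc k) s) (at s)"
          by (simp add: X_def algebra_simps)
        have "norm (exp s) * norm (\<eta> k s) \<le> norm (exp s) * (2 * \<kappa> * (e * E2))" using \<eta>(2) k s by (intro mult_left_mono) auto
        then show "norm (X k s - ?X0 k s) \<le> 2 * \<kappa> * E2 * e * exp (Re s)" by (simp add: X_def norm_mult mult_ac)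
      next
        fix s assume s: "s \<in> strip"
        define t where "t = exp s"
        define m where "m = n - 1"
        let ?x = "\<lambda>i. ?X0 i s" and ?h = "\<lambda>i. \<eta> i s" and ?M = "\<lambda>i l. M i l (z s)" and ?N = "\<lambda>i. N i (z s)"
        have nm: "{..<n} = {..m}" using n by (auto simp: m_def)
        have conv: "(\<Sum>i\<le>m. of_nat (m choose i) * (u i * v (m - i))) = (\<Sum>i<n. \<Sum>l<n. cc i l * (u i * v l))" for u v
        proof -
          have "(\<Sum>l<n. cc i l * (u i * v l)) = of_nat (m choose i) * (u i * v (m - i))" if "i \<le> m" for i
          proof -
            have "(\<Sum>l<n. cc i l * (u i * v l)) = (\<Sum>l<n. if l = m - i then of_nat (m choose i) * (u i * v (m - i)) else 0)"
              by (intro sum.cong) (use that in \<open>auto simp: cc_def m_def\<close>)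
            then show ?thesis using that n by (simp add: m_def)
          qed
          then show ?thesis unfolding nm by (intro sum.cong) auto
        qed
        \<comment> \<open>The product of \<eta> with the pole part is the negative of the sum with
          \<open>pole_coeff\<close>, which moves to the left-hand side; the product with the g-part
          is the first term of \<open>P\<close>.\<close>
        have cross: "2 * A0 * (\<Sum>i\<le>m. of_nat (m choose i) * (?h i * ?x (m - i))) =
          - (\<Sum>i<n. pole_coeff m i * ?h i) + (\<Sum>i<n. 2 * A0 * g * of_nat (m choose i) * ffact (of_nat j) (m - i) * t ^ (j + 1) * ?h i)"
          unfolding nm sum_distrib_left sum_negf[symmetric] sum.distrib[symmetric]
        proof (intro sum.cong refl)
          fix i assume "i \<in> {..m}"
          then have i: "i \<le> m" by simp
          have "of_nat (m choose i) * fact (m - i) = (fact m / fact i :: complex)"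
            using binomial_fact[OF i, where 'a = complex] by simp
          then have "2 * (of_nat (m choose i) * fact (m - i)) * (- 1) ^ (m - i) = pole_coeff m i" by (simp add: pole_coeff_def)
          then have pc: "pole_coeff m i = 2 * of_nat (m choose i) * ((- 1) ^ (m - i) * fact (m - i))" by (simp add: mult_ac)
          have "2 * A0 * (of_nat (m choose i) * (?h i * ?x (m - i))) = (A0 / A0) * - (2 * of_nat (m choose i) * ((- 1) ^ (m - i) * fact (m - i)) * ?h i)
             + 2 * A0 * g * of_nat (m choose i) * ffact (of_nat j) (m - i) * t ^ (j + 1) * ?h i"
            by (simp add: lead_def t_def algebra_simps)
          then show "2 * A0 * (of_nat (m choose i) * (?h i * ?x (m - i))) = - (pole_coeff m i * ?h i) + 2 * A0 * g * of_nat (m choose i) * ffact (of_nat j) (m - i) * t ^ (j + 1) * ?h i"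
            unfolding pc using A0 by simp
        qed
        have sq: "(\<Sum>i\<le>m. of_nat (m choose i) * (X i s * X (m - i) s)) = (\<Sum>i\<le>m. of_nat (m choose i) * (?x i * ?x (m - i)))
          + t * (2 * (\<Sum>i\<le>m. of_nat (m choose i) * (?h i * ?x (m - i)))) + t * t * (\<Sum>i\<le>m. of_nat (m choose i) * (?h i * ?h (m - i)))"
        proof -
          have "(\<Sum>i\<le>m. of_nat (m choose i) * (?x i * ?h (m - i))) = (\<Sum>i\<le>m. of_nat (m choose i) * (?h i * ?x (m - i)))"
            by (rule sum.reindex_bij_witness[of _ "\<lambda>i. m - i" "\<lambda>i. m - i"]) (auto simp: binomial_symmetric[symmetric] mult.commute)
          moreover have "(\<Sum>i\<le>m. of_nat (m choose i) * (X i s * X (m - i) s)) = (\<Sum>i\<le>m. of_nat (m choose i) * (?x i * ?x (m - i)))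
            + t * (\<Sum>i\<le>m. of_nat (m choose i) * (?h i * ?x (m - i))) + t * (\<Sum>i\<le>m. of_nat (m choose i) * (?x i * ?h (m - i))) + t * t * (\<Sum>i\<le>m. of_nat (m choose i) * (?h i * ?h (m - i)))"
            unfolding sum_distrib_left sum.distrib[symmetric] by (intro sum.cong refl) (simp add: X_def t_def[symmetric] algebra_simps)
          ultimately show ?thesis by (simp add: algebra_simps)
        qed
        have Mx: "(\<Sum>i<n. \<Sum>l<n. ?M i l * (X i s * X l s)) = (\<Sum>i<n. \<Sum>l<n. ?M i l * (?x i * ?x l))
            + t * (\<Sum>i<n. (\<Sum>l<n. ?M i l * ?x l + ?M l i * ?x l) * ?h i) + t * t * (\<Sum>i<n. \<Sum>l<n. ?M i l * (?h i * ?h l))"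
        proof -
          have "(\<Sum>i<n. \<Sum>l<n. ?M i l * (X i s * X l s)) = (\<Sum>i<n. \<Sum>l<n. ?M i l * (?x i * ?x l))
            + t * (\<Sum>i<n. \<Sum>l<n. ?M i l * ?x l * ?h i) + t * (\<Sum>i<n. \<Sum>l<n. ?M i l * ?x i * ?h l) + t * t * (\<Sum>i<n. \<Sum>l<n. ?M i l * (?h i * ?h l))"
            unfolding sum_distrib_left sum.distrib[symmetric] by (intro sum.cong refl) (simp add: X_def t_def[symmetric] algebra_simps)
          moreover have "(\<Sum>i<n. \<Sum>l<n. ?M i l * ?x i * ?h l) = (\<Sum>i<n. \<Sum>l<n. ?M l i * ?x l * ?h i)" by (rule sum.swap)
          ultimately show ?thesis by (simp add: sum.distrib sum_distrib_right distrib_right distrib_left)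
        qed
        have Nx: "(\<Sum>i<n. ?N i * X i s) = (\<Sum>i<n. ?N i * ?x i) + t * (\<Sum>i<n. ?N i * ?h i)"
          unfolding sum_distrib_left sum.distrib[symmetric] by (intro sum.cong refl) (simp add: X_def t_def[symmetric] algebra_simps)
        have Qx: "(\<Sum>i<n. \<Sum>l<n. Q i l s * (?h i * ?h l)) = A0 * t * (\<Sum>i\<le>m. of_nat (m choose i) * (?h i * ?h (m - i))) + of_real e * (t * t) * (\<Sum>i<n. \<Sum>l<n. ?M i l * (?h i * ?h l))"
          unfolding conv[of ?h ?h] sum_distrib_left sum.distrib[symmetric] by (intro sum.cong refl) (simp add: Q_def t_def[symmetric] algebra_simps)
        have P': "P i s = 2 * A0 * g * of_nat (m choose i) * ffact (of_nat j) (m - i) * t ^ (j + 1)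
          + of_real e * t * ((\<Sum>l<n. ?M i l * ?x l + ?M l i * ?x l) + ?N i)" for i
          unfolding P_def m_def t_def ..
        have Px: "(\<Sum>i<n. P i s * ?h i) = (\<Sum>i<n. 2 * A0 * g * of_nat (m choose i) * ffact (of_nat j) (m - i) * t ^ (j + 1) * ?h i)
          + of_real e * t * (\<Sum>i<n. (\<Sum>l<n. ?M i l * ?x l + ?M l i * ?x l) * ?h i) + of_real e * t * (\<Sum>i<n. ?N i * ?h i)"
          unfolding sum_distrib_left[of "of_real e * t"] sum.distrib[symmetric]
          by (intro sum.cong refl) (simp only: P' distrib_left distrib_right mult.assoc add.assoc)
        have hn: "?h n = - (\<Sum>i<n. pole_coeff m i * ?h i) + quad_fun n Q P Rr s (\<lambda>k. \<eta> k s)"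
          using \<eta>(3)[rule_format, OF s] by (simp add: m_def algebra_simps)
        have ld: "?x n = A0 * (\<Sum>i\<le>m. of_nat (m choose i) * (?x i * ?x (m - i)))"
          using lead_square[OF n A0 j g(2), of s] by (simp add: m_def)
        define T1 where "T1 = (\<Sum>i\<le>m. of_nat (m choose i) * (?x i * ?x (m - i)))"
        define T2 where "T2 = (\<Sum>i\<le>m. of_nat (m choose i) * (?h i * ?x (m - i)))"
        define T3 where "T3 = (\<Sum>i\<le>m. of_nat (m choose i) * (?h i * ?h (m - i)))"
        define T4 where "T4 = (\<Sum>i<n. pole_coeff m i * ?h i)"
        define T5 where "T5 = (\<Sum>i<n. 2 * A0 * g * of_nat (m choose i) * ffact (of_nat j) (m - i) * t ^ (j + 1) * ?h i)"
        define T6 where "T6 = (\<Sum>i<n. \<Sum>l<n. ?M i l * (?x i * ?x l))"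
        define T7 where "T7 = (\<Sum>i<n. (\<Sum>l<n. ?M i l * ?x l + ?M l i * ?x l) * ?h i)"
        define T8 where "T8 = (\<Sum>i<n. \<Sum>l<n. ?M i l * (?h i * ?h l))"
        define T9 where "T9 = (\<Sum>i<n. ?N i * ?x i)"
        define T10 where "T10 = (\<Sum>i<n. ?N i * ?h i)"
        have hn': "?h n = - T4 + (A0 * t * T3 + of_real e * (t * t) * T8 + (T5 + of_real e * t * T7 + of_real e * t * T10) + of_real e * (T6 + T9 + c (z s)))"
          using hn unfolding quad_fun_def Qx Px Rr_def by (simp only: T3_def[symmetric] T4_def[symmetric] T5_def[symmetric] T6_def[symmetric] T7_def[symmetric] T8_def[symmetric] T9_def[symmetric] T10_def[symmetric])
        have cross': "2 * A0 * T2 = - T4 + T5" using cross by (simp only: T2_def T4_def T5_def)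
        have "X n s = A0 * T1 + t * ?h n" using ld by (simp add: X_def t_def T1_def)
        also have "\<dots> = A0 * T1 + t * (2 * A0 * T2) + A0 * (t * t * T3) + of_real e * t * ((T6 + t * T7 + t * t * T8) + (T9 + t * T10) + c (z s))"
          unfolding hn' cross' by (simp add: algebra_simps)
        also have "\<dots> = A0 * (T1 + t * (2 * T2) + t * t * T3) + of_real e * t * ((T6 + t * T7 + t * t * T8) + (T9 + t * T10) + c (z s))"
          by (simp add: algebra_simps)
        also have "T1 + t * (2 * T2) + t * t * T3 = (\<Sum>i\<le>m. of_nat (m choose i) * (X i s * X (m - i) s))" unfolding sq T1_def T2_def T3_def ..
        also have "T6 + t * T7 + t * t * T8 = (\<Sum>i<n. \<Sum>l<n. ?M i l * (X i s * X l s))" unfolding Mx T6_def T7_def T8_def ..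
        also have "T9 + t * T10 = (\<Sum>i<n. ?N i * X i s)" unfolding Nx T9_def T10_def ..
        finally show "X n s = A0 * (\<Sum>i\<le>n - 1. of_nat ((n - 1) choose i) * (X i s * X (n - 1 - i) s))
           + of_real e * exp s * ((\<Sum>i<n. \<Sum>l<n. M i l (z0 + of_real e * exp s) * (X i s * X l s))
             + (\<Sum>i<n. N i (z0 + of_real e * exp s) * X i s) + c (z0 + of_real e * exp s))"
          by (simp only: m_def t_def z_def)
      qed
    qed
  qed
qed

text \<open>With \<open>z = z\<^sub>0 + e exp s\<close> and \<open>X\<^sub>k = (z - z\<^sub>0)\<^sup>k\<^sup>+\<^sup>1 w\<^sup>(\<^sup>k\<^sup>)\<close> the equation for \<open>w\<close> becomes the last clause.\<close>
definition jet_solution :: "nat \<Rightarrow> (complex \<Rightarrow> complex) \<Rightarrow> (nat \<Rightarrow> nat \<Rightarrow> complex \<Rightarrow> complex) \<Rightarrow>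
     (nat \<Rightarrow> complex \<Rightarrow> complex) \<Rightarrow> (complex \<Rightarrow> complex) \<Rightarrow> complex \<Rightarrow> real \<Rightarrow> (nat \<Rightarrow> complex \<Rightarrow> complex) \<Rightarrow> bool" where
  "jet_solution n A a b c z0 e X \<longleftrightarrow>
     (\<forall>k<n. \<forall>s\<in>strip. (X k has_field_derivative of_nat (Suc k) * X k s + X (Suc k) s) (at s)) \<and>
     (\<forall>s\<in>strip. let \<zeta> = of_real e * exp s; z = z0 + \<zeta> in
        X n s = A z * (\<Sum>i\<le>n - 1. of_nat ((n - 1) choose i) * (X i s * X (n - 1 - i) s))
          + (\<Sum>(k, j)\<in>quadratic_index n. a k j z * \<zeta> ^ (n - 1 - k - j) * (X k s * X j s))
          + (\<Sum>j=0..n - 1. b j z * \<zeta> ^ (n - j) * X j s) + \<zeta> ^ Suc n * c z)"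

section \<open>Return to the original variable\<close>

lemma jet_solution_exists:
  assumes n: "n \<ge> 2" and R: "R > 0" and coh: "coeffs_holomorphic n A a b c (ball z0 R)" and A0: "A z0 \<noteq> 0" and j: "j \<ge> 1"
  obtains g0 where "g0 > 0"
    "\<And>g. norm g \<le> g0 \<Longrightarrow> g = 0 \<or> 2 * j \<le> n - 2 \<Longrightarrow>
      \<exists>e0 K. 0 < e0 \<and> e0 < R \<and> (\<forall>e. 0 < e \<and> e < e0 \<longrightarrow> (\<exists>X. jet_solution n A a b c z0 e X \<and>
        (\<forall>k<n. \<forall>s\<in>strip. norm (X k s - lead (A z0) g j k s) \<le> K * e * exp (Re s))))"
proof -
  have A: "A holomorphic_on ball z0 R" and c: "c holomorphic_on ball z0 R" and b: "\<And>i. i < n \<Longrightarrow> b i holomorphic_on ball z0 R"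
    and a: "\<And>k j. (k, j) \<in> quadratic_index n \<Longrightarrow> a k j holomorphic_on ball z0 R"
    using coh n by (auto simp: coeffs_holomorphic_def)
  \<comment> \<open>Difference quotient of \<open>A\<close> at \<open>z0\<close>: the constant
    \<open>A z0\<close> belongs to the limiting equation, the rest of \<open>A\<close> carries a
    factor z - z0 and joins the perturbation.\<close>
  define A1 where "A1 z = (if z = z0 then deriv A z0 else (A z - A z0) / (z - z0))" for z
  have A1: "A1 holomorphic_on ball z0 R" unfolding A1_def[abs_def] by (rule pole_lemma_open[OF A open_ball])
  have AA1: "A z = A z0 + (z - z0) * A1 z" for z by (simp add: A1_def)
  define cc where "cc i l = (if i + l = n - 1 then of_nat ((n - 1) choose i) else (0::complex))" for i l
  \<comment> \<open>One factor z - z0 has been pulled out of every term. The remaining exponent is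
    non-negative because k + j < n - 1.\<close>
  define M where "M i l z = A1 z * cc i l + (if (i, l) \<in> quadratic_index n then a i l z * (z - z0) ^ (n - 2 - i - l) else 0)" for i l z
  define N where "N i z = b i z * (z - z0) ^ (n - 1 - i)" for i z
  define d where "d z = c z * (z - z0) ^ n" for z
  have hM: "M i l holomorphic_on ball z0 R" for i l
  proof (cases "(i, l) \<in> quadratic_index n")
    case True
    then show ?thesis unfolding M_def[abs_def] using A1 a[OF True] by (simp, intro holomorphic_intros)
  next
    case False
    then show ?thesis unfolding M_def[abs_def] using A1 by (simp, intro holomorphic_intros)
  qed
  have hN: "N i holomorphic_on ball z0 R" if "i < n" for i unfolding N_def[abs_def] using b[OF that] by (intro holomorphic_intros)
  have hd: "d holomorphic_on ball z0 R" unfolding d_def[abs_def] using c by (intro holomorphic_intros)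
  have js: "jet_solution n A a b c z0 e X" if
    X: "\<forall>k<n. \<forall>s\<in>strip. (X k has_field_derivative of_nat (Suc k) * X k s + X (Suc k) s) (at s)" and
    top: "\<forall>s\<in>strip. X n s = A z0 * (\<Sum>i\<le>n - 1. of_nat ((n - 1) choose i) * (X i s * X (n - 1 - i) s))
           + of_real e * exp s * ((\<Sum>i<n. \<Sum>l<n. M i l (z0 + of_real e * exp s) * (X i s * X l s))
             + (\<Sum>i<n. N i (z0 + of_real e * exp s) * X i s) + d (z0 + of_real e * exp s))" for e X
    unfolding jet_solution_def Let_def
  proof (intro conjI ballI)
    fix s assume s: "s \<in> strip"
    define \<zeta> where "\<zeta> = of_real e * exp s"
    define z where "z = z0 + \<zeta>"
    define Y where "Y = (\<Sum>i\<le>n - 1. of_nat ((n - 1) choose i) * (X i s * X (n - 1 - i) s))"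
    have zz: "z - z0 = \<zeta>" by (simp add: z_def)
    have "(\<Sum>i<n. \<Sum>l<n. cc i l * (X i s * X l s)) = Y"
    proof -
      have "(\<Sum>l<n. cc i l * (X i s * X l s)) = of_nat ((n - 1) choose i) * (X i s * X (n - 1 - i) s)" if "i < n" for i
      proof -
        have "(\<Sum>l<n. cc i l * (X i s * X l s)) = (\<Sum>l<n. if l = n - 1 - i then of_nat ((n - 1) choose i) * (X i s * X (n - 1 - i) s) else 0)"
          by (intro sum.cong) (use that in \<open>auto simp: cc_def\<close>)
        then show ?thesis using that n by simp
      qed
      moreover have "{..n - 1} = {..<n}" using n by auto
      ultimately show ?thesis unfolding Y_def by (intro sum.cong) auto
    qed
    then have "(\<Sum>i<n. \<Sum>l<n. M i l z * (X i s * X l s)) = A1 z * Y + (\<Sum>i<n. \<Sum>l<n. if (i, l) \<in> quadratic_index n then a i l z * \<zeta> ^ (n - 2 - i - l) * (X i s * X l s) else 0)"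
      unfolding M_def zz distrib_right sum.distrib mult.assoc[of "A1 z"] sum_distrib_left[symmetric]
      by (intro arg_cong2[where f = "(+)"] sum.cong refl) auto
    also have "(\<Sum>i<n. \<Sum>l<n. if (i, l) \<in> quadratic_index n then a i l z * \<zeta> ^ (n - 2 - i - l) * (X i s * X l s) else 0)
      = (\<Sum>p\<in>{..<n} \<times> {..<n}. if p \<in> quadratic_index n then (case p of (i, l) \<Rightarrow> a i l z * \<zeta> ^ (n - 2 - i - l) * (X i s * X l s)) else 0)"
      by (subst sum.cartesian_product) (intro sum.cong, auto)
    also have "\<dots> = (\<Sum>p\<in>({..<n} \<times> {..<n}) \<inter> quadratic_index n. case p of (i, l) \<Rightarrow> a i l z * \<zeta> ^ (n - 2 - i - l) * (X i s * X l s))"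
      by (rule sum.inter_restrict[symmetric]) simp
    also have "({..<n} \<times> {..<n}) \<inter> quadratic_index n = quadratic_index n" by (auto simp: quadratic_index_def)
    finally have MM: "(\<Sum>i<n. \<Sum>l<n. M i l z * (X i s * X l s)) = A1 z * Y + (\<Sum>(k, j)\<in>quadratic_index n. a k j z * \<zeta> ^ (n - 2 - k - j) * (X k s * X j s))" .
    have q: "\<zeta> * (\<Sum>(k, j)\<in>quadratic_index n. a k j z * \<zeta> ^ (n - 2 - k - j) * (X k s * X j s)) = (\<Sum>(k, j)\<in>quadratic_index n. a k j z * \<zeta> ^ (n - 1 - k - j) * (X k s * X j s))"
      unfolding sum_distrib_left
    proof (intro sum.cong refl)
      fix p assume p: "p \<in> quadratic_index n"
      obtain k j where kj: "p = (k, j)" by fastforce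
      have "n - 1 - k - j = Suc (n - 2 - k - j)" using p by (auto simp: quadratic_index_def kj)
      then show "\<zeta> * (case p of (k, j) \<Rightarrow> a k j z * \<zeta> ^ (n - 2 - k - j) * (X k s * X j s)) = (case p of (k, j) \<Rightarrow> a k j z * \<zeta> ^ (n - 1 - k - j) * (X k s * X j s))"
        by (simp add: kj)
    qed
    have l: "\<zeta> * (\<Sum>i<n. N i z * X i s) = (\<Sum>j=0..n - 1. b j z * \<zeta> ^ (n - j) * X j s)"
    proof -
      have set: "{0..n - 1} = {..<n}" using n by auto
      have e: "\<zeta> * (N i z * X i s) = b i z * \<zeta> ^ (n - i) * X i s" if "i < n" for i
      proof -
        have "n - i = Suc (n - 1 - i)" using that by simp
        then show ?thesis by (simp add: N_def zz)
      qed
      show ?thesis unfolding sum_distrib_left set by (intro sum.cong refl e) simp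
    qed
    have "X n s = A z0 * Y + \<zeta> * ((\<Sum>i<n. \<Sum>l<n. M i l z * (X i s * X l s)) + (\<Sum>i<n. N i z * X i s) + d z)"
      using top s unfolding Y_def z_def \<zeta>_def by blast
    also have "\<dots> = (A z0 + \<zeta> * A1 z) * Y + \<zeta> * (\<Sum>(k, j)\<in>quadratic_index n. a k j z * \<zeta> ^ (n - 2 - k - j) * (X k s * X j s)) + \<zeta> * (\<Sum>i<n. N i z * X i s) + \<zeta> * d z"
      unfolding MM by (simp add: algebra_simps)
    also have "A z0 + \<zeta> * A1 z = A z" using AA1[of z] by (simp add: zz)
    also have "\<zeta> * d z = \<zeta> ^ Suc n * c z" by (simp add: d_def zz)
    finally show "X n s = A (z0 + of_real e * exp s) * (\<Sum>i\<le>n - 1. of_nat ((n - 1) choose i) * (X i s * X (n - 1 - i) s))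
          + (\<Sum>(k, j)\<in>quadratic_index n. a k j (z0 + of_real e * exp s) * (of_real e * exp s) ^ (n - 1 - k - j) * (X k s * X j s))
          + (\<Sum>j=0..n - 1. b j (z0 + of_real e * exp s) * (of_real e * exp s) ^ (n - j) * X j s) + (of_real e * exp s) ^ Suc n * c (z0 + of_real e * exp s)"
      unfolding q l unfolding Y_def z_def \<zeta>_def .
  qed (use X in blast)
  show ?thesis
  proof (rule pole_solution_exists[OF n A0 R j, of M z0 N d], goal_cases)
    case (4 g0)
    show ?case
    proof (rule that[OF 4(1)])
      fix g :: complex assume g: "norm g \<le> g0" "g = 0 \<or> 2 * j \<le> n - 2"
      from 4(2)[OF g] obtain e0 K where e0: "0 < e0" "e0 < R" and
        ex: "\<forall>e. 0 < e \<and> e < e0 \<longrightarrow> (\<exists>X.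
        (\<forall>k<n. \<forall>s\<in>strip. (X k has_field_derivative of_nat (Suc k) * X k s + X (Suc k) s) (at s)) \<and>
        (\<forall>k<n. \<forall>s\<in>strip. norm (X k s - lead (A z0) g j k s) \<le> K * e * exp (Re s)) \<and>
        (\<forall>s\<in>strip. X n s = A z0 * (\<Sum>i\<le>n - 1. of_nat ((n - 1) choose i) * (X i s * X (n - 1 - i) s))
           + of_real e * exp s * ((\<Sum>i<n. \<Sum>l<n. M i l (z0 + of_real e * exp s) * (X i s * X l s))
             + (\<Sum>i<n. N i (z0 + of_real e * exp s) * X i s) + d (z0 + of_real e * exp s))))"
        by (elim exE conjE) (rule that; assumption)
      show "\<exists>e0 K. 0 < e0 \<and> e0 < R \<and> (\<forall>e. 0 < e \<and> e < e0 \<longrightarrow> (\<exists>X. jet_solution n A a b c z0 e X \<and>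
        (\<forall>k<n. \<forall>s\<in>strip. norm (X k s - lead (A z0) g j k s) \<le> K * e * exp (Re s))))"
      proof (rule exI[of _ e0], rule exI[of _ K], intro conjI e0 allI impI)
        fix e :: real assume e: "0 < e \<and> e < e0"
        show "\<exists>X. jet_solution n A a b c z0 e X \<and> (\<forall>k<n. \<forall>s\<in>strip. norm (X k s - lead (A z0) g j k s) \<le> K * e * exp (Re s))"
          using ex[rule_format, OF e] by (elim exE conjE) (rule exI, rule conjI, rule js, assumption+)
      qed
    qed
  qed (use hM hN hd in auto)
qed

text \<open>Stated for an arbitrary branch \<open>lg\<close> of the logarithm: the principal one
  gives the solution to which the Painleve property is applied, local ones cover the whole punctured
  disc afterwards.\<close>

lemma branch_solution:
  assumes n: "n \<ge> 2" and X: "jet_solution n A a b c z0 e X" and e: "e > 0" and V: "open V"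
    and lg: "\<And>z. z \<in> V \<Longrightarrow> lg z \<in> strip" "\<And>z. z \<in> V \<Longrightarrow> of_real e * exp (lg z) = z - z0"
      "\<And>z. z \<in> V \<Longrightarrow> (lg has_field_derivative 1 / (z - z0)) (at z)"
  defines "W \<equiv> \<lambda>k z. X k (lg z) / (z - z0) ^ Suc k"
  shows "\<And>k z. k < n \<Longrightarrow> z \<in> V \<Longrightarrow> (W k has_field_derivative W (Suc k) z) (at z)"
    and "\<And>k z. k \<le> n \<Longrightarrow> z \<in> V \<Longrightarrow> (deriv ^^ k) (W 0) z = W k z"
    and "\<And>z. z \<in> V \<Longrightarrow> quadratic_ode n A a b c (W 0) z"
proof -
  have nz: "z - z0 \<noteq> 0" if "z \<in> V" for z using lg(2)[OF that] e by (metis exp_not_eq_zero mult_eq_0_iff of_real_eq_0_iff less_irrefl)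
  show D: "(W k has_field_derivative W (Suc k) z) (at z)" if "k < n" "z \<in> V" for k z
  proof -
    have dX: "(X k has_field_derivative of_nat (Suc k) * X k (lg z) + X (Suc k) (lg z)) (at (lg z))"
      using X that lg(1) unfolding jet_solution_def by blast
    have "((\<lambda>z. X k (lg z)) has_field_derivative (of_nat (Suc k) * X k (lg z) + X (Suc k) (lg z)) * (1 / (z - z0))) (at z)"
      by (rule DERIV_chain2[OF dX lg(3)[OF that(2)]])
    moreover have "((\<lambda>z. (z - z0) ^ Suc k) has_field_derivative (1 + of_nat k) * (1 * (z - z0) ^ k)) (at z)"
      by (rule DERIV_power_Suc) (auto intro!: derivative_eq_intros)
    ultimately have d: "(W k has_field_derivative (((of_nat (Suc k) * X k (lg z) + X (Suc k) (lg z)) * (1 / (z - z0))) * (z - z0) ^ Suc k - X k (lg z) * ((1 + of_nat k) * (1 * (z - z0) ^ k))) / ((z - z0) ^ Suc k * (z - z0) ^ Suc k)) (at z)"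
      unfolding W_def using nz[OF that(2)] by (intro DERIV_divide) auto
    have alg: "(((of_nat (Suc k) * x + y) * (1 / h)) * h ^ Suc k - x * ((1 + of_nat k) * (1 * h ^ k))) / (h ^ Suc k * h ^ Suc k) = y / h ^ Suc (Suc k)" if "h \<noteq> 0" for x y h :: complex
      using that by (simp add: divide_simps) (simp add: algebra_simps)
    have E: "((of_nat (Suc k) * X k (lg z) + X (Suc k) (lg z)) * (1 / (z - z0)) * (z - z0) ^ Suc k - X k (lg z) * ((1 + of_nat k) * (1 * (z - z0) ^ k))) / ((z - z0) ^ Suc k * (z - z0) ^ Suc k) = W (Suc k) z"
      unfolding W_def by (rule alg[OF nz[OF that(2)]])
    show ?thesis using d unfolding E .
  qed
  show H: "(deriv ^^ k) (W 0) z = W k z" if "k \<le> n" "z \<in> V" for k z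
    by (rule higher_deriv_chain[of V "Suc n" W]) (use V D that in auto)
  show "quadratic_ode n A a b c (W 0) z" if z: "z \<in> V" for z
  proof -
    define h where "h = z - z0"
    have h: "h \<noteq> 0" using nz[OF z] by (simp add: h_def)
    let ?X = "\<lambda>k. X k (lg z)"
    have zz: "of_real e * exp (lg z) = h" "z0 + of_real e * exp (lg z) = z" using lg(2)[OF z] by (auto simp: h_def)
    have top: "?X n = A z * (\<Sum>i\<le>n - 1. of_nat ((n - 1) choose i) * (?X i * ?X (n - 1 - i)))
          + (\<Sum>(k, j)\<in>quadratic_index n. a k j z * h ^ (n - 1 - k - j) * (?X k * ?X j))
          + (\<Sum>j=0..n - 1. b j z * h ^ (n - j) * ?X j) + h ^ Suc n * c z"
      using X lg(1)[OF z] zz unfolding jet_solution_def Let_def by simp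
    have Wk: "W k z = ?X k / h ^ Suc k" for k by (simp add: W_def h_def)
    have Whol: "W 0 holomorphic_on V" by (rule holomorphic_on_derivI[OF D]) (use n in auto)
    have sq: "(deriv ^^ (n - 1)) (\<lambda>x. (W 0 x)\<^sup>2) z = (\<Sum>i\<le>n - 1. of_nat ((n - 1) choose i) * W i z * W (n - 1 - i) z)"
      unfolding higher_deriv_square[OF Whol V z] using H[OF _ z] by (intro sum.cong) auto
    have 1: "(\<Sum>i\<le>n - 1. of_nat ((n - 1) choose i) * (?X i * ?X (n - 1 - i))) = h ^ Suc n * (\<Sum>i\<le>n - 1. of_nat ((n - 1) choose i) * W i z * W (n - 1 - i) z)"
      unfolding sum_distrib_left
    proof (intro sum.cong refl)
      fix i assume "i \<in> {..n - 1}"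
      then have "Suc n = Suc i + Suc (n - 1 - i)" using n by auto
      then have "h ^ Suc n = h ^ Suc i * h ^ Suc (n - 1 - i)" by (metis power_add)
      then show "of_nat ((n - 1) choose i) * (?X i * ?X (n - 1 - i)) = h ^ Suc n * (of_nat ((n - 1) choose i) * W i z * W (n - 1 - i) z)"
        unfolding Wk using h by simp
    qed
    have 2: "(\<Sum>(k, j)\<in>quadratic_index n. a k j z * h ^ (n - 1 - k - j) * (?X k * ?X j)) = h ^ Suc n * (\<Sum>(k, j)\<in>quadratic_index n. a k j z * W k z * W j z)"
      unfolding sum_distrib_left
    proof (intro sum.cong refl)
      fix p assume p: "p \<in> quadratic_index n"
      obtain k j where kj: "p = (k, j)" by fastforce
      have "Suc n = (n - 1 - k - j) + (Suc k + Suc j)" using p by (auto simp: quadratic_index_def kj)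
      then have "h ^ Suc n = h ^ (n - 1 - k - j) * (h ^ Suc k * h ^ Suc j)" by (metis power_add)
      then show "(case p of (k, j) \<Rightarrow> a k j z * h ^ (n - 1 - k - j) * (?X k * ?X j)) = h ^ Suc n * (case p of (k, j) \<Rightarrow> a k j z * W k z * W j z)"
        unfolding Wk using h by (simp add: kj)
    qed
    have 3: "(\<Sum>j=0..n - 1. b j z * h ^ (n - j) * ?X j) = h ^ Suc n * (\<Sum>j=0..n - 1. b j z * W j z)"
      unfolding sum_distrib_left
    proof (intro sum.cong refl)
      fix j assume "j \<in> {0..n - 1}"
      then have "Suc n = (n - j) + Suc j" using n by auto
      then have "h ^ Suc n = h ^ (n - j) * h ^ Suc j" by (metis power_add)
      then show "b j z * h ^ (n - j) * ?X j = h ^ Suc n * (b j z * W j z)" unfolding Wk using h by simp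
    qed
    have "h ^ Suc n * W n z = ?X n" unfolding Wk using h by simp
    also have "\<dots> = h ^ Suc n * (A z * (\<Sum>i\<le>n - 1. of_nat ((n - 1) choose i) * W i z * W (n - 1 - i) z)
       + (\<Sum>(k, j)\<in>quadratic_index n. a k j z * W k z * W j z) + (\<Sum>j=0..n - 1. b j z * W j z) + c z)"
      unfolding top 1 2 3 by (simp only: distrib_left mult.left_commute)
    finally have eq: "W n z = A z * (\<Sum>i\<le>n - 1. of_nat ((n - 1) choose i) * W i z * W (n - 1 - i) z)
       + (\<Sum>(k, j)\<in>quadratic_index n. a k j z * W k z * W j z) + (\<Sum>j=0..n - 1. b j z * W j z) + c z"
      using h by (simp only: mult_cancel_left power_eq_0_iff) simp
    have 4: "(\<Sum>(k, j)\<in>quadratic_index n. a k j z * (deriv ^^ k) (W 0) z * (deriv ^^ j) (W 0) z) = (\<Sum>(k, j)\<in>quadratic_index n. a k j z * W k z * W j z)"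
    proof (intro sum.cong refl)
      fix p assume p: "p \<in> quadratic_index n"
      obtain k j where kj: "p = (k, j)" by fastforce
      then have "k \<le> n" "j \<le> n" using quadratic_index_less p by fastforce+
      then show "(case p of (k, j) \<Rightarrow> a k j z * (deriv ^^ k) (W 0) z * (deriv ^^ j) (W 0) z) = (case p of (k, j) \<Rightarrow> a k j z * W k z * W j z)"
        using H[OF _ z] kj by simp
    qed
    have 5: "(\<Sum>j=0..n - 1. b j z * (deriv ^^ j) (W 0) z) = (\<Sum>j=0..n - 1. b j z * W j z)"
      using H[OF _ z] by (intro sum.cong) auto
    show ?thesis unfolding quadratic_ode_def sq 4 5 using eq H[OF _ z, of n] by simp
  qed
qed

lemma Ln_branch:
  assumes e: "e > 0" and z: "0 < Re (z - z0)" "dist z0 z < e"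
  shows "Ln ((z - z0) / of_real e) \<in> strip" "of_real e * exp (Ln ((z - z0) / of_real e)) = z - z0"
    "((\<lambda>z. Ln ((z - z0) / of_real e)) has_field_derivative 1 / (z - z0)) (at z)"
proof -
  have nz: "z - z0 \<noteq> 0" using z by auto
  then have t: "(z - z0) / of_real e \<noteq> 0" using e by simp
  have "norm ((z - z0) / of_real e) < 1" using z e by (simp add: norm_divide dist_norm norm_minus_commute)
  then have "ln (norm ((z - z0) / of_real e)) < 0" using t by (subst ln_less_zero_iff) auto
  moreover have "\<bar>Im (Ln ((z - z0) / of_real e))\<bar> < 4"
    using Im_Ln_le_pi[OF t] mpi_less_Im_Ln[OF t] pi_less_4 by linarith
  ultimately show "Ln ((z - z0) / of_real e) \<in> strip" using t by (simp add: strip_def)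
  show "of_real e * exp (Ln ((z - z0) / of_real e)) = z - z0" using t e by simp
  have "Re ((z - z0) / of_real e) > 0" using z e by simp
  then have "(z - z0) / of_real e \<notin> \<real>\<^sub>\<le>\<^sub>0" using complex_nonpos_Reals_iff by auto
  then show "((\<lambda>z. Ln ((z - z0) / of_real e)) has_field_derivative 1 / (z - z0)) (at z)"
    using e nz by (auto intro!: derivative_eq_intros simp: field_simps)
qed

section \<open>Single-valuedness\<close>

lemma holomorphic_continuable_along:
  assumes "f holomorphic_on U" "open U" "path_image \<gamma> \<subseteq> U"
  shows "continuable_along f \<gamma>"
  unfolding continuable_along_def analytic_continuation_def
proof (intro exI[of _ "\<lambda>_. f"] conjI ballI)
  fix t :: real assume t: "t \<in> {0..1}"
  then have "\<gamma> t \<in> U" using assms(3) by (auto simp: path_image_def)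
  then show "f analytic_on {\<gamma> t}" using assms(1,2) analytic_at by blast
  show "\<exists>\<delta>>0. \<forall>s\<in>{0..1}. \<bar>s - t\<bar> < \<delta> \<longrightarrow> (\<forall>\<^sub>F z in nhds (\<gamma> s). f z = f z)"
    by (intro exI[of _ 1]) simp
qed simp

text \<open>The imaginary parts differ by less than 8, which is less than 4 pi.\<close>

lemma exp_eq_strip:
  assumes "s \<in> strip" "s' \<in> strip" "exp s = exp s'"
  shows "s' = s \<or> s' = s + 2 * of_real pi * \<i> \<or> s = s' + 2 * of_real pi * \<i>"
proof -
  obtain m :: int where m: "s = s' + complex_of_real (real_of_int (2 * m) * pi) * \<i>" using assms(3) exp_eq by blast
  then have im: "Im s = Im s' + 2 * real_of_int m * pi" by simp
  have "\<bar>Im s - Im s'\<bar> < 8" using assms(1,2) unfolding strip_def by (simp, linarith)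
  then have "\<bar>real_of_int m\<bar> * pi < 4" using im pi_gt_zero by (simp add: abs_mult mult.commute)
  moreover have "2 * pi \<le> \<bar>real_of_int m\<bar> * pi" if "2 \<le> \<bar>real_of_int m\<bar>" using that by (intro mult_right_mono) auto
  ultimately have "\<bar>real_of_int m\<bar> < 2" using pi_gt3 by linarith
  then have "m = 0 \<or> m = 1 \<or> m = -1" by linarith
  then show ?thesis using m by auto
qed

text \<open>Along the segment to \<open>z0\<close> the principal branch has a movable singularity:
  (z - z0) w tends to - 1 / A0, so w is not analytic there. If it is a pole, then near
  \<open>z0\<close> the solution is given by a function on a punctured disc, so X 0 is periodic far
  to the left, hence wherever two periods fit into the strip.\<close>

lemma strong_Painleve_single_valued:
  assumes n: "n \<ge> 2" and U: "open U" "coeffs_holomorphic n A a b c U" and sP: "strong_Painleve n A a b c U"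
    and e: "e > 0" "ball z0 e \<subseteq> U" and X: "jet_solution n A a b c z0 e X" and A0: "A0 \<noteq> 0"
    and close: "\<And>s. s \<in> strip \<Longrightarrow> norm (X 0 s - lead A0 g j 0 s) \<le> K * exp (Re s)"
  shows "\<exists>w. w holomorphic_on ball z0 e - {z0} \<and> (\<forall>z\<in>ball z0 e - {z0}. quadratic_ode n A a b c w z) \<and>
    (\<forall>k<n. \<forall>s\<in>strip. (deriv ^^ k) w (z0 + of_real e * exp s) * (of_real e * exp s) ^ Suc k = X k s)"
proof -
  have chain: "(X k has_field_derivative of_nat (Suc k) * X k s + X (Suc k) s) (at s)" if "k < n" "s \<in> strip" for k s
    using X that unfolding jet_solution_def by blast
  have X0h: "X 0 holomorphic_on strip" by (rule holomorphic_on_derivI[OF chain]) (use n in auto)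
  let ?lg = "\<lambda>z. Ln ((z - z0) / of_real e)" and ?E = "\<lambda>s. z0 + of_real e * exp s"
  define S where "S = {z. 0 < Re (z - z0)} \<inter> ball z0 e"
  have S: "open S" unfolding S_def by (intro open_Int open_ball open_Collect_less continuous_intros)
  have lgS: "?lg z \<in> strip" "of_real e * exp (?lg z) = z - z0" "(?lg has_field_derivative 1 / (z - z0)) (at z)" if "z \<in> S" for z
    using Ln_branch[OF e(1), of z z0] that by (auto simp: S_def)
  define w0 where "w0 z = X 0 (?lg z) / (z - z0) ^ Suc 0" for z
  have br1: "((\<lambda>z. X k (?lg z) / (z - z0) ^ Suc k) has_field_derivative X (Suc k) (?lg y) / (y - z0) ^ Suc (Suc k)) (at y)" if "k < n" "y \<in> S" for k y
      by (rule branch_solution(1)[OF n X e(1) S, of ?lg]) (use lgS that in auto)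
    have br3: "quadratic_ode n A a b c (\<lambda>z. X 0 (?lg z) / (z - z0) ^ Suc 0) y" if "y \<in> S" for y
      by (rule branch_solution(3)[OF n X e(1) S, of ?lg]) (use lgS that in auto)
  have w0h: "w0 holomorphic_on S" unfolding w0_def[abs_def] by (rule holomorphic_on_derivI[OF br1]) (use n in auto)
  have w0ode: "quadratic_ode n A a b c w0 z" if "z \<in> S" for z unfolding w0_def[abs_def] by (rule br3[OF that])
  define \<gamma> where "\<gamma> = linepath (z0 + of_real (e / 2)) z0"
  have \<gamma>t: "\<gamma> t = z0 + of_real ((1 - t) * e / 2)" for t by (simp add: \<gamma>_def linepath_def scaleR_conv_of_real algebra_simps)
  have \<gamma>S: "\<gamma> t \<in> S" if "t \<in> {0..<1}" for t
  proof -
    have "(1 - t) * e / 2 > 0" "(1 - t) * e / 2 < e" using that e(1) by (auto simp: field_simps intro: add_pos_nonneg)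
    then show ?thesis by (simp add: \<gamma>t S_def dist_norm del: of_real_mult of_real_divide of_real_diff)
  qed
  have \<gamma>p: "path \<gamma>" by (simp add: \<gamma>_def)
  have \<gamma>U: "path_image \<gamma> \<subseteq> U"
  proof -
    have "\<gamma> t \<in> ball z0 e" if "t \<in> {0..1}" for t using \<gamma>S[of t] that e(1) by (cases "t = 1") (auto simp: \<gamma>t S_def)
    then show ?thesis using e(2) by (auto simp: path_image_def)
  qed
  have "analytic_continuation w0 \<gamma> {0..<1} (\<lambda>_. w0)"
    unfolding analytic_continuation_def
  proof (intro conjI ballI)
    fix t :: real assume "t \<in> {0..<1}"
    then show "w0 analytic_on {\<gamma> t}" using w0h S \<gamma>S analytic_at by blast
    show "\<exists>\<delta>>0. \<forall>s\<in>{0..<1}. \<bar>s - t\<bar> < \<delta> \<longrightarrow> (\<forall>\<^sub>F z in nhds (\<gamma> s). w0 z = w0 z)" by (intro exI[of _ 1]) simp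
  qed simp
  \<comment> \<open>A germ of w0 at \<open>z0\<close> would make (z - z0) w0 tend to 0 along the
    path, but this product is \<open>X 0\<close> at the logarithm, with limit - 1 / A0.\<close>
  moreover have "\<not> continuable_along w0 \<gamma>"
  proof
    assume "continuable_along w0 \<gamma>"
    then obtain G where G: "analytic_continuation w0 \<gamma> {0..1} G" by (auto simp: continuable_along_def)
    have G': "analytic_continuation w0 \<gamma> {0..<1} G" using G unfolding analytic_continuation_def
      by (meson atLeastAtMost_iff atLeastLessThan_iff less_imp_le)
    \<comment> \<open>The factor 1 is the denominator in \<open>eventually_quotient_iff\<close>,
      used here for plain equality of germs.\<close>
    have Gw: "\<forall>\<^sub>F z in nhds (\<gamma> t). G t z * 1 = w0 z" if t: "t \<in> {0..<1}" for t
    proof (rule connected_locally_constant[where T = "{0..<1}" and a = 0])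
      show "\<forall>\<^sub>F z in nhds (\<gamma> 0). G 0 z * 1 = w0 z" using G by (simp add: analytic_continuation_def)
      show "\<forall>\<^sub>F s in at t within {0..<1}. (\<forall>\<^sub>F z in nhds (\<gamma> s). G s z * 1 = w0 z) = (\<forall>\<^sub>F z in nhds (\<gamma> t). G t z * 1 = w0 z)"
        if "t \<in> {0..<1}" for t
        by (rule eventually_quotient_iff[OF G' \<gamma>p that _ S w0h]) (use \<gamma>S[OF that] in auto)
    qed (use t in auto)
    have one: "(1::real) \<in> {0..1}" by simp
    have "\<forall>\<^sub>F s in at 1 within {0..1}. \<forall>\<^sub>F z in nhds (\<gamma> s). G s z = G 1 z" by (rule germ_near[OF G one])
    then have "\<forall>\<^sub>F s in at 1 within {0..<1}. \<forall>\<^sub>F z in nhds (\<gamma> s). G s z = G 1 z"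
      by (rule filter_leD[OF at_le, rotated]) auto
    moreover have in01: "\<forall>\<^sub>F s in at 1 within {0..<1}. (s::real) \<in> {0..<1}" by (simp add: eventually_at_filter)
    ultimately have ev: "\<forall>\<^sub>F s in at 1 within {0..<1}. G 1 (\<gamma> s) * (\<gamma> s - z0) = X 0 (?lg (\<gamma> s))"
    proof eventually_elim
      case (elim s)
      have "\<forall>\<^sub>F z in nhds (\<gamma> s). G 1 z = w0 z" using elim(1) Gw[OF elim(2)] by eventually_elim simp
      then have "G 1 (\<gamma> s) = w0 (\<gamma> s)" by (rule eventually_nhds_x_imp_x)
      moreover have "\<gamma> s - z0 \<noteq> 0" using \<gamma>S[OF elim(2)] by (auto simp: S_def)
      ultimately show ?case by (simp add: w0_def)
    qed
    have g1: "\<gamma> 1 = z0" by (simp add: \<gamma>t)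
    have lim\<gamma>: "(\<gamma> \<longlongrightarrow> z0) (at 1 within {0..<1})"
    proof -
      have "((\<lambda>t. z0 + of_real ((1 - t) * e / 2)) \<longlongrightarrow> z0 + of_real ((1 - 1) * e / 2)) (at 1 within {0..<1})"
        by (intro tendsto_intros) simp
      then show ?thesis by (simp add: \<gamma>t[abs_def])
    qed
    have "G 1 analytic_on {z0}" using G g1 by (force simp: analytic_continuation_def)
    then have "isCont (G 1) z0" by (rule analytic_at_imp_isCont)
    then have "((\<lambda>s. G 1 (\<gamma> s)) \<longlongrightarrow> G 1 z0) (at 1 within {0..<1})" by (rule isCont_tendsto_compose[OF _ lim\<gamma>])
    then have "((\<lambda>s. G 1 (\<gamma> s) * (\<gamma> s - z0)) \<longlongrightarrow> G 1 z0 * (z0 - z0)) (at 1 within {0..<1})"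
      by (intro tendsto_intros lim\<gamma>)
    then have L0: "((\<lambda>s. X 0 (?lg (\<gamma> s))) \<longlongrightarrow> 0) (at 1 within {0..<1})"
      using ev by (simp add: Lim_transform_eventually)
    define tt where "tt s = (1 - s) / 2" for s :: real
    have ex: "exp (?lg (\<gamma> s)) = of_real (tt s)" if "s \<in> {0..<1}" for s
    proof -
      have "(\<gamma> s - z0) / of_real e = of_real (tt s)" using e(1) by (simp add: \<gamma>t tt_def)
      moreover have "tt s \<noteq> 0" using that by (simp add: tt_def)
      ultimately show ?thesis by simp
    qed
    have ld: "lead A0 g j 0 s = - (1 / A0) + g * exp s ^ (j + 1)" for s by (simp add: lead_def ffact_def)
    have "\<forall>\<^sub>F s in at 1 within {0..<1}. norm (X 0 (?lg (\<gamma> s)) - (- (1 / A0) + g * of_real (tt s) ^ (j + 1))) \<le> K * tt s"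
      using in01
    proof eventually_elim
      case (elim s)
      have "norm (exp (?lg (\<gamma> s))) = tt s" unfolding ex[OF elim] norm_of_real using elim by (simp add: tt_def)
      then have "exp (Re (?lg (\<gamma> s))) = tt s" by simp
      then show ?case using close[OF lgS(1)[OF \<gamma>S[OF elim]]] unfolding ld ex[OF elim] by simp
    qed
    moreover
    have "((\<lambda>s. K * tt s) \<longlongrightarrow> K * ((1 - 1) / 2)) (at 1 within {0..<1})" unfolding tt_def by (intro tendsto_intros) auto
    then have "((\<lambda>s. K * tt s) \<longlongrightarrow> 0) (at 1 within {0..<1})" by simp
    ultimately have "((\<lambda>s. X 0 (?lg (\<gamma> s)) - (- (1 / A0) + g * of_real (tt s) ^ (j + 1))) \<longlongrightarrow> 0) (at 1 within {0..<1})"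
      by (rule Lim_null_comparison)
    moreover have "((\<lambda>s. - (1 / A0) + g * of_real (tt s) ^ (j + 1)) \<longlongrightarrow> - (1 / A0) + g * of_real ((1 - 1) / 2) ^ (j + 1)) (at 1 within {0..<1})"
      unfolding tt_def by (intro tendsto_intros) auto
    ultimately have "((\<lambda>s. X 0 (?lg (\<gamma> s)) - (- (1 / A0) + g * of_real (tt s) ^ (j + 1)) + (- (1 / A0) + g * of_real (tt s) ^ (j + 1))) \<longlongrightarrow> 0 + (- (1 / A0) + g * of_real ((1 - 1) / 2) ^ (j + 1))) (at 1 within {0..<1})"
      by (rule tendsto_add)
    then have "((\<lambda>s. X 0 (?lg (\<gamma> s))) \<longlongrightarrow> - (1 / A0)) (at 1 within {0..<1})" by simp
    moreover have "at (1::real) within {0..<1} \<noteq> bot"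
      by (simp add: trivial_limit_within islimpt_Ico)
    ultimately have "- (1 / A0) = 0" using tendsto_unique L0 by blast
    then show False using A0 by simp
  qed
  ultimately have sing: "comes_to_singularity w0 \<gamma> (\<lambda>_. w0)" by (simp add: comes_to_singularity_def)
  have "movable_singularity n A a b c U w0 \<gamma> (\<lambda>_. w0)"
    unfolding movable_singularity_def
  proof (intro conjI)
    show "path \<gamma>" by (rule \<gamma>p)
    show "pathstart \<gamma> \<in> U" using \<gamma>U by auto
    show "\<exists>S. open S \<and> pathstart \<gamma> \<in> S \<and> S \<subseteq> U \<and> w0 holomorphic_on S \<and> (\<forall>z\<in>S. quadratic_ode n A a b c w0 z)"
    proof (intro exI[of _ S] conjI)
      show "pathstart \<gamma> \<in> S" using \<gamma>S[of 0] by (simp add: pathstart_def)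
      show "S \<subseteq> U" using e(2) by (auto simp: S_def)
    qed (use S w0h w0ode in auto)
    show "continuable_along A \<gamma>" "continuable_along c \<gamma>"
      using U \<gamma>U by (auto simp: coeffs_holomorphic_def intro: holomorphic_continuable_along)
    show "\<forall>(k, j)\<in>quadratic_index n. continuable_along (a k j) \<gamma>" "\<forall>j\<in>{0..n - 1}. continuable_along (b j) \<gamma>"
      using U \<gamma>U by (auto simp: coeffs_holomorphic_def intro!: holomorphic_continuable_along)
  qed (rule sing)
  then have "singularity_is_pole \<gamma> (\<lambda>_. w0)" using sP by (simp add: strong_Painleve_def)
  then obtain h r \<delta> where h: "r > 0" "h holomorphic_on (ball (\<gamma> 1) r - {\<gamma> 1})" "\<delta> > 0"
    "\<And>t. t \<in> {0..<1} \<Longrightarrow> 1 - t < \<delta> \<Longrightarrow> \<forall>\<^sub>F z in nhds (\<gamma> t). w0 z = h z"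
    unfolding singularity_is_pole_def by blast
  have g1: "\<gamma> 1 = z0" by (simp add: \<gamma>t)
  \<comment> \<open>The part of the strip lying over the punctured disc where the function
    \<open>h\<close> from the pole is defined.\<close>
  define \<Omega> where "\<Omega> = strip \<inter> {s. Re s < ln (r / e)}"
  have \<Omega>: "open \<Omega>" "connected \<Omega>" unfolding \<Omega>_def
    by (intro open_Int open_strip open_halfspace_Re_lt, intro convex_connected convex_Int convex_strip convex_halfspace_Re_lt)
  have E\<Omega>: "?E s \<in> ball z0 r - {z0}" if "s \<in> \<Omega>" for s
  proof -
    have "exp (Re s) < exp (ln (r / e))" using that by (simp add: \<Omega>_def)
    then have "e * exp (Re s) < r" using e(1) h(1) by (simp add: field_simps)
    then show ?thesis using e(1) by (simp add: dist_norm norm_mult)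
  qed
  define f2 where "f2 s = h (?E s) * (of_real e * exp s)" for s
  have f2h: "f2 holomorphic_on \<Omega>"
  proof -
    have "(h \<circ> ?E) holomorphic_on \<Omega>"
      by (rule holomorphic_on_compose_gen[of _ _ h "ball z0 r - {z0}"]) (use h(2) g1 E\<Omega> in \<open>auto intro!: holomorphic_intros\<close>)
    then show ?thesis unfolding f2_def[abs_def] o_def by (intro holomorphic_intros)
  qed
  \<comment> \<open>So late that the germs are those of \<open>h\<close> and
    \<open>\<gamma> t1\<close> lies in its disc; the 1/2 keeps the parameter non-negative.\<close>
  define t1 where "t1 = max (1/2) (max (1 - \<delta> / 2) (1 - r / e))"
  have t1: "t1 \<in> {0..<1}" "1 - t1 < \<delta>" "(1 - t1) / 2 < r / e" 
  proof -
    have re: "r / e > 0" using h(1) e(1) by simp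
    then show "t1 \<in> {0..<1}" "1 - t1 < \<delta>" using h(3) unfolding t1_def atLeastLessThan_iff by linarith+
    have "1 - r / e \<le> t1" by (simp add: t1_def)
    moreover have "(1 - t1) / 2 = 1 / 2 - t1 / 2" by (simp add: diff_divide_distrib)
    ultimately show "(1 - t1) / 2 < r / e" using re by linarith
  qed
  define s1 :: complex where "s1 = of_real (ln ((1 - t1) / 2))"
  have s1e: "exp s1 = of_real ((1 - t1) / 2)" using t1 by (simp add: s1_def exp_of_real)
  have Es1: "?E s1 = \<gamma> t1" unfolding s1e \<gamma>t by (simp add: mult.commute)
  have s1\<Omega>: "s1 \<in> \<Omega>"
  proof -
    have "(1 - t1) / 2 < 1" "0 < (1 - t1) / 2" using t1(1) by auto
    then have "ln ((1 - t1) / 2) < 0" by simp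
    moreover have "ln ((1 - t1) / 2) < ln (r / e)" using t1 h(1) e(1) \<open>0 < (1 - t1) / 2\<close> by (subst ln_less_cancel_iff) auto
    ultimately show ?thesis by (simp add: \<Omega>_def strip_def s1_def)
  qed
  have X0f2: "X 0 s = f2 s" if "s \<in> \<Omega>" for s
  proof (rule eq_on_connected[of "X 0" \<Omega> f2 s1])
    have "((\<lambda>s. ?E s) \<longlongrightarrow> ?E s1) (nhds s1)" by (intro tendsto_intros filterlim_ident)
    then have "filterlim ?E (nhds (\<gamma> t1)) (nhds s1)" unfolding Es1 .
    from eventually_compose_filterlim[OF h(4)[OF t1(1,2)] this]
    have "\<forall>\<^sub>F s in nhds s1. w0 (?E s) = h (?E s)" .
    moreover have "\<forall>\<^sub>F s in nhds s1. s \<in> {s. Im s < pi} \<inter> {s. Im s > - pi}"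
      by (rule eventually_nhds_in_open) (auto simp: s1_def intro!: open_Int open_halfspace_Im_lt open_halfspace_Im_gt)
    ultimately show "\<forall>\<^sub>F s in nhds s1. X 0 s = f2 s"
    proof eventually_elim
      case (elim s)
      have "Ln ((?E s - z0) / of_real e) = s" using elim(2) e(1) by simp
      then have "w0 (?E s) = X 0 s / (of_real e * exp s)" by (simp add: w0_def)
      then show ?case using elim(1) e(1) by (simp add: f2_def field_simps)
    qed
    show "X 0 holomorphic_on \<Omega>" using X0h by (rule holomorphic_on_subset) (simp add: \<Omega>_def)
  qed (use \<Omega> f2h s1\<Omega> that in auto)
  let ?p = "2 * of_real pi * \<i> :: complex"
  \<comment> \<open>The points of the strip whose translate by 2 pi i is again in the strip;
    non-empty because 2 pi < 8.\<close>
  define Q where "Q = {s. Re s < 0} \<inter> ({s. Im s > - 4} \<inter> {s. Im s < 4 - 2 * pi})"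
  have Q: "open Q" "connected Q" unfolding Q_def
    by (intro open_Int open_halfspace_Re_lt open_halfspace_Im_lt open_halfspace_Im_gt, intro convex_connected convex_Int convex_halfspace_Re_lt convex_halfspace_Im_lt convex_halfspace_Im_gt)
  have QS: "s \<in> strip" "s + ?p \<in> strip" if "s \<in> Q" for s
    using that pi_gt3 by (auto simp: Q_def strip_def)
  have SQ: "s \<in> Q" if "s \<in> strip" "s + ?p \<in> strip" for s using that by (auto simp: Q_def strip_def)
  have shift: "((\<lambda>s. X k (s + ?p)) has_field_derivative of_nat (Suc k) * X k (s + ?p) + X (Suc k) (s + ?p)) (at s)" if "k < n" "s \<in> Q" for k s
    using chain[OF that(1) QS(2)[OF that(2)]] by (rule DERIV_shift[THEN iffD1])
  have exp_p: "exp (s + ?p) = exp s" for s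
  proof -
    have "exp ?p = 1" using exp_two_pi_i by simp
    then show ?thesis by (simp add: exp_add)
  qed
  \<comment> \<open>Periodicity passes from \<open>X k\<close> to the next function because the
    latter is the derivative of \<open>X k\<close> minus \<open>Suc k\<close> times
    \<open>X k\<close>.\<close>
  have per: "\<forall>s\<in>Q. X k (s + ?p) = X k s" if "k \<le> n" for k using that
  proof (induction k)
    case 0
    \<comment> \<open>Height -pi, so that the translate has height pi and both lie in the strip; far
      enough to the left that both lie in \<Omega>.\<close>
    define s2 where "s2 = Complex (min (-1) (ln (r / e) - 1)) (- pi)"
    have s2: "s2 \<in> Q" using pi_less_4 by (simp add: Q_def s2_def)
    have "\<forall>\<^sub>F s in nhds s2. s \<in> Q \<inter> {s. Re s < ln (r / e)}"
      by (rule eventually_nhds_in_open) (use Q s2 in \<open>auto simp: s2_def intro!: open_Int open_halfspace_Re_lt\<close>)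
    then have ev: "\<forall>\<^sub>F s in nhds s2. X 0 (s + ?p) = X 0 s"
    proof eventually_elim
      case (elim s)
      then have "s \<in> \<Omega>" "s + ?p \<in> \<Omega>" using QS by (auto simp: \<Omega>_def)
      then show ?case using X0f2 exp_p by (simp add: f2_def)
    qed
    show ?case
    proof
      fix s assume s: "s \<in> Q"
      show "X 0 (s + ?p) = X 0 s"
      proof (rule eq_on_connected[of "\<lambda>s. X 0 (s + ?p)" Q "X 0" s2])
        show "(\<lambda>s. X 0 (s + ?p)) holomorphic_on Q" by (rule holomorphic_on_derivI[OF shift]) (use n in auto)
        show "X 0 holomorphic_on Q" using X0h by (rule holomorphic_on_subset) (use QS in blast)
      qed (use Q s2 ev s in auto)
    qed
  next
    case (Suc k)
    show ?case
    proof
      fix s assume s: "s \<in> Q"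
      have IH: "\<forall>s\<in>Q. X k (s + ?p) = X k s" using Suc by simp
      have "((\<lambda>s. X k (s + ?p)) has_field_derivative of_nat (Suc k) * X k s + X (Suc k) s) (at s)"
        by (rule has_field_derivative_transform_within_open[OF chain[OF _ QS(1)[OF s]] Q(1) s]) (use Suc IH in auto)
      then have "of_nat (Suc k) * X k (s + ?p) + X (Suc k) (s + ?p) = of_nat (Suc k) * X k s + X (Suc k) s"
        using DERIV_unique[OF shift[OF _ s]] Suc by simp
      then show "X (Suc k) (s + ?p) = X (Suc k) s" using IH s by simp
    qed
  qed
  have expX: "X k s = X k s'" if "k \<le> n" "s \<in> strip" "s' \<in> strip" "exp s = exp s'" for k s s'
    using exp_eq_strip[OF that(2-4)] per[OF that(1)] SQ that by metis
  let ?P = "ball z0 e - {z0}"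
  define w where "w z = X 0 (?lg z) / (z - z0) ^ Suc 0" for z
  \<comment> \<open>The principal logarithm jumps on the negative axis, so each point gets its own
    branch with values in the strip. By \<open>expX\<close> the value of w does not depend on the
    branch.\<close>
  have local: "\<exists>V lg. open V \<and> z \<in> V \<and> V \<subseteq> ?P \<and> (\<forall>z\<in>V. lg z \<in> strip \<and> of_real e * exp (lg z) = z - z0 \<and> (lg has_field_derivative 1 / (z - z0)) (at z))"
    if z: "z \<in> ?P" for z
  proof -
    define t where "t = (z - z0) / of_real e"
    have t: "t \<noteq> 0" using z e(1) by (simp add: t_def)
    have "norm t < 1" using z e(1) by (simp add: t_def norm_divide dist_norm norm_minus_commute)
    then have "ln (norm t) < 0" using t by (subst ln_less_zero_iff) auto
    moreover have "\<bar>Im (Ln t)\<bar> < 4" using Im_Ln_le_pi[OF t] mpi_less_Im_Ln[OF t] pi_less_4 by linarith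
    ultimately have Lnt: "Ln t \<in> strip" using t by (simp add: strip_def)
    define D where "D = {y. 0 < Re ((y - z0) / of_real e / t)}"
    define lg where "lg y = Ln ((y - z0) / of_real e / t) + Ln t" for y
    have D: "open D" unfolding D_def by (intro open_Collect_less continuous_intros) (use e(1) t in auto)
    have zt: "(z - z0) / of_real e / t = 1" using t unfolding t_def by (rule divide_self)
    have zD: "z \<in> D" unfolding D_def mem_Collect_eq zt by simp
    have lgd: "(lg has_field_derivative 1 / (y - z0)) (at y)" if "y \<in> D" for y
    proof -
      have "(y - z0) / of_real e / t \<notin> \<real>\<^sub>\<le>\<^sub>0" using that complex_nonpos_Reals_iff by (auto simp: D_def)
      moreover have "y - z0 \<noteq> 0" using that by (auto simp: D_def)
      ultimately show ?thesis unfolding lg_def[abs_def] using e(1) t by (auto intro!: derivative_eq_intros simp: field_simps)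
    qed
    define V where "V = D \<inter> lg -` strip"
    have "continuous_on D lg" by (rule holomorphic_on_imp_continuous_on[OF holomorphic_on_derivI[OF lgd]])
    then have V: "open V" unfolding V_def using D open_strip by (rule continuous_open_preimage)
    have zV: "z \<in> V" using zD Lnt unfolding V_def lg_def vimage_def Int_iff mem_Collect_eq zt by simp
    have elg: "of_real e * exp (lg y) = y - z0" if "y \<in> V" for y
    proof -
      have "y - z0 \<noteq> 0" using that by (auto simp: V_def D_def)
      then show ?thesis using e(1) t by (simp add: lg_def exp_add)
    qed
    have "V \<subseteq> ?P"
    proof
      fix y assume y: "y \<in> V"
      have "norm (exp (lg y)) < 1" using y by (simp add: V_def strip_def)
      then have "e * norm (exp (lg y)) < e" using e(1) by simp
      then have "norm (y - z0) < e" unfolding elg[OF y, symmetric] norm_mult using e(1) by simp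
      moreover have "y - z0 \<noteq> 0" using y by (auto simp: V_def D_def)
      ultimately show "y \<in> ?P" by (simp add: dist_norm norm_minus_commute)
    qed
    moreover have "\<forall>y\<in>V. lg y \<in> strip \<and> of_real e * exp (lg y) = y - z0 \<and> (lg has_field_derivative 1 / (y - z0)) (at y)"
      using elg lgd by (auto simp: V_def)
    ultimately show ?thesis using V zV by blast
  qed
  have key: "(w has_field_derivative deriv w z) (at z) \<and> quadratic_ode n A a b c w z \<and>
      (\<forall>k\<le>n. \<forall>s\<in>strip. z = ?E s \<longrightarrow> (deriv ^^ k) w z * (of_real e * exp s) ^ Suc k = X k s)" if z: "z \<in> ?P" for z
  proof -
    obtain V lg where V: "open V" "z \<in> V" "V \<subseteq> ?P" and "\<forall>z\<in>V. lg z \<in> strip \<and> of_real e * exp (lg z) = z - z0 \<and> (lg has_field_derivative 1 / (z - z0)) (at z)"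
      using local[OF z] by (elim exE conjE) (rule that; assumption)
    then have lg: "lg z \<in> strip" "of_real e * exp (lg z) = z - z0" "(lg has_field_derivative 1 / (z - z0)) (at z)" if "z \<in> V" for z
      using that by blast+
    have br1: "((\<lambda>z. X k (lg z) / (z - z0) ^ Suc k) has_field_derivative X (Suc k) (lg y) / (y - z0) ^ Suc (Suc k)) (at y)" if "k < n" "y \<in> V" for k y
      by (rule branch_solution(1)[OF n X e(1) V(1), of lg]) (use lg that in auto)
    have br2: "(deriv ^^ k) (\<lambda>z. X 0 (lg z) / (z - z0) ^ Suc 0) y = X k (lg y) / (y - z0) ^ Suc k" if "k \<le> n" "y \<in> V" for k y
      by (rule branch_solution(2)[OF n X e(1) V(1), of lg]) (use lg that in auto)
    have br3: "quadratic_ode n A a b c (\<lambda>z. X 0 (lg z) / (z - z0) ^ Suc 0) y" if "y \<in> V" for y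
      by (rule branch_solution(3)[OF n X e(1) V(1), of lg]) (use lg that in auto)
    have weq: "w y = X 0 (lg y) / (y - z0) ^ Suc 0" if y: "y \<in> V" for y
    proof -
      have nz: "(y - z0) / of_real e \<noteq> 0" using y V e(1) by auto
      have "norm ((y - z0) / of_real e) < 1" using y V(3) e(1) by (auto simp: norm_divide dist_norm norm_minus_commute)
      then have "ln (norm ((y - z0) / of_real e)) < 0" using nz by (subst ln_less_zero_iff) auto
      moreover have "\<bar>Im (?lg y)\<bar> < 4" using Im_Ln_le_pi[OF nz] mpi_less_Im_Ln[OF nz] pi_less_4 by linarith
      ultimately have s: "?lg y \<in> strip" using nz by (simp add: strip_def)
      have "exp (?lg y) = exp (lg y)" using nz lg(2)[OF y] e(1) by (simp add: field_simps)
      then have "X 0 (?lg y) = X 0 (lg y)" by (intro expX s lg(1)[OF y]) auto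
      then show ?thesis by (simp add: w_def)
    qed
    have "((\<lambda>y. X 0 (lg y) / (y - z0) ^ Suc 0) has_field_derivative X (Suc 0) (lg z) / (z - z0) ^ Suc (Suc 0)) (at z)"
      by (rule br1[OF _ V(2)]) (use n in simp)
    then have "(w has_field_derivative X (Suc 0) (lg z) / (z - z0) ^ Suc (Suc 0)) (at z)"
      by (rule has_field_derivative_transform_within_open[OF _ V(1,2)]) (simp add: weq)
    then have "(w has_field_derivative deriv w z) (at z)" using DERIV_imp_deriv by force
    moreover have "quadratic_ode n A a b c w z"
      by (subst quadratic_ode_cong[OF V(1,2) _ coeffs_eq_refl]) (use weq br3[OF V(2)] in auto)
    moreover have "(deriv ^^ k) w z * (of_real e * exp s) ^ Suc k = X k s" if k: "k \<le> n" and s: "s \<in> strip" and zs: "z = ?E s" for k s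
    proof -
      have "(deriv ^^ k) w z = (deriv ^^ k) (\<lambda>y. X 0 (lg y) / (y - z0) ^ Suc 0) z"
        by (rule higher_deriv_cong_open[OF V(1,2) weq])
      also have "\<dots> = X k (lg z) / (z - z0) ^ Suc k" by (rule br2[OF k V(2)])
      finally have "(deriv ^^ k) w z = X k (lg z) / (z - z0) ^ Suc k" .
      moreover have "z - z0 = of_real e * exp s" using zs by simp
      moreover have "X k (lg z) = X k s"
      proof (rule expX[OF k lg(1)[OF V(2)] s])
        have "of_real e * exp (lg z) = of_real e * exp s" using lg(2)[OF V(2)] zs by simp
        then show "exp (lg z) = exp s" using e(1) by simp
      qed
      ultimately show ?thesis using e(1) by simp
    qed
    ultimately show ?thesis by blast
  qed
  show ?thesis
  proof (intro exI[of _ w] conjI ballI allI impI)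
    show "w holomorphic_on ?P" by (rule holomorphic_on_derivI) (use key in blast)
    show "quadratic_ode n A a b c w z" if "z \<in> ?P" for z using key[OF that] by blast
    fix k s assume k: "k < n" and s: "s \<in> strip"
    have "norm (exp s) < 1" using s by (simp add: strip_def)
    then have "e * norm (exp s) < e" using e(1) by simp
    then have "?E s \<in> ?P" using e(1) by (simp add: dist_norm norm_mult)
    then show "(deriv ^^ k) w (?E s) * (of_real e * exp s) ^ Suc k = X k s" using key[of "?E s", THEN conjunct2, THEN conjunct2, rule_format, of k s] k s by simp
  qed
qed

section \<open>Residues of the defect\<close>

text \<open>Integration by parts, repeated j times. The primitive G is built from derivatives, so it
  is single-valued also on domains that are not simply connected; this is what makes residues vanish
  later.\<close>

lemma concomitant:
  assumes "open S" "f holomorphic_on S" "u holomorphic_on S"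
  shows "\<exists>G. \<forall>z\<in>S. (G has_field_derivative f z * (deriv ^^ j) u z - (- 1) ^ j * (deriv ^^ j) f z * u z) (at z)"
  using assms(2)
proof (induction j arbitrary: f)
  case 0
  show ?case by (rule exI[of _ "\<lambda>_. 0"]) simp
next
  case (Suc j)
  have f': "deriv f holomorphic_on S" using Suc.prems assms(1) by (rule holomorphic_deriv)
  obtain G where G: "\<forall>z\<in>S. (G has_field_derivative deriv f z * (deriv ^^ j) u z - (- 1) ^ j * (deriv ^^ j) (deriv f) z * u z) (at z)"
    using Suc.IH[OF f'] by blast
  have uj: "(deriv ^^ j) u holomorphic_on S" using assms(3,1) by (rule holomorphic_higher_deriv)
  have "((\<lambda>z. f z * (deriv ^^ j) u z - G z) has_field_derivative f z * (deriv ^^ Suc j) u z - (- 1) ^ Suc j * (deriv ^^ Suc j) f z * u z) (at z)"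
    if z: "z \<in> S" for z
  proof -
    have "(f has_field_derivative deriv f z) (at z)" using Suc.prems assms(1) z by (rule holomorphic_derivI)
    moreover have "((deriv ^^ j) u has_field_derivative deriv ((deriv ^^ j) u) z) (at z)" using uj assms(1) z by (rule holomorphic_derivI)
    ultimately have "((\<lambda>z. f z * (deriv ^^ j) u z - G z) has_field_derivative
        (deriv f z * (deriv ^^ j) u z + deriv ((deriv ^^ j) u) z * f z) - (deriv f z * (deriv ^^ j) u z - (- 1) ^ j * (deriv ^^ j) (deriv f) z * u z)) (at z)"
      by (intro DERIV_diff DERIV_mult) (use G z in auto)
    moreover have "(deriv ^^ j) (deriv f) = (deriv ^^ Suc j) f" by (simp add: funpow_Suc_right del: funpow.simps)
    ultimately show ?thesis by (simp add: algebra_simps)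
  qed
  then show ?case by (intro exI[of _ "\<lambda>z. f z * (deriv ^^ j) u z - G z"]) blast
qed

lemma lagrange_identity:
  assumes S: "open S" "\<psi> holomorphic_on S" "u holomorphic_on S" and l: "\<And>j. j < n \<Longrightarrow> l j holomorphic_on S"
  shows "\<exists>G. \<forall>z\<in>S. (G has_field_derivative \<psi> z * (\<Sum>j<n. l j z * (deriv ^^ j) u z)
      - (\<Sum>j<n. (- 1) ^ j * (deriv ^^ j) (\<lambda>x. l j x * \<psi> x) z) * u z) (at z)"
proof -
  let ?D = "\<lambda>j z. (l j z * \<psi> z) * (deriv ^^ j) u z - (- 1) ^ j * (deriv ^^ j) (\<lambda>x. l j x * \<psi> x) z * u z"
  have "\<forall>j. \<exists>G. j < n \<longrightarrow> (\<forall>z\<in>S. (G has_field_derivative ?D j z) (at z))"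
  proof
    fix j
    show "\<exists>G. j < n \<longrightarrow> (\<forall>z\<in>S. (G has_field_derivative ?D j z) (at z))"
    proof (cases "j < n")
      case True
      have "(\<lambda>x. l j x * \<psi> x) holomorphic_on S" using l[OF True] S(2) by (rule holomorphic_on_mult)
      from concomitant[OF S(1) this S(3), of j] show ?thesis by simp
    qed simp
  qed
  from choice[OF this] obtain G where G: "\<And>j z. j < n \<Longrightarrow> z \<in> S \<Longrightarrow> (G j has_field_derivative ?D j z) (at z)" by auto
  have "((\<lambda>z. \<Sum>j<n. G j z) has_field_derivative (\<Sum>j<n. ?D j z)) (at z)" if "z \<in> S" for z
    by (rule DERIV_sum) (use G that in auto)
  moreover have "(\<Sum>j<n. ?D j z) = \<psi> z * (\<Sum>j<n. l j z * (deriv ^^ j) u z) - (\<Sum>j<n. (- 1) ^ j * (deriv ^^ j) (\<lambda>x. l j x * \<psi> x) z) * u z" for z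
    unfolding sum_subtractf sum_distrib_left sum_distrib_right by (simp add: mult_ac)
  ultimately show ?thesis by (intro exI[of _ "\<lambda>z. \<Sum>j<n. G j z"]) simp
qed

text \<open>By the Leibniz rule the adjoint is an operator of order \<open>n - 1\<close> with
  leading coefficient \<open>(- 1) ^ (n - 1)\<close>, so the derivatives of order below
  \<open>n - 1\<close> at \<open>z0\<close> can be prescribed; in particular every order of
  vanishing up to \<open>n - 2\<close> occurs.\<close>

lemma adjoint_solution_exists:
  assumes r: "0 < r" "r < R" and n: "n \<ge> 2" and l: "\<And>j. j < n \<Longrightarrow> l j holomorphic_on ball z0 R"
    and top: "\<And>z. z \<in> ball z0 R \<Longrightarrow> l (n - 1) z = 1"
  obtains \<psi> where "\<psi> holomorphic_on ball z0 r" "\<And>k. k < n - 1 \<Longrightarrow> (deriv ^^ k) \<psi> z0 = (x0 k :: complex)"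
    "\<And>z. z \<in> ball z0 r \<Longrightarrow> (\<Sum>j<n. (- 1) ^ j * (deriv ^^ j) (\<lambda>x. l j x * \<psi> x) z) = 0"
proof -
  define q where "q i z = (\<Sum>j=i..n - 1. (- 1) ^ j * (of_nat (j choose i) * (deriv ^^ (j - i)) (l j) z))" for i z
  have qh: "q i holomorphic_on ball z0 R" for i unfolding q_def[abs_def]
  proof (intro holomorphic_on_sum holomorphic_on_mult holomorphic_on_const)
    fix j assume "j \<in> {i..n - 1}"
    then show "(deriv ^^ (j - i)) (l j) holomorphic_on ball z0 R" using l n by (intro holomorphic_higher_deriv) auto
  qed
  define d where "d i z = - ((- 1) ^ (n - 1) * q i z)" for i z
  have dh: "d i holomorphic_on ball z0 R" for i unfolding d_def[abs_def] by (intro holomorphic_intros qh)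
  have N: "n - 1 > 0" using n by simp
  have z0: "z0 \<in> ball z0 r" using r by simp
  obtain \<psi> where \<psi>: "\<psi> holomorphic_on ball z0 r" "\<And>k. k < n - 1 \<Longrightarrow> (deriv ^^ k) \<psi> z0 = x0 k"
    and ode: "\<And>z. z \<in> ball z0 r \<Longrightarrow> (deriv ^^ (n - 1)) \<psi> z = (\<Sum>j<n - 1. d j z * (deriv ^^ j) \<psi> z) + 0"
    by (rule linear_ode_exists[of r R "n - 1" d z0 "\<lambda>_. 0" z0 x0]) (use r dh N z0 in auto)
  have "(\<Sum>j<n. (- 1) ^ j * (deriv ^^ j) (\<lambda>x. l j x * \<psi> x) z) = 0" if z: "z \<in> ball z0 r" for z
  proof -
    have lr: "l j holomorphic_on ball z0 r" if "j < n" for j using l[OF that] by (rule holomorphic_on_subset) (use r in auto)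
    have zR: "z \<in> ball z0 R" using z r by auto
    have "(\<Sum>j<n. (- 1) ^ j * (deriv ^^ j) (\<lambda>x. l j x * \<psi> x) z)
      = (\<Sum>j<n. \<Sum>i=0..j. (- 1) ^ j * (of_nat (j choose i) * (deriv ^^ (j - i)) (l j) z) * (deriv ^^ i) \<psi> z)"
    proof (intro sum.cong refl)
      fix j assume "j \<in> {..<n}"
      then have "(deriv ^^ j) (\<lambda>x. \<psi> x * l j x) z = (\<Sum>i=0..j. of_nat (j choose i) * (deriv ^^ i) \<psi> z * (deriv ^^ (j - i)) (l j) z)"
        by (intro higher_deriv_mult[OF \<psi>(1) lr open_ball z]) auto
      then show "(- 1) ^ j * (deriv ^^ j) (\<lambda>x. l j x * \<psi> x) z = (\<Sum>i=0..j. (- 1) ^ j * (of_nat (j choose i) * (deriv ^^ (j - i)) (l j) z) * (deriv ^^ i) \<psi> z)"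
        by (simp add: mult_ac sum_distrib_left)
    qed
    also have "\<dots> = (\<Sum>i<n. \<Sum>j=i..n - 1. (- 1) ^ j * (of_nat (j choose i) * (deriv ^^ (j - i)) (l j) z) * (deriv ^^ i) \<psi> z)"
      by (rule sum_triangle_swap)
    also have "\<dots> = (\<Sum>i<n. q i z * (deriv ^^ i) \<psi> z)" by (simp add: q_def sum_distrib_right)
    also have "\<dots> = (\<Sum>i<Suc (n - 1). q i z * (deriv ^^ i) \<psi> z)" using n by simp
    also have "\<dots> = (\<Sum>i<n - 1. q i z * (deriv ^^ i) \<psi> z) + q (n - 1) z * (\<Sum>i<n - 1. d i z * (deriv ^^ i) \<psi> z)"
      using ode[OF z] by simp
    also have "q (n - 1) z = (- 1) ^ (n - 1)" using top[OF zR] by (simp add: q_def)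
    also have "(- 1) ^ (n - 1) * (\<Sum>i<n - 1. d i z * (deriv ^^ i) \<psi> z) = - (\<Sum>i<n - 1. q i z * (deriv ^^ i) \<psi> z)"
    proof -
      have "(- 1) ^ (n - 1) * (- 1) ^ (n - 1) = (1::complex)" by (simp flip: power_mult_distrib)
      then have "(- 1) ^ (n - 1) * d i z = - q i z" for i by (simp add: d_def flip: mult.assoc)
      then have "(- 1) ^ (n - 1) * (d i z * (deriv ^^ i) \<psi> z) = - (q i z * (deriv ^^ i) \<psi> z)" for i by (simp flip: mult.assoc)
      then show ?thesis by (simp add: sum_distrib_left sum_negf)
    qed
    finally show ?thesis by simp
  qed
  with \<psi> show ?thesis by (rule that)
qed

lemma factor_power:
  fixes \<psi> :: "complex \<Rightarrow> complex"
  assumes r: "r > 0" and \<psi>: "\<psi> holomorphic_on ball z0 r" "\<And>k. k < i \<Longrightarrow> (deriv ^^ k) \<psi> z0 = 0" "(deriv ^^ i) \<psi> z0 \<noteq> 0"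
  obtains h r' where "0 < r'" "r' \<le> r" "h holomorphic_on ball z0 r'" "h z0 \<noteq> 0" "\<And>z. z \<in> ball z0 r' \<Longrightarrow> \<psi> z = (z - z0) ^ i * h z"
proof (cases "i = 0")
  case True
  then show ?thesis using that[of r \<psi>] assms by simp
next
  case False
  obtain g r' where g: "0 < r'" "g holomorphic_on ball z0 r'" "\<And>w. w \<in> ball z0 r' \<Longrightarrow> \<psi> w - \<psi> z0 = (w - z0) ^ i * g w"
      "\<And>w. w \<in> ball z0 r' \<Longrightarrow> g w \<noteq> 0"
    by (rule holomorphic_factor_order_of_zero[OF \<psi>(1) open_ball, of z0 i]) (use r False \<psi> in auto)
  have "\<psi> z0 = 0" using \<psi>(2)[of 0] False by simp
  then show ?thesis using g r by (intro that[of "min r r'" g]) (auto intro: holomorphic_on_subset)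
qed

text \<open>Continuity of the limit is included to make the class closed under products.\<close>
definition circle_limit :: "(real \<Rightarrow> complex \<Rightarrow> complex) \<Rightarrow> (complex \<Rightarrow> complex) \<Rightarrow> bool" where
  "circle_limit F l \<longleftrightarrow> uniform_limit (sphere 0 (1/2)) F l (at_right 0) \<and> continuous_on (sphere 0 (1/2)) l"

lemma circle_limit_const: "continuous_on (sphere 0 (1/2)) l \<Longrightarrow> circle_limit (\<lambda>_. l) l"
  by (simp add: circle_limit_def uniform_limit_const)

lemma circle_limit_add: "circle_limit F l \<Longrightarrow> circle_limit G m \<Longrightarrow> circle_limit (\<lambda>e t. F e t + G e t) (\<lambda>t. l t + m t)"
  by (simp add: circle_limit_def uniform_limit_add continuous_on_add)

lemma circle_limit_mult:
  assumes "circle_limit F l" "circle_limit G m"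
  shows "circle_limit (\<lambda>e t. F e t * G e t) (\<lambda>t. l t * m t)"
proof -
  have "bounded (l ` sphere 0 (1/2))" "bounded (m ` sphere 0 (1/2))"
    using assms by (auto simp: circle_limit_def intro!: compact_imp_bounded compact_continuous_image)
  then show ?thesis using assms by (auto simp: circle_limit_def intro: uniform_lim_mult continuous_on_mult)
qed

lemma circle_limit_power: "circle_limit F l \<Longrightarrow> circle_limit (\<lambda>e t. F e t ^ k) (\<lambda>t. l t ^ k)"
  by (induction k) (auto intro: circle_limit_mult circle_limit_const)

lemma circle_limit_sum:
  assumes "finite I" "\<And>i. i \<in> I \<Longrightarrow> circle_limit (\<lambda>e t. F i e t) (\<lambda>t. l i t)"
  shows "circle_limit (\<lambda>e t. \<Sum>i\<in>I. F i e t) (\<lambda>t. \<Sum>i\<in>I. l i t)"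
  using assms by (induction I rule: finite_induct) (auto intro: circle_limit_add circle_limit_const)

lemma circle_limit_isCont:
  assumes "isCont f z0"
  shows "circle_limit (\<lambda>e t. f (z0 + of_real e * t)) (\<lambda>t. f z0)"
  unfolding circle_limit_def
proof
  show "uniform_limit (sphere 0 (1/2)) (\<lambda>e t. f (z0 + of_real e * t)) (\<lambda>t. f z0) (at_right 0)"
  proof (rule uniform_limitI)
    fix d :: real assume "d > 0"
    then obtain \<delta> where \<delta>: "\<delta> > 0" "\<And>z. dist z z0 < \<delta> \<Longrightarrow> dist (f z) (f z0) < d"
      using assms unfolding continuous_at_eps_delta by blast
    have "\<forall>\<^sub>F e in at_right 0. (e::real) \<in> {0<..<\<delta>}" using \<delta>(1) by (rule eventually_at_right_real)
    then show "\<forall>\<^sub>F e in at_right 0. \<forall>t\<in>sphere 0 (1/2). dist (f (z0 + of_real e * t)) (f z0) < d"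
    proof eventually_elim
      case (elim e)
      show ?case
      proof
        fix t :: complex assume "t \<in> sphere 0 (1/2)"
        then have "dist (z0 + of_real e * t) z0 = e / 2" using elim by (simp add: dist_norm norm_mult)
        then show "dist (f (z0 + of_real e * t)) (f z0) < d" using elim by (intro \<delta>(2)) simp
      qed
    qed
  qed
qed (rule continuous_on_const)

lemma circle_limit_bound:
  assumes "e0 > 0" "\<And>e t. 0 < e \<Longrightarrow> e < e0 \<Longrightarrow> norm t = 1 / 2 \<Longrightarrow> norm (F e t - l t) \<le> K * e" "continuous_on (sphere 0 (1/2)) l"
  shows "circle_limit F l"
  unfolding circle_limit_def
proof
  show "uniform_limit (sphere 0 (1/2)) F l (at_right 0)"
  proof (rule uniform_limitI)
    fix d :: real assume d: "d > 0"
    have "\<forall>\<^sub>F e in at_right 0. (e::real) \<in> {0<..<min e0 (d / (\<bar>K\<bar> + 1))}" using d assms(1) by (intro eventually_at_right_real) simp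
    then show "\<forall>\<^sub>F e in at_right 0. \<forall>t\<in>sphere 0 (1/2). dist (F e t) (l t) < d"
    proof eventually_elim
      case (elim e)
      have "K * e \<le> (\<bar>K\<bar> + 1) * e" using elim by (intro mult_right_mono) auto
      moreover have "(\<bar>K\<bar> + 1) * e < d" using elim by (simp add: field_simps)
      ultimately have Ke: "K * e < d" by linarith
      show ?case
      proof
        fix t :: complex assume "t \<in> sphere 0 (1/2)"
        then have "norm (F e t - l t) \<le> K * e" using elim by (intro assms(2)) auto
        then show "dist (F e t) (l t) < d" using Ke by (simp add: dist_norm)
      qed
    qed
  qed
qed (rule assms(3))

text \<open>Uniform convergence on the circle permits passing to the limit under the
  integral.\<close>

lemma circle_limit_integral_zero:
  assumes "circle_limit F l" and zero: "\<forall>\<^sub>F e in at_right 0. (F e has_contour_integral 0) (circlepath 0 (1/2))"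
  shows "contour_integral (circlepath 0 (1/2)) l = 0"
proof -
  have "((\<lambda>e. contour_integral (circlepath 0 (1/2)) (F e)) \<longlongrightarrow> contour_integral (circlepath 0 (1/2)) l) (at_right 0)"
    by (rule contour_integral_uniform_limit_circlepath(2))
      (use assms zero in \<open>auto simp: circle_limit_def elim!: eventually_mono intro: has_contour_integral_integrable\<close>)
  moreover have "((\<lambda>e. contour_integral (circlepath 0 (1/2)) (F e)) \<longlongrightarrow> 0) (at_right 0)"
    by (rule tendsto_eventually) (use zero in \<open>auto elim!: eventually_mono simp: contour_integral_unique\<close>)
  ultimately show ?thesis using tendsto_unique trivial_limit_at_right_real by blast
qed

text \<open>\<open>\<zeta>\<^sup>M S(w)\<close> in terms of \<open>Y\<^sub>k = \<zeta>\<^bsup>k+1\<^esup> w\<^sup>(\<^sup>k\<^sup>)\<close>, without the terms of weight above \<open>M\<close>.\<close>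
definition weighted_defect :: "nat \<Rightarrow> (complex \<Rightarrow> complex) \<Rightarrow> (nat \<Rightarrow> nat \<Rightarrow> complex \<Rightarrow> complex) \<Rightarrow> (nat \<Rightarrow> complex \<Rightarrow> complex) \<Rightarrow>
    nat \<Rightarrow> complex \<Rightarrow> complex \<Rightarrow> (nat \<Rightarrow> complex) \<Rightarrow> complex" where
  "weighted_defect n A a b M z \<zeta> Y =
     (\<Sum>m<n - 1. if m + 2 \<le> M then \<Sum>i\<le>m. quad_defect a m i z * \<zeta> ^ (M - m - 2) * (Y i * Y (m - i)) else 0)
     + (\<Sum>m<n - 1. if m + 1 \<le> M then lin_defect n A a b m z * \<zeta> ^ (M - m - 1) * Y m else 0)"

text \<open>A quadratic term of order m has weight m + 2, a linear one m + 1; the missing factors up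
  to \<open>\<zeta> ^ M\<close> are supplied explicitly. Terms of larger weight are left out of
  \<open>weighted_defect\<close>, so their coefficients must vanish.\<close>

lemma defect_weighted:
  assumes hq: "\<And>m i. m < n - 1 \<Longrightarrow> i \<le> m \<Longrightarrow> M < m + 2 \<Longrightarrow> quad_defect a m i z = 0"
    and hl: "\<And>m. m < n - 1 \<Longrightarrow> M < m + 1 \<Longrightarrow> lin_defect n A a b m z = 0"
    and Y: "\<And>k. k < n \<Longrightarrow> Y k = (deriv ^^ k) w z * \<zeta> ^ Suc k"
  shows "weighted_defect n A a b M z \<zeta> Y = \<zeta> ^ M * defect n A a b w z"
proof -
  have "(\<Sum>m<n - 1. if m + 2 \<le> M then \<Sum>i\<le>m. quad_defect a m i z * \<zeta> ^ (M - m - 2) * (Y i * Y (m - i)) else 0)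
    = (\<Sum>m<n - 1. \<Sum>i\<le>m. \<zeta> ^ M * (quad_defect a m i z * (deriv ^^ i) w z * (deriv ^^ (m - i)) w z))"
  proof (intro sum.cong refl)
    fix m assume m: "m \<in> {..<n - 1}"
    show "(if m + 2 \<le> M then \<Sum>i\<le>m. quad_defect a m i z * \<zeta> ^ (M - m - 2) * (Y i * Y (m - i)) else 0)
      = (\<Sum>i\<le>m. \<zeta> ^ M * (quad_defect a m i z * (deriv ^^ i) w z * (deriv ^^ (m - i)) w z))"
    proof (cases "m + 2 \<le> M")
      case True
      have q: "quad_defect a m i z * \<zeta> ^ (M - m - 2) * (Y i * Y (m - i)) = \<zeta> ^ M * (quad_defect a m i z * (deriv ^^ i) w z * (deriv ^^ (m - i)) w z)"
        if i: "i \<le> m" for i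
      proof -
        have "\<zeta> ^ (M - m - 2) * (\<zeta> ^ Suc i * \<zeta> ^ Suc (m - i)) = \<zeta> ^ ((M - m - 2) + (Suc i + Suc (m - i)))" by (simp only: power_add)
        also have "(M - m - 2) + (Suc i + Suc (m - i)) = M" using True i by simp
        finally have p: "\<zeta> ^ (M - m - 2) * (\<zeta> ^ Suc i * \<zeta> ^ Suc (m - i)) = \<zeta> ^ M" .
        have Yi: "Y i = (deriv ^^ i) w z * \<zeta> ^ Suc i" "Y (m - i) = (deriv ^^ (m - i)) w z * \<zeta> ^ Suc (m - i)"
          using m i by (intro Y; simp)+
        show ?thesis unfolding Yi p[symmetric] by (simp only: mult_ac)
      qed
      show ?thesis unfolding if_P[OF True] by (intro sum.cong refl q) simp
    next
      case False
      then show ?thesis using hq m by simp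
    qed
  qed
  moreover have "(\<Sum>m<n - 1. if m + 1 \<le> M then lin_defect n A a b m z * \<zeta> ^ (M - m - 1) * Y m else 0)
    = (\<Sum>m<n - 1. \<zeta> ^ M * (lin_defect n A a b m z * (deriv ^^ m) w z))"
  proof (intro sum.cong refl)
    fix m assume m: "m \<in> {..<n - 1}"
    show "(if m + 1 \<le> M then lin_defect n A a b m z * \<zeta> ^ (M - m - 1) * Y m else 0) = \<zeta> ^ M * (lin_defect n A a b m z * (deriv ^^ m) w z)"
    proof (cases "m + 1 \<le> M")
      case True
      have "\<zeta> ^ (M - m - 1) * \<zeta> ^ Suc m = \<zeta> ^ ((M - m - 1) + Suc m)" by (simp only: power_add)
      also have "(M - m - 1) + Suc m = M" using True by simp
      finally have p: "\<zeta> ^ (M - m - 1) * \<zeta> ^ Suc m = \<zeta> ^ M" .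
      have Ym: "Y m = (deriv ^^ m) w z * \<zeta> ^ Suc m" using m by (intro Y) simp
      show ?thesis using True unfolding Ym p[symmetric] by (simp only: if_True mult_ac)
    next
      case False
      then show ?thesis using hl m by simp
    qed
  qed
  ultimately show ?thesis
    unfolding weighted_defect_def defect_def by (simp only: distrib_left sum_distrib_left)
qed

text \<open>By Lagrange's identity \<psi> L u is a derivative when the adjoint annihilates \<psi>.
  As L u = c + S(w) and \<psi> c has the primitive C, the product of \<psi> with S(w) has a
  single-valued primitive.\<close>

lemma defect_annihilated:
  assumes n: "n \<ge> 2" and S: "open S" and coh: "coeffs_holomorphic n A a b c S" and A0: "\<And>z. z \<in> S \<Longrightarrow> A z \<noteq> 0"
    and w: "w holomorphic_on S" "\<And>z. z \<in> S \<Longrightarrow> quadratic_ode n A a b c w z"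
    and \<psi>: "\<psi> holomorphic_on S" "\<And>z. z \<in> S \<Longrightarrow> (\<Sum>j<n. (- 1) ^ j * (deriv ^^ j) (\<lambda>x. lin_coeff n A a j x * \<psi> x) z) = 0"
    and C: "\<And>z. z \<in> S \<Longrightarrow> (C has_field_derivative \<psi> z * c z) (at z)"
  shows "\<exists>G. \<forall>z\<in>S. (G has_field_derivative \<psi> z * defect n A a b w z) (at z)"
proof -
  let ?u = "riccati_change A (riccati_coeff n A a b) w"
  have "A holomorphic_on S" using coh by (simp add: coeffs_holomorphic_def)
  then have u: "?u holomorphic_on S"
    by (intro riccati_change_holomorphic[OF S] holomorphic_riccati_coeff[OF coh S A0 n] w(1)) auto
  have "\<exists>G. \<forall>z\<in>S. (G has_field_derivative \<psi> z * (\<Sum>j<n. lin_coeff n A a j z * (deriv ^^ j) ?u z)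
      - (\<Sum>j<n. (- 1) ^ j * (deriv ^^ j) (\<lambda>x. lin_coeff n A a j x * \<psi> x) z) * ?u z) (at z)"
    by (rule lagrange_identity[OF S \<psi>(1) u]) (use holomorphic_lin_coeff[OF coh S A0 n] in auto)
  then obtain G where G: "\<And>z. z \<in> S \<Longrightarrow> (G has_field_derivative \<psi> z * lin_op n A a ?u z - 0 * ?u z) (at z)"
    using \<psi>(2) unfolding lin_op_def by auto
  have "((\<lambda>z. G z - C z) has_field_derivative \<psi> z * defect n A a b w z) (at z)" if z: "z \<in> S" for z
  proof -
    have "lin_op n A a ?u z = c z + defect n A a b w z"
      using w(2)[OF z] quadratic_ode_iff[OF S z A0 w(1) n coh] by blast
    then have "\<psi> z * lin_op n A a ?u z - 0 * ?u z - \<psi> z * c z = \<psi> z * defect n A a b w z" by (simp add: algebra_simps)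
    then show ?thesis using DERIV_diff[OF G[OF z] C[OF z]] by simp
  qed
  then show ?thesis by blast
qed

text \<open>The vanishing integral of \<psi> S(w) around \<open>z0\<close>, rescaled to a circle in
  t and multiplied by the right power of e, has a limit depending only on \<open>lead\<close> and
  the coefficients of weight \<open>M\<close> at \<open>z0\<close>. A zero of \<psi> of order
  \<open>i0\<close> selects the Taylor coefficient of order \<open>M - 1 - i0\<close> in that
  limit.\<close>

lemma weighted_defect_residue:
  assumes n: "n \<ge> 2" and U: "open U" "coeffs_holomorphic n A a b c U" and sP: "strong_Painleve n A a b c U"
    and R: "R > 0" "ball z0 R \<subseteq> U" and A0: "\<And>z. z \<in> ball z0 R \<Longrightarrow> A z \<noteq> 0"
    and hq: "\<And>m i z. m < n - 1 \<Longrightarrow> i \<le> m \<Longrightarrow> M < m + 2 \<Longrightarrow> z \<in> ball z0 R \<Longrightarrow> quad_defect a m i z = 0"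
    and hl: "\<And>m z. m < n - 1 \<Longrightarrow> M < m + 1 \<Longrightarrow> z \<in> ball z0 R \<Longrightarrow> lin_defect n A a b m z = 0"
    and i0: "i0 < M" "i0 < n - 1"
    and e0: "0 < e0" "e0 < R" and jets: "\<And>e. 0 < e \<Longrightarrow> e < e0 \<Longrightarrow> \<exists>X. jet_solution n A a b c z0 e X \<and>
        (\<forall>k<n. \<forall>s\<in>strip. norm (X k s - lead (A z0) g j k s) \<le> K * e * exp (Re s))"
  defines "L \<equiv> \<lambda>t k. - ((- 1) ^ k * fact k / A z0) + g * ffact (of_nat j) k * t ^ (j + 1)"
  shows "(deriv ^^ (M - 1 - i0)) (\<lambda>t. weighted_defect n A a b M z0 0 (L t)) 0 = 0"
proof -
  have coh: "coeffs_holomorphic n A a b c (ball z0 R)" by (rule coeffs_holomorphic_subset[OF U(2) R(2)])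
  have Az0: "A z0 \<noteq> 0" using A0 R(1) by simp
  have ldh: "lin_coeff n A a i holomorphic_on ball z0 R" for i by (rule holomorphic_lin_coeff[OF coh open_ball A0 n])
  have R2: "0 < R / 2" "R / 2 < R" using R(1) by auto
  have top: "lin_coeff n A a (n - 1) z = 1" if "z \<in> ball z0 R" for z using A0[OF that] by (rule lin_coeff_top[OF n])
  obtain \<psi> where \<psi>: "\<psi> holomorphic_on ball z0 (R / 2)" "\<And>k. k < n - 1 \<Longrightarrow> (deriv ^^ k) \<psi> z0 = (if k = i0 then 1 else 0)"
    "\<And>z. z \<in> ball z0 (R / 2) \<Longrightarrow> (\<Sum>j<n. (- 1) ^ j * (deriv ^^ j) (\<lambda>x. lin_coeff n A a j x * \<psi> x) z) = 0"
    by (rule adjoint_solution_exists[OF R2 n, of "lin_coeff n A a" z0 "\<lambda>k. if k = i0 then 1 else 0"]) (use ldh top in auto)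
  obtain h r where r: "0 < r" "r \<le> R / 2" and h: "h holomorphic_on ball z0 r" "h z0 \<noteq> 0" "\<And>z. z \<in> ball z0 r \<Longrightarrow> \<psi> z = (z - z0) ^ i0 * h z"
    by (rule factor_power[OF R2(1) \<psi>(1), of i0]) (use \<psi>(2) i0 in auto)
  have sub: "ball z0 r \<subseteq> ball z0 R" "ball z0 r \<subseteq> ball z0 (R / 2)" using r R by auto
  have \<psi>c: "(\<lambda>z. \<psi> z * c z) holomorphic_on ball z0 r"
    using \<psi>(1) coh sub by (intro holomorphic_on_mult) (auto simp: coeffs_holomorphic_def intro: holomorphic_on_subset)
  obtain C where "\<And>z. z \<in> ball z0 r \<Longrightarrow> (C has_field_derivative \<psi> z * c z) (at z within ball z0 r)"
    by (rule holomorphic_convex_primitive'[OF convex_ball open_ball \<psi>c]) (rule that; assumption)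
  then have C: "(C has_field_derivative \<psi> z * c z) (at z)" if "z \<in> ball z0 r" for z
    using that by (metis at_within_open open_ball)
  define e1 where "e1 = min e0 r"
  have e1: "0 < e1" using e0 r by (simp add: e1_def)
  have "\<forall>e. \<exists>X. 0 < e \<and> e < e0 \<longrightarrow> jet_solution n A a b c z0 e X \<and>
        (\<forall>k<n. \<forall>s\<in>strip. norm (X k s - lead (A z0) g j k s) \<le> K * e * exp (Re s))"
    using jets by blast
  from choice[OF this] obtain X where X: "\<And>e. 0 < e \<Longrightarrow> e < e0 \<Longrightarrow> jet_solution n A a b c z0 e (X e)"
    and XL: "\<And>e k s. 0 < e \<Longrightarrow> e < e0 \<Longrightarrow> k < n \<Longrightarrow> s \<in> strip \<Longrightarrow> norm (X e k s - lead (A z0) g j k s) \<le> K * e * exp (Re s)"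
    by auto
  have Lnt: "Ln t \<in> strip" "exp (Ln t) = t" if "norm t = 1 / 2" for t :: complex
  proof -
    have t: "t \<noteq> 0" using that by auto
    then show "exp (Ln t) = t" by simp
    have "\<bar>Im (Ln t)\<bar> < 4" using Im_Ln_le_pi[OF t] mpi_less_Im_Ln[OF t] pi_less_4 by linarith
    moreover have "ln (1 / 2 :: real) < 0" by (subst ln_less_zero_iff) auto
    ultimately show "Ln t \<in> strip" using t that by (simp add: strip_def)
  qed
  define Y where "Y e t k = X e k (Ln t)" for e t k
  \<comment> \<open>\<psi> S(w) dz / dt with its power of e removed: \<psi> contributes t^i0 and h,
    and S(w) contributes t^(-M) and the weighted defect.\<close>
  define F where "F e t = h (z0 + of_real e * t) * weighted_defect n A a b M (z0 + of_real e * t) (of_real e * t) (Y e t) * (1 / t ^ (M - i0))" for e :: real and t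
  define J where "J t = weighted_defect n A a b M z0 0 (L t)" for t
  have contL: "continuous_on T (\<lambda>t. L t k)" for k T unfolding L_def by (intro continuous_intros)
  have YL: "circle_limit (\<lambda>e t. Y e t k) (\<lambda>t. L t k)" if k: "k < n" for k
  proof (rule circle_limit_bound[OF e1 _ contL])
    fix e :: real and t :: complex assume e: "0 < e" "e < e1" and t: "norm t = 1 / 2"
    have "norm (X e k (Ln t) - lead (A z0) g j k (Ln t)) \<le> K * e * exp (Re (Ln t))"
      by (rule XL) (use e e1_def k Lnt[OF t] in auto)
    moreover have "exp (Re (Ln t)) = 1 / 2" using Lnt(2)[OF t] t by (metis norm_exp_eq_Re)
    moreover have "lead (A z0) g j k (Ln t) = L t k" unfolding lead_def L_def Lnt(2)[OF t] ..
    ultimately show "norm (Y e t k - L t k) \<le> K / 2 * e" by (simp add: Y_def)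
  qed
  have cont: "isCont f z0" if "f holomorphic_on ball z0 r" for f :: "complex \<Rightarrow> complex"
    using that r(1) by (metis centre_in_ball continuous_on_eq_continuous_at holomorphic_on_imp_continuous_on open_ball)
  have hol: "f holomorphic_on ball z0 r" if "f holomorphic_on ball z0 R" for f :: "complex \<Rightarrow> complex"
    using that sub(1) by (rule holomorphic_on_subset)
  have \<zeta>lim: "circle_limit (\<lambda>e t. of_real e * t) (\<lambda>t. 0)"
    using circle_limit_isCont[of z0 "\<lambda>z. z - z0"] by simp
  have lim: "circle_limit F (\<lambda>t. h z0 * J t * (1 / t ^ (M - i0)))"
    unfolding F_def[abs_def] J_def weighted_defect_def
  proof (intro circle_limit_mult circle_limit_add circle_limit_sum)
    show "circle_limit (\<lambda>e t. h (z0 + of_real e * t)) (\<lambda>t. h z0)" by (rule circle_limit_isCont[OF cont[OF h(1)]])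
    show "circle_limit (\<lambda>e t. 1 / t ^ (M - i0)) (\<lambda>t. 1 / t ^ (M - i0))"
      by (intro circle_limit_const continuous_intros) auto
    show "circle_limit (\<lambda>e t. if m + 2 \<le> M then \<Sum>i\<le>m. quad_defect a m i (z0 + of_real e * t) * (of_real e * t) ^ (M - m - 2) * (Y e t i * Y e t (m - i)) else 0)
        (\<lambda>t. if m + 2 \<le> M then \<Sum>i\<le>m. quad_defect a m i z0 * 0 ^ (M - m - 2) * (L t i * L t (m - i)) else 0)" if m: "m \<in> {..<n - 1}" for m
    proof (cases "m + 2 \<le> M")
      case True
      have "circle_limit (\<lambda>e t. \<Sum>i\<le>m. quad_defect a m i (z0 + of_real e * t) * (of_real e * t) ^ (M - m - 2) * (Y e t i * Y e t (m - i)))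
        (\<lambda>t. \<Sum>i\<le>m. quad_defect a m i z0 * 0 ^ (M - m - 2) * (L t i * L t (m - i)))"
      proof (intro circle_limit_sum circle_limit_mult)
        fix i assume i: "i \<in> {..m}"
        show "circle_limit (\<lambda>e t. quad_defect a m i (z0 + of_real e * t)) (\<lambda>t. quad_defect a m i z0)"
          by (rule circle_limit_isCont[OF cont[OF hol[OF holomorphic_quad_defect[OF coh]]]]) (use m i in auto)
        show "circle_limit (\<lambda>e t. (of_real e * t) ^ (M - m - 2)) (\<lambda>t. 0 ^ (M - m - 2))"
          by (rule circle_limit_power[OF \<zeta>lim])
        show "circle_limit (\<lambda>e t. Y e t i) (\<lambda>t. L t i)" "circle_limit (\<lambda>e t. Y e t (m - i)) (\<lambda>t. L t (m - i))"
          using m i by (auto intro!: YL)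
      qed simp
      then show ?thesis using True by simp
    next
      case False
      then show ?thesis using circle_limit_const[of "\<lambda>_. 0"] by simp
    qed
    show "circle_limit (\<lambda>e t. if m + 1 \<le> M then lin_defect n A a b m (z0 + of_real e * t) * (of_real e * t) ^ (M - m - 1) * Y e t m else 0)
        (\<lambda>t. if m + 1 \<le> M then lin_defect n A a b m z0 * 0 ^ (M - m - 1) * L t m else 0)" if m: "m \<in> {..<n - 1}" for m
    proof (cases "m + 1 \<le> M")
      case True
      have "circle_limit (\<lambda>e t. lin_defect n A a b m (z0 + of_real e * t) * (of_real e * t) ^ (M - m - 1) * Y e t m)
        (\<lambda>t. lin_defect n A a b m z0 * 0 ^ (M - m - 1) * L t m)"
      proof (intro circle_limit_mult)
        show "circle_limit (\<lambda>e t. lin_defect n A a b m (z0 + of_real e * t)) (\<lambda>t. lin_defect n A a b m z0)"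
          by (rule circle_limit_isCont[OF cont[OF hol[OF holomorphic_lin_defect[OF coh open_ball A0 n]]]]) (use m in auto)
        show "circle_limit (\<lambda>e t. (of_real e * t) ^ (M - m - 1)) (\<lambda>t. 0 ^ (M - m - 1))"
          by (rule circle_limit_power[OF \<zeta>lim])
        show "circle_limit (\<lambda>e t. Y e t m) (\<lambda>t. L t m)" using m by (auto intro!: YL)
      qed
      then show ?thesis using True by simp
    next
      case False
      then show ?thesis using circle_limit_const[of "\<lambda>_. 0"] by simp
    qed
  qed auto
  have zero: "(F e has_contour_integral 0) (circlepath 0 (1/2))" if e: "0 < e" "e < e1" for e :: real
  proof -
    have ee: "e < e0" "e < r" using e by (auto simp: e1_def)
    let ?P = "ball z0 e - {z0}"
    have eU: "ball z0 e \<subseteq> U" "ball z0 e \<subseteq> ball z0 r" "ball z0 e \<subseteq> ball z0 R" using ee sub R by force+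
    have "norm (X e 0 s - lead (A z0) g j 0 s) \<le> K * e * exp (Re s)" if "s \<in> strip" for s
      by (rule XL) (use e ee n that in auto)
    from strong_Painleve_single_valued[OF n U sP e(1) eU(1) X[OF e(1) ee(1)] Az0 this]
    obtain w where w: "w holomorphic_on ?P" "\<And>z. z \<in> ?P \<Longrightarrow> quadratic_ode n A a b c w z"
      "\<And>k s. k < n \<Longrightarrow> s \<in> strip \<Longrightarrow> (deriv ^^ k) w (z0 + of_real e * exp s) * (of_real e * exp s) ^ Suc k = X e k s"
      by auto
    have P: "open ?P" by auto
    have PR: "?P \<subseteq> ball z0 R" "?P \<subseteq> ball z0 r" "?P \<subseteq> ball z0 (R / 2)" using eU sub by auto
    have "\<exists>G. \<forall>z\<in>?P. (G has_field_derivative \<psi> z * defect n A a b w z) (at z)"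
    proof (rule defect_annihilated[OF n P coeffs_holomorphic_subset[OF coh PR(1)] _ w(1,2) holomorphic_on_subset[OF \<psi>(1) PR(3)]])
      show "A z \<noteq> 0" if "z \<in> ?P" for z using A0 that PR(1) by blast
      show "(\<Sum>j<n. (- 1) ^ j * (deriv ^^ j) (\<lambda>x. lin_coeff n A a j x * \<psi> x) z) = 0" if "z \<in> ?P" for z
        by (rule \<psi>(3)) (use that PR(3) in blast)
      show "(C has_field_derivative \<psi> z * c z) (at z)" if "z \<in> ?P" for z
        by (rule C) (use that PR(2) in blast)
    qed
    then obtain G where G: "\<And>z. z \<in> ?P \<Longrightarrow> (G has_field_derivative \<psi> z * defect n A a b w z) (at z)" by blast
    define D where "D t = \<psi> (z0 + of_real e * t) * defect n A a b w (z0 + of_real e * t)" for t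
    let ?S = "ball 0 1 - {0::complex}"
    have "((\<lambda>t. G (z0 + of_real e * t)) has_field_derivative D t * of_real e) (at t within ?S)" if t: "t \<in> ?S" for t
    proof -
      have "e * norm t < e" using t e(1) by simp
      then have "z0 + of_real e * t \<in> ?P" using t e(1) by (simp add: dist_norm norm_mult)
      then have "(G has_field_derivative D t) (at (z0 + of_real e * t))" unfolding D_def by (rule G)
      moreover have "((\<lambda>t. z0 + of_real e * t) has_field_derivative of_real e) (at t within ?S)"
        by (auto intro!: derivative_eq_intros)
      ultimately show ?thesis by (rule DERIV_chain2)
    qed
    then have "((\<lambda>t. D t * of_real e) has_contour_integral 0) (circlepath 0 (1/2))"
      by (rule Cauchy_theorem_primitive) auto
    \<comment> \<open>This factor compensates the power of e in \<psi> S(w) dz, so that the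
      integrand stays bounded as e tends to 0.\<close>
    then have "((\<lambda>t. of_real e ^ (M - i0) / of_real e * (D t * of_real e)) has_contour_integral of_real e ^ (M - i0) / of_real e * 0) (circlepath 0 (1/2))"
      by (rule has_contour_integral_lmul)
    moreover have "of_real e ^ (M - i0) / of_real e * (D t * of_real e) = F e t" if t: "t \<in> path_image (circlepath 0 (1/2))" for t :: complex
    proof -
      have t: "norm t = 1 / 2" "t \<noteq> 0" using that by auto
      let ?z = "z0 + of_real e * t"
      have "norm (of_real e * t) < e" using e(1) t by (simp add: norm_mult)
      then have z: "?z \<in> ball z0 e" by (simp add: dist_norm)
      have "weighted_defect n A a b M ?z (of_real e * t) (Y e t) = (of_real e * t) ^ M * defect n A a b w ?z"
      proof (rule defect_weighted)
        show "quad_defect a m i ?z = 0" if "m < n - 1" "i \<le> m" "M < m + 2" for m i by (rule hq[OF that]) (use z eU in blast)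
        show "lin_defect n A a b m ?z = 0" if "m < n - 1" "M < m + 1" for m by (rule hl[OF that]) (use z eU in blast)
        show "Y e t k = (deriv ^^ k) w ?z * (of_real e * t) ^ Suc k" if "k < n" for k
          using w(3)[OF that Lnt(1)[OF t(1)]] unfolding Lnt(2)[OF t(1)] Y_def by simp
      qed
      moreover have "\<psi> ?z = (of_real e * t) ^ i0 * h ?z" using h(3)[of ?z] z eU by auto
      moreover have "(of_real e * t) ^ M = (of_real e * t) ^ i0 * (of_real e * t) ^ (M - i0)"
        using i0(1) by (simp flip: power_add)
      ultimately show ?thesis using e(1) t(2) unfolding D_def F_def by (simp add: power_mult_distrib)
    qed
    ultimately have "(F e has_contour_integral of_real e ^ (M - i0) / of_real e * 0) (circlepath 0 (1/2))"
      by (rule has_contour_integral_eq)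
    then show ?thesis by simp
  qed
  have "contour_integral (circlepath 0 (1/2)) (\<lambda>t. h z0 * J t * (1 / t ^ (M - i0))) = 0"
  proof (rule circle_limit_integral_zero[OF lim])
    have "\<forall>\<^sub>F e in at_right 0. e \<in> {0<..<e1}" using e1 by (rule eventually_at_right_real)
    then show "\<forall>\<^sub>F e in at_right 0. (F e has_contour_integral 0) (circlepath 0 (1/2))"
      by eventually_elim (use zero in auto)
  qed
  moreover have "(\<lambda>t. h z0 * J t * (1 / t ^ (M - i0))) = (\<lambda>t. h z0 * J t / (t - 0) ^ Suc (M - 1 - i0))"
    using i0(1) by (simp add: Suc_diff_Suc)
  moreover have Jh: "J holomorphic_on UNIV"
  proof -
    have if0: "(\<lambda>t. if p then f t else 0) holomorphic_on UNIV" if "f holomorphic_on UNIV" for p and f :: "complex \<Rightarrow> complex"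
      using that by (cases p) auto
    show ?thesis unfolding J_def[abs_def] weighted_defect_def L_def
      by (intro holomorphic_on_add holomorphic_on_sum if0 holomorphic_on_mult holomorphic_on_power holomorphic_on_const holomorphic_on_ident)
  qed
  moreover have "contour_integral (circlepath 0 (1/2)) (\<lambda>t. h z0 * J t / (t - 0) ^ Suc (M - 1 - i0))
    = (2 * pi * \<i>) * (deriv ^^ (M - 1 - i0)) (\<lambda>t. h z0 * J t) 0 / fact (M - 1 - i0)"
    by (rule Cauchy_contour_integral_circlepath)
      (use Jh in \<open>auto intro!: continuous_on_mult continuous_on_const holomorphic_on_mult holomorphic_on_const
        intro: holomorphic_on_subset holomorphic_on_imp_continuous_on\<close>)
  ultimately have "(deriv ^^ (M - 1 - i0)) (\<lambda>t. h z0 * J t) 0 = 0" by simp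
  moreover have "(deriv ^^ (M - 1 - i0)) (\<lambda>t. h z0 * J t) 0 = h z0 * (deriv ^^ (M - 1 - i0)) J 0"
    by (rule higher_deriv_cmult[OF Jh]) auto
  ultimately show ?thesis using h(2) by (simp add: J_def[abs_def])
qed

section \<open>Contradiction from a coefficient of maximal weight\<close>

text \<open>Only weight exactly \<open>M\<close> survives. The bounds in the conditions reflect that
  the quadratic terms of order \<open>M - 2\<close> or the linear term of order \<open>M - 1\<close>
  may not exist.\<close>

lemma weighted_defect_0:
  "weighted_defect n A a b M z 0 Y =
     (if 2 \<le> M \<and> M - 2 < n - 1 then \<Sum>i\<le>M - 2. quad_defect a (M - 2) i z * (Y i * Y (M - 2 - i)) else 0)
     + (if 1 \<le> M \<and> M - 1 < n - 1 then lin_defect n A a b (M - 1) z * Y (M - 1) else 0)"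
proof -
  have "(\<Sum>m<n - 1. if m + 2 \<le> M then \<Sum>i\<le>m. quad_defect a m i z * 0 ^ (M - m - 2) * (Y i * Y (m - i)) else 0)
    = (\<Sum>m<n - 1. if m = M - 2 then if 2 \<le> M then \<Sum>i\<le>M - 2. quad_defect a (M - 2) i z * (Y i * Y (M - 2 - i)) else 0 else 0)"
    by (intro sum.cong refl) (auto simp: power_0_left)
  moreover have "(\<Sum>m<n - 1. if m + 1 \<le> M then lin_defect n A a b m z * 0 ^ (M - m - 1) * Y m else 0)
    = (\<Sum>m<n - 1. if m = M - 1 then if 1 \<le> M then lin_defect n A a b (M - 1) z * Y (M - 1) else 0 else 0)"
    by (intro sum.cong refl) (auto simp: power_0_left)
  ultimately show ?thesis unfolding weighted_defect_def by (simp add: sum.delta) arith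
qed

lemma power_jet_middle:
  fixes c0 c1 c2 :: complex
  assumes "k \<ge> 1"
  shows "(deriv ^^ k) (\<lambda>t. c0 + c1 * t ^ k + c2 * (t ^ k)\<^sup>2) 0 = c1 * fact k"
proof -
  have p: "(deriv ^^ k) (\<lambda>t. t ^ m) 0 = (if k = m then fact m else (0::complex))" for m
    using power_jet[of k 0 m] by simp
  have h: "(\<lambda>t. c * t ^ m) holomorphic_on UNIV" for c :: complex and m by (intro holomorphic_intros)
  have d: "(deriv ^^ k) (\<lambda>t. c * t ^ m) 0 = c * (if k = m then fact m else 0)" for c :: complex and m
    using higher_deriv_cmult[of "\<lambda>t. t ^ m" UNIV 0 k c] p[of m] by (simp add: holomorphic_intros)
  have "(\<lambda>t. c0 + c1 * t ^ k + c2 * (t ^ k)\<^sup>2) = (\<lambda>t. (c0 * t ^ 0 + c1 * t ^ k) + c2 * t ^ (k * 2))"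
    by (simp add: power_mult)
  moreover have "(deriv ^^ k) (\<lambda>t. (c0 * t ^ 0 + c1 * t ^ k) + c2 * t ^ (k * 2)) 0
      = (deriv ^^ k) (\<lambda>t. c0 * t ^ 0 + c1 * t ^ k) 0 + (deriv ^^ k) (\<lambda>t. c2 * t ^ (k * 2)) 0"
    by (rule higher_deriv_add[OF holomorphic_on_add[OF h h] h open_UNIV UNIV_I])
  moreover have "(deriv ^^ k) (\<lambda>t. c0 * t ^ 0 + c1 * t ^ k) 0 = (deriv ^^ k) (\<lambda>t. c0 * t ^ 0) 0 + (deriv ^^ k) (\<lambda>t. c1 * t ^ k) 0"
    by (rule higher_deriv_add[OF h h open_UNIV UNIV_I])
  ultimately show ?thesis using assms unfolding d by simp
qed

text \<open>In a product of \<beta> i with \<alpha> (m - i) the factor \<open>s i\<close> excludes i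
  < j and \<open>\<beta> i\<close> excludes i > j. So only the coefficient of index j enters the
  part linear in \<tau>, twice because of the symmetry.\<close>

lemma symmetric_convolution:
  fixes s \<alpha> \<beta> :: "nat \<Rightarrow> complex"
  assumes sym: "\<And>i. i \<le> m \<Longrightarrow> s (m - i) = s i" and j: "j \<le> m" and s0: "\<And>i. i < j \<Longrightarrow> s i = 0" and \<beta>0: "\<And>i. j < i \<Longrightarrow> \<beta> i = 0"
  shows "(\<Sum>i\<le>m. s i * ((\<alpha> i + \<beta> i * \<tau>) * (\<alpha> (m - i) + \<beta> (m - i) * \<tau>))) =
    (\<Sum>i\<le>m. s i * (\<alpha> i * \<alpha> (m - i))) + (2 * s j * \<beta> j * \<alpha> (m - j)) * \<tau> + (\<Sum>i\<le>m. s i * (\<beta> i * \<beta> (m - i))) * \<tau>\<^sup>2"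
proof -
  have "(\<Sum>i\<le>m. s i * (\<beta> i * \<alpha> (m - i))) = (\<Sum>i\<le>m. if i = j then s j * (\<beta> j * \<alpha> (m - j)) else 0)"
  proof (intro sum.cong refl)
    show "s i * (\<beta> i * \<alpha> (m - i)) = (if i = j then s j * (\<beta> j * \<alpha> (m - j)) else 0)" for i
      by (cases i j rule: linorder_cases) (simp_all add: s0 \<beta>0)
  qed
  then have 1: "(\<Sum>i\<le>m. s i * (\<beta> i * \<alpha> (m - i))) = s j * (\<beta> j * \<alpha> (m - j))" using j by simp
  have 2: "(\<Sum>i\<le>m. s i * (\<alpha> i * \<beta> (m - i))) = (\<Sum>i\<le>m. s i * (\<beta> i * \<alpha> (m - i)))"
    by (rule sum.reindex_bij_witness[of _ "\<lambda>i. m - i" "\<lambda>i. m - i"]) (auto simp: sym)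
  have "(\<Sum>i\<le>m. s i * ((\<alpha> i + \<beta> i * \<tau>) * (\<alpha> (m - i) + \<beta> (m - i) * \<tau>))) =
    (\<Sum>i\<le>m. s i * (\<alpha> i * \<alpha> (m - i)) + (s i * (\<beta> i * \<alpha> (m - i)) * \<tau> + s i * (\<alpha> i * \<beta> (m - i)) * \<tau>) + s i * (\<beta> i * \<beta> (m - i)) * \<tau>\<^sup>2)"
    by (intro sum.cong refl) (simp add: algebra_simps power2_eq_square)
  also have "\<dots> = (\<Sum>i\<le>m. s i * (\<alpha> i * \<alpha> (m - i))) + ((\<Sum>i\<le>m. s i * (\<beta> i * \<alpha> (m - i))) * \<tau> + (\<Sum>i\<le>m. s i * (\<alpha> i * \<beta> (m - i))) * \<tau>)
      + (\<Sum>i\<le>m. s i * (\<beta> i * \<beta> (m - i))) * \<tau>\<^sup>2"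
    by (simp only: sum.distrib sum_distrib_right)
  finally show ?thesis unfolding 2 1 by (simp add: algebra_simps)
qed

lemma quad_defect_0: "quad_defect a m 0 z = 0"
  by (simp add: quad_defect_def)

lemma ffact_self_nonzero: "ffact (of_nat j) j \<noteq> 0"
  unfolding ffact_def by (subst prod_zero_iff) auto

lemma strong_Painleve_imp_defects_zero:
  assumes n: "n \<ge> 2" and U: "open U" "coeffs_holomorphic n A a b c U" and sP: "strong_Painleve n A a b c U"
    and D: "open D" "D \<subseteq> U" and A0: "\<And>z. z \<in> D \<Longrightarrow> A z \<noteq> 0"
  shows "(\<forall>m<n - 1. \<forall>i\<le>m. \<forall>z\<in>D. quad_defect a m i z = 0) \<and> (\<forall>m<n - 1. \<forall>z\<in>D. lin_defect n A a b m z = 0)"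
proof (rule ccontr)
  define bad where "bad M \<longleftrightarrow> (\<exists>m i z. m < n - 1 \<and> m + 2 = M \<and> i \<le> m \<and> z \<in> D \<and> quad_defect a m i z \<noteq> 0) \<or>
    (\<exists>m z. m < n - 1 \<and> m + 1 = M \<and> z \<in> D \<and> lin_defect n A a b m z \<noteq> 0)" for M
  assume "\<not> ?thesis"
  then have ex: "\<exists>M. bad M" unfolding bad_def by blast
  have bd: "M \<le> n" if "bad M" for M using that unfolding bad_def by auto
  \<comment> \<open>Maximal over all of \<open>D\<close>, not at one point, so that the coefficients
    of larger weight vanish identically around whichever \<open>z0\<close> is used.\<close>
  define M where "M = (GREATEST M. bad M)"
  have M: "bad M" unfolding M_def using ex by (rule GreatestI_ex_nat[where b = n]) (rule bd)
  have max: "M' \<le> M" if "bad M'" for M' unfolding M_def using that by (rule Greatest_le_nat[where b = n]) (rule bd)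
  have hq: "quad_defect a m i z = 0" if "m < n - 1" "i \<le> m" "M < m + 2" "z \<in> D" for m i z
  proof (rule ccontr)
    assume "quad_defect a m i z \<noteq> 0"
    then have "bad (m + 2)" using that unfolding bad_def by blast
    then show False using max[of "m + 2"] that by simp
  qed
  have hl: "lin_defect n A a b m z = 0" if "m < n - 1" "M < m + 1" "z \<in> D" for m z
  proof (rule ccontr)
    assume "lin_defect n A a b m z \<noteq> 0"
    then have "bad (m + 1)" using that unfolding bad_def by blast
    then show False using max[of "m + 1"] that by simp
  qed
  have residue: "(deriv ^^ (M - 1 - i0)) (\<lambda>t. weighted_defect n A a b M z0 0 (\<lambda>k. - ((- 1) ^ k * fact k / A z0) + g * ffact (of_nat j) k * t ^ (j + 1))) 0 = 0"
    if z0: "z0 \<in> D" and i0: "i0 < M" "i0 < n - 1" and e0: "0 < e0" "e0 < R" and R: "R > 0" "ball z0 R \<subseteq> D"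
      and jets: "\<forall>e. 0 < e \<and> e < e0 \<longrightarrow> (\<exists>X. jet_solution n A a b c z0 e X \<and>
        (\<forall>k<n. \<forall>s\<in>strip. norm (X k s - lead (A z0) g j k s) \<le> K * e * exp (Re s)))"
    for z0 i0 g j e0 K R
  proof (rule weighted_defect_residue[OF n U sP R(1) _ _ _ _ i0 e0])
    show "ball z0 R \<subseteq> U" using R D by blast
    show "A z \<noteq> 0" if "z \<in> ball z0 R" for z using that R(2) A0 by blast
    show "quad_defect a m i z = 0" if "m < n - 1" "i \<le> m" "M < m + 2" "z \<in> ball z0 R" for m i z using that R(2) hq by blast
    show "lin_defect n A a b m z = 0" if "m < n - 1" "M < m + 1" "z \<in> ball z0 R" for m z using that R(2) hl by blast
    show "\<exists>X. jet_solution n A a b c z0 e X \<and> (\<forall>k<n. \<forall>s\<in>strip. norm (X k s - lead (A z0) g j k s) \<le> K * e * exp (Re s))"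
      if "0 < e" "e < e0" for e using jets that by blast
  qed
  show False
  proof (cases "\<exists>m i z. m < n - 1 \<and> m + 2 = M \<and> i \<le> m \<and> z \<in> D \<and> quad_defect a m i z \<noteq> 0")
    case True
    then obtain m i z0 where m: "m < n - 1" "m + 2 = M" "i \<le> m" and z0: "z0 \<in> D" and i: "quad_defect a m i z0 \<noteq> 0" by blast
    \<comment> \<open>The least index isolates one coefficient in
      \<open>symmetric_convolution\<close>, and it is at least 1 because the defect of index 0
      vanishes.\<close>
    define j where "j = (LEAST i. quad_defect a m i z0 \<noteq> 0)"
    have j: "quad_defect a m j z0 \<noteq> 0" unfolding j_def using i by (rule LeastI)
    have jm: "j \<le> m" unfolding j_def using Least_le[of "\<lambda>i. quad_defect a m i z0 \<noteq> 0", OF i] m(3) by simp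
    have lj: "quad_defect a m i z0 = 0" if "i < j" for i using not_less_Least[of i "\<lambda>i. quad_defect a m i z0 \<noteq> 0"] that unfolding j_def by blast
    have j1: "j \<ge> 1" using j quad_defect_0 by (cases j) auto
    \<comment> \<open>By symmetry and minimality 2 j \<le> m \<le> n - 2, the range in which a
      perturbation by t^j is allowed.\<close>
    have "quad_defect a m (m - j) z0 \<noteq> 0" using j quad_defect_sym[OF jm] by simp
    then have "j \<le> m - j" using lj by (meson not_less)
    then have jj: "2 * j \<le> m" using jm by simp
    obtain R where R: "R > 0" "ball z0 R \<subseteq> D" using D(1) z0 open_contains_ball by blast
    have coh: "coeffs_holomorphic n A a b c (ball z0 R)" using R(2) D(2) by (intro coeffs_holomorphic_subset[OF U(2)]) auto
    obtain g0 where g0: "g0 > 0" "\<And>g. norm g \<le> g0 \<Longrightarrow> g = 0 \<or> 2 * j \<le> n - 2 \<Longrightarrow>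
      \<exists>e0 K. 0 < e0 \<and> e0 < R \<and> (\<forall>e. 0 < e \<and> e < e0 \<longrightarrow> (\<exists>X. jet_solution n A a b c z0 e X \<and>
        (\<forall>k<n. \<forall>s\<in>strip. norm (X k s - lead (A z0) g j k s) \<le> K * e * exp (Re s))))"
      by (rule jet_solution_exists[OF n R(1) coh A0[OF z0] j1]) (rule that; assumption)
    \<comment> \<open>Any nonzero value within the admissible size would do.\<close>
    define g :: complex where "g = of_real g0"
    have "norm g \<le> g0" "g = 0 \<or> 2 * j \<le> n - 2" "g \<noteq> 0" using g0(1) jj m by (auto simp: g_def)
    from g0(2)[OF this(1,2)] obtain e0 K where e0: "0 < e0" "e0 < R" and jets: "\<forall>e. 0 < e \<and> e < e0 \<longrightarrow> (\<exists>X. jet_solution n A a b c z0 e X \<and>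
        (\<forall>k<n. \<forall>s\<in>strip. norm (X k s - lead (A z0) g j k s) \<le> K * e * exp (Re s)))"
      by (elim exE conjE) (rule that; assumption)
    define \<alpha> where "\<alpha> k = - ((- 1) ^ k * fact k / A z0)" for k
    define \<beta> where "\<beta> k = g * ffact (of_nat j) k" for k
    \<comment> \<open>\<psi> vanishes to order m - j, which makes the selected Taylor coefficient
      the one of t^(j+1).\<close>
    have "m - j < M" "m - j < n - 1" using m by auto
    from residue[OF z0 this e0 R jets]
    have z: "(deriv ^^ (M - 1 - (m - j))) (\<lambda>t. weighted_defect n A a b M z0 0 (\<lambda>k. \<alpha> k + \<beta> k * t ^ (j + 1))) 0 = 0"
      unfolding \<alpha>_def \<beta>_def .
    have k: "M - 1 - (m - j) = j + 1" using m jm by simp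
    have \<beta>0: "\<beta> i = 0" if "j < i" for i using ffact_eq_0[OF that] by (simp add: \<beta>_def)
    have M2: "2 \<le> M" "M - 2 = m" "1 \<le> M" "M - 1 = m + 1" using m by auto
    \<comment> \<open>For m = n - 2 there is no linear coefficient of the same weight. If there is
      one, it meets only the constant part of \<open>lead\<close>, since \<beta> vanishes at m +
      1.\<close>
    define l where "l = (if m + 1 < n - 1 then lin_defect n A a b (m + 1) z0 else 0)"
    have "weighted_defect n A a b M z0 0 (\<lambda>k. \<alpha> k + \<beta> k * t ^ (j + 1)) =
      ((\<Sum>i\<le>m. quad_defect a m i z0 * (\<alpha> i * \<alpha> (m - i))) + l * \<alpha> (m + 1)) + (2 * quad_defect a m j z0 * \<beta> j * \<alpha> (m - j)) * t ^ (j + 1)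
        + (\<Sum>i\<le>m. quad_defect a m i z0 * (\<beta> i * \<beta> (m - i))) * (t ^ (j + 1))\<^sup>2" for t
    proof -
      have c: "(\<Sum>i\<le>m. quad_defect a m i z0 * ((\<alpha> i + \<beta> i * t ^ (j + 1)) * (\<alpha> (m - i) + \<beta> (m - i) * t ^ (j + 1)))) =
        (\<Sum>i\<le>m. quad_defect a m i z0 * (\<alpha> i * \<alpha> (m - i))) + (2 * quad_defect a m j z0 * \<beta> j * \<alpha> (m - j)) * t ^ (j + 1)
        + (\<Sum>i\<le>m. quad_defect a m i z0 * (\<beta> i * \<beta> (m - i))) * (t ^ (j + 1))\<^sup>2"
        by (rule symmetric_convolution[OF _ jm]) (use quad_defect_sym lj \<beta>0 in auto)
      have "\<beta> (m + 1) = 0" using jm by (intro \<beta>0) simp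
      then show ?thesis unfolding weighted_defect_0 M2(2,4) c l_def using M2(1,3) m(1) by simp
    qed
    then have "2 * quad_defect a m j z0 * \<beta> j * \<alpha> (m - j) * fact (j + 1) = 0"
      using z unfolding k by (simp only: power_jet_middle[of "j + 1", OF le_add2])
    moreover have "\<alpha> (m - j) \<noteq> 0" using A0[OF z0] by (simp add: \<alpha>_def)
    moreover have "\<beta> j \<noteq> 0" using \<open>g \<noteq> 0\<close> ffact_self_nonzero by (simp add: \<beta>_def)
    moreover have "fact (j + 1) \<noteq> (0::complex)" by (rule fact_nonzero)
    ultimately show False using j by (metis mult_eq_0_iff zero_neq_numeral)
  next
    case False
    then obtain m z0 where m: "m < n - 1" "m + 1 = M" and z0: "z0 \<in> D" and ld: "lin_defect n A a b m z0 \<noteq> 0"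
      using M unfolding bad_def by blast
    obtain R where R: "R > 0" "ball z0 R \<subseteq> D" using D(1) z0 open_contains_ball by blast
    have coh: "coeffs_holomorphic n A a b c (ball z0 R)" using R(2) D(2) by (intro coeffs_holomorphic_subset[OF U(2)]) auto
    obtain g0 where g0: "g0 > 0" "\<And>g. norm g \<le> g0 \<Longrightarrow> g = 0 \<or> 2 * 1 \<le> n - 2 \<Longrightarrow>
      \<exists>e0 K. 0 < e0 \<and> e0 < R \<and> (\<forall>e. 0 < e \<and> e < e0 \<longrightarrow> (\<exists>X. jet_solution n A a b c z0 e X \<and>
        (\<forall>k<n. \<forall>s\<in>strip. norm (X k s - lead (A z0) g 1 k s) \<le> K * e * exp (Re s))))"
      by (rule jet_solution_exists[OF n R(1) coh A0[OF z0] order_refl]) (rule that; assumption)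
    \<comment> \<open>All quadratic coefficients of weight \<open>M\<close> vanish, so the bare pole
      suffices; the index 1 is a placeholder.\<close>
    have "norm (0 :: complex) \<le> g0" "(0 :: complex) = 0 \<or> 2 * 1 \<le> n - 2" using g0(1) by auto
    from g0(2)[OF this] obtain e0 K where e0: "0 < e0" "e0 < R" and jets: "\<forall>e. 0 < e \<and> e < e0 \<longrightarrow> (\<exists>X. jet_solution n A a b c z0 e X \<and>
        (\<forall>k<n. \<forall>s\<in>strip. norm (X k s - lead (A z0) 0 1 k s) \<le> K * e * exp (Re s)))"
      by (elim exE conjE) (rule that; assumption)
    \<comment> \<open>With \<psi> vanishing to order m = M - 1 the selected coefficient is the
      constant term.\<close>
    have "m < M" "m < n - 1" using m by auto
    from residue[OF z0 this e0 R jets]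
    have z: "weighted_defect n A a b M z0 0 (\<lambda>k. - ((- 1) ^ k * fact k / A z0)) = 0" using m by simp
    have "quad_defect a (M - 2) i z0 = 0" if "2 \<le> M" "M - 2 < n - 1" "i \<le> M - 2" for i
      using False that z0 by (metis le_add_diff_inverse2)
    then have "weighted_defect n A a b M z0 0 (\<lambda>k. - ((- 1) ^ k * fact k / A z0)) = lin_defect n A a b m z0 * - ((- 1) ^ m * fact m / A z0)"
      unfolding weighted_defect_0 using m by (auto simp: m(2)[symmetric])
    then show False using z ld A0[OF z0] by simp
  qed
qed

text \<open>On a disc where \<open>A\<close> has no zero all defects vanish, and the rewritten
  equation is L u = c itself: its leading coefficient is 1, so the linear equation has the
  coefficients \<open>- lin_coeff n A a j\<close> and the inhomogeneity \<open>c\<close>.\<close>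

lemma strong_Painleve_imp_linearizable:
  assumes n: "n \<ge> 2" and U: "open U" "coeffs_holomorphic n A a b c U" and sP: "strong_Painleve n A a b c U"
    and ne: "\<exists>z\<in>U. A z \<noteq> 0"
  shows "linearizable_by_riccati n A a b c U"
proof -
  obtain p where p: "p \<in> U" "A p \<noteq> 0" using ne by blast
  have Ah: "A holomorphic_on U" using U(2) by (simp add: coeffs_holomorphic_def)
  obtain r where r: "r > 0" "ball p r \<subseteq> U" and A0: "\<And>x. x \<in> ball p r \<Longrightarrow> A x \<noteq> 0"
    by (rule nonzero_ball[OF Ah U(1) p]) (rule that; assumption)
  let ?D = "ball p r"
  have coh: "coeffs_holomorphic n A a b c ?D" by (rule coeffs_holomorphic_subset[OF U(2) r(2)])
  have d: "(\<forall>m<n - 1. \<forall>i\<le>m. \<forall>z\<in>?D. quad_defect a m i z = 0) \<and> (\<forall>m<n - 1. \<forall>z\<in>?D. lin_defect n A a b m z = 0)"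
    by (rule strong_Painleve_imp_defects_zero[OF n U sP open_ball r(2) A0])
  have eq: "quadratic_ode n A a b c w z \<longleftrightarrow> linear_ode (n - 1) (\<lambda>j z. - lin_coeff n A a j z) c (riccati_change A (riccati_coeff n A a b) w) z"
    if V: "open V" "V \<subseteq> ?D" "w holomorphic_on V" and z: "z \<in> V" for V w z
  proof -
    have zD: "z \<in> ?D" using V z by blast
    have AV: "A x \<noteq> 0" if "x \<in> V" for x using that V(2) A0 by blast
    have "quadratic_ode n A a b c w z \<longleftrightarrow> lin_op n A a (riccati_change A (riccati_coeff n A a b) w) z = c z + defect n A a b w z"
      by (rule quadratic_ode_iff[OF V(1) z AV V(3) n coeffs_holomorphic_subset[OF coh V(2)]])
    moreover have "defect n A a b w z = 0" using d zD unfolding defect_def by (auto intro!: sum.neutral)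
    ultimately show ?thesis using lin_op_linear_ode[of n A z a _ c, OF n A0[OF zD]] by simp
  qed
  have "\<And>V w. open V \<and> V \<subseteq> ?D \<and> w holomorphic_on V \<Longrightarrow> (\<forall>z\<in>V. quadratic_ode n A a b c w z) \<longleftrightarrow>
      (\<forall>z\<in>V. linear_ode (n - 1) (\<lambda>j z. - lin_coeff n A a j z) c (riccati_change A (riccati_coeff n A a b) w) z)"
    by (intro ball_cong refl eq) auto
  moreover have "?D \<noteq> {}" using r(1) by simp
  moreover have "riccati_coeff n A a b holomorphic_on ?D" by (rule holomorphic_riccati_coeff[OF coh open_ball A0 n])
  moreover have "(\<lambda>z. - lin_coeff n A a j z) holomorphic_on ?D" for j
    by (rule holomorphic_on_minus[OF holomorphic_lin_coeff[OF coh open_ball A0 n]])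
  moreover have "c holomorphic_on ?D" using coh by (simp add: coeffs_holomorphic_def)
  ultimately show ?thesis unfolding linearizable_by_riccati_def
    by (intro exI[of _ ?D] exI[of _ "riccati_coeff n A a b"] exI[of _ "\<lambda>j z. - lin_coeff n A a j z"] exI[of _ c] conjI allI impI)
      (use r in auto)
qed

theorem theorem3:
  fixes n :: nat
    and U :: "complex set"
    and A c :: "complex \<Rightarrow> complex"
    and a :: "nat \<Rightarrow> nat \<Rightarrow> complex \<Rightarrow> complex"
    and b :: "nat \<Rightarrow> complex \<Rightarrow> complex"
  assumes "n \<ge> 2"
    and "open U" and "connected U" and "U \<noteq> {}"
    and "A holomorphic_on U"
    and "\<And>k j. (k, j) \<in> quadratic_index n \<Longrightarrow> a k j holomorphic_on U"
    and "\<And>j. j \<le> n - 1 \<Longrightarrow> b j holomorphic_on U"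
    and "c holomorphic_on U"
    and "\<exists>z\<in>U. A z \<noteq> 0"
  shows "strong_Painleve n A a b c U \<longleftrightarrow> linearizable_by_riccati n A a b c U"
proof -
  have "coeffs_holomorphic n A a b c U" unfolding coeffs_holomorphic_def using assms(5-8) by blast
  then show ?thesis
    using strong_Painleve_imp_linearizable[OF assms(1,2) _ _ assms(9)] linearizable_imp_strong_Painleve[OF assms(1-3) _ assms(9)] by blast
qed

end
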